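(* Let $\mathbb{F}$ be an infinite field and let $n$ be a positive integer. If $G$ is a finitely generated subgroup of $\mathrm{GL}(n,\mathbb{F})$ of finite Prüfer rank, then $G$ is $\mathbb{Q}$-linear, i.e., isomorphic to a subgroup of $\mathrm{GL}(d,\mathbb{Q})$ for some $d$.
   Context: A group $G$ has finite Prüfer rank $\mathrm{rk}(G)$ if each finitely generated subgroup of $G$ can be generated by $\mathrm{rk}(G)$ elements, and $\mathrm{rk}(G)$ is the least such integer. *)

theory Defs
  imports
    "HOL-Algebra.Generated_Groups"
    "Jordan_Normal_Form.Matrix"
begin

definition GL :: "nat \<Rightarrow> 'a::field mat monoid" where
  "GL n = units_of (ring_mat TYPE('a) n ())"

lemma group_GL: "group (GL n)"
proof -
  interpret ring "ring_mat TYPE('a) n ()" by (rule ring_mat)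
  show ?thesis unfolding GL_def by (rule units_group)
qed

definition generated_by_at_most :: "('a, 'b) monoid_scheme \<Rightarrow> nat \<Rightarrow> bool" where
  "generated_by_at_most G r \<longleftrightarrow>
     (\<exists>S \<subseteq> carrier G. finite S \<and> card S \<le> r \<and> generate G S = carrier G)"

definition finitely_generated :: "('a, 'b) monoid_scheme \<Rightarrow> bool" where
  "finitely_generated G \<longleftrightarrow> (\<exists>S \<subseteq> carrier G. finite S \<and> generate G S = carrier G)"

text \<open>Being generated by \<open>r\<close> elements, possibly with repetitions, amounts to being generated
  by a set of at most \<open>r\<close> elements. The Pruefer rank is the least \<open>r\<close> below, so it is finite
  precisely when some such \<open>r\<close> exists.\<close>

definition finite_pruefer_rank :: "('a, 'b) monoid_scheme \<Rightarrow> bool" where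
  "finite_pruefer_rank G \<longleftrightarrow>
     (\<exists>r. \<forall>K. subgroup K G \<longrightarrow> finitely_generated (G\<lparr>carrier := K\<rparr>) \<longrightarrow>
            generated_by_at_most (G\<lparr>carrier := K\<rparr>) r)"

definition Q_linear :: "('a, 'b) monoid_scheme \<Rightarrow> bool" where
  "Q_linear G \<longleftrightarrow>
     (\<exists>d > 0. \<exists>K. subgroup K (GL d :: rat mat monoid) \<and>
            G \<cong> (GL d :: rat mat monoid)\<lparr>carrier := K\<rparr>)"

end

theory Submission
  imports Defs "HOL-Algebra.Algebraic_Closure_Type" "HOL-Algebra.Zassenhaus"
    "HOL-Computational_Algebra.Computational_Algebra"
begin

text \<open>
  Let \<open>G\<close> be generated by finitely many matrices. After a base change the entries of \<open>G\<close> lie in a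
  localization \<open>R = B[1/f]\<close> of a polynomial ring \<open>B\<close> over the prime ring, in variables \<open>a\<close>. Choose
  constants \<open>c\<close> with \<open>f(c) \<noteq> 0\<close>, integers in characteristic \<open>0\<close> and elements of a finite field in
  characteristic \<open>p\<close>. The Taylor expansion \<open>a \<mapsto> c + x (a - c)\<close> embeds \<open>R\<close> into power series in \<open>x\<close>
  whose \<open>k\<close>-th coefficient lies in a finite-dimensional space \<open>H k\<close> over the field of constants, and
  \<open>G\<close> is filtered by its congruence subgroups modulo \<open>x^k\<close>.

  In characteristic \<open>0\<close> a group of rank at most \<open>r\<close> cannot contain elements congruent to \<open>1\<close> to exactly
  \<open>r + 1\<close> distinct positive orders: specialize to rational power series and consider \<open>p\<close>-th powers of
  these elements modulo \<open>p^2\<close> for a large prime \<open>p\<close>. Hence some congruence subgroup is trivial, and \<open>G\<close>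
  acts faithfully on truncated series, a finite-dimensional rational vector space.

  In characteristic \<open>p\<close> the congruence quotients of the first congruence subgroup are finite
  \<open>p\<close>-groups of rank at most \<open>r\<close> in which sufficiently high \<open>p\<close>-powers commute. The exponents grow
  slowly compared with the order of the congruence, so a degree estimate for the numerators of the
  entries shows that high \<open>p\<close>-powers of any two elements \<open>g, h\<close> commute exactly, and a Frobenius
  argument bounds the exponent independently of \<open>g\<close> and \<open>h\<close>. Therefore some congruence subgroup is
  abelian. Being of finite index, it is finitely generated, has a free abelian subgroup of finite
  index that embeds into the multiplicative group of the rationals, and \<open>G\<close> embeds by induction.
\<close>

subsection \<open>Commutators and rank\<close>

text \<open>The entries themselves carry no filtration with small quotients. After expansion the
  k-th coefficients are polynomials of degree at most k, a space that is finite-dimensional over the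
  constants whatever the transcendence degree, and finite when the constants are. The rank enters in
  two ways. In characteristic 0, matrices congruent to 1 modulo p multiply modulo p^2 like vectors
  over the field with p elements; the p-th powers of elements of distinct orders are in echelon form
  there, and r generators leave room for r of them. In characteristic p, an abelian section of
  exponent p has at most p^r elements, so p^r-th powers centralize it; the subgroup they generate
  then behaves like a powerful group, and commutators of p^(r+i)-th powers sink to depth p^(2i+1),
  while degrees of numerators only reach a constant times p^i. The obstacle is that i depends on the
  two elements. Linear dependence among A, A^p, A^(p^2), ... replaces it by N^2, and only such a
  uniform exponent bounds the indices that show a congruence subgroup to be abelian.\<close>

definition rank_le :: "('a, 'b) monoid_scheme \<Rightarrow> nat \<Rightarrow> bool" where
  "rank_le G r \<longleftrightarrow> (\<forall>S\<subseteq>carrier G. finite S \<longrightarrow>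
     (\<exists>T\<subseteq>carrier G. finite T \<and> card T \<le> r \<and> generate G T = generate G S))"

lemma rank_le_hom_image:
  assumes "group_hom G P \<pi>" and surj: "\<pi> ` carrier G = carrier P" and rk: "rank_le G r"
  shows "rank_le P r"
  unfolding rank_le_def
proof (intro allI impI)
  interpret group_hom G P \<pi> by fact
  fix S assume S: "S \<subseteq> carrier P" "finite S"
  have "S \<subseteq> \<pi> ` carrier G" using S(1) surj by simp
  from finite_subset_image[OF S(2) this]
  obtain S' where S': "S' \<subseteq> carrier G" "finite S'" "S = \<pi> ` S'" by auto
  from rk[unfolded rank_le_def, rule_format, OF S'(1,2)]
  obtain T where T: "T \<subseteq> carrier G" "finite T" "card T \<le> r" "generate G T = generate G S'"
    by auto
  have "generate P (\<pi> ` T) = generate P S"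
    using generate_img[OF T(1)] generate_img[OF S'(1)] T(4) S'(3) by simp
  moreover have "card (\<pi> ` T) \<le> r"
    using T(2,3) card_image_le le_trans by blast
  ultimately show "\<exists>T\<subseteq>carrier P. finite T \<and> card T \<le> r \<and> generate P T = generate P S"
    using T by (intro exI[of _ "\<pi> ` T"]) auto
qed

lemma (in group) rank_le_subgroup:
  assumes "rank_le G r" "subgroup H G"
  shows "rank_le (G\<lparr>carrier := H\<rparr>) r"
  unfolding rank_le_def
proof (intro allI impI)
  fix S assume S: "S \<subseteq> carrier (G\<lparr>carrier := H\<rparr>)" "finite S"
  then have SH: "S \<subseteq> H" by simp
  have Hc: "H \<subseteq> carrier G" using assms(2) subgroup.subset by blast
  obtain T where T: "T \<subseteq> carrier G" "finite T" "card T \<le> r" "generate G T = generate G S"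
    using assms(1) S SH Hc unfolding rank_le_def by (metis subset_trans)
  have "T \<subseteq> generate G S" using T(4) generate.incl by fastforce
  then have "T \<subseteq> H" using generate_subgroup_incl[OF SH assms(2)] by blast
  then show "\<exists>T\<subseteq>carrier (G\<lparr>carrier := H\<rparr>). finite T \<and> card T \<le> r \<and>
      generate (G\<lparr>carrier := H\<rparr>) T = generate (G\<lparr>carrier := H\<rparr>) S"
    using T SH assms(2) generate_consistent by (intro exI[of _ T]) simp
qed

lemma (in group) commute_inv:
  assumes "x \<otimes> y = y \<otimes> x" "x \<in> carrier G" "y \<in> carrier G"
  shows "x \<otimes> inv y = inv y \<otimes> x"
proof -
  have "x = y \<otimes> (x \<otimes> inv y)"
    using assms by (simp add: m_assoc[symmetric] assms(1)[symmetric]) (simp add: m_assoc)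
  then show ?thesis using assms inv_solve_left by auto
qed

lemma (in group) commute_mult:
  assumes "x \<otimes> a = a \<otimes> x" "x \<otimes> b = b \<otimes> x" "x \<in> carrier G" "a \<in> carrier G" "b \<in> carrier G"
  shows "x \<otimes> (a \<otimes> b) = (a \<otimes> b) \<otimes> x"
proof -
  have "x \<otimes> (a \<otimes> b) = (a \<otimes> x) \<otimes> b" using assms by (simp add: m_assoc[symmetric])
  also have "\<dots> = a \<otimes> (b \<otimes> x)" using assms by (simp add: m_assoc)
  finally show ?thesis using assms by (simp add: m_assoc)
qed

section \<open>Commutators modulo a normal subgroup\<close>

context group
begin

text \<open>Commuting modulo \<open>L\<close>, phrased by a commutator so that no quotient group has
  to be formed. For normal \<open>L\<close> it is commutation of cosets, for
  \<open>L = {\<one>}\<close> ordinary commutation.\<close>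

definition cmod :: "'a set \<Rightarrow> 'a \<Rightarrow> 'a \<Rightarrow> bool" where
  "cmod L x y \<longleftrightarrow> x \<otimes> y \<otimes> inv x \<otimes> inv y \<in> L"

lemma cmod_mono: "cmod L x y \<Longrightarrow> L \<subseteq> M \<Longrightarrow> cmod M x y"
  unfolding cmod_def by blast

lemma rcos_eq_iff:
  assumes "subgroup L G" "x \<in> carrier G" "y \<in> carrier G"
  shows "L #> x = L #> y \<longleftrightarrow> x \<otimes> inv y \<in> L"
  using assms by (metis is_group rcos_self repr_independence subgroup.rcos_module)

lemma cmod_iff:
  assumes "L \<lhd> G" "x \<in> carrier G" "y \<in> carrier G"
  shows "cmod L x y \<longleftrightarrow> L #> (x \<otimes> y) = L #> (y \<otimes> x)"
proof -
  have "x \<otimes> y \<otimes> inv x \<otimes> inv y = (x \<otimes> y) \<otimes> inv (y \<otimes> x)"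
    using assms by (simp add: inv_mult_group m_assoc)
  then show ?thesis
    using rcos_eq_iff[of L "x \<otimes> y" "y \<otimes> x"] assms normal_imp_subgroup unfolding cmod_def by auto
qed

lemma cmod_sym:
  assumes "L \<lhd> G" "x \<in> carrier G" "y \<in> carrier G"
  shows "cmod L x y \<longleftrightarrow> cmod L y x"
  using assms cmod_iff by metis

text \<open>This is the preimage of the centralizer of the coset of \<open>x\<close> in
  \<open>G Mod L\<close>. Hence commutation modulo \<open>L\<close> need only be checked on
  generators.\<close>

lemma cmod_subgroup:
  assumes L: "L \<lhd> G" and x: "x \<in> carrier G"
  shows "subgroup {y \<in> carrier G. cmod L x y} G"
proof -
  interpret L: normal L G by fact
  interpret q: group_hom G "G Mod L" "\<lambda>x. L #> x"
    using L.factorgroup_is_group L.r_coset_hom_Mod is_group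
    by (simp add: group_hom_axioms_def group_hom_def)
  have eq: "{y \<in> carrier G. cmod L x y} =
      {y \<in> carrier G. (L #> x) \<otimes>\<^bsub>G Mod L\<^esub> (L #> y) = (L #> y) \<otimes>\<^bsub>G Mod L\<^esub> (L #> x)}"
    using cmod_iff[OF L x] q.hom_mult x by auto
  have Qx: "L #> x \<in> carrier (G Mod L)" using x by auto
  show ?thesis unfolding eq
  proof (rule subgroupI)
    show "{y \<in> carrier G. (L #> x) \<otimes>\<^bsub>G Mod L\<^esub> (L #> y) = (L #> y) \<otimes>\<^bsub>G Mod L\<^esub> (L #> x)} \<noteq> {}"
      using x by blast
  next
    fix a assume a: "a \<in> {y \<in> carrier G. (L #> x) \<otimes>\<^bsub>G Mod L\<^esub> (L #> y) = (L #> y) \<otimes>\<^bsub>G Mod L\<^esub> (L #> x)}"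
    then have Qa: "L #> a \<in> carrier (G Mod L)" by auto
    have "(L #> x) \<otimes>\<^bsub>G Mod L\<^esub> inv\<^bsub>G Mod L\<^esub> (L #> a) = inv\<^bsub>G Mod L\<^esub> (L #> a) \<otimes>\<^bsub>G Mod L\<^esub> (L #> x)"
      using a Qa Qx by (intro q.H.commute_inv) auto
    then show "inv a \<in> {y \<in> carrier G. (L #> x) \<otimes>\<^bsub>G Mod L\<^esub> (L #> y) = (L #> y) \<otimes>\<^bsub>G Mod L\<^esub> (L #> x)}"
      using a q.hom_inv by auto
  next
    fix a b assume a: "a \<in> {y \<in> carrier G. (L #> x) \<otimes>\<^bsub>G Mod L\<^esub> (L #> y) = (L #> y) \<otimes>\<^bsub>G Mod L\<^esub> (L #> x)}"
      and b: "b \<in> {y \<in> carrier G. (L #> x) \<otimes>\<^bsub>G Mod L\<^esub> (L #> y) = (L #> y) \<otimes>\<^bsub>G Mod L\<^esub> (L #> x)}"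
    have Q: "L #> a \<in> carrier (G Mod L)" "L #> b \<in> carrier (G Mod L)" using a b by auto
    have "(L #> x) \<otimes>\<^bsub>G Mod L\<^esub> ((L #> a) \<otimes>\<^bsub>G Mod L\<^esub> (L #> b)) = ((L #> a) \<otimes>\<^bsub>G Mod L\<^esub> (L #> b)) \<otimes>\<^bsub>G Mod L\<^esub> (L #> x)"
      using a b Q Qx by (intro q.H.commute_mult) auto
    then show "a \<otimes> b \<in> {y \<in> carrier G. (L #> x) \<otimes>\<^bsub>G Mod L\<^esub> (L #> y) = (L #> y) \<otimes>\<^bsub>G Mod L\<^esub> (L #> x)}"
      using a b q.hom_mult by auto
  qed auto
qed

lemma cmod_generate:
  assumes L: "L \<lhd> G" and x: "x \<in> carrier G" and S: "S \<subseteq> carrier G" "\<And>s. s \<in> S \<Longrightarrow> cmod L x s"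
    and y: "y \<in> generate G S"
  shows "cmod L x y"
  using generate_subgroup_incl[OF _ cmod_subgroup[OF L x], of S] S y by blast

lemma cmod_generate2:
  assumes L: "L \<lhd> G" and S: "S \<subseteq> carrier G" and T: "T \<subseteq> carrier G"
    and "\<And>s t. s \<in> S \<Longrightarrow> t \<in> T \<Longrightarrow> cmod L s t"
    and x: "x \<in> generate G S" and y: "y \<in> generate G T"
  shows "cmod L x y"
proof -
  have yc: "y \<in> carrier G" using y T generate_in_carrier by blast
  have "cmod L y s" if "s \<in> S" for s
    using cmod_generate[OF L _ T _ y, of s] assms(4) that S cmod_sym[OF L] yc by (meson subset_eq)
  then have "cmod L y x" using cmod_generate[OF L yc S _ x] by blast
  then show ?thesis using cmod_sym[OF L] yc x S generate_in_carrier by blast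
qed

lemma normal_set_mult:
  assumes "M \<lhd> G" "N \<lhd> G"
  shows "M <#> N \<lhd> G"
proof -
  interpret M: normal M G by fact
  interpret N: normal N G by fact
  have c: "subgroup (M <#> N) G"
    by (rule mult_norm_subgroup[OF assms(1) N.subgroup_axioms])
  show ?thesis
  proof (rule normal_invI[OF c])
    fix x h assume x: "x \<in> carrier G" and "h \<in> M <#> N"
    then obtain m n where mn: "m \<in> M" "n \<in> N" "h = m \<otimes> n" unfolding set_mult_def by blast
    have "x \<otimes> h \<otimes> inv x = (x \<otimes> m \<otimes> inv x) \<otimes> (x \<otimes> n \<otimes> inv x)"
    proof -
      have "inv x \<otimes> (x \<otimes> (n \<otimes> inv x)) = n \<otimes> inv x"
        using mn x by (simp add: m_assoc[symmetric])
      then show ?thesis using mn x by (simp add: m_assoc)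
    qed
    moreover have "x \<otimes> m \<otimes> inv x \<in> M" "x \<otimes> n \<otimes> inv x \<in> N"
      using mn x M.inv_op_closed2 N.inv_op_closed2 by auto
    ultimately show "x \<otimes> h \<otimes> inv x \<in> M <#> N"
      unfolding set_mult_def by auto
  qed
qed

end

section \<open>Orders of abelian subgroups, and central filtrations\<close>

context group
begin

lemma cmod_one_iff:
  assumes "x \<in> carrier G" "y \<in> carrier G"
  shows "cmod {\<one>} x y \<longleftrightarrow> x \<otimes> y = y \<otimes> x"
proof -
  have "x \<otimes> y \<otimes> inv x \<otimes> inv y = (x \<otimes> y) \<otimes> inv (y \<otimes> x)"
    using assms by (simp add: inv_mult_group m_assoc)
  then show ?thesis
    using assms unfolding cmod_def by (auto simp: inv_solve_right')
qed

lemma commute_nat_pow: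
  assumes "x \<otimes> y = y \<otimes> x" "x \<in> carrier G" "y \<in> carrier G"
  shows "x \<otimes> y [^] (n::nat) = y [^] n \<otimes> x"
proof (induction n)
  case (Suc n)
  then show ?case using assms commute_mult[of x "y [^] n" y] by simp
qed (use assms in simp)

text \<open>Adjoining a generator \<open>t\<close> that commutes with the rest multiplies the order
  by at most \<open>q\<close>: every element is some \<open>x \<otimes> t [^] e\<close> with
  \<open>x\<close> from the previous subgroup and \<open>e < q\<close>.\<close>

lemma card_generate_commuting:
  assumes "finite T" "T \<subseteq> carrier G" "\<And>s t. s \<in> T \<Longrightarrow> t \<in> T \<Longrightarrow> s \<otimes> t = t \<otimes> s"
    and "\<And>t. t \<in> T \<Longrightarrow> t [^] (q::nat) = \<one>" and q: "q > 0"
  shows "finite (generate G T) \<and> card (generate G T) \<le> q ^ card T"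
  using assms(1-4)
proof (induction T rule: finite_induct)
  case empty
  then show ?case by (simp add: generate_empty)
next
  case (insert t T)
  have T: "T \<subseteq> carrier G" and t: "t \<in> carrier G" "t [^] q = \<one>" using insert.prems by auto
  have IH: "finite (generate G T)" "card (generate G T) \<le> q ^ card T"
    using insert.IH[OF T] insert.prems by auto
  define K where "K = (\<lambda>(x, e). x \<otimes> t [^] (e::nat)) ` (generate G T \<times> {..<q})"
  have red: "t [^] e = t [^] (e mod q)" for e :: nat
  proof -
    have "(t [^] q) [^] (e div q) \<otimes> t [^] (e mod q) = t [^] (q * (e div q) + e mod q)"
      unfolding nat_pow_pow[OF t(1)] nat_pow_mult[OF t(1)] ..
    then show ?thesis using t by simp
  qed
  have KI: "x \<otimes> t [^] e \<in> K" if "x \<in> generate G T" for x and e :: nat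
  proof -
    have "(x, e mod q) \<in> generate G T \<times> {..<q}" using that q by simp
    then have "x \<otimes> t [^] (e mod q) \<in> K" unfolding K_def by force
    then show ?thesis using red by simp
  qed
  have comm: "t \<otimes> x = x \<otimes> t" if "x \<in> generate G T" for x
  proof -
    have "cmod {\<one>} t x"
      by (rule cmod_generate[OF one_is_normal t(1) T _ that])
         (use insert.prems T t cmod_one_iff in auto)
    then show ?thesis using cmod_one_iff t T generate_in_carrier that by blast
  qed
  have o: "\<one> \<in> generate G T" by (rule generate.one)
  have gT: "h \<in> generate G T \<and> h \<in> carrier G" if "h \<in> T" for h
    using that T generate.incl[of h T G] by auto
  have "z \<in> K" if "z \<in> generate G (insert t T)" for z
    using that
  proof (induction rule: generate.induct)
    case one
    then show ?case using KI[OF o, of 0] by simp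
  next
    case (incl h)
    then show ?case using KI[OF o, of 1] KI[of h 0] gT[of h] t by auto
  next
    case (inv h)
    show ?case
    proof (cases "h = t")
      case True
      have "t [^] (q - 1) \<otimes> t = \<one>" using t q nat_pow_Suc[of t "q - 1"] by (simp del: nat_pow_Suc)
      then have "inv t = t [^] (q - 1)" using t by (metis inv_equality nat_pow_closed)
      then show ?thesis using KI[OF o, of "q - 1"] t True by simp
    next
      case False
      then have h: "h \<in> T" using inv by simp
      then have "inv h \<in> generate G T" by (rule generate.inv)
      then show ?thesis using KI[of "inv h" 0] gT[OF h] by auto
    qed
  next
    case (eng h1 h2)
    then obtain x y and e f :: nat where h: "h1 = x \<otimes> t [^] e" "x \<in> generate G T" "h2 = y \<otimes> t [^] f" "y \<in> generate G T"
      unfolding K_def by auto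
    have c: "x \<in> carrier G" "y \<in> carrier G" using h T generate_in_carrier by auto
    have "t [^] e \<otimes> y = y \<otimes> t [^] e"
      using commute_nat_pow[of y t e] comm[OF h(4)] c t by simp
    then have "h1 \<otimes> h2 = (x \<otimes> y) \<otimes> t [^] (e + f)"
    proof -
      assume comm: "t [^] e \<otimes> y = y \<otimes> t [^] e"
      have "h1 \<otimes> h2 = x \<otimes> (t [^] e \<otimes> y) \<otimes> t [^] f"
        using h c t by (simp add: m_assoc)
      also have "\<dots> = (x \<otimes> y) \<otimes> (t [^] e \<otimes> t [^] f)"
        unfolding comm using c t by (simp add: m_assoc)
      finally show ?thesis unfolding nat_pow_mult[OF t(1)] .
    qed
    then show ?case using KI[OF generate.eng[OF h(2,4)], of "e + f"] by simp
  qed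
  then have sub: "generate G (insert t T) \<subseteq> K" by blast
  have fK: "finite K" unfolding K_def using IH by simp
  have "card K \<le> card (generate G T \<times> {..<q})" unfolding K_def by (rule card_image_le) (use IH in simp)
  also have "\<dots> \<le> q ^ card T * q" using IH by (simp add: card_cartesian_product)
  finally have "card K \<le> q ^ card (insert t T)" using insert.hyps by (simp add: mult.commute)
  then show ?case using sub fK card_mono finite_subset by (meson le_trans)
qed

text \<open>Modelled on congruence subgroups modulo the powers of the series variable. The whole
  group sits at index 1, hence also at index 0, and each quotient of consecutive terms is
  central.\<close>

definition central_filtration :: "(nat \<Rightarrow> 'a set) \<Rightarrow> bool" where
  "central_filtration \<Gamma> \<longleftrightarrow> (\<forall>k. \<Gamma> k \<lhd> G) \<and> \<Gamma> 1 = carrier G \<and> (\<forall>k. \<Gamma> (Suc k) \<subseteq> \<Gamma> k) \<and>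
     (\<forall>k x y. x \<in> carrier G \<longrightarrow> y \<in> \<Gamma> k \<longrightarrow> cmod (\<Gamma> (Suc k)) x y)"

lemma central_filtration_antimono:
  "central_filtration \<Gamma> \<Longrightarrow> i \<le> j \<Longrightarrow> \<Gamma> j \<subseteq> \<Gamma> i"
  unfolding central_filtration_def by (metis lift_Suc_antimono_le)

text \<open>In characteristic \<open>p\<close> the identity \<open>(1 + D)^p = 1 + D^p\<close>
  multiplies the order of a congruence by \<open>p\<close>. This geometric growth is what later
  outruns the degrees.\<close>

definition p_filtration :: "nat \<Rightarrow> (nat \<Rightarrow> 'a set) \<Rightarrow> bool" where
  "p_filtration p \<Gamma> \<longleftrightarrow> central_filtration \<Gamma> \<and> (\<forall>k x. x \<in> \<Gamma> k \<longrightarrow> x [^] p \<in> \<Gamma> (p * k))"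

lemma p_filtration_pow:
  assumes "p_filtration p \<Gamma>" "x \<in> \<Gamma> k"
  shows "x [^] (p ^ i) \<in> \<Gamma> (p ^ i * k)"
proof (induction i)
  case 0
  have "x \<in> carrier G" using assms unfolding p_filtration_def central_filtration_def
    by (metis normal_imp_subgroup subgroup.mem_carrier)
  then show ?case using assms by simp
next
  case (Suc i)
  have xc: "x \<in> carrier G" using assms unfolding p_filtration_def central_filtration_def
    by (metis normal_imp_subgroup subgroup.mem_carrier)
  have "(x [^] (p ^ i)) [^] p \<in> \<Gamma> (p * (p ^ i * k))"
    using Suc assms unfolding p_filtration_def by blast
  then show ?case using xc by (simp add: nat_pow_pow mult.commute mult.left_commute)
qed

lemma p_filtration_order:
  assumes "p_filtration p \<Gamma>" "\<Gamma> M = {\<one>}" "x \<in> carrier G" "p \<ge> 2"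
  shows "x [^] (p ^ M) = \<one>"
proof -
  have "x \<in> \<Gamma> 1" using assms unfolding p_filtration_def central_filtration_def by auto
  then have "x [^] (p ^ M) \<in> \<Gamma> (p ^ M)" using p_filtration_pow[OF assms(1), of x 1 M] by simp
  moreover have "M \<le> p ^ M" using assms(4) by (metis less_exp order.strict_implies_order order_trans power_mono zero_le_numeral)
  ultimately show ?thesis
    using central_filtration_antimono assms unfolding p_filtration_def by blast
qed

end

lemma central_filtration_hom_image:
  assumes "group_hom G P \<pi>" and surj: "\<pi> ` carrier G = carrier P" and c: "group.central_filtration G \<Gamma>"
  shows "group.central_filtration P (\<lambda>k. \<pi> ` \<Gamma> k)"
proof -
  interpret group_hom G P \<pi> by fact
  note c = c[unfolded G.central_filtration_def]
  have sub: "\<Gamma> k \<subseteq> carrier G" for k using c normal_imp_subgroup subgroup.subset by metis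
  have "\<pi> ` \<Gamma> k \<lhd> P" for k
    using normal.surj_hom_normal_subgroup[of "\<Gamma> k" G P \<pi>] c surj group_hom_axioms by blast
  moreover have "H.cmod (\<pi> ` \<Gamma> (Suc k)) x y" if x: "x \<in> carrier P" and y: "y \<in> \<pi> ` \<Gamma> k" for k x y
  proof -
    obtain x' where x': "x' \<in> carrier G" "x = \<pi> x'" using x surj by blast
    obtain y' where y': "y' \<in> \<Gamma> k" "y = \<pi> y'" using y by blast
    have "G.cmod (\<Gamma> (Suc k)) x' y'" using c x' y' by blast
    moreover have "\<pi> (x' \<otimes>\<^bsub>G\<^esub> y' \<otimes>\<^bsub>G\<^esub> inv\<^bsub>G\<^esub> x' \<otimes>\<^bsub>G\<^esub> inv\<^bsub>G\<^esub> y') = x \<otimes>\<^bsub>P\<^esub> y \<otimes>\<^bsub>P\<^esub> inv\<^bsub>P\<^esub> x \<otimes>\<^bsub>P\<^esub> inv\<^bsub>P\<^esub> y"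
      using x' y' sub[of k] by (simp add: subset_iff)
    ultimately show ?thesis unfolding G.cmod_def H.cmod_def by (metis imageI)
  qed
  ultimately show ?thesis unfolding H.central_filtration_def using c surj by (auto simp: image_mono)
qed

lemma p_filtration_hom_image:
  assumes "group_hom G P \<pi>" and surj: "\<pi> ` carrier G = carrier P" and c: "group.p_filtration G p \<Gamma>"
  shows "group.p_filtration P p (\<lambda>k. \<pi> ` \<Gamma> k)"
proof -
  interpret group_hom G P \<pi> by fact
  note c = c[unfolded G.p_filtration_def]
  have sub: "\<Gamma> k \<subseteq> carrier G" for k
    using c[unfolded G.central_filtration_def] normal_imp_subgroup subgroup.subset by metis
  have "y [^]\<^bsub>P\<^esub> p \<in> \<pi> ` \<Gamma> (p * k)" if y: "y \<in> \<pi> ` \<Gamma> k" for y k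
  proof -
    obtain y' where y': "y' \<in> \<Gamma> k" "y = \<pi> y'" using y by blast
    then have "y [^]\<^bsub>P\<^esub> p = \<pi> (y' [^]\<^bsub>G\<^esub> p)" using sub[of k] hom_nat_pow[of y' p] by auto
    then show ?thesis using c y' by blast
  qed
  then show ?thesis
    unfolding H.p_filtration_def using central_filtration_hom_image[OF assms(1,2)] c by blast
qed

section \<open>Conjugation orbits in sections of bounded rank\<close>

context group
begin

text \<open>The number of conjugates of \<open>w\<close> under powers of \<open>u\<close> is the
  least \<open>t > 0\<close> for which \<open>u [^] t\<close> commutes with \<open>w\<close>. It
  divides \<open>p ^ M\<close>, so it is a power of \<open>p\<close>; being at most
  \<open>card C\<close>, it divides \<open>p ^ r\<close>.\<close>

lemma commute_pow_of_orbit: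
  assumes u: "u \<in> carrier G" and w: "w \<in> carrier G" and p: "Factorial_Ring.prime (p::nat)"
    and C: "finite C" "card C \<le> p ^ r" "\<And>k::nat. u [^] k \<otimes> w \<otimes> inv (u [^] k) \<in> C"
    and M: "u [^] (p ^ M) \<otimes> w = w \<otimes> u [^] (p ^ M)"
  shows "u [^] (p ^ r) \<otimes> w = w \<otimes> u [^] (p ^ r)"
proof -
  define D where "D = {k::nat. u [^] k \<otimes> w = w \<otimes> u [^] k}"
  have Dsum: "a + b \<in> D \<longleftrightarrow> b \<in> D" if "a \<in> D" for a b
  proof -
    have "u [^] (a + b) \<otimes> w = u [^] a \<otimes> (u [^] b \<otimes> w)"
      using u w by (simp add: nat_pow_mult[symmetric] m_assoc)
    moreover have "w \<otimes> u [^] (a + b) = u [^] a \<otimes> (w \<otimes> u [^] b)"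
    proof -
      have "w \<otimes> u [^] (a + b) = (w \<otimes> u [^] a) \<otimes> u [^] b"
        using u w by (simp add: nat_pow_mult[symmetric] m_assoc)
      also have "\<dots> = (u [^] a \<otimes> w) \<otimes> u [^] b" using that unfolding D_def by simp
      finally show ?thesis using u w by (simp add: m_assoc)
    qed
    ultimately show ?thesis unfolding D_def using u w by simp
  qed
  have D0: "0 \<in> D" unfolding D_def using u w by simp
  have Dmul: "a * k \<in> D" if "a \<in> D" for a k
    by (induction k) (use D0 Dsum that in auto)
  have pM: "p ^ M \<in> D" using M unfolding D_def by simp
  define t where "t = (LEAST k. 0 < k \<and> k \<in> D)"
  have p0: "p ^ M > 0" using p by (simp add: prime_gt_0_nat)
  have t: "0 < t" "t \<in> D" using LeastI[of "\<lambda>k. 0 < k \<and> k \<in> D" "p ^ M"] pM p0 unfolding t_def by auto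
  have tmin: "k \<notin> D" if "0 < k" "k < t" for k
    using not_less_Least[of k "\<lambda>k. 0 < k \<and> k \<in> D"] that unfolding t_def by auto
  have "t * (p ^ M div t) + p ^ M mod t \<in> D" using pM by simp
  then have "p ^ M mod t \<in> D" using Dsum[OF Dmul[OF t(2)]] by blast
  then have "t dvd p ^ M" using tmin[of "p ^ M mod t"] t by (metis bot_nat_0.not_eq_extremum dvd_eq_mod_eq_0 mod_less_divisor)
  then obtain a where a: "t = p ^ a" using divides_primepow_nat[OF p] by blast
  have "inj_on (\<lambda>k. u [^] k \<otimes> w \<otimes> inv (u [^] k)) {..<t}"
  proof (rule linorder_inj_onI')
    fix i j assume ij: "i \<in> {..<t}" "j \<in> {..<t}" "i < j"
    obtain d where d: "j = i + d" "0 < d" using ij(3) less_imp_add_positive by blast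
    show "u [^] i \<otimes> w \<otimes> inv (u [^] i) \<noteq> u [^] j \<otimes> w \<otimes> inv (u [^] j)"
    proof
      assume eq: "u [^] i \<otimes> w \<otimes> inv (u [^] i) = u [^] j \<otimes> w \<otimes> inv (u [^] j)"
      have "u [^] j = u [^] i \<otimes> u [^] d" using d u by (simp add: nat_pow_mult)
      then have "u [^] j \<otimes> w \<otimes> inv (u [^] j) = u [^] i \<otimes> (u [^] d \<otimes> w \<otimes> inv (u [^] d)) \<otimes> inv (u [^] i)"
        using u w by (simp add: inv_mult_group m_assoc)
      then have "w = u [^] d \<otimes> w \<otimes> inv (u [^] d)" using eq u w by simp
      then have "d \<in> D" unfolding D_def using u w by (simp add: inv_solve_right)
      then show False using tmin[of d] d ij by auto
    qed
  qed
  then have "card {..<t} \<le> card C" by (rule card_inj_on_le) (use C in auto)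
  then have "p ^ a \<le> p ^ r" using C a by simp
  then have "a \<le> r" using p prime_gt_1_nat power_le_imp_le_exp by blast
  then have "p ^ r = t * p ^ (r - a)" using a by (simp add: power_add[symmetric])
  then show ?thesis using Dmul[OF t(2)] unfolding D_def by (metis (mono_tags, lifting) mem_Collect_eq)
qed

text \<open>\<open>N / L\<close> is abelian, killed by \<open>p\<close> and, by the rank bound,
  generated by at most \<open>r\<close> elements, so it has at most \<open>p ^ r\<close> elements.
  Conjugation by \<open>g\<close> permutes them, and the orbit argument applies in
  \<open>G Mod L\<close>.\<close>

lemma section_centralized:
  assumes rk: "rank_le G r" and fin: "finite (carrier G)" and p: "Factorial_Ring.prime (p::nat)"
    and ord: "\<And>x. x \<in> carrier G \<Longrightarrow> x [^] (p ^ M) = \<one>"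
    and L: "L \<lhd> G" and N: "subgroup N G" "N \<lhd> G" and pow: "\<And>n. n \<in> N \<Longrightarrow> n [^] p \<in> L"
    and ab: "\<And>m n. m \<in> N \<Longrightarrow> n \<in> N \<Longrightarrow> cmod L m n"
    and g: "g \<in> carrier G" and n: "n \<in> N"
  shows "cmod L (g [^] (p ^ r)) n"
proof -
  interpret L: normal L G by fact
  interpret N: normal N G by fact
  interpret q: group_hom G "G Mod L" "\<lambda>x. L #> x"
    using L.factorgroup_is_group L.r_coset_hom_Mod is_group
    by (simp add: group_hom_axioms_def group_hom_def)
  have Nc: "N \<subseteq> carrier G" by (rule N.subset)
  have fN: "finite N" using fin Nc finite_subset by blast
  obtain T where T: "T \<subseteq> carrier G" "finite T" "card T \<le> r" "generate G T = generate G N"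
    using rk[unfolded rank_le_def, rule_format, OF Nc fN] by auto
  have gN: "generate G N = N"
    using generate_subgroup_incl[OF _ N(1), of N] generate.incl by fastforce
  have TN: "T \<subseteq> N" using T(4) gN generate.incl[of _ T G] by blast
  let ?q = "\<lambda>x. L #> x"
  have img: "?q ` N = generate (G Mod L) (?q ` T)"
    using q.generate_img[OF T(1)] T(4) gN by simp
  have nc: "n \<in> carrier G" using n Nc by blast
  have "finite (generate (G Mod L) (?q ` T)) \<and> card (generate (G Mod L) (?q ` T)) \<le> p ^ card (?q ` T)"
  proof (rule q.H.card_generate_commuting)
    show "?q ` T \<subseteq> carrier (G Mod L)" using T(1) by auto
    fix s assume s: "s \<in> ?q ` T"
    then obtain s' where s': "s' \<in> T" "s = L #> s'" by blast
    then have s'c: "s' \<in> carrier G" using T(1) by blast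
    have "s [^]\<^bsub>G Mod L\<^esub> p = L #> (s' [^] p)" using s' s'c q.hom_nat_pow by simp
    also have "\<dots> = L" using pow[of s'] s' TN L.subset by (simp add: coset_join2 L.subgroup_axioms subsetD)
    finally show "s [^]\<^bsub>G Mod L\<^esub> p = \<one>\<^bsub>G Mod L\<^esub>" by simp
    fix t assume "t \<in> ?q ` T"
    then obtain t' where t': "t' \<in> T" "t = L #> t'" by blast
    then have t'c: "t' \<in> carrier G" using T(1) by blast
    have "L #> (s' \<otimes> t') = L #> (t' \<otimes> s')"
      using ab s' t' TN cmod_iff[OF L s'c t'c] by blast
    then show "s \<otimes>\<^bsub>G Mod L\<^esub> t = t \<otimes>\<^bsub>G Mod L\<^esub> s"
      using s' t' s'c t'c q.hom_mult by metis
  qed (use T p prime_gt_0_nat in auto)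
  moreover have "p ^ card (?q ` T) \<le> p ^ r"
    using T card_image_le[of T ?q] p by (intro power_increasing) (auto simp: prime_gt_0_nat Suc_leI)
  ultimately have C: "finite (?q ` N)" "card (?q ` N) \<le> p ^ r" unfolding img by auto
  have "(?q g) [^]\<^bsub>G Mod L\<^esub> (p ^ r) \<otimes>\<^bsub>G Mod L\<^esub> ?q n = ?q n \<otimes>\<^bsub>G Mod L\<^esub> (?q g) [^]\<^bsub>G Mod L\<^esub> (p ^ r)"
  proof (rule q.H.commute_pow_of_orbit[OF _ _ p C])
    show qc: "?q g \<in> carrier (G Mod L)" "?q n \<in> carrier (G Mod L)" using g nc by auto
    show "(?q g) [^]\<^bsub>G Mod L\<^esub> k \<otimes>\<^bsub>G Mod L\<^esub> ?q n \<otimes>\<^bsub>G Mod L\<^esub> inv\<^bsub>G Mod L\<^esub> ((?q g) [^]\<^bsub>G Mod L\<^esub> k) \<in> ?q ` N" for k :: nat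
    proof -
      have "(?q g) [^]\<^bsub>G Mod L\<^esub> k \<otimes>\<^bsub>G Mod L\<^esub> ?q n \<otimes>\<^bsub>G Mod L\<^esub> inv\<^bsub>G Mod L\<^esub> ((?q g) [^]\<^bsub>G Mod L\<^esub> k)
          = ?q (g [^] k \<otimes> n \<otimes> inv (g [^] k))"
        using g nc by (simp only: q.hom_mult q.hom_inv q.hom_nat_pow inv_closed m_closed nat_pow_closed)
      moreover have "g [^] k \<otimes> n \<otimes> inv (g [^] k) \<in> N" using N.inv_op_closed2[of "g [^] k" n] g n by simp
      ultimately show ?thesis by (metis (no_types, lifting) imageI)
    qed
    have "(?q g) [^]\<^bsub>G Mod L\<^esub> (p ^ M) = \<one>\<^bsub>G Mod L\<^esub>"
      using ord[OF g] q.hom_nat_pow[OF g, of "p ^ M"] q.hom_one by metis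
    then show "(?q g) [^]\<^bsub>G Mod L\<^esub> (p ^ M) \<otimes>\<^bsub>G Mod L\<^esub> ?q n = ?q n \<otimes>\<^bsub>G Mod L\<^esub> (?q g) [^]\<^bsub>G Mod L\<^esub> (p ^ M)"
      using qc by (metis q.H.l_one q.H.r_one)
  qed
  then have "L #> (g [^] (p ^ r) \<otimes> n) = L #> (n \<otimes> g [^] (p ^ r))"
    using g nc q.hom_mult q.hom_nat_pow by (metis nat_pow_closed)
  then show ?thesis using cmod_iff[OF L] g nc by simp
qed

end

subsection \<open>Powers in finite \<open>p\<close>-groups of bounded rank\<close>

context group
begin

lemma cmod_of_mem:
  assumes L: "L \<lhd> G" and n: "n \<in> L" and v: "v \<in> carrier G"
  shows "cmod L n v"
proof -
  interpret L: normal L G by fact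
  have nc: "n \<in> carrier G" using n by (rule L.mem_carrier)
  have "n \<otimes> (v \<otimes> inv n \<otimes> inv v) \<in> L"
    using L.inv_op_closed2[OF v, of "inv n"] n by simp
  then show ?thesis unfolding cmod_def using nc v by (simp add: m_assoc)
qed

lemma conj_nat_pow:
  assumes "h \<in> carrier G" "g \<in> carrier G"
  shows "h \<otimes> g [^] (k::nat) \<otimes> inv h = (h \<otimes> g \<otimes> inv h) [^] k"
proof (induction k)
  case (Suc k)
  have "(h \<otimes> g \<otimes> inv h) [^] Suc k = (h \<otimes> g [^] k \<otimes> inv h) \<otimes> (h \<otimes> g \<otimes> inv h)"
    using Suc by simp
  also have "\<dots> = h \<otimes> g [^] k \<otimes> (inv h \<otimes> h) \<otimes> g \<otimes> inv h"
    using assms by (simp only: m_assoc inv_closed m_closed nat_pow_closed)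
  also have "\<dots> = h \<otimes> g [^] Suc k \<otimes> inv h" using assms by (simp add: m_assoc)
  finally show ?case by simp
qed (use assms in simp)

lemma normal_generate_pow:
  assumes N: "N \<lhd> G"
  shows "generate G ((\<lambda>x. x [^] (k::nat)) ` N) \<lhd> G"
proof (rule normal_generateI)
  interpret N: normal N G by fact
  show "(\<lambda>x. x [^] k) ` N \<subseteq> carrier G" by auto
  fix h g assume h: "h \<in> (\<lambda>x. x [^] k) ` N" and g: "g \<in> carrier G"
  then obtain x where x: "x \<in> N" "h = x [^] k" by blast
  then have "g \<otimes> h \<otimes> inv g = (g \<otimes> x \<otimes> inv g) [^] k" using conj_nat_pow g by simp
  then show "g \<otimes> h \<otimes> inv g \<in> (\<lambda>x. x [^] k) ` N" using N.inv_op_closed2[OF g x(1)] by blast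
qed

lemma normal_of_commutators:
  assumes T: "subgroup T G" and "\<And>x t. x \<in> carrier G \<Longrightarrow> t \<in> T \<Longrightarrow> cmod T x t"
  shows "T \<lhd> G"
proof (rule normal_invI[OF T])
  fix x t assume x: "x \<in> carrier G" and t: "t \<in> T"
  have tc: "t \<in> carrier G" using T t by (rule subgroup.mem_carrier)
  have "(x \<otimes> t \<otimes> inv x \<otimes> inv t) \<otimes> t \<in> T"
    using subgroup.m_closed[OF T assms(2)[OF x t, unfolded cmod_def] t] .
  then show "x \<otimes> t \<otimes> inv x \<in> T" using x tc by (simp add: m_assoc)
qed

lemma generate_subgroup:
  assumes "subgroup H G" shows "generate G H = H"
proof
  show "generate G H \<subseteq> H" by (rule generate_subgroup_incl[OF subset_refl assms])
  show "H \<subseteq> generate G H" using generate.incl[of _ H G] by blast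
qed

lemma set_mult_left: 
  assumes "subgroup L G" "subgroup K G" shows "L \<subseteq> L <#> K"
proof
  fix l assume l: "l \<in> L"
  have "l \<otimes> \<one> \<in> L <#> K" unfolding set_mult_def using l subgroup.one_closed[OF assms(2)] by blast
  then show "l \<in> L <#> K" using subgroup.mem_carrier[OF assms(1) l] by simp
qed

lemma set_mult_right: 
  assumes "subgroup L G" "subgroup K G" shows "K \<subseteq> L <#> K"
proof
  fix l assume l: "l \<in> K"
  have "\<one> \<otimes> l \<in> L <#> K" unfolding set_mult_def using l subgroup.one_closed[OF assms(1)] by blast
  then show "l \<in> L <#> K" using subgroup.mem_carrier[OF assms(2) l] by simp
qed

text \<open>The section \<open>N / L\<close> is not assumed abelian; overcoming this is the purpose
  of the induction. The filtration provides a normal \<open>L'\<close> with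
  \<open>L \<subseteq> L' \<subset> N\<close> and \<open>N / L'\<close> central in
  \<open>G / L'\<close>. If \<open>n\<close> and \<open>L'\<close> generate less than
  \<open>N\<close>, induction applies to what they generate. Otherwise \<open>N / L'\<close> is
  cyclic, and induction for \<open>L'\<close> makes \<open>L' / L\<close> central in
  \<open>V / L\<close>. As \<open>N\<close> lies in \<open>V\<close>, the section
  \<open>N / L\<close> is then abelian, hence centralized by the generators
  \<open>g [^] (p ^ r)\<close> of \<open>V\<close>.\<close>

lemma powers_centralize_sections:
  assumes rk: "rank_le G r" and fin: "finite (carrier G)" and p: "Factorial_Ring.prime (p::nat)"
    and \<Gamma>: "p_filtration p \<Gamma>" "\<Gamma> M = {\<one>}"
    and V: "V = generate G ((\<lambda>x. x [^] (p ^ r)) ` carrier G)"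
    and "N \<lhd> G" "L \<lhd> G" "L \<subseteq> N" "N \<subseteq> V" "\<And>n. n \<in> N \<Longrightarrow> n [^] p \<in> L" "n \<in> N" "v \<in> V"
  shows "cmod L n v"
  using assms(7-)
proof (induction "card N" arbitrary: N L n v rule: less_induct)
  case less
  interpret N: normal N G by fact
  interpret L: normal L G by fact
  have Vc: "V \<subseteq> carrier G" unfolding V by (rule generate_incl) auto
  have nc: "n \<in> carrier G" and vc: "v \<in> carrier G" using less.prems Vc by auto
  have p2: "p \<ge> 2" using p by (rule prime_ge_2_nat)
  have ord: "x [^] (p ^ M) = \<one>" if "x \<in> carrier G" for x
    using p_filtration_order[OF \<Gamma> that p2] .
  note cf = \<Gamma>(1)[unfolded p_filtration_def, THEN conjunct1, unfolded central_filtration_def]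
  have \<Gamma>n: "\<Gamma> k \<lhd> G" for k using cf by blast
  have \<Gamma>s: "subgroup (\<Gamma> k) G" for k using normal_imp_subgroup[OF \<Gamma>n] .
  have fN: "finite N" using fin N.subset finite_subset by blast
  show ?case
  proof (cases "N = L")
    case True
    then show ?thesis using cmod_of_mem[OF less.prems(2) _ vc, of n] less.prems(6) by simp
  next
    case False
    have NM: "\<not> N \<subseteq> L <#> \<Gamma> M"
    proof -
      have "L <#> \<Gamma> M = L" unfolding \<Gamma>(2) set_mult_def by auto
      then show ?thesis using False less.prems(3) by blast
    qed
    \<comment> \<open>The first index at which \<open>L <#> \<Gamma> j\<close> no longer covers
      \<open>N\<close>. Its intersection with \<open>N\<close> is proper, yet commutators with
      \<open>N\<close> fall into it because \<open>N\<close> is still covered at the preceding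
      index.\<close>
    define j where "j = (LEAST j. \<not> N \<subseteq> L <#> \<Gamma> j)"
    have j: "\<not> N \<subseteq> L <#> \<Gamma> j" unfolding j_def by (rule LeastI[of "\<lambda>j. \<not> N \<subseteq> L <#> \<Gamma> j", OF NM])
    have "\<Gamma> 1 = carrier G" "\<Gamma> 1 \<subseteq> \<Gamma> 0" using cf by auto
    then have "N \<subseteq> \<Gamma> 0" using N.subset by blast
    then have "N \<subseteq> L <#> \<Gamma> 0" using set_mult_right[OF L.subgroup_axioms \<Gamma>s] by blast
    then have "j \<noteq> 0" using j by metis
    then obtain k where k: "j = Suc k" using not0_implies_Suc by blast
    have Nk: "N \<subseteq> L <#> \<Gamma> k" using not_less_Least[of k "\<lambda>j. \<not> N \<subseteq> L <#> \<Gamma> j"] k unfolding j_def by auto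
    let ?K = "L <#> \<Gamma> j"
    have K: "?K \<lhd> G" by (rule normal_set_mult[OF less.prems(2) \<Gamma>n])
    define L' where "L' = N \<inter> ?K"
    have L': "L' \<lhd> G" unfolding L'_def by (rule normal_subgroup_intersect[OF less.prems(1) K])
    have LK: "L \<subseteq> ?K" "\<Gamma> j \<subseteq> ?K"
      using set_mult_left[OF L.subgroup_axioms \<Gamma>s] set_mult_right[OF L.subgroup_axioms \<Gamma>s] by auto
    have LL': "L \<subseteq> L'" using LK less.prems(3) unfolding L'_def by blast
    have L'N: "L' \<subset> N" using j unfolding L'_def by blast
    have comm: "cmod L' x y" if x: "x \<in> carrier G" and y: "y \<in> N" for x y
    proof -
      obtain l \<gamma> where l: "l \<in> L" "\<gamma> \<in> \<Gamma> k" "y = l \<otimes> \<gamma>" using Nk y unfolding set_mult_def by blast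
      have lc: "l \<in> carrier G" "\<gamma> \<in> carrier G"
        using L.mem_carrier[OF l(1)] subgroup.mem_carrier[OF \<Gamma>s l(2)] by auto
      have "cmod ?K x l" using cmod_of_mem[OF K _ x] LK l cmod_sym[OF K x lc(1)] by blast
      moreover have "cmod ?K x \<gamma>"
      proof -
        have "cmod (\<Gamma> (Suc k)) x \<gamma>" using cf x l(2) by blast
        then show ?thesis using cmod_mono[OF _ LK(2)] k by simp
      qed
      ultimately have "cmod ?K x y"
        using subgroup.m_closed[OF cmod_subgroup[OF K x], of l \<gamma>] l lc by blast
      moreover have "x \<otimes> y \<otimes> inv x \<otimes> inv y \<in> N" using N.inv_op_closed2[OF x y] y by simp
      ultimately show ?thesis unfolding cmod_def L'_def by blast
    qed
    have L's: "subgroup L' G" using normal_imp_subgroup[OF L'] .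
    have gc: "insert n L' \<subseteq> carrier G" using nc subgroup.subset[OF L's] by blast
    define T where "T = generate G (insert n L')"
    have Ts: "subgroup T G" unfolding T_def by (rule generate_is_subgroup[OF gc])
    have TN: "T \<subseteq> N" unfolding T_def
      by (rule generate_subgroup_incl[OF _ N.subgroup_axioms]) (use L'N less.prems in auto)
    have L'T: "L' \<subseteq> T" and nT: "n \<in> T" unfolding T_def using generate.incl[of _ "insert n L'" G] by auto
    have T: "T \<lhd> G"
    proof (rule normal_of_commutators[OF Ts])
      fix x t assume "x \<in> carrier G" "t \<in> T"
      then have "cmod L' x t" using comm TN by blast
      then show "cmod T x t" using cmod_mono L'T by blast
    qed
    show ?thesis
    proof (cases "T = N")
      case False
      then have "card T < card N" using TN fN by (simp add: psubset_card_mono psubsetI)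
      then show ?thesis
        by (rule less.hyps[OF _ T less.prems(2)]) (use LL' L'T TN nT less.prems in auto)
    next
      case True
      have cL': "card L' < card N" using L'N fN by (rule psubset_card_mono[rotated])
      have IH: "cmod L l w" if "l \<in> L'" "w \<in> V" for l w
        by (rule less.hyps[OF cL' L' less.prems(2) LL']) (use that L'N less.prems in auto)
      have IH': "cmod L w l" if "l \<in> L'" "w \<in> V" for l w
        using IH[OF that] cmod_sym[OF less.prems(2)] that Vc subgroup.mem_carrier[OF L's] by blast
      have nn: "cmod L n n" unfolding cmod_def using nc L.one_closed by (simp add: m_assoc)
      have nV: "n \<in> V" "L' \<subseteq> V" using less.prems L'N by auto
      have ab: "cmod L a b" if "a \<in> N" "b \<in> N" for a b
        by (rule cmod_generate2[OF less.prems(2) gc gc])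
          (use that True T_def IH IH' nn nV in auto)
      have "cmod L (g [^] (p ^ r)) n" if "g \<in> carrier G" for g
        by (rule section_centralized[OF rk fin p ord less.prems(2) N.subgroup_axioms less.prems(1)])
          (use that less.prems ab in auto)
      then have "cmod L n (g [^] (p ^ r))" if "g \<in> carrier G" for g
        using that cmod_sym[OF less.prems(2)] nc by blast
      then show ?thesis
        by (intro cmod_generate[OF less.prems(2) nc _ _ less.prems(7)[unfolded V]]) auto
    qed
  qed
qed

text \<open>These play the role of the lower \<open>p\<close>-series of a powerful group, starting
  from the subgroup generated by the \<open>p ^ r\<close>-th powers.\<close>

primrec iterated_powers :: "nat \<Rightarrow> nat \<Rightarrow> nat \<Rightarrow> 'a set" where
  "iterated_powers p r 0 = generate G ((\<lambda>x. x [^] (p ^ r)) ` carrier G)"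
| "iterated_powers p r (Suc i) = generate G ((\<lambda>x. x [^] p) ` iterated_powers p r i)"

lemma carrier_normal: "carrier G \<lhd> G"
  by (rule normal_invI[OF subgroup_self]) auto

lemma iterated_powers_normal: "iterated_powers p r i \<lhd> G"
  by (induction i) (auto intro: normal_generate_pow carrier_normal)

lemma subgroup_nat_pow_closed:
  assumes "subgroup H G" "x \<in> H" shows "x [^] (k::nat) \<in> H"
  by (induction k) (use assms subgroup.one_closed subgroup.m_closed in auto)

lemma iterated_powers_Suc_subset: "iterated_powers p r (Suc i) \<subseteq> iterated_powers p r i"
proof -
  have "subgroup (iterated_powers p r i) G" using normal_imp_subgroup[OF iterated_powers_normal] .
  then show ?thesis
    unfolding iterated_powers.simps(2)
    by (intro generate_subgroup_incl) (auto intro: subgroup_nat_pow_closed)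
qed

lemma iterated_powers_subset: "iterated_powers p r i \<subseteq> iterated_powers p r 0"
  by (induction i) (use iterated_powers_Suc_subset in blast)+

lemma iterated_powers_pow: "x \<in> iterated_powers p r i \<Longrightarrow> x [^] p \<in> iterated_powers p r (Suc i)"
  unfolding iterated_powers.simps(2) by (rule generate.incl) auto

lemma pow_mem_iterated_powers:
  assumes "x \<in> carrier G" shows "x [^] (p ^ (r + i)) \<in> iterated_powers p r i"
proof (induction i)
  case 0
  show ?case unfolding iterated_powers.simps(1) using assms by (auto intro: generate.incl)
next
  case (Suc i)
  have "(x [^] (p ^ (r + i))) [^] p = x [^] (p ^ (r + Suc i))"
    unfolding nat_pow_pow[OF assms] by (simp add: mult.commute)
  then show ?case using iterated_powers_pow[OF Suc] by simp
qed

lemma iterated_powers_filtration: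
  assumes "p_filtration p \<Gamma>"
  shows "iterated_powers p r i \<subseteq> \<Gamma> (p ^ i)"
proof -
  note cf = assms[unfolded p_filtration_def, THEN conjunct1, unfolded central_filtration_def]
  have s: "subgroup (\<Gamma> k) G" for k using cf normal_imp_subgroup by blast
  show ?thesis
  proof (induction i)
    case 0
    have "\<Gamma> (p ^ 0) = carrier G" using cf by simp
    then show ?case using normal_imp_subgroup[OF iterated_powers_normal[of p r 0]] subgroup.subset by metis
  next
    case (Suc i)
    show ?case unfolding iterated_powers.simps(2)
      by (rule generate_subgroup_incl[OF _ s]) (use Suc assms in \<open>auto simp: p_filtration_def\<close>)
  qed
qed

context
  fixes r p :: nat and \<Gamma> :: "nat \<Rightarrow> 'a set" and M :: nat
  assumes rk: "rank_le G r" and fin: "finite (carrier G)" and p: "Factorial_Ring.prime p"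
    and \<Gamma>: "p_filtration p \<Gamma>" "\<Gamma> M = {\<one>}"
begin

lemma iterated_powers_central:
  assumes "x \<in> iterated_powers p r i" "v \<in> iterated_powers p r 0"
  shows "cmod (iterated_powers p r (Suc i)) x v"
  by (rule powers_centralize_sections[OF rk fin p \<Gamma> _ iterated_powers_normal iterated_powers_normal
        iterated_powers_Suc_subset iterated_powers_subset iterated_powers_pow assms]) simp

text \<open>Let \<open>m\<close> lie in the \<open>j\<close>-th term. By induction the commutator
  \<open>z\<close> of \<open>x\<close> and \<open>m\<close> lies one term above the target, so
  modulo the target \<open>z\<close> commutes with \<open>m\<close> and \<open>z^p = 1\<close>.
  Hence \<open>x m^p x^-1 = (z m)^p = z^p m^p = m^p\<close> there, and the elements
  \<open>m^p\<close> generate the next term.\<close>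

lemma iterated_powers_commutator:
  assumes "x \<in> iterated_powers p r i" "y \<in> iterated_powers p r j"
  shows "cmod (iterated_powers p r (Suc (i + j))) x y"
  using assms
proof (induction j arbitrary: y)
  case 0
  then show ?case using iterated_powers_central by simp
next
  case (Suc j)
  let ?L = "iterated_powers p r (Suc (i + Suc j))"
  have L: "?L \<lhd> G" by (rule iterated_powers_normal)
  interpret L: normal ?L G by fact
  interpret q: group_hom G "G Mod ?L" "\<lambda>x. ?L #> x"
    using L.factorgroup_is_group L.r_coset_hom_Mod is_group
    by (simp add: group_hom_axioms_def group_hom_def)
  have c: "iterated_powers p r k \<subseteq> carrier G" for k
    using subgroup.subset[OF normal_imp_subgroup[OF iterated_powers_normal]] .
  have xc: "x \<in> carrier G" using Suc.prems c by blast
  have "cmod ?L x (m [^] p)" if m: "m \<in> iterated_powers p r j" for m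
  proof -
    have mc: "m \<in> carrier G" using m c by blast
    let ?z = "x \<otimes> m \<otimes> inv x \<otimes> inv m"
    have z: "?z \<in> iterated_powers p r (Suc (i + j))" using Suc.IH[OF Suc.prems(1) m] unfolding cmod_def .
    then have zc: "?z \<in> carrier G" using c by blast
    have "m \<in> iterated_powers p r 0" using m iterated_powers_subset by blast
    from iterated_powers_central[OF z this] have zm: "cmod ?L ?z m" by simp
    have zp: "?z [^] p \<in> ?L" using iterated_powers_pow[OF z] by simp
    let ?q = "\<lambda>x. ?L #> x"
    have Q: "?q ?z \<in> carrier (G Mod ?L)" "?q m \<in> carrier (G Mod ?L)" using q.hom_closed zc mc by auto
    have "?q (?z \<otimes> m) = ?q (m \<otimes> ?z)" using zm cmod_iff[OF L zc mc] by simp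
    then have cm: "?q ?z \<otimes>\<^bsub>G Mod ?L\<^esub> ?q m = ?q m \<otimes>\<^bsub>G Mod ?L\<^esub> ?q ?z"
      using q.hom_mult zc mc by metis
    have zp1: "?q ?z [^]\<^bsub>G Mod ?L\<^esub> p = \<one>\<^bsub>G Mod ?L\<^esub>"
      unfolding q.hom_nat_pow[OF zc, symmetric] one_FactGroup
      by (rule coset_join2[OF nat_pow_closed[OF zc] L.subgroup_axioms zp])
    have "x \<otimes> m [^] p \<otimes> inv x = (?z \<otimes> m) [^] p"
      using conj_nat_pow[OF xc mc] xc mc by (simp add: m_assoc)
    then have "?q (x \<otimes> m [^] p \<otimes> inv x) = (?q ?z \<otimes>\<^bsub>G Mod ?L\<^esub> ?q m) [^]\<^bsub>G Mod ?L\<^esub> p"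
      using q.hom_nat_pow[of "?z \<otimes> m" p] q.hom_mult[OF zc mc] zc mc by (metis m_closed)
    also have "\<dots> = ?q ?z [^]\<^bsub>G Mod ?L\<^esub> p \<otimes>\<^bsub>G Mod ?L\<^esub> ?q m [^]\<^bsub>G Mod ?L\<^esub> p"
      using q.H.pow_mult_distrib[OF cm Q] .
    also have "\<dots> = ?q (m [^] p)"
      unfolding zp1 using q.hom_nat_pow[OF mc, of p] Q q.H.nat_pow_closed q.H.l_one by metis
    finally have "x \<otimes> m [^] p \<otimes> inv x \<otimes> inv (m [^] p) \<in> ?L"
      using rcos_eq_iff[OF L.subgroup_axioms, of "x \<otimes> m [^] p \<otimes> inv x" "m [^] p"] xc mc by simp
    then show ?thesis unfolding cmod_def .
  qed
  then show ?case
    by (intro cmod_generate[OF L xc _ _ Suc.prems(2)[unfolded iterated_powers.simps(2)]]) (use c in auto)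
qed

end

text \<open>Both powers lie in the \<open>i\<close>-th term of the series, so their commutator lies
  in the term of index \<open>2 * i + 1\<close>, which the filtration makes trivial. The gain is
  that \<open>i\<close> in the exponent controls depth \<open>2 * i + 1\<close>.\<close>

theorem p_powers_commute:
  assumes "rank_le G r" "finite (carrier G)" "Factorial_Ring.prime p"
    and \<Gamma>: "p_filtration p \<Gamma>" "\<Gamma> (p ^ (2 * i + 1)) = {\<one>}"
    and g: "g \<in> carrier G" and h: "h \<in> carrier G"
  shows "g [^] (p ^ (r + i)) \<otimes> h [^] (p ^ (r + i)) = h [^] (p ^ (r + i)) \<otimes> g [^] (p ^ (r + i))"
proof -
  have "cmod (iterated_powers p r (Suc (i + i))) (g [^] (p ^ (r + i))) (h [^] (p ^ (r + i)))"
    by (rule iterated_powers_commutator[OF assms(1-5)]) (use pow_mem_iterated_powers g h in auto)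
  moreover have "iterated_powers p r (Suc (i + i)) \<subseteq> {\<one>}"
    using iterated_powers_filtration[OF \<Gamma>(1), of r "2 * i + 1"] \<Gamma>(2) by (simp add: mult_2)
  ultimately show ?thesis using cmod_mono cmod_one_iff g h by (metis nat_pow_closed)
qed

end

subsection \<open>Groups of bounded rank and exponent, and subgroups of finite index\<close>

context group
begin

text \<open>The classical fact on maximal normal abelian subgroups of nilpotent groups. If the
  centralizer \<open>C\<close> of \<open>A\<close> were larger than \<open>A\<close>, an element
  \<open>c\<close> of \<open>C\<close> outside \<open>A\<close>, taken as deep as possible in the
  filtration, would have all its commutators in \<open>A\<close>, and \<open>c\<close> and
  \<open>A\<close> would generate a larger normal abelian subgroup.\<close>

lemma self_centralizing_normal:
  assumes fin: "finite (carrier G)" and \<Gamma>: "central_filtration \<Gamma>" "\<Gamma> M = {\<one>}"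
  obtains A where "A \<lhd> G" "\<And>a b. a \<in> A \<Longrightarrow> b \<in> A \<Longrightarrow> a \<otimes> b = b \<otimes> a"
    "\<And>c. c \<in> carrier G \<Longrightarrow> (\<And>a. a \<in> A \<Longrightarrow> c \<otimes> a = a \<otimes> c) \<Longrightarrow> c \<in> A"
proof -
  define P where "P A \<longleftrightarrow> A \<lhd> G \<and> (\<forall>a\<in>A. \<forall>b\<in>A. a \<otimes> b = b \<otimes> a)" for A
  have P1: "P {\<one>}" unfolding P_def using one_is_normal by auto
  have "card A < Suc (card (carrier G))" if "P A" for A
  proof -
    have "A \<subseteq> carrier G" using that normal_imp_subgroup subgroup.subset unfolding P_def by metis
    then show ?thesis using fin by (simp add: card_mono le_imp_less_Suc)
  qed
  then obtain A where PA: "P A" and max: "\<And>B. P B \<Longrightarrow> card B \<le> card A"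
    using ex_has_greatest_nat[of P "{\<one>}" card "Suc (card (carrier G))"] P1 by blast
  have A: "A \<lhd> G" and ab: "a \<otimes> b = b \<otimes> a" if "a \<in> A" "b \<in> A" for a b using PA that unfolding P_def by auto
  have A: "A \<lhd> G" using PA unfolding P_def by auto
  interpret A: normal A G by fact
  note cf = \<Gamma>(1)[unfolded central_filtration_def]
  define C where "C = {c \<in> carrier G. \<forall>a\<in>A. c \<otimes> a = a \<otimes> c}"
  have CA: "C \<subseteq> A"
  proof (rule ccontr)
    assume nCA: "\<not> C \<subseteq> A"
    have M: "C \<inter> \<Gamma> M \<subseteq> A" using \<Gamma>(2) A.one_closed by auto
    define j where "j = (LEAST j. C \<inter> \<Gamma> j \<subseteq> A)"
    have j: "C \<inter> \<Gamma> j \<subseteq> A" unfolding j_def by (rule LeastI[of "\<lambda>j. C \<inter> \<Gamma> j \<subseteq> A", OF M])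
    have "\<Gamma> 1 = carrier G" "\<Gamma> 1 \<subseteq> \<Gamma> 0" using cf by auto
    then have "C \<subseteq> \<Gamma> 0" unfolding C_def by blast
    then have "j \<noteq> 0" using nCA j by (metis inf.absorb1)
    then obtain k where k: "j = Suc k" using not0_implies_Suc by blast
    have "\<not> C \<inter> \<Gamma> k \<subseteq> A" using not_less_Least[of k "\<lambda>j. C \<inter> \<Gamma> j \<subseteq> A"] k unfolding j_def by auto
    then obtain c where c: "c \<in> C" "c \<in> \<Gamma> k" "c \<notin> A" by blast
    have cc: "c \<in> carrier G" using c unfolding C_def by auto
    have Ccomm: "x \<otimes> c \<otimes> inv x \<otimes> inv c \<in> C" if x: "x \<in> carrier G" for x
    proof -
      have "x \<otimes> c \<otimes> inv x \<otimes> a = a \<otimes> (x \<otimes> c \<otimes> inv x)" if a: "a \<in> A" for a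
      proof -
        let ?b = "inv x \<otimes> a \<otimes> x"
        have b: "?b \<in> A" using A.inv_op_closed1[OF x a] .
        have ac: "a \<in> carrier G" and bc: "?b \<in> carrier G" using A.mem_carrier a b by auto
        have "x \<otimes> c \<otimes> inv x \<otimes> a = x \<otimes> (c \<otimes> ?b) \<otimes> inv x" using x cc ac by (simp add: m_assoc)
        also have "\<dots> = x \<otimes> (?b \<otimes> c) \<otimes> inv x" using c(1) b unfolding C_def by simp
        also have "\<dots> = (x \<otimes> inv x) \<otimes> a \<otimes> (x \<otimes> c \<otimes> inv x)"
          using x cc ac by (simp only: m_assoc m_closed inv_closed)
        finally show ?thesis using x cc ac by simp
      qed
      then have "a \<otimes> (x \<otimes> c \<otimes> inv x) = (x \<otimes> c \<otimes> inv x) \<otimes> a" if "a \<in> A" for a using that by simp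
      moreover have "a \<otimes> inv c = inv c \<otimes> a" if "a \<in> A" for a
        using commute_inv[of a c] c(1) that A.mem_carrier cc unfolding C_def by simp
      ultimately have "a \<otimes> (x \<otimes> c \<otimes> inv x \<otimes> inv c) = (x \<otimes> c \<otimes> inv x \<otimes> inv c) \<otimes> a" if "a \<in> A" for a
        using commute_mult[of a "x \<otimes> c \<otimes> inv x" "inv c"] that A.mem_carrier x cc by simp
      then show ?thesis unfolding C_def using x cc by simp
    qed
    have comm: "cmod A x c" if x: "x \<in> carrier G" for x
    proof -
      have "cmod (\<Gamma> (Suc k)) x c" using cf x c(2) by blast
      then show ?thesis using Ccomm[OF x] j k unfolding cmod_def by blast
    qed
    have gc: "insert c A \<subseteq> carrier G" using cc A.subset by blast
    define B where "B = generate G (insert c A)"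
    have Bs: "subgroup B G" unfolding B_def by (rule generate_is_subgroup[OF gc])
    have AB: "A \<subset> B" unfolding B_def using c(3) generate.incl[of _ "insert c A" G] by blast
    have "B \<lhd> G"
    proof (rule normal_of_commutators[OF Bs])
      fix x t assume x: "x \<in> carrier G" and t: "t \<in> B"
      have "cmod A x s" if "s \<in> insert c A" for s
        using that comm[OF x] cmod_of_mem[OF A _ x, of s] cmod_sym[OF A x, of s] gc by auto
      then have "cmod A x t" using cmod_generate[OF A x gc _ t[unfolded B_def]] by blast
      then show "cmod B x t" using cmod_mono AB by blast
    qed
    moreover have "a \<otimes> b = b \<otimes> a" if "a \<in> B" "b \<in> B" for a b
    proof -
      have "cmod {\<one>} a b"
      proof (rule cmod_generate2[OF one_is_normal gc gc _ that[unfolded B_def]])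
        fix s t assume st: "s \<in> insert c A" "t \<in> insert c A"
        have "s \<otimes> t = t \<otimes> s" using st ab c(1) unfolding C_def by auto
        then show "cmod {\<one>} s t" using cmod_one_iff st gc by blast
      qed
      then show ?thesis using cmod_one_iff subgroup.mem_carrier[OF Bs] that by blast
    qed
    ultimately have "P B" unfolding P_def by blast
    then have "card B \<le> card A" by (rule max)
    moreover have "finite B" using fin subgroup.subset[OF Bs] finite_subset by blast
    ultimately show False using AB psubset_card_mono by (metis leD)
  qed
  show ?thesis by (rule that[OF A]) (use ab CA in \<open>auto simp: C_def\<close>)
qed

text \<open>A self-centralizing normal abelian \<open>A\<close> has at most \<open>q ^ r\<close>
  elements. Conjugation on at most \<open>r\<close> generators of \<open>A\<close> determines an
  element up to the centralizer of \<open>A\<close>, which is \<open>A\<close> itself. So there are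
  at most \<open>card A ^ r\<close> classes of at most \<open>card A\<close> elements each.\<close>

lemma card_bound_of_exponent:
  assumes rk: "rank_le G r" and fin: "finite (carrier G)" and \<Gamma>: "central_filtration \<Gamma>" "\<Gamma> M = {\<one>}"
    and q: "q > 0" "\<And>x. x \<in> carrier G \<Longrightarrow> x [^] (q::nat) = \<one>"
  shows "card (carrier G) \<le> (q ^ r) ^ r * q ^ r"
proof -
  obtain A where A: "A \<lhd> G" and ab: "\<And>a b. a \<in> A \<Longrightarrow> b \<in> A \<Longrightarrow> a \<otimes> b = b \<otimes> a"
    and sc: "\<And>c. c \<in> carrier G \<Longrightarrow> (\<And>a. a \<in> A \<Longrightarrow> c \<otimes> a = a \<otimes> c) \<Longrightarrow> c \<in> A"
    using self_centralizing_normal[OF fin \<Gamma>] by blast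
  interpret A: normal A G by fact
  have fA: "finite A" using fin A.subset finite_subset by blast
  obtain T where T: "T \<subseteq> carrier G" "finite T" "card T \<le> r" "generate G T = generate G A"
    using rk[unfolded rank_le_def, rule_format, OF A.subset fA] by auto
  have gT: "generate G T = A" using T(4) generate_subgroup[OF A.subgroup_axioms] by simp
  have TA: "T \<subseteq> A" using gT generate.incl[of _ T G] by blast
  have "card A \<le> q ^ card T"
    using card_generate_commuting[OF T(2,1) _ _ q(1)] ab q(2) TA T(1) gT by blast
  also have "\<dots> \<le> q ^ r" using T(3) q(1) by (simp add: power_increasing)
  finally have cA: "card A \<le> q ^ r" .
  define \<phi> where "\<phi> g = (\<lambda>t\<in>T. g \<otimes> t \<otimes> inv g)" for g
  define s where "s f = (SOME g. g \<in> carrier G \<and> \<phi> g = f)" for f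
  have s: "s (\<phi> g) \<in> carrier G" "\<phi> (s (\<phi> g)) = \<phi> g" if "g \<in> carrier G" for g
    using someI[of "\<lambda>h. h \<in> carrier G \<and> \<phi> h = \<phi> g" g] that unfolding s_def by auto
  have fib: "inv h \<otimes> g \<in> A" if g: "g \<in> carrier G" and h: "h \<in> carrier G" and eq: "\<phi> h = \<phi> g" for g h
  proof (rule sc)
    show c: "inv h \<otimes> g \<in> carrier G" using g h by simp
    fix a assume a: "a \<in> A"
    have "cmod {\<one>} (inv h \<otimes> g) t" if t: "t \<in> T" for t
    proof -
      have tc: "t \<in> carrier G" using t T by blast
      have "h \<otimes> t \<otimes> inv h = g \<otimes> t \<otimes> inv g" using fun_cong[OF eq, of t] t unfolding \<phi>_def by simp
      then have "inv h \<otimes> (h \<otimes> t \<otimes> inv h) \<otimes> g = inv h \<otimes> (g \<otimes> t \<otimes> inv g) \<otimes> g" by simp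
      moreover have "inv h \<otimes> (h \<otimes> t \<otimes> inv h) \<otimes> g = (inv h \<otimes> h) \<otimes> t \<otimes> (inv h \<otimes> g)"
        using g h tc by (simp only: m_assoc m_closed inv_closed)
      moreover have "inv h \<otimes> (g \<otimes> t \<otimes> inv g) \<otimes> g = (inv h \<otimes> g) \<otimes> t \<otimes> (inv g \<otimes> g)"
        using g h tc by (simp only: m_assoc m_closed inv_closed)
      ultimately have "inv h \<otimes> g \<otimes> t = t \<otimes> (inv h \<otimes> g)" using g h tc by simp
      then show ?thesis using cmod_one_iff c tc by blast
    qed
    then have "cmod {\<one>} (inv h \<otimes> g) a"
      using cmod_generate[OF one_is_normal c T(1), of a] a gT by blast
    then show "inv h \<otimes> g \<otimes> a = a \<otimes> (inv h \<otimes> g)" using cmod_one_iff[OF c] A.mem_carrier[OF a] by blast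
  qed
  define F where "F g = (\<phi> g, inv (s (\<phi> g)) \<otimes> g)" for g
  have inj: "inj_on F (carrier G)"
  proof (rule inj_onI)
    fix x y assume xy: "x \<in> carrier G" "y \<in> carrier G" "F x = F y"
    then have "\<phi> x = \<phi> y" and "inv (s (\<phi> x)) \<otimes> x = inv (s (\<phi> y)) \<otimes> y" unfolding F_def by auto
    then have "inv (s (\<phi> x)) \<otimes> x = inv (s (\<phi> x)) \<otimes> y" by metis
    then show "x = y" using xy s(1)[OF xy(1)] by simp
  qed
  have "F ` carrier G \<subseteq> (T \<rightarrow>\<^sub>E A) \<times> A"
    unfolding F_def using fib s TA A.inv_op_closed2 by (auto simp: \<phi>_def subset_iff)
  moreover have "finite ((T \<rightarrow>\<^sub>E A) \<times> A)" using T(2) fA by (intro finite_cartesian_product finite_PiE) auto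
  ultimately have "card (carrier G) \<le> card ((T \<rightarrow>\<^sub>E A) \<times> A)" using card_inj_on_le[OF inj] by blast
  also have "\<dots> = card A ^ card T * card A" using T(2) by (simp add: card_cartesian_product card_PiE)
  also have "\<dots> \<le> (q ^ r) ^ r * q ^ r"
  proof (rule mult_mono[OF _ cA])
    have "card A ^ card T \<le> (q ^ r) ^ card T" using cA by (rule power_mono) simp
    also have "\<dots> \<le> (q ^ r) ^ r" using T(3) q(1) by (simp add: power_increasing)
    finally show "card A ^ card T \<le> (q ^ r) ^ r" .
  qed auto
  finally show ?thesis .
qed

text \<open>Schreier's argument: while a word is read letter by letter, the current representative
  times the next letter is replaced by its own representative, and the quotient of the two is one of
  the generators of \<open>H\<close>.\<close>

lemma finite_index_finitely_generated:
  assumes S: "S \<subseteq> carrier G" "finite S" "generate G S = carrier G"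
    and H: "subgroup H G" and R: "finite R" "R \<subseteq> carrier G" "carrier G = (\<Union>\<rho>\<in>R. H #> \<rho>)"
  shows "\<exists>S'\<subseteq>H. finite S' \<and> generate G S' = H"
proof -
  have Hc: "H \<subseteq> carrier G" by (rule subgroup.subset[OF H])
  define f where "f g = (SOME \<rho>. \<rho> \<in> R \<and> g \<otimes> inv \<rho> \<in> H)" for g
  have f: "f g \<in> R" "g \<otimes> inv (f g) \<in> H" if "g \<in> carrier G" for g
  proof -
    have "g \<in> (\<Union>\<rho>\<in>R. H #> \<rho>)" using that unfolding R(3)[symmetric] .
    then obtain \<rho> where \<rho>: "\<rho> \<in> R" "g \<in> H #> \<rho>" by blast
    have "g \<otimes> inv \<rho> \<in> H"
      using subgroup.rcos_module_imp[OF H is_group _ \<rho>(2)] R(2) \<rho>(1) by (simp add: subsetD)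
    then have "\<exists>\<rho>. \<rho> \<in> R \<and> g \<otimes> inv \<rho> \<in> H" using \<rho>(1) by blast
    from someI_ex[OF this] show "f g \<in> R" "g \<otimes> inv (f g) \<in> H" unfolding f_def by auto
  qed
  define Q where "Q = S \<union> m_inv G ` S"
  \<comment> \<open>\<open>R\<close> merely covers \<open>G\<close> by cosets. Adding
    \<open>\<one>\<close> gives the rewriting a start, and \<open>R' \<inter> H\<close> is put into
    \<open>S'\<close> because the representative left at the end lies in \<open>H\<close> but may
    differ from \<open>\<one>\<close>.\<close>
  define R' where "R' = insert \<one> R"
  have R': "R' \<subseteq> carrier G" "finite R'" unfolding R'_def using R by auto
  have Q: "Q \<subseteq> carrier G" "finite Q" unfolding Q_def using S by auto
  define S' where "S' = (\<lambda>(t, s). t \<otimes> s \<otimes> inv (f (t \<otimes> s))) ` (R' \<times> Q) \<union> (R' \<inter> H)"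
  have S'H: "S' \<subseteq> H"
  proof
    fix x assume x: "x \<in> S'"
    show "x \<in> H"
    proof (cases "x \<in> R' \<inter> H")
      case False
      then obtain t s where ts: "t \<in> R'" "s \<in> Q" "x = t \<otimes> s \<otimes> inv (f (t \<otimes> s))"
        using x unfolding S'_def by auto
      then show ?thesis using f(2)[of "t \<otimes> s"] R'(1) Q(1) by (simp add: subsetD)
    qed simp
  qed
  have S'c: "S' \<subseteq> carrier G" using S'H Hc by blast
  have fS': "finite S'" unfolding S'_def using Q R' by auto
  define P where "P g \<longleftrightarrow> (\<exists>u\<in>generate G S'. \<exists>t\<in>R'. g = u \<otimes> t)" for g
  have gc: "u \<in> carrier G" if "u \<in> generate G S'" for u using generate_in_carrier[OF S'c that] .
  have step: "P (t \<otimes> s)" if t: "t \<in> R'" and s: "s \<in> Q" for t s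
  proof -
    have c: "t \<in> carrier G" "s \<in> carrier G" using t s R' Q by auto
    have fc: "f (t \<otimes> s) \<in> R'" "f (t \<otimes> s) \<in> carrier G" using f[of "t \<otimes> s"] c R(2) unfolding R'_def by auto
    have "t \<otimes> s \<otimes> inv (f (t \<otimes> s)) \<in> generate G S'"
      by (rule generate.incl) (use t s in \<open>auto simp: S'_def\<close>)
    moreover have "t \<otimes> s = t \<otimes> s \<otimes> inv (f (t \<otimes> s)) \<otimes> f (t \<otimes> s)"
      using c fc by (simp add: m_assoc)
    ultimately show ?thesis unfolding P_def using fc(1) by blast
  qed
  have all: "\<forall>t\<in>R'. P (t \<otimes> g)" if "g \<in> generate G S" for g
    using that
  proof (induction rule: generate.induct)
    case one
    have "P t" if "t \<in> R'" for t
    proof -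
      have "t = \<one> \<otimes> t" using that R' by auto
      then show ?thesis unfolding P_def using that generate.one by blast
    qed
    then show ?case using R' by auto
  next
    case (incl h)
    then show ?case using step unfolding Q_def by blast
  next
    case (inv h)
    then show ?case using step unfolding Q_def by blast
  next
    case (eng g h)
    have gh: "g \<in> carrier G" "h \<in> carrier G" using eng.hyps generate_in_carrier[OF S(1)] by auto
    show ?case
    proof
      fix t assume t: "t \<in> R'"
      obtain u t' where 1: "u \<in> generate G S'" "t' \<in> R'" "t \<otimes> g = u \<otimes> t'"
        using eng.IH(1) t unfolding P_def by blast
      obtain u' t'' where 2: "u' \<in> generate G S'" "t'' \<in> R'" "t' \<otimes> h = u' \<otimes> t''"
        using eng.IH(2) 1(2) unfolding P_def by blast
      have c: "t \<in> carrier G" "t' \<in> carrier G" "t'' \<in> carrier G" "u \<in> carrier G" "u' \<in> carrier G"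
        using t 1 2 R' gc by auto
      have "t \<otimes> (g \<otimes> h) = (t \<otimes> g) \<otimes> h" using c gh by (simp add: m_assoc)
      also have "\<dots> = u \<otimes> (t' \<otimes> h)" unfolding 1(3) using c gh by (simp add: m_assoc)
      also have "\<dots> = (u \<otimes> u') \<otimes> t''" unfolding 2(3) using c by (simp add: m_assoc)
      finally show "P (t \<otimes> (g \<otimes> h))" unfolding P_def using generate.eng[OF 1(1) 2(1)] 2(2) by blast
    qed
  qed
  have gS': "generate G S' \<subseteq> H" by (rule generate_subgroup_incl[OF S'H H])
  have "h \<in> generate G S'" if h: "h \<in> H" for h
  proof -
    have hc: "h \<in> carrier G" using h Hc by blast
    have "P (\<one> \<otimes> h)" using all[of h] S(3) hc unfolding R'_def by blast
    then obtain u t where u: "u \<in> generate G S'" "t \<in> R'" "h = u \<otimes> t" unfolding P_def using hc by auto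
    have c: "u \<in> carrier G" "t \<in> carrier G" using u R' gc by auto
    have "t = inv u \<otimes> h" using u c by (simp add: m_assoc[symmetric])
    then have "t \<in> H" using u(1) gS' h H by (auto intro: subgroup.m_closed subgroup.m_inv_closed)
    then have "t \<in> generate G S'" using u(2) by (auto intro: generate.incl simp: S'_def)
    then show ?thesis using u generate.eng by auto
  qed
  then show ?thesis using gS' S'H fS' by blast
qed

end

subsection \<open>Linear representations\<close>

text \<open>Stated over any commutative ring, so that fields and power series rings are treated
  alike. Invertibility of the values follows from the group laws.\<close>

definition mrep :: "('g, 'b) monoid_scheme \<Rightarrow> nat \<Rightarrow> ('g \<Rightarrow> 'a::comm_ring_1 mat) \<Rightarrow> bool" where
  "mrep G N \<sigma> \<longleftrightarrow> (\<forall>g\<in>carrier G. \<sigma> g \<in> carrier_mat N N) \<and> \<sigma> \<one>\<^bsub>G\<^esub> = 1\<^sub>m N \<and>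
     (\<forall>g\<in>carrier G. \<forall>h\<in>carrier G. \<sigma> (g \<otimes>\<^bsub>G\<^esub> h) = \<sigma> g * \<sigma> h)"

lemma mat_mult_entry:
  assumes "A \<in> carrier_mat N N" "B \<in> carrier_mat N N" "i < N" "j < N"
  shows "(A * B) $$ (i, j) = (\<Sum>l<N. A $$ (i, l) * B $$ (l, j))"
  using assms by (auto simp: scalar_prod_def lessThan_atLeast0 intro!: sum.cong)

lemma (in group) Q_linear_of_mrep:
  assumes "mrep G d (\<sigma> :: 'a \<Rightarrow> rat mat)" "inj_on \<sigma> (carrier G)"
  shows "Q_linear G"
proof -
  have key: "Q_linear G" if m: "mrep G d (\<sigma> :: 'a \<Rightarrow> rat mat)" and inj: "inj_on \<sigma> (carrier G)" and "d > 0" for d and \<sigma> :: "'a \<Rightarrow> rat mat"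
  proof -
    note m = m[unfolded mrep_def]
    have U: "\<sigma> g \<in> carrier (GL d :: rat mat monoid)" if g: "g \<in> carrier G" for g
    proof -
      have "\<sigma> (inv g) * \<sigma> g = 1\<^sub>m d" "\<sigma> g * \<sigma> (inv g) = 1\<^sub>m d"
        using m g by (metis inv_closed l_inv r_inv)+
      then show ?thesis using m g inv_closed[OF g]
        unfolding GL_def units_of_carrier Units_def by (auto simp: ring_mat_simps)
    qed
    have "\<sigma> \<in> hom G (GL d)"
      unfolding hom_def using U m by (auto simp: GL_def units_of_def ring_mat_simps)
    then interpret h: group_hom G "GL d :: rat mat monoid" \<sigma>
      using group_GL by (simp add: group_hom_def group_hom_axioms_def)
    have "subgroup (\<sigma> ` carrier G) (GL d :: rat mat monoid)" by (rule h.img_is_subgroup)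
    moreover have "\<sigma> \<in> iso G ((GL d :: rat mat monoid)\<lparr>carrier := \<sigma> ` carrier G\<rparr>)"
      using inj h.hom_mult by (auto simp: iso_def hom_def bij_betw_def)
    ultimately show ?thesis unfolding Q_linear_def is_iso_def using \<open>d > 0\<close> by blast
  qed
  show ?thesis
  proof (cases "d = 0")
    \<comment> \<open>\<open>Q_linear\<close> asks for positive degree. Only the trivial group has a
      faithful representation of degree 0, and for it the trivial 1 by 1 representation
      serves.\<close>
    case True
    have "g = h" if "g \<in> carrier G" "h \<in> carrier G" for g h
    proof -
      have "\<sigma> g \<in> carrier_mat 0 0" "\<sigma> h \<in> carrier_mat 0 0" using assms(1) that True unfolding mrep_def by auto
      then have "\<sigma> g = \<sigma> h" by (intro eq_matI) auto
      then show ?thesis using assms(2) that by (auto dest: inj_onD)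
    qed
    then show ?thesis by (intro key[of 1 "\<lambda>_. 1\<^sub>m 1"]) (auto simp: mrep_def inj_on_def)
  next
    case False
    then show ?thesis using key assms by blast
  qed
qed

section \<open>Linear spans over a subfield and modules with a group action\<close>

definition is_subfield :: "'f::field set \<Rightarrow> bool" where
  "is_subfield K \<longleftrightarrow> 0 \<in> K \<and> 1 \<in> K \<and> (\<forall>x\<in>K. \<forall>y\<in>K. x + y \<in> K \<and> x * y \<in> K) \<and>
     (\<forall>x\<in>K. - x \<in> K \<and> inverse x \<in> K)"

lemma is_subfield_sum: "is_subfield K \<Longrightarrow> (\<And>i. i \<in> I \<Longrightarrow> f i \<in> K) \<Longrightarrow> sum f I \<in> K"
  by (induction I rule: infinite_finite_induct) (auto simp: is_subfield_def)

text \<open>The scalars form a subfield given as a set, while the functions take values in the whole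
  field. This is the form needed for restriction of scalars and for descent to the field of
  constants.\<close>

definition fspan :: "'f::field set \<Rightarrow> ('s \<Rightarrow> 'f) set \<Rightarrow> ('s \<Rightarrow> 'f) set" where
  "fspan K W = {(\<lambda>s. \<Sum>w\<in>W. u w * w s) |u. \<forall>w\<in>W. u w \<in> K}"

lemma fspan_add:
  assumes K: "is_subfield K" and "v \<in> fspan K W" "w \<in> fspan K W"
  shows "(\<lambda>s. v s + w s) \<in> fspan K W"
proof -
  obtain a b where ab: "\<forall>w\<in>W. a w \<in> K" "v = (\<lambda>s. \<Sum>w\<in>W. a w * w s)"
    "\<forall>w\<in>W. b w \<in> K" "w = (\<lambda>s. \<Sum>w\<in>W. b w * w s)"
    using assms(2,3) unfolding fspan_def by auto
  have "(\<lambda>s. v s + w s) = (\<lambda>s. \<Sum>w\<in>W. (a w + b w) * w s)"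
    unfolding ab by (simp add: sum.distrib algebra_simps)
  then show ?thesis unfolding fspan_def using K ab unfolding is_subfield_def
    by (intro CollectI exI[of _ "\<lambda>w. a w + b w"]) auto
qed

lemma fspan_scale:
  assumes K: "is_subfield K" and "v \<in> fspan K W" "c \<in> K"
  shows "(\<lambda>s. c * v s) \<in> fspan K W"
proof -
  obtain a where ab: "\<forall>w\<in>W. a w \<in> K" "v = (\<lambda>s. \<Sum>w\<in>W. a w * w s)"
    using assms(2) unfolding fspan_def by auto
  have "(\<lambda>s. c * v s) = (\<lambda>s. \<Sum>w\<in>W. (c * a w) * w s)"
    unfolding ab by (simp add: sum_distrib_left mult.assoc)
  then show ?thesis unfolding fspan_def using K ab assms(3) unfolding is_subfield_def
    by (intro CollectI exI[of _ "\<lambda>w. c * a w"]) auto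
qed

lemma fspan_zero: "is_subfield K \<Longrightarrow> (\<lambda>s. 0) \<in> fspan K W"
  unfolding fspan_def is_subfield_def by (intro CollectI exI[of _ "\<lambda>w. 0"]) auto

lemma fspan_base:
  assumes "is_subfield K" "finite W" "w \<in> W" shows "w \<in> fspan K W"
  unfolding fspan_def
proof (intro CollectI exI[of _ "\<lambda>x. if x = w then 1 else 0"] conjI)
  show "w = (\<lambda>s. \<Sum>x\<in>W. (if x = w then 1 else 0) * x s)"
    using assms by (auto simp: if_distrib[of "\<lambda>x. x * _"] cong: if_cong)
qed (use assms in \<open>auto simp: is_subfield_def\<close>)

lemma fspan_sum:
  assumes "is_subfield K" "\<And>i. i \<in> I \<Longrightarrow> v i \<in> fspan K W"
  shows "(\<lambda>s. \<Sum>i\<in>I. v i s) \<in> fspan K W"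
  using assms(2)
proof (induction I rule: infinite_finite_induct)
  case (insert i I)
  then show ?case using fspan_add[OF assms(1), of "v i" W "\<lambda>s. \<Sum>i\<in>I. v i s"] by simp
qed (use fspan_zero[OF assms(1)] in auto)

lemma fspan_subset:
  assumes K: "is_subfield K" and "W \<subseteq> fspan K W'"
  shows "fspan K W \<subseteq> fspan K W'"
proof
  fix v assume "v \<in> fspan K W"
  then obtain a where ab: "\<forall>w\<in>W. a w \<in> K" "v = (\<lambda>s. \<Sum>w\<in>W. a w * w s)"
    unfolding fspan_def by auto
  show "v \<in> fspan K W'" unfolding ab(2)
    by (rule fspan_sum[OF K]) (use assms ab(1) fspan_scale[OF K] in blast)
qed

lemma fspan_basis:
  assumes K: "is_subfield K" and "finite W"
  shows "\<exists>B. finite B \<and> fspan K B = fspan K W \<and>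
    (\<forall>u. (\<forall>w\<in>B. u w \<in> K) \<longrightarrow> (\<forall>s. (\<Sum>w\<in>B. u w * w s) = 0) \<longrightarrow> (\<forall>w\<in>B. u w = 0))"
proof -
  define P where "P B \<longleftrightarrow> finite B \<and> fspan K B = fspan K W" for B
  obtain B where B: "P B" and min: "\<And>B'. P B' \<Longrightarrow> card B \<le> card B'"
    using ex_has_least_nat[of P W card] assms(2) unfolding P_def by blast
  have fB: "finite B" and sB: "fspan K B = fspan K W" using B unfolding P_def by auto
  have "u w0 = 0" if u: "\<And>w. w \<in> B \<Longrightarrow> u w \<in> K" and z: "\<And>s. (\<Sum>w\<in>B. u w * w s) = 0" and w0: "w0 \<in> B" for u w0
  proof (rule ccontr)
    assume nz: "u w0 \<noteq> 0"
    let ?B = "B - {w0}"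
    have "w0 s = (\<Sum>w\<in>?B. (- u w / u w0) * w s)" for s
    proof -
      have "u w0 * w0 s + (\<Sum>w\<in>?B. u w * w s) = 0" using z[of s] fB w0 by (simp add: sum.remove)
      then have "w0 s = - (\<Sum>w\<in>?B. u w * w s) / u w0" using nz by (simp add: field_simps eq_neg_iff_add_eq_0)
      then show ?thesis by (simp add: sum_divide_distrib sum_negf)
    qed
    then have "w0 = (\<lambda>s. \<Sum>w\<in>?B. (- u w / u w0) * w s)" by blast
    moreover have "\<forall>w\<in>?B. - u w / u w0 \<in> K" using K u w0 unfolding is_subfield_def by (auto simp: divide_inverse)
    ultimately have w0s: "w0 \<in> fspan K ?B"
      unfolding fspan_def by (intro CollectI exI[of _ "\<lambda>w. - u w / u w0"] conjI)
    have "fspan K ?B = fspan K B"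
    proof
      show "fspan K ?B \<subseteq> fspan K B" by (rule fspan_subset[OF K]) (use fspan_base[OF K fB] in blast)
      show "fspan K B \<subseteq> fspan K ?B"
        by (rule fspan_subset[OF K]) (use fspan_base[OF K, of ?B] w0s fB in blast)
    qed
    then have "P ?B" unfolding P_def using fB sB by simp
    then show False using min[of ?B] fB w0 by (metis card_Diff1_less leD)
  qed
  then show ?thesis using fB sB by (intro exI[of _ B]) blast
qed

text \<open>The common source of representations below: induction of a character, restriction of
  scalars from a finite extension, and truncated power series are all given as actions on a
  finite-dimensional space. Here a basis is chosen and the matrices are read off.\<close>

lemma (in group) mrep_of_module:
  fixes act :: "'a \<Rightarrow> ('s \<Rightarrow> 'f::field) \<Rightarrow> ('s \<Rightarrow> 'f)"
  assumes K: "is_subfield K" and W: "finite W" and V: "V = fspan K W"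
    and closed: "\<And>g v. g \<in> carrier G \<Longrightarrow> v \<in> V \<Longrightarrow> act g v \<in> V"
    and add: "\<And>g v w. g \<in> carrier G \<Longrightarrow> v \<in> V \<Longrightarrow> w \<in> V \<Longrightarrow> act g (\<lambda>s. v s + w s) = (\<lambda>s. act g v s + act g w s)"
    and scale: "\<And>g v c. g \<in> carrier G \<Longrightarrow> v \<in> V \<Longrightarrow> c \<in> K \<Longrightarrow> act g (\<lambda>s. c * v s) = (\<lambda>s. c * act g v s)"
    and mult: "\<And>g h v. g \<in> carrier G \<Longrightarrow> h \<in> carrier G \<Longrightarrow> v \<in> V \<Longrightarrow> act (g \<otimes>\<^bsub>G\<^esub> h) v = act g (act h v)"
    and one: "\<And>v. v \<in> V \<Longrightarrow> act \<one>\<^bsub>G\<^esub> v = v"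
    and faithful: "\<And>g. g \<in> carrier G \<Longrightarrow> (\<And>v. v \<in> V \<Longrightarrow> act g v = v) \<Longrightarrow> g = \<one>\<^bsub>G\<^esub>"
  obtains N \<sigma> where "mrep G N \<sigma>" "inj_on \<sigma> (carrier G)"
    "\<And>g i j. g \<in> carrier G \<Longrightarrow> i < N \<Longrightarrow> j < N \<Longrightarrow> \<sigma> g $$ (i, j) \<in> K"
proof -
  obtain B where B: "finite B" "fspan K B = fspan K W" and indep0:
    "\<forall>u. (\<forall>w\<in>B. u w \<in> K) \<longrightarrow> (\<forall>s. (\<Sum>w\<in>B. u w * w s) = 0) \<longrightarrow> (\<forall>w\<in>B. u w = 0)"
    using fspan_basis[OF K W] by (elim exE conjE)
  have indep: "u w = 0" if "\<And>w. w \<in> B \<Longrightarrow> u w \<in> K" "\<And>s. (\<Sum>w\<in>B. u w * w s) = 0" "w \<in> B" for u w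
    using indep0 that by simp
  have B: "finite B" "fspan K B = V" using B V by auto
  define N where "N = card B"
  obtain e where e: "bij_betw e {..<N} B" using ex_bij_betw_nat_finite[OF B(1)] N_def lessThan_atLeast0 by metis
  have eV: "e i \<in> V" if "i < N" for i using fspan_base[OF K B(1)] B(2) e that bij_betwE by blast
  have ex: "\<exists>u. (\<forall>i<N. u i \<in> K) \<and> v = (\<lambda>s. \<Sum>i<N. u i * e i s)" if "v \<in> V" for v
  proof -
    have "\<exists>u. v = (\<lambda>s. \<Sum>w\<in>B. u w * w s) \<and> (\<forall>w\<in>B. u w \<in> K)"
      using that unfolding B(2)[symmetric] fspan_def by simp
    then obtain u where u: "\<forall>w\<in>B. u w \<in> K" "v = (\<lambda>s. \<Sum>w\<in>B. u w * w s)" by blast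
    have "v = (\<lambda>s. \<Sum>i<N. u (e i) * e i s)" unfolding u(2)
      using sum.reindex_bij_betw[OF e, of "\<lambda>w. u w * w s" for s] by auto
    then show ?thesis using u(1) e bij_betwE by (intro exI[of _ "\<lambda>i. u (e i)"]) blast
  qed
  have uniq0: "u i = 0" if u: "\<And>i. i < N \<Longrightarrow> u i \<in> K" and z: "\<And>s. (\<Sum>i<N. u i * e i s) = 0" and i: "i < N" for u i
  proof -
    define f where "f = inv_into {..<N} e"
    have fe: "f (e i) = i" if "i < N" for i using e that unfolding f_def bij_betw_def by auto
    have "(\<Sum>w\<in>B. u (f w) * w s) = 0" for s
      using sum.reindex_bij_betw[OF e, of "\<lambda>w. u (f w) * w s"] z[of s] fe by simp
    moreover have "u (f w) \<in> K" if "w \<in> B" for w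
      using that e fe u unfolding bij_betw_def by (metis imageE lessThan_iff)
    ultimately have "u (f (e i)) = 0" using indep[of "\<lambda>w. u (f w)" "e i"] e i bij_betwE by blast
    then show ?thesis using fe i by simp
  qed
  have uniq: "a i = b i" if a: "\<And>i. i < N \<Longrightarrow> a i \<in> K" and b: "\<And>i. i < N \<Longrightarrow> b i \<in> K"
    and z: "(\<lambda>s. \<Sum>i<N. a i * e i s) = (\<lambda>s. \<Sum>i<N. b i * e i s)" and i: "i < N" for a b i
  proof -
    have "a i - b i = 0"
    proof (rule uniq0[of "\<lambda>i. a i - b i", OF _ _ i])
      show "a i - b i \<in> K" if "i < N" for i using a[OF that] b[OF that] K
        unfolding is_subfield_def by (metis diff_conv_add_uminus)
      show "(\<Sum>i<N. (a i - b i) * e i s) = 0" for s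
        using fun_cong[OF z, of s] by (simp add: left_diff_distrib sum_subtractf)
    qed
    then show ?thesis by simp
  qed
  define co where "co v = (SOME u. (\<forall>i<N. u i \<in> K) \<and> v = (\<lambda>s. \<Sum>i<N. u i * e i s))" for v
  have co: "co v i \<in> K" "v = (\<lambda>s. \<Sum>i<N. co v i * e i s)" if "v \<in> V" "i < N" for v i
    using someI_ex[OF ex[OF that(1)]] that(2) unfolding co_def[symmetric] by blast+
  have co': "v = (\<lambda>s. \<Sum>i<N. co v i * e i s)" if "v \<in> V" for v
    using someI_ex[OF ex[OF that(1)]] unfolding co_def[symmetric] by blast
  define \<sigma> where "\<sigma> g = mat N N (\<lambda>(i, j). co (act g (e j)) i)" for g
  have \<sigma>c: "\<sigma> g \<in> carrier_mat N N" for g unfolding \<sigma>_def by simp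
  have \<sigma>K: "\<sigma> g $$ (i, j) \<in> K" if "g \<in> carrier G" "i < N" "j < N" for g i j
    unfolding \<sigma>_def using co(1)[OF closed[OF that(1) eV[OF that(3)]] that(2)] that by simp
  have act_sum: "act g (\<lambda>s. \<Sum>i\<in>I. u i * e i s) = (\<lambda>s. \<Sum>i\<in>I. u i * act g (e i) s)"
    if g: "g \<in> carrier G" and I: "finite I" "I \<subseteq> {..<N}" and u: "\<And>i. i < N \<Longrightarrow> u i \<in> K" for g u I
    using I
  proof (induction I rule: finite_induct)
    case empty
    have "act g (\<lambda>s. 0 * (\<lambda>s. 0) s) = (\<lambda>s. 0 * act g (\<lambda>s. 0) s)"
      by (rule scale[OF g]) (use fspan_zero[OF K] V K in \<open>auto simp: is_subfield_def\<close>)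
    then show ?case by simp
  next
    case (insert i I)
    have i: "i < N" using insert.prems by auto
    have "(\<lambda>s. \<Sum>i\<in>I. u i * e i s) \<in> V" unfolding V
    proof (rule fspan_sum[OF K])
      fix k assume "k \<in> I"
      then have "k < N" using insert.prems by auto
      then show "(\<lambda>s. u k * e k s) \<in> fspan K W" using fspan_scale[OF K] eV u V by blast
    qed
    moreover have "(\<lambda>s. u i * e i s) \<in> V" using fspan_scale[OF K] eV[OF i] u[OF i] V by blast
    ultimately have "act g (\<lambda>s. u i * e i s + (\<Sum>i\<in>I. u i * e i s)) = (\<lambda>s. act g (\<lambda>s. u i * e i s) s + act g (\<lambda>s. \<Sum>i\<in>I. u i * e i s) s)"
      by (rule add[OF g, rotated])
    then show ?case using insert scale[OF g eV[OF i] u[OF i]] by simp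
  qed
  have act_e: "act g (e j) = (\<lambda>s. \<Sum>i<N. \<sigma> g $$ (i, j) * e i s)" if "g \<in> carrier G" "j < N" for g j
  proof -
    have "\<And>s. (\<Sum>i<N. co (act g (e j)) i * e i s) = (\<Sum>i<N. \<sigma> g $$ (i, j) * e i s)"
      unfolding \<sigma>_def using that by (intro sum.cong) auto
    then show ?thesis using co'[OF closed[OF that(1) eV[OF that(2)]]] by simp
  qed
  have m: "mrep G N \<sigma>"
    unfolding mrep_def
  proof (intro conjI ballI)
    show "\<sigma> \<one> = 1\<^sub>m N"
    proof (rule eq_matI)
      fix i j assume "i < dim_row (1\<^sub>m N :: 'f mat)" "j < dim_col (1\<^sub>m N :: 'f mat)"
      then have ij: "i < N" "j < N" by auto
      have "\<sigma> \<one> $$ (i, j) = (if i = j then 1 else 0)"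
      proof (rule uniq[OF _ _ _ ij(1)])
        show "\<sigma> \<one> $$ (i, j) \<in> K" if "i < N" for i using \<sigma>K that ij by simp
        show "(if i = j then 1 else 0) \<in> K" for i using K unfolding is_subfield_def by auto
        have "(\<Sum>i<N. \<sigma> \<one> $$ (i, j) * e i s) = e j s" for s
          using act_e[OF one_closed ij(2)] one[OF eV[OF ij(2)]] by metis
        moreover have "(\<Sum>i<N. (if i = j then 1 else 0) * e i s) = e j s" for s
          using ij by (simp add: if_distrib[of "\<lambda>x. x * _"] cong: if_cong)
        ultimately show "(\<lambda>s. \<Sum>i<N. \<sigma> \<one> $$ (i, j) * e i s) = (\<lambda>s. \<Sum>i<N. (if i = j then 1 else 0) * e i s)" by simp
      qed
      then show "\<sigma> \<one> $$ (i, j) = 1\<^sub>m N $$ (i, j)" using ij by simp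
    qed (auto simp: \<sigma>_def)
    fix g h assume g: "g \<in> carrier G" and h: "h \<in> carrier G"
    show "\<sigma> (g \<otimes> h) = \<sigma> g * \<sigma> h"
    proof (rule eq_matI)
      fix i j assume "i < dim_row (\<sigma> g * \<sigma> h)" "j < dim_col (\<sigma> g * \<sigma> h)"
      then have ij: "i < N" "j < N" using \<sigma>c[of g] \<sigma>c[of h] by auto
      have "\<sigma> (g \<otimes> h) $$ (i, j) = (\<Sum>l<N. \<sigma> g $$ (i, l) * \<sigma> h $$ (l, j))"
      proof (rule uniq[OF _ _ _ ij(1)])
        show "\<sigma> (g \<otimes> h) $$ (i, j) \<in> K" if "i < N" for i using \<sigma>K that ij g h by simp
        show "(\<Sum>l<N. \<sigma> g $$ (i, l) * \<sigma> h $$ (l, j)) \<in> K" if "i < N" for i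
          by (rule is_subfield_sum[OF K]) (use \<sigma>K that ij g h K in \<open>auto simp: is_subfield_def\<close>)
        have "act (g \<otimes> h) (e j) = act g (\<lambda>s. \<Sum>l<N. \<sigma> h $$ (l, j) * e l s)"
          using mult[OF g h eV[OF ij(2)]] act_e[OF h ij(2)] by simp
        also have "\<dots> = (\<lambda>s. \<Sum>l<N. \<sigma> h $$ (l, j) * act g (e l) s)"
          by (rule act_sum[OF g]) (use \<sigma>K h ij in auto)
        also have "\<dots> = (\<lambda>s. \<Sum>l<N. \<sigma> h $$ (l, j) * (\<Sum>i<N. \<sigma> g $$ (i, l) * e i s))"
          using act_e[OF g] by (intro ext sum.cong) auto
        also have "\<dots> = (\<lambda>s. \<Sum>i<N. (\<Sum>l<N. \<sigma> g $$ (i, l) * \<sigma> h $$ (l, j)) * e i s)"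
          by (auto simp: sum_distrib_left sum_distrib_right mult.assoc mult.commute mult.left_commute intro!: ext sum.swap[THEN trans] sum.cong)
        finally show "(\<lambda>s. \<Sum>i<N. \<sigma> (g \<otimes> h) $$ (i, j) * e i s) = \<dots>"
          using act_e[OF m_closed[OF g h] ij(2)] by simp
      qed
      then show "\<sigma> (g \<otimes> h) $$ (i, j) = (\<sigma> g * \<sigma> h) $$ (i, j)" using mat_mult_entry[OF \<sigma>c \<sigma>c ij] by simp
    qed (auto simp: \<sigma>_def)
  qed (rule \<sigma>c)
  have "inj_on \<sigma> (carrier G)"
  proof (rule inj_onI)
    fix g h assume g: "g \<in> carrier G" and h: "h \<in> carrier G" and eq: "\<sigma> g = \<sigma> h"
    have "\<sigma> (inv h \<otimes> g) = \<sigma> (inv h) * \<sigma> h" using m g h eq unfolding mrep_def by auto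
    also have "\<dots> = 1\<^sub>m N" using m h unfolding mrep_def by (metis inv_closed l_inv)
    finally have \<sigma>1: "\<sigma> (inv h \<otimes> g) = 1\<^sub>m N" .
    have "inv h \<otimes> g = \<one>"
    proof (rule faithful)
      show c: "inv h \<otimes> g \<in> carrier G" using g h by simp
      fix v assume v: "v \<in> V"
      have ae: "act (inv h \<otimes> g) (e j) = e j" if "j < N" for j
      proof
        fix s
        have "(\<Sum>i<N. 1\<^sub>m N $$ (i, j) * e i s) = (\<Sum>i<N. (if i = j then e i s else 0))"
          using that by (intro sum.cong) auto
        then show "act (inv h \<otimes> g) (e j) s = e j s"
          unfolding act_e[OF c that] \<sigma>1 using that by simp
      qed
      have "act (inv h \<otimes> g) (\<lambda>s. \<Sum>i<N. co v i * e i s) = (\<lambda>s. \<Sum>i<N. co v i * act (inv h \<otimes> g) (e i) s)"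
        by (rule act_sum[OF c]) (use co(1)[OF v] in auto)
      also have "\<dots> = (\<lambda>s. \<Sum>i<N. co v i * e i s)" using ae by simp
      finally show "act (inv h \<otimes> g) v = v" using co'[OF v] by simp
    qed
    then show "g = h" using g h by (metis inv_closed inv_equality inv_inv)
  qed
  then show ?thesis using that[OF m] \<sigma>K by blast
qed

subsection \<open>Virtually abelian groups\<close>

text \<open>Free abelian groups are embedded into the positive rationals by sending a basis to distinct
  primes; \<open>smooth b\<close> records that only primes up to \<open>b\<close> have been used so far.\<close>

definition smooth :: "nat \<Rightarrow> rat \<Rightarrow> bool" where
  "smooth b q \<longleftrightarrow> (\<exists>u v::nat. u > 0 \<and> v > 0 \<and> q = of_nat u / of_nat v \<and>
     (\<forall>l. Factorial_Ring.prime l \<longrightarrow> l dvd u * v \<longrightarrow> l \<le> b))"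

lemma smooth_mult: "smooth b x \<Longrightarrow> smooth b y \<Longrightarrow> smooth b (x * y)"
  unfolding smooth_def
proof (elim exE conjE)
  fix u v u' v' :: nat
  assume *: "u > 0" "v > 0" "x = of_nat u / of_nat v" "u' > 0" "v' > 0" "y = of_nat u' / of_nat v'"
    "\<forall>l. Factorial_Ring.prime l \<longrightarrow> l dvd u * v \<longrightarrow> l \<le> b" "\<forall>l. Factorial_Ring.prime l \<longrightarrow> l dvd u' * v' \<longrightarrow> l \<le> b"
  have "l \<le> b" if "Factorial_Ring.prime l" "l dvd u * u' * (v * v')" for l
  proof -
    have "l dvd (u * v) * (u' * v')" using that(2) by (simp add: ac_simps)
    then show ?thesis using * that(1) prime_dvd_mult_iff by blast
  qed
  then show "\<exists>u v. 0 < u \<and> 0 < v \<and> x * y = of_nat u / of_nat v \<and> (\<forall>l. Factorial_Ring.prime l \<longrightarrow> l dvd u * v \<longrightarrow> l \<le> b)"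
    using * by (intro exI[of _ "u * u'"] exI[of _ "v * v'"]) auto
qed

lemma smooth_inverse: "smooth b x \<Longrightarrow> smooth b (inverse x)"
  unfolding smooth_def
proof (elim exE conjE)
  fix u v :: nat
  assume "u > 0" "v > 0" "x = of_nat u / of_nat v" "\<forall>l. Factorial_Ring.prime l \<longrightarrow> l dvd u * v \<longrightarrow> l \<le> b"
  then show "\<exists>u v. 0 < u \<and> 0 < v \<and> inverse x = of_nat u / of_nat v \<and> (\<forall>l. Factorial_Ring.prime l \<longrightarrow> l dvd u * v \<longrightarrow> l \<le> b)"
    by (intro exI[of _ v] exI[of _ u]) (auto simp: mult.commute)
qed

lemma smooth_mono: "smooth b x \<Longrightarrow> b \<le> c \<Longrightarrow> smooth c x"
  unfolding smooth_def by (metis order_trans)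

lemma smooth_pos: "smooth b x \<Longrightarrow> x > 0"
  unfolding smooth_def by auto

lemma smooth_prime:
  assumes "Factorial_Ring.prime l" shows "smooth l (of_nat l)"
  unfolding smooth_def using assms
  by (rule_tac x = l in exI, rule_tac x = 1 in exI) (auto simp: prime_gt_0_nat dest: primes_dvd_imp_eq)

lemma smooth_one: "smooth b 1"
  unfolding smooth_def by (intro exI[of _ 1]) auto

lemma smooth_power: "smooth b x \<Longrightarrow> smooth b (x ^ n)"
  by (induction n) (auto intro: smooth_one smooth_mult)

lemma smooth_powi: "smooth b x \<Longrightarrow> smooth b (x powi n)"
  unfolding power_int_def by (auto intro: smooth_power smooth_inverse)

lemma not_smooth_prime_power:
  assumes l: "Factorial_Ring.prime l" "b < l" and n: "n \<noteq> 0"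
  shows "\<not> smooth b ((of_nat l :: rat) powi n)"
proof -
  have key: "\<not> smooth b ((of_nat l :: rat) ^ k)" if "k > 0" for k
  proof
    assume "smooth b ((of_nat l :: rat) ^ k)"
    then obtain u v :: nat where uv: "u > 0" "v > 0" "(of_nat l :: rat) ^ k = of_nat u / of_nat v"
      "\<forall>l. Factorial_Ring.prime l \<longrightarrow> l dvd u * v \<longrightarrow> l \<le> b" unfolding smooth_def by blast
    have "(of_nat (l ^ k * v) :: rat) = of_nat u" using uv by (simp add: field_simps)
    then have "u = l ^ k * v" using of_nat_eq_iff by metis
    then have "l dvd u * v" using that by (auto intro: dvd_mult2 dvd_power)
    then show False using uv(4) l by auto
  qed
  show ?thesis
  proof (cases "n > 0")
    case True
    then show ?thesis using key[of "nat n"] by (simp add: power_int_def)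
  next
    case False
    then have "\<not> smooth b ((of_nat l :: rat) ^ nat (- n))" using key n by simp
    moreover have "inverse ((of_nat l :: rat) powi n) = (of_nat l :: rat) ^ nat (- n)"
      using False n by (simp add: power_int_def power_inverse)
    ultimately show ?thesis using smooth_inverse by metis
  qed
qed

context group
begin

text \<open>The representation induced from the one-dimensional representation \<open>\<chi>\<close> of \<open>A\<close>.\<close>

lemma Q_linear_of_character:
  assumes A: "subgroup A G" and fin: "finite (rcosets A)"
    and \<chi>: "\<And>a b. a \<in> A \<Longrightarrow> b \<in> A \<Longrightarrow> \<chi> (a \<otimes> b) = \<chi> a * (\<chi> b :: rat)"
    and \<chi>0: "\<And>a. a \<in> A \<Longrightarrow> \<chi> a \<noteq> 0" and \<chi>1: "\<And>a. a \<in> A \<Longrightarrow> \<chi> a = 1 \<Longrightarrow> a = \<one>"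
  shows "Q_linear G"
proof -
  interpret A: subgroup A G by fact
  define s where "s c = (SOME g. g \<in> c)" for c :: "'a set"
  have s: "s c \<in> c" if "c \<in> rcosets A" for c
    using A.rcosets_non_empty[OF that] unfolding s_def by (simp add: some_in_eq)
  have cc: "c \<subseteq> carrier G" if "c \<in> rcosets A" for c using A.rcosets_carrier[OF is_group that] .
  \<comment> \<open>The equivariant function supported on the single coset \<open>c\<close>; these
    functions, one for each coset, span the induced module \<open>V\<close>.\<close>
  define f where "f c = (\<lambda>g. if g \<in> c then \<chi> (g \<otimes> inv (s c)) else 0)" for c
  have rep: "\<exists>x\<in>carrier G. c = A #> x" if "c \<in> rcosets A" for c
    using that unfolding RCOSETS_def by auto
  have mem: "g \<otimes> inv h \<in> A" if "c \<in> rcosets A" "g \<in> c" "h \<in> c" for c g h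
  proof -
    obtain x where x: "x \<in> carrier G" "c = A #> x" using rep[OF \<open>c \<in> rcosets A\<close>] by blast
    have "c = A #> h" using repr_independence[of h A x] that(3) x A.subgroup_axioms by simp
    then show ?thesis using that cc A.rcos_module_imp[OF is_group, of h g] by auto
  qed
  have mem': "a \<otimes> g \<in> c \<longleftrightarrow> g \<in> c" if "c \<in> rcosets A" "a \<in> A" "g \<in> carrier G" for c a g
  proof -
    obtain x where x: "x \<in> carrier G" "c = A #> x" using rep[OF \<open>c \<in> rcosets A\<close>] by blast
    have a: "a \<in> carrier G" using that(2) by simp
    have "a \<otimes> g \<in> c \<longleftrightarrow> a \<otimes> (g \<otimes> inv x) \<in> A"
      unfolding x(2) using A.rcos_module[OF is_group x(1)] that x a by (simp add: m_assoc)
    also have "\<dots> \<longleftrightarrow> g \<otimes> inv x \<in> A"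
    proof
      assume h: "a \<otimes> (g \<otimes> inv x) \<in> A"
      have "inv a \<otimes> (a \<otimes> (g \<otimes> inv x)) \<in> A" by (rule A.m_closed) (use h that in auto)
      then show "g \<otimes> inv x \<in> A" using a that x by (simp add: m_assoc[symmetric])
    qed (use that in auto)
    also have "\<dots> \<longleftrightarrow> g \<in> c" unfolding x(2) using A.rcos_module[OF is_group x(1)] that by simp
    finally show ?thesis .
  qed
  define W where "W = f ` (rcosets A)"
  have W: "finite W" unfolding W_def using fin by simp
  have K: "is_subfield (UNIV :: rat set)" unfolding is_subfield_def by simp
  define V where "V = {v. (\<forall>a\<in>A. \<forall>g\<in>carrier G. v (a \<otimes> g) = \<chi> a * v g) \<and> (\<forall>g. g \<notin> carrier G \<longrightarrow> v g = (0::rat))}"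
  have fV: "f c \<in> V" if c: "c \<in> rcosets A" for c
    unfolding V_def
  proof (intro CollectI conjI ballI allI impI)
    fix a g assume a: "a \<in> A" and g: "g \<in> carrier G"
    show "f c (a \<otimes> g) = \<chi> a * f c g"
    proof (cases "g \<in> c")
      case True
      have sc: "s c \<in> carrier G" using s[OF c] cc[OF c] by blast
      have "\<chi> (a \<otimes> (g \<otimes> inv (s c))) = \<chi> a * \<chi> (g \<otimes> inv (s c))"
        by (rule \<chi>[OF a mem[OF c True s[OF c]]])
      then show ?thesis using True mem'[OF c a g] a g sc unfolding f_def by (simp add: m_assoc)
    next
      case False
      then show ?thesis using mem'[OF c a g] unfolding f_def by simp
    qed
  qed (use cc[OF c] in \<open>auto simp: f_def\<close>)
  have VW: "V = fspan UNIV W"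
  proof
    show "fspan UNIV W \<subseteq> V"
    proof
      fix v assume "v \<in> fspan UNIV W"
      then obtain u where u: "v = (\<lambda>g. \<Sum>w\<in>W. u w * w g)" unfolding fspan_def by blast
      have "w \<in> V" if "w \<in> W" for w using that fV unfolding W_def by blast
      then show "v \<in> V" unfolding V_def u
        by (auto simp: sum_distrib_left mult.left_commute intro!: sum.cong sum.neutral)
    qed
    show "V \<subseteq> fspan UNIV W"
    proof
      fix v assume v: "v \<in> V"
      have "v g = (\<Sum>c\<in>rcosets A. v (s c) * f c g)" for g
      proof (cases "g \<in> carrier G")
        case True
        define c0 where "c0 = A #> g"
        have c0: "c0 \<in> rcosets A" "g \<in> c0" unfolding c0_def
          using True rcosetsI[OF A.subset True] rcos_self[OF True A.subgroup_axioms] by auto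
        have other: "f c g = 0" if "c \<in> rcosets A" "c \<noteq> c0" for c
          using rcos_disjoint[OF A.subgroup_axioms] that c0 unfolding f_def pairwise_def disjnt_def by auto
        have "(\<Sum>c\<in>rcosets A. v (s c) * f c g) = v (s c0) * f c0 g"
          using fin c0(1) other by (subst sum.remove[of _ c0]) (auto intro!: sum.neutral)
        also have "\<dots> = \<chi> (g \<otimes> inv (s c0)) * v (s c0)" using c0 unfolding f_def by simp
        also have "\<dots> = v (g \<otimes> inv (s c0) \<otimes> s c0)"
          using v mem[OF c0(1,2) s[OF c0(1)]] s[OF c0(1)] cc[OF c0(1)] unfolding V_def by auto
        also have "\<dots> = v g" using True s[OF c0(1)] cc[OF c0(1)] by (simp add: m_assoc subsetD)
        finally show ?thesis by simp
      next
        case False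
        then have "f c g = 0" if "c \<in> rcosets A" for c using cc[OF that] unfolding f_def by auto
        then show ?thesis using v False unfolding V_def by simp
      qed
      then have "v = (\<lambda>g. \<Sum>c\<in>rcosets A. v (s c) * f c g)" by blast
      also have "\<dots> \<in> fspan UNIV W"
        by (intro fspan_sum[OF K] fspan_scale[OF K] fspan_base[OF K W]) (auto simp: W_def)
      finally show "v \<in> fspan UNIV W" .
    qed
  qed
  define act where "act x v = (\<lambda>g. if g \<in> carrier G then v (g \<otimes> x) else (0::rat))" for x and v :: "'a \<Rightarrow> rat"
  obtain N and \<sigma> :: "'a \<Rightarrow> rat mat" where \<sigma>: "mrep G N \<sigma>" "inj_on \<sigma> (carrier G)"
  proof (rule mrep_of_module[OF K W VW, of act])
    fix g v assume g: "g \<in> carrier G" and v: "v \<in> V"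
    show "act g v \<in> V" using v g unfolding V_def act_def by (auto simp: m_assoc)
  next
    fix g assume g: "g \<in> carrier G" and triv: "\<And>v. v \<in> V \<Longrightarrow> act g v = v"
    have c: "A \<in> rcosets A" using A.subgroup_in_rcosets[OF is_group] .
    \<comment> \<open>The function \<open>f A\<close> alone detects faithfulness: evaluation at
      \<open>\<one>\<close> forces \<open>f A g \<noteq> 0\<close>, so \<open>g \<in> A\<close>, and
      then \<open>\<chi> g = 1\<close>.\<close>
    have "act g (f A) \<one> = f A \<one>" using triv[OF fV[OF c]] by simp
    then have 1: "f A g = f A \<one>" unfolding act_def using g by simp
    have sA: "s A \<in> A" using s[OF c] .
    have "f A \<one> = \<chi> (inv (s A))" unfolding f_def using sA by simp
    then have "f A g \<noteq> 0" using \<chi>0 sA 1 by simp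
    then have gA: "g \<in> A" unfolding f_def by (auto split: if_splits)
    then have "\<chi> (g \<otimes> inv (s A)) = \<chi> (inv (s A))" using 1 sA unfolding f_def by simp
    then have "\<chi> g * \<chi> (inv (s A)) = \<chi> (inv (s A))" using \<chi> gA sA by simp
    then have "\<chi> g = 1" using \<chi>0[of "inv (s A)"] sA by simp
    then show "g = \<one>" using \<chi>1 gA by blast
  qed (auto simp: act_def V_def m_assoc)
  then show ?thesis by (rule Q_linear_of_mrep)
qed

lemma generate_insert_int_pow:
  assumes T: "T \<subseteq> carrier G" and t: "t \<in> carrier G"
    and comm: "\<And>s. s \<in> T \<Longrightarrow> t \<otimes> s = s \<otimes> t" and z: "z \<in> generate G (insert t T)"
  shows "\<exists>x\<in>generate G T. \<exists>n::int. z = x \<otimes> t [^] n"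
  using z
proof (induction rule: generate.induct)
  case one
  then show ?case using generate.one by (intro bexI[of _ \<one>] exI[of _ 0]) auto
next
  case (incl h)
  show ?case
  proof (cases "h = t")
    case True
    then show ?thesis using generate.one t by (intro bexI[of _ \<one>] exI[of _ 1]) auto
  next
    case False
    then have "h \<in> T" using incl by simp
    then show ?thesis using generate.incl[of h T G] T by (intro bexI[of _ h] exI[of _ 0]) auto
  qed
next
  case (inv h)
  show ?case
  proof (cases "h = t")
    case True
    then show ?thesis using generate.one t by (intro bexI[of _ \<one>] exI[of _ "-1"]) (auto simp: int_pow_neg)
  next
    case False
    then have "h \<in> T" using inv by simp
    then show ?thesis using generate.inv[of h T G] T by (intro bexI[of _ "inv h"] exI[of _ 0]) auto
  qed
next
  case (eng h1 h2)
  then obtain x y and m n :: int where h: "x \<in> generate G T" "h1 = x \<otimes> t [^] m" "y \<in> generate G T" "h2 = y \<otimes> t [^] n"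
    by blast
  have c: "x \<in> carrier G" "y \<in> carrier G" using h generate_in_carrier[OF T] by auto
  have "cmod {\<one>} y (t [^] m)"
  proof (rule cmod_generate2[OF one_is_normal T _ _ h(3)])
    show "t [^] m \<in> generate G {t}" using generate_pow[OF t] by blast
    fix s t' assume "s \<in> T" "t' \<in> {t}"
    then show "cmod {\<one>} s t'" using comm[of s] cmod_one_iff[of s t] T t by auto
  qed (use t in auto)
  then have yt: "y \<otimes> t [^] m = t [^] m \<otimes> y" using cmod_one_iff c t by simp
  have "h1 \<otimes> h2 = x \<otimes> (t [^] m \<otimes> y) \<otimes> t [^] n" using h c t by (simp add: m_assoc)
  also have "\<dots> = (x \<otimes> y) \<otimes> (t [^] m \<otimes> t [^] n)" using c t by (simp add: m_assoc yt[symmetric])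
  also have "\<dots> = (x \<otimes> y) \<otimes> t [^] (m + n)" using t by (simp add: int_pow_mult)
  finally show ?case using generate.eng[OF h(1,3)] by blast
qed

text \<open>Freeness of \<open>A\<close> is never stated; a character \<open>\<chi>\<close> with
  trivial kernel and positive rational values stands in for it. A new generator \<open>t\<close>
  with a positive power in \<open>A\<close> only enlarges \<open>R\<close>. Otherwise the powers of
  \<open>t\<close> split off as a direct factor, and \<open>t\<close> is sent to a prime beyond the
  bound \<open>b\<close>.\<close>

lemma abelian_free_finite_index:
  assumes "finite T" "T \<subseteq> carrier G" "\<forall>s\<in>T. \<forall>t\<in>T. s \<otimes> t = t \<otimes> s"
  shows "\<exists>A \<chi> R b. subgroup A G \<and> A \<subseteq> generate G T \<and> finite R \<and> R \<subseteq> generate G T \<and>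
    generate G T \<subseteq> (\<Union>\<rho>\<in>R. A #> \<rho>) \<and> (\<forall>x\<in>A. \<forall>y\<in>A. \<chi> (x \<otimes> y) = \<chi> x * \<chi> y) \<and>
    (\<forall>x\<in>A. smooth b (\<chi> x)) \<and> (\<forall>x\<in>A. \<chi> x = 1 \<longrightarrow> x = \<one>)"
  using assms
proof (induction T rule: finite_induct)
  case empty
  show ?case
    by (rule exI[of _ "{\<one>}"], rule exI[of _ "\<lambda>_. 1"], rule exI[of _ "{\<one>}"], rule exI[of _ 0])
      (auto simp: generate_empty triv_subgroup smooth_one)
next
  case (insert t T)
  have T: "T \<subseteq> carrier G" and t: "t \<in> carrier G" using insert.prems by auto
  have comm0: "\<forall>s\<in>T. \<forall>t\<in>T. s \<otimes> t = t \<otimes> s" using insert.prems(2) by simp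
  have comm1: "t \<otimes> s = s \<otimes> t" if "s \<in> T" for s
    by (rule insert.prems(2)[rule_format]) (use that in auto)
  obtain A \<chi> R b where A: "subgroup A G" "A \<subseteq> generate G T" and R: "finite R" "R \<subseteq> generate G T"
      "generate G T \<subseteq> (\<Union>\<rho>\<in>R. A #> \<rho>)" and \<chi>0: "\<forall>x\<in>A. \<forall>y\<in>A. \<chi> (x \<otimes> y) = \<chi> x * \<chi> y"
    and sm0: "\<forall>x\<in>A. smooth b (\<chi> x)" and ker0: "\<forall>x\<in>A. \<chi> x = 1 \<longrightarrow> x = \<one>"
    using insert.IH[OF T comm0] by (elim exE conjE) simp
  have \<chi>: "\<chi> (x \<otimes> y) = \<chi> x * \<chi> y" if "x \<in> A" "y \<in> A" for x y using \<chi>0 that by blast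
  have sm: "smooth b (\<chi> x)" and ker: "\<chi> x = 1 \<Longrightarrow> x = \<one>" if "x \<in> A" for x using sm0 ker0 that by auto
  interpret A: subgroup A G by fact
  have gTc: "x \<in> carrier G" if "x \<in> generate G T" for x using generate_in_carrier[OF T that] .
  have gsub: "generate G T \<subseteq> generate G (insert t T)" by (rule mono_generate) auto
  have gt: "t [^] n \<in> generate G (insert t T)" for n :: int
  proof -
    have "t [^] n \<in> generate G {t}" using generate_pow[OF t] by blast
    then show ?thesis using mono_generate[of "{t}" "insert t T"] by auto
  qed
  have dec: "\<exists>x\<in>generate G T. \<exists>n::int. z = x \<otimes> t [^] n" if "z \<in> generate G (insert t T)" for z
    by (rule generate_insert_int_pow[OF T t comm1 that])
  have xt: "x \<otimes> t [^] n = t [^] n \<otimes> x" if "x \<in> generate G T" for x and n :: int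
  proof -
    have "cmod {\<one>} x (t [^] n)"
    proof (rule cmod_generate2[OF one_is_normal T _ _ that])
      show "t [^] n \<in> generate G {t}" using generate_pow[OF t] by blast
      fix s t' assume "s \<in> T" "t' \<in> {t}"
      then show "cmod {\<one>} s t'" using comm1[of s] cmod_one_iff[of s t] T t by auto
    qed (use t in auto)
    then show ?thesis using cmod_one_iff gTc[OF that] t by simp
  qed
  have cov: "\<exists>a\<in>A. \<exists>\<rho>\<in>R. x = a \<otimes> \<rho>" if "x \<in> generate G T" for x
    using R(3) that unfolding r_coset_def by blast
  show ?case
  proof (cases "\<exists>k>0. t [^] (k::int) \<in> A")
    case True
    then obtain k :: int where k: "k > 0" "t [^] k \<in> A" by blast
    define R' where "R' = (\<lambda>(\<rho>, e). \<rho> \<otimes> t [^] e) ` (R \<times> {0..<k})"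
    have "z \<in> (\<Union>\<rho>\<in>R'. A #> \<rho>)" if z: "z \<in> generate G (insert t T)" for z
    proof -
      obtain x and n :: int where x: "x \<in> generate G T" "z = x \<otimes> t [^] n" using dec[OF z] by blast
      obtain a \<rho> where a: "a \<in> A" "\<rho> \<in> R" "x = a \<otimes> \<rho>" using cov[OF x(1)] by blast
      have c: "a \<in> carrier G" "\<rho> \<in> carrier G" using a gTc R by auto
      have tk: "t [^] (k * (n div k)) = (t [^] k) [^] (n div k)" using t by (simp add: int_pow_pow)
      have tA: "t [^] (k * (n div k)) \<in> A" unfolding tk by (rule subgroup_int_pow_closed[OF A(1) k(2)])
      have "z = a \<otimes> \<rho> \<otimes> t [^] (k * (n div k) + n mod k)" using x a by simp
      also have "\<dots> = a \<otimes> (\<rho> \<otimes> t [^] (k * (n div k))) \<otimes> t [^] (n mod k)"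
        unfolding int_pow_mult[OF t] using c t by (simp add: m_assoc)
      also have "\<rho> \<otimes> t [^] (k * (n div k)) = t [^] (k * (n div k)) \<otimes> \<rho>" using xt a R by blast
      also have "a \<otimes> (t [^] (k * (n div k)) \<otimes> \<rho>) \<otimes> t [^] (n mod k) = (a \<otimes> t [^] (k * (n div k))) \<otimes> (\<rho> \<otimes> t [^] (n mod k))"
        using c t by (simp add: m_assoc)
      finally have "z \<in> A #> (\<rho> \<otimes> t [^] (n mod k))" unfolding r_coset_def using a(1) tA by blast
      moreover have "\<rho> \<otimes> t [^] (n mod k) \<in> R'" unfolding R'_def using a(2) k(1) by force
      ultimately show ?thesis by blast
    qed
    moreover have "finite R'" unfolding R'_def using R by simp
    moreover have "R' \<subseteq> generate G (insert t T)" unfolding R'_def using R gsub gt by (auto intro!: generate.eng)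
    ultimately show ?thesis using A \<chi> sm ker gsub
      by (intro exI[of _ A] exI[of _ \<chi>] exI[of _ R'] exI[of _ b]) auto
  next
    case False
    have tn: "n = 0" if "t [^] n \<in> A" for n :: int
    proof (rule ccontr)
      assume "n \<noteq> 0"
      moreover have "t [^] (- n) \<in> A" using A.m_inv_closed[OF that] t by (simp add: int_pow_neg)
      ultimately show False using False that by (cases "n > 0") auto
    qed
    obtain l where l: "Factorial_Ring.prime l" "b < l" using bigger_prime by blast
    define A' where "A' = {a \<otimes> t [^] n |a n::int. a \<in> A}"
    have uniq: "a = a' \<and> n = n'" if "a \<in> A" "a' \<in> A" "a \<otimes> t [^] n = a' \<otimes> t [^] n'" for a a' and n n' :: int
    proof -
      have c: "a \<in> carrier G" "a' \<in> carrier G" using that by auto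
      have "inv a' \<otimes> (a \<otimes> t [^] n) \<otimes> t [^] (- n) = inv a' \<otimes> (a' \<otimes> t [^] n') \<otimes> t [^] (- n)" using that by simp
      moreover have "inv a' \<otimes> (a \<otimes> t [^] n) \<otimes> t [^] (- n) = inv a' \<otimes> a \<otimes> (t [^] n \<otimes> t [^] (- n))"
        using c t by (simp only: m_assoc m_closed inv_closed int_pow_closed)
      moreover have "inv a' \<otimes> (a' \<otimes> t [^] n') \<otimes> t [^] (- n) = (inv a' \<otimes> a') \<otimes> (t [^] n' \<otimes> t [^] (- n))"
        using c t by (simp only: m_assoc m_closed inv_closed int_pow_closed)
      ultimately have e: "inv a' \<otimes> a = t [^] (n' - n)" using c t by (simp add: int_pow_mult[symmetric])
      have "inv a' \<otimes> a \<in> A" using that by simp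
      then have "n' - n = 0" using tn e by metis
      then have "n = n'" "inv a' \<otimes> a = \<one>" using e by auto
      then show ?thesis using c by (metis inv_closed inv_equality inv_inv)
    qed
    have Ac: "a \<in> generate G T" if "a \<in> A" for a using that A by blast
    have prod: "(a \<otimes> t [^] m) \<otimes> (a' \<otimes> t [^] n) = (a \<otimes> a') \<otimes> t [^] (m + n)" if "a \<in> A" "a' \<in> A" for a a' and m n :: int
    proof -
      have c: "a \<in> carrier G" "a' \<in> carrier G" using that by auto
      have "(a \<otimes> t [^] m) \<otimes> (a' \<otimes> t [^] n) = a \<otimes> (t [^] m \<otimes> a') \<otimes> t [^] n" using c t by (simp add: m_assoc)
      also have "\<dots> = (a \<otimes> a') \<otimes> (t [^] m \<otimes> t [^] n)"
        unfolding xt[OF Ac[OF that(2)], symmetric] using c t by (simp add: m_assoc)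
      finally show ?thesis using t by (simp add: int_pow_mult)
    qed
    have A'I: "a \<otimes> t [^] n \<in> A'" if "a \<in> A" for a and n :: int using that unfolding A'_def by blast
    have A's: "subgroup A' G"
    proof (rule subgroupI)
      show "A' \<subseteq> carrier G" unfolding A'_def using t by auto
      show "A' \<noteq> {}" using A'I A.one_closed by blast
      show "x \<otimes> y \<in> A'" if "x \<in> A'" "y \<in> A'" for x y
      proof -
        obtain a m a' n where a: "a \<in> A" "x = a \<otimes> t [^] (m::int)" "a' \<in> A" "y = a' \<otimes> t [^] (n::int)"
          using \<open>x \<in> A'\<close> \<open>y \<in> A'\<close> unfolding A'_def by blast
        show ?thesis unfolding a(2,4) prod[OF a(1,3)] by (rule A'I) (use a in auto)
      qed
      show "inv x \<in> A'" if "x \<in> A'" for x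
      proof -
        obtain a n where a: "a \<in> A" "x = a \<otimes> t [^] (n::int)" using \<open>x \<in> A'\<close> unfolding A'_def by blast
        have c: "a \<in> carrier G" using a by auto
        have "(inv a \<otimes> t [^] (- n)) \<otimes> x = \<one>" unfolding a(2) using prod[of "inv a" a "-n" n] a(1) c by simp
        then have "inv x = inv a \<otimes> t [^] (- n)" using inv_equality c t a by auto
        then show ?thesis using A'I a by auto
      qed
    qed
    define \<chi>' where "\<chi>' z = (THE q. \<exists>a\<in>A. \<exists>n::int. z = a \<otimes> t [^] n \<and> q = \<chi> a * of_nat l powi n)" for z
    have \<chi>': "\<chi>' (a \<otimes> t [^] n) = \<chi> a * of_nat l powi n" if "a \<in> A" for a and n :: int
      unfolding \<chi>'_def
    proof (rule the_equality)
      fix q assume "\<exists>a'\<in>A. \<exists>n'::int. a \<otimes> t [^] n = a' \<otimes> t [^] n' \<and> q = \<chi> a' * of_nat l powi n'"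
      then obtain a' and n' :: int where a': "a' \<in> A" "a \<otimes> t [^] n = a' \<otimes> t [^] n'" "q = \<chi> a' * of_nat l powi n'"
        by blast
      then show "q = \<chi> a * of_nat l powi n" using uniq[OF that a'(1,2)] by simp
    qed (use that in blast)
    have l0: "(of_nat l :: rat) \<noteq> 0" using l prime_gt_0_nat by auto
    have hom: "\<chi>' (x \<otimes> y) = \<chi>' x * \<chi>' y" if "x \<in> A'" "y \<in> A'" for x y
    proof -
      obtain a m a' n where a: "a \<in> A" "x = a \<otimes> t [^] (m::int)" "a' \<in> A" "y = a' \<otimes> t [^] (n::int)"
        using \<open>x \<in> A'\<close> \<open>y \<in> A'\<close> unfolding A'_def by blast
      have aa: "a \<otimes> a' \<in> A" using a by simp
      show ?thesis unfolding a(2,4) prod[OF a(1,3)] \<chi>'[OF aa] \<chi>'[OF a(1)] \<chi>'[OF a(3)] \<chi>[OF a(1,3)]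
        using l0 by (simp add: power_int_add)
    qed
    have sm': "smooth l (\<chi>' x)" if "x \<in> A'" for x
    proof -
      obtain a m where a: "a \<in> A" "x = a \<otimes> t [^] (m::int)" using \<open>x \<in> A'\<close> unfolding A'_def by blast
      have "smooth l (\<chi> a)" using sm[OF a(1)] smooth_mono l by (metis less_imp_le)
      then show ?thesis unfolding a(2) \<chi>'[OF a(1)] by (intro smooth_mult smooth_powi smooth_prime l)
    qed
    have ker': "x = \<one>" if "x \<in> A'" "\<chi>' x = 1" for x
    proof -
      obtain a m where a: "a \<in> A" "x = a \<otimes> t [^] (m::int)" using \<open>x \<in> A'\<close> unfolding A'_def by blast
      have e: "\<chi> a * of_nat l powi m = 1" using that(2) \<chi>'[OF a(1)] a(2) by simp
      then have "of_nat l powi m = inverse (\<chi> a)" by (metis inverse_unique)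
      \<comment> \<open>A nontrivial power of \<open>l\<close> cannot be built from primes up to
        \<open>b < l\<close>, so the exponent \<open>m\<close> must vanish.\<close>
      then have "smooth b (of_nat l powi m)" using smooth_inverse sm a(1) by simp
      then have m: "m = 0" using not_smooth_prime_power[OF l] by blast
      then have "a = \<one>" using ker[OF a(1)] e by simp
      then show ?thesis using m a by simp
    qed
    have "z \<in> (\<Union>\<rho>\<in>R. A' #> \<rho>)" if z: "z \<in> generate G (insert t T)" for z
    proof -
      obtain x and n :: int where x: "x \<in> generate G T" "z = x \<otimes> t [^] n" using dec[OF z] by blast
      obtain a \<rho> where a: "a \<in> A" "\<rho> \<in> R" "x = a \<otimes> \<rho>" using cov[OF x(1)] by blast
      have c: "a \<in> carrier G" "\<rho> \<in> carrier G" using a gTc R by auto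
      have "z = a \<otimes> (\<rho> \<otimes> t [^] n)" using x a c t by (simp add: m_assoc)
      also have "\<rho> \<otimes> t [^] n = t [^] n \<otimes> \<rho>" using xt a R by blast
      also have "a \<otimes> (t [^] n \<otimes> \<rho>) = (a \<otimes> t [^] n) \<otimes> \<rho>" using c t by (simp add: m_assoc)
      finally have "z \<in> A' #> \<rho>" unfolding r_coset_def using A'I[OF a(1)] by blast
      then show ?thesis using a(2) by blast
    qed
    moreover have "A' \<subseteq> generate G (insert t T)" unfolding A'_def using A gsub gt by (auto intro!: generate.eng)
    ultimately show ?thesis using A's R gsub hom sm' ker'
      by (intro exI[of _ A'] exI[of _ \<chi>'] exI[of _ R] exI[of _ l]) auto
  qed
qed

lemma Q_linear_of_abelian_finite_index:
  assumes fg: "S \<subseteq> carrier G" "finite S" "generate G S = carrier G"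
    and H: "subgroup H G" "\<And>x y. x \<in> H \<Longrightarrow> y \<in> H \<Longrightarrow> x \<otimes> y = y \<otimes> x"
    and R: "finite R" "R \<subseteq> carrier G" "carrier G = (\<Union>\<rho>\<in>R. H #> \<rho>)"
  shows "Q_linear G"
proof -
  obtain T where T: "T \<subseteq> H" "finite T" "generate G T = H"
    using finite_index_finitely_generated[OF fg H(1) R] by blast
  have Hc: "H \<subseteq> carrier G" by (rule subgroup.subset[OF H(1)])
  have comm: "\<forall>s\<in>T. \<forall>t\<in>T. s \<otimes> t = t \<otimes> s" using H(2) T(1) by (simp add: subset_iff)
  have Tc: "T \<subseteq> carrier G" using T(1) Hc by blast
  obtain A \<chi> R' b where A: "subgroup A G" "A \<subseteq> H" and R': "finite R'" "R' \<subseteq> H"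
      "H \<subseteq> (\<Union>\<rho>\<in>R'. A #> \<rho>)" and \<chi>0: "\<forall>x\<in>A. \<forall>y\<in>A. \<chi> (x \<otimes> y) = \<chi> x * \<chi> y"
    and sm0: "\<forall>x\<in>A. smooth b (\<chi> x)" and ker0: "\<forall>x\<in>A. \<chi> x = 1 \<longrightarrow> x = \<one>"
    using abelian_free_finite_index[OF T(2) Tc comm, unfolded T(3)] by (elim exE conjE) simp
  have \<chi>: "\<chi> (x \<otimes> y) = \<chi> x * \<chi> y" if "x \<in> A" "y \<in> A" for x y using \<chi>0 that by blast
  have sm: "smooth b (\<chi> x)" and ker: "\<chi> x = 1 \<Longrightarrow> x = \<one>" if "x \<in> A" for x using sm0 ker0 that by auto
  have "rcosets A \<subseteq> (\<lambda>(\<rho>', \<rho>). A #> (\<rho>' \<otimes> \<rho>)) ` (R' \<times> R)"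
  proof
    fix c assume "c \<in> rcosets A"
    then obtain g where g: "g \<in> carrier G" "c = A #> g" unfolding RCOSETS_def by auto
    have "g \<in> (\<Union>\<rho>\<in>R. H #> \<rho>)" using g(1) unfolding R(3)[symmetric] .
    then obtain h \<rho> where h: "h \<in> H" "\<rho> \<in> R" "g = h \<otimes> \<rho>" unfolding r_coset_def by blast
    obtain a \<rho>' where a: "a \<in> A" "\<rho>' \<in> R'" "h = a \<otimes> \<rho>'" using R'(3) h(1) unfolding r_coset_def by blast
    have c: "a \<in> carrier G" "\<rho> \<in> carrier G" "\<rho>' \<in> carrier G" using a h A R R' Hc by auto
    have "g = a \<otimes> (\<rho>' \<otimes> \<rho>)" using h a c by (simp add: m_assoc)
    then have "g \<in> A #> (\<rho>' \<otimes> \<rho>)" unfolding r_coset_def using a(1) by blast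
    then have "c = A #> (\<rho>' \<otimes> \<rho>)" unfolding g(2) using repr_independence[OF _ _ A(1)] c by simp
    then show "c \<in> (\<lambda>(\<rho>', \<rho>). A #> (\<rho>' \<otimes> \<rho>)) ` (R' \<times> R)" using a(2) h(2) by force
  qed
  then have "finite (rcosets A)" using R(1) R'(1) finite_subset by blast
  then show ?thesis
    by (rule Q_linear_of_character[OF A(1) _ \<chi> _ ker]) (use sm smooth_pos in fastforce)+
qed

end

subsection \<open>Rational power series representations of groups of finite rank\<close>

text \<open>The localization of the integers at the prime ideal generated by
  \<open>p\<close>.\<close>

definition p_integral :: "nat \<Rightarrow> rat \<Rightarrow> bool" where
  "p_integral p q \<longleftrightarrow> (\<exists>s m::int. \<not> int p dvd s \<and> of_int s * q = of_int m)"

lemma p_integral_of_int [simp]: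
  assumes "Factorial_Ring.prime p" shows "p_integral p (of_int m)"
  unfolding p_integral_def
  by (rule exI[of _ 1], rule exI[of _ m]) (use assms not_prime_unit in auto)

lemma p_integral_add:
  assumes p: "Factorial_Ring.prime p" and "p_integral p x" "p_integral p y"
  shows "p_integral p (x + y)"
proof -
  obtain s m t n where st: "\<not> int p dvd s" "of_int s * x = of_int m" "\<not> int p dvd t" "of_int t * y = of_int n"
    using assms unfolding p_integral_def by blast
  have "of_int (s * t) * (x + y) = of_int t * (of_int s * x) + of_int s * (of_int t * y)"
    by (simp add: algebra_simps)
  also have "\<dots> = of_int (t * m + s * n)" using st by simp
  finally have "of_int (s * t) * (x + y) = of_int (t * m + s * n)" .
  moreover have "\<not> int p dvd s * t" using st p by (simp add: prime_dvd_mult_iff)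
  ultimately show ?thesis unfolding p_integral_def by blast
qed

lemma p_integral_mult:
  assumes p: "Factorial_Ring.prime p" and "p_integral p x" "p_integral p y"
  shows "p_integral p (x * y)"
proof -
  obtain s m t n where st: "\<not> int p dvd s" "of_int s * x = of_int m" "\<not> int p dvd t" "of_int t * y = of_int n"
    using assms unfolding p_integral_def by blast
  have "of_int (s * t) * (x * y) = (of_int s * x) * (of_int t * y)"
    by (simp add: algebra_simps)
  also have "\<dots> = of_int (m * n)" using st by simp
  finally have "of_int (s * t) * (x * y) = of_int (m * n)" .
  moreover have "\<not> int p dvd s * t" using st p by (simp add: prime_dvd_mult_iff)
  ultimately show ?thesis unfolding p_integral_def by blast
qed

lemma p_integral_0: "Factorial_Ring.prime p \<Longrightarrow> p_integral p 0"
  using p_integral_of_int[of p 0] by simp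

lemma p_integral_1: "Factorial_Ring.prime p \<Longrightarrow> p_integral p 1"
  using p_integral_of_int[of p 1] by simp

lemma p_integral_uminus: "Factorial_Ring.prime p \<Longrightarrow> p_integral p x \<Longrightarrow> p_integral p (- x)"
  using p_integral_mult[of p "of_int (-1)" x] p_integral_of_int[of p "-1"] by simp

lemma p_integral_sum:
  "Factorial_Ring.prime p \<Longrightarrow> (\<And>i. i \<in> I \<Longrightarrow> p_integral p (f i)) \<Longrightarrow> p_integral p (sum f I)"
  by (induction I rule: infinite_finite_induct) (auto intro: p_integral_0 p_integral_add)

lemma p_integral_quotient:
  assumes p: "Factorial_Ring.prime p" and "p_integral p (of_int d / of_nat p)"
  shows "int p dvd d"
proof -
  obtain s m where s: "\<not> int p dvd s" "of_int s * (of_int d / of_nat p) = (of_int m :: rat)"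
    using assms unfolding p_integral_def by blast
  have "(of_nat p :: rat) \<noteq> 0" using p by auto
  then have "(of_int (s * d) :: rat) = of_int (int p * m)" using s by (simp add: field_simps)
  then have "s * d = int p * m" using of_int_eq_iff by blast
  then have "int p dvd s * d" by simp
  then show ?thesis using s p by (simp add: prime_dvd_mult_iff)
qed

lemma p_integral_large:
  assumes "finite F"
  shows "\<exists>B. \<forall>p. Factorial_Ring.prime p \<longrightarrow> p > B \<longrightarrow> (\<forall>q\<in>F. p_integral p q)"
  using assms
proof (induction F rule: finite_induct)
  case (insert q F)
  then obtain B where B: "\<forall>p. Factorial_Ring.prime p \<longrightarrow> p > B \<longrightarrow> (\<forall>q\<in>F. p_integral p q)" by blast
  obtain a b where ab: "b > 0" "q = of_int a / of_int b"
    by (metis quotient_of_denom_pos quotient_of_div surj_pair)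
  have "p_integral p q" if "p > nat b" for p
  proof -
    have "\<not> int p dvd b" using that ab(1) by (metis nat_less_iff not_less zdvd_imp_le of_nat_0_le_iff zless_nat_eq_int_zless less_le)
    moreover have "of_int b * q = of_int a" using ab by simp
    ultimately show ?thesis unfolding p_integral_def by blast
  qed
  then show ?case using B by (intro exI[of _ "max B (nat b)"]) auto
qed auto

lemma (in group) mrep_pow:
  assumes "mrep G N \<sigma>" "z \<in> carrier G"
  shows "\<sigma> (z [^] (k::nat)) = \<sigma> z ^\<^sub>m k"
  by (induction k) (use assms in \<open>auto simp: mrep_def\<close>)

lemma mat_binomial:
  fixes D :: "'a::comm_ring_1 mat"
  assumes D: "D \<in> carrier_mat N N" and "u < N" "v < N"
  shows "((1\<^sub>m N + D) ^\<^sub>m n) $$ (u, v) = (\<Sum>k\<le>n. of_nat (n choose k) * (D ^\<^sub>m k) $$ (u, v))"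
  using assms(2,3)
proof (induction n arbitrary: u v)
  case 0
  then show ?case using D by simp
next
  case (Suc n)
  let ?A = "1\<^sub>m N + D"
  have A: "?A \<in> carrier_mat N N" using D by simp
  have Dk: "(D ^\<^sub>m Suc k) $$ (u, v) = (\<Sum>a<N. (D ^\<^sub>m k) $$ (u, a) * D $$ (a, v))" for k
    using mat_mult_entry[OF pow_carrier_mat[OF D] D Suc.prems] by simp
  have "(?A ^\<^sub>m Suc n) $$ (u, v) = (\<Sum>a<N. (?A ^\<^sub>m n) $$ (u, a) * ?A $$ (a, v))"
    using mat_mult_entry[OF pow_carrier_mat[OF A] A Suc.prems] by simp
  also have "\<dots> = (\<Sum>a<N. (?A ^\<^sub>m n) $$ (u, a) * (if a = v then 1 else 0)) + (\<Sum>a<N. (?A ^\<^sub>m n) $$ (u, a) * D $$ (a, v))"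
    unfolding sum.distrib[symmetric] by (rule sum.cong) (use Suc.prems D in \<open>auto simp: algebra_simps\<close>)
  also have "(\<Sum>a<N. (?A ^\<^sub>m n) $$ (u, a) * (if a = v then 1 else 0)) = (\<Sum>k\<le>n. of_nat (n choose k) * (D ^\<^sub>m k) $$ (u, v))"
    using Suc by (simp add: if_distrib[of "\<lambda>x. _ * x"] cong: if_cong)
  also have "(\<Sum>a<N. (?A ^\<^sub>m n) $$ (u, a) * D $$ (a, v)) = (\<Sum>a<N. \<Sum>k\<le>n. of_nat (n choose k) * ((D ^\<^sub>m k) $$ (u, a) * D $$ (a, v)))"
    using Suc by (intro sum.cong) (auto simp: sum_distrib_right mult.assoc)
  also have "\<dots> = (\<Sum>k\<le>n. of_nat (n choose k) * (D ^\<^sub>m Suc k) $$ (u, v))"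
    unfolding Dk sum_distrib_left by (rule sum.swap)
  also have "(\<Sum>k\<le>n. of_nat (n choose k) * (D ^\<^sub>m k) $$ (u, v)) + (\<Sum>k\<le>n. of_nat (n choose k) * (D ^\<^sub>m Suc k) $$ (u, v))
      = (\<Sum>k\<le>Suc n. of_nat (Suc n choose k) * (D ^\<^sub>m k) $$ (u, v))"
  proof -
    have "(\<Sum>k\<le>n. of_nat (n choose k) * (D ^\<^sub>m k) $$ (u, v)) = (\<Sum>k\<le>Suc n. of_nat (n choose k) * (D ^\<^sub>m k) $$ (u, v))"
      by (simp add: binomial_eq_0)
    also have "\<dots> = (D ^\<^sub>m 0) $$ (u, v) + (\<Sum>k\<le>n. of_nat (n choose Suc k) * (D ^\<^sub>m Suc k) $$ (u, v))"
      by (subst sum.atMost_Suc_shift) simp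
    finally show ?thesis
      by (subst sum.atMost_Suc_shift) (simp add: algebra_simps sum.distrib del: pow_mat.simps)
  qed
  finally show ?case .
qed

lemma mat_pow_low_zero:
  fixes D :: "'a::comm_ring_1 fps mat"
  assumes D: "D \<in> carrier_mat N N" and low: "\<And>u v l. u < N \<Longrightarrow> v < N \<Longrightarrow> l < m \<Longrightarrow> fps_nth (D $$ (u, v)) l = 0"
    and "u < N" "v < N" "l < k * m"
  shows "fps_nth ((D ^\<^sub>m k) $$ (u, v)) l = 0"
  using assms(3-)
proof (induction k arbitrary: u v l)
  case (Suc k)
  have "fps_nth ((D ^\<^sub>m Suc k) $$ (u, v)) l = (\<Sum>a<N. \<Sum>i=0..l. fps_nth ((D ^\<^sub>m k) $$ (u, a)) i * fps_nth (D $$ (a, v)) (l - i))"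
    using mat_mult_entry[OF pow_carrier_mat[OF D] D Suc.prems(1,2)] by (simp add: fps_sum_nth fps_mult_nth)
  also have "\<dots> = 0"
  proof (intro sum.neutral ballI)
    fix a i assume a: "a \<in> {..<N}" and i: "i \<in> {0..l}"
    show "fps_nth ((D ^\<^sub>m k) $$ (u, a)) i * fps_nth (D $$ (a, v)) (l - i) = 0"
    proof (cases "i < k * m")
      case True
      then show ?thesis using Suc.IH[of u a i] Suc.prems a by simp
    next
      case False
      then have "l - i < m" using Suc.prems i by auto
      then show ?thesis using low[of a v] a Suc.prems by simp
    qed
  qed
  finally show ?case .
qed simp

text \<open>For an element \<open>z\<close> acting as the identity modulo \<open>p\<close> and modulo the \<open>K\<close>-th power of the variable,
  the coefficients \<open>\<theta>\<close> of \<open>(\<sigma> z - 1) / p\<close> are additive in \<open>z\<close> modulo \<open>p\<close>.\<close>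

locale rat_series_rep = group G for G :: "('g, 'b) monoid_scheme" (structure) +
  fixes N K :: nat and \<sigma> :: "'g \<Rightarrow> rat fps mat" and p :: nat
  assumes rep: "mrep G N \<sigma>" and p: "Factorial_Ring.prime p" and Kp: "K \<le> p"
begin

definition dev :: "'g \<Rightarrow> nat \<Rightarrow> nat \<Rightarrow> rat fps" where
  "dev z u v = \<sigma> z $$ (u, v) - (if u = v then 1 else 0)"

definition \<theta> :: "'g \<Rightarrow> nat \<Rightarrow> nat \<Rightarrow> nat \<Rightarrow> rat" where
  "\<theta> z u v l = fps_nth (dev z u v) l / of_nat p"

definition integral :: "'g \<Rightarrow> bool" where
  "integral z \<longleftrightarrow> (\<forall>u<N. \<forall>v<N. \<forall>l<K. p_integral p (\<theta> z u v l))"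

text \<open>Membership in the maximal ideal of the local ring at \<open>p\<close>, that is,
  vanishing in the residue field with \<open>p\<close> elements.\<close>

definition zero_mod :: "rat \<Rightarrow> bool" where
  "zero_mod q \<longleftrightarrow> p_integral p (q / of_nat p)"

lemma p_nonzero: "(of_nat p :: rat) \<noteq> 0" using p by auto

lemma zero_mod_add: "zero_mod x \<Longrightarrow> zero_mod y \<Longrightarrow> zero_mod (x + y)"
  unfolding zero_mod_def add_divide_distrib by (rule p_integral_add[OF p])

lemma zero_mod_mult: "p_integral p x \<Longrightarrow> zero_mod y \<Longrightarrow> zero_mod (x * y)"
  unfolding zero_mod_def times_divide_eq_right[symmetric] by (rule p_integral_mult[OF p])

lemma zero_mod_0: "zero_mod 0"
  unfolding zero_mod_def using p_integral_0[OF p] by simp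

lemma zero_mod_uminus: "zero_mod x \<Longrightarrow> zero_mod (- x)"
  unfolding zero_mod_def using p_integral_uminus[OF p] by fastforce

lemma zero_mod_sum: "(\<And>i. i \<in> I \<Longrightarrow> zero_mod (f i)) \<Longrightarrow> zero_mod (sum f I)"
  by (induction I rule: infinite_finite_induct) (auto intro: zero_mod_0 zero_mod_add)

lemma zero_mod_p: "p_integral p x \<Longrightarrow> zero_mod (of_nat p * x)"
  unfolding zero_mod_def using p_nonzero by simp

lemma dev_mult:
  assumes "z \<in> carrier G" "w \<in> carrier G" "u < N" "v < N"
  shows "dev (z \<otimes> w) u v = dev z u v + dev w u v + (\<Sum>a<N. dev z u a * dev w a v)"
proof -
  have m: "\<sigma> z \<in> carrier_mat N N" "\<sigma> w \<in> carrier_mat N N" "\<sigma> (z \<otimes> w) = \<sigma> z * \<sigma> w"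
    using rep assms unfolding mrep_def by auto
  let ?d = "\<lambda>a b. (if a = b then 1 else 0) :: rat fps"
  have "\<sigma> (z \<otimes> w) $$ (u, v) = (\<Sum>a<N. (dev z u a + ?d u a) * (dev w a v + ?d a v))"
    unfolding m(3) mat_mult_entry[OF m(1,2) assms(3,4)] dev_def by simp
  also have "\<dots> = (\<Sum>a<N. dev z u a * dev w a v) + (\<Sum>a<N. dev z u a * ?d a v) + (\<Sum>a<N. ?d u a * dev w a v)
      + (\<Sum>a<N. ?d u a * ?d a v)"
    by (simp add: algebra_simps sum.distrib)
  also have "(\<Sum>a<N. dev z u a * ?d a v) = dev z u v"
    using assms by (simp add: if_distrib[of "\<lambda>x. _ * x"] cong: if_cong)
  also have "(\<Sum>a<N. ?d u a * dev w a v) = dev w u v"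
    using assms by (simp add: if_distrib[of "\<lambda>x. x * _"] cong: if_cong)
  also have "(\<Sum>a<N. ?d u a * ?d a v) = ?d u v"
    using assms by (simp add: if_distrib[of "\<lambda>x. x * _"] cong: if_cong)
  finally show ?thesis unfolding dev_def by simp
qed

text \<open>From \<open>(1 + p X) (1 + p Y) = 1 + p (X + Y) + p^2 X Y\<close>: the cross term is
  divisible by \<open>p\<close> even after the division by \<open>p\<close> in
  \<open>\<theta>\<close>.\<close>

lemma \<theta>_mult:
  assumes "z \<in> carrier G" "w \<in> carrier G" "integral z" "integral w" "u < N" "v < N" "l < K"
  shows "zero_mod (\<theta> (z \<otimes> w) u v l - (\<theta> z u v l + \<theta> w u v l))" (is ?A)
    and "p_integral p (\<theta> (z \<otimes> w) u v l)" (is ?B)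
proof -
  have "\<theta> (z \<otimes> w) u v l - (\<theta> z u v l + \<theta> w u v l) = (\<Sum>a<N. fps_nth (dev z u a * dev w a v) l) / of_nat p"
    unfolding \<theta>_def dev_mult[OF assms(1,2,5,6)] by (simp add: fps_sum_nth add_divide_distrib)
  also have "\<dots> = of_nat p * (\<Sum>a<N. \<Sum>i=0..l. \<theta> z u a i * \<theta> w a v (l - i))"
    using p_nonzero unfolding fps_mult_nth \<theta>_def by (simp add: sum_divide_distrib sum_distrib_left field_simps)
  finally have e: "\<theta> (z \<otimes> w) u v l - (\<theta> z u v l + \<theta> w u v l) = of_nat p * (\<Sum>a<N. \<Sum>i=0..l. \<theta> z u a i * \<theta> w a v (l - i))" .
  have i: "p_integral p (\<Sum>a<N. \<Sum>i=0..l. \<theta> z u a i * \<theta> w a v (l - i))"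
    using assms unfolding integral_def by (intro p_integral_sum p_integral_mult p) auto
  then show ?A unfolding e by (rule zero_mod_p)
  have "\<theta> (z \<otimes> w) u v l = (\<theta> z u v l + \<theta> w u v l) + of_nat p * (\<Sum>a<N. \<Sum>i=0..l. \<theta> z u a i * \<theta> w a v (l - i))"
    using e by simp
  moreover have "p_integral p (of_nat p)" using p_integral_of_int[OF p, of "int p"] by simp
  ultimately show ?B
    using i assms unfolding integral_def by (auto intro!: p_integral_add p_integral_mult p)
qed

lemma \<theta>_one: "u < N \<Longrightarrow> v < N \<Longrightarrow> \<theta> \<one> u v l = 0"
  using rep unfolding \<theta>_def dev_def mrep_def by auto

text \<open>Additivity maps the generated subgroup into the span of the images of \<open>Y\<close>
  over the field with \<open>p\<close> elements. Integrality is also required of the inverses,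
  because words contain them and additivity holds only between integral elements.\<close>

lemma integral_generate:
  assumes Y: "Y \<subseteq> carrier G" "finite Y" "\<And>y. y \<in> Y \<Longrightarrow> integral y \<and> integral (inv y)" and z: "z \<in> generate G Y"
  shows "integral z \<and> (\<exists>n::'g \<Rightarrow> int. \<forall>u<N. \<forall>v<N. \<forall>l<K.
    zero_mod (\<theta> z u v l - (\<Sum>y\<in>Y. of_int (n y) * \<theta> y u v l)))"
  using z
proof (induction rule: generate.induct)
  case one
  show ?case unfolding integral_def using \<theta>_one p_integral_0[OF p] zero_mod_0 by (intro conjI exI[of _ "\<lambda>_. 0"]) auto
next
  case (incl h)
  have "(\<Sum>y\<in>Y. of_int (if y = h then 1 else 0) * \<theta> y u v l) = \<theta> h u v l" for u v l
    using incl Y(2) by (simp add: if_distrib[of "\<lambda>x. x * _"] if_distrib[of of_int] cong: if_cong)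
  then show ?case using Y(3)[OF incl] zero_mod_0 by (intro conjI exI[of _ "\<lambda>y. if y = h then 1 else 0"]) auto
next
  case (inv h)
  have hc: "h \<in> carrier G" using inv Y(1) by blast
  have "(\<Sum>y\<in>Y. of_int (if y = h then - 1 else 0) * \<theta> y u v l) = - \<theta> h u v l" for u v l
    using inv Y(2) by (simp add: if_distrib[of "\<lambda>x. x * _"] if_distrib[of of_int] cong: if_cong)
  moreover have "zero_mod (\<theta> (inv h) u v l + \<theta> h u v l)" if "u < N" "v < N" "l < K" for u v l
    using zero_mod_uminus[OF \<theta>_mult(1)[OF _ hc, of "inv h" u v l]] Y(3)[OF inv] that hc \<theta>_one
    by (simp add: add.commute)
  ultimately show ?case using Y(3)[OF inv] by (intro conjI exI[of _ "\<lambda>y. if y = h then - 1 else 0"]) auto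
next
  case (eng a b)
  have c: "a \<in> carrier G" "b \<in> carrier G" using eng.hyps generate_in_carrier[OF Y(1)] by auto
  obtain m n where mn: "\<And>u v l. u < N \<Longrightarrow> v < N \<Longrightarrow> l < K \<Longrightarrow> zero_mod (\<theta> a u v l - (\<Sum>y\<in>Y. of_int (m y) * \<theta> y u v l))"
     "\<And>u v l. u < N \<Longrightarrow> v < N \<Longrightarrow> l < K \<Longrightarrow> zero_mod (\<theta> b u v l - (\<Sum>y\<in>Y. of_int (n y) * \<theta> y u v l))"
    using eng.IH[THEN conjunct2] by (elim exE) blast
  have ii: "integral a" "integral b" using eng.IH by auto
  have "zero_mod (\<theta> (a \<otimes> b) u v l - (\<Sum>y\<in>Y. of_int (m y + n y) * \<theta> y u v l))" if uvl: "u < N" "v < N" "l < K" for u v l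
  proof -
    have "\<theta> (a \<otimes> b) u v l - (\<Sum>y\<in>Y. of_int (m y + n y) * \<theta> y u v l)
      = (\<theta> (a \<otimes> b) u v l - (\<theta> a u v l + \<theta> b u v l)) + (\<theta> a u v l - (\<Sum>y\<in>Y. of_int (m y) * \<theta> y u v l))
        + (\<theta> b u v l - (\<Sum>y\<in>Y. of_int (n y) * \<theta> y u v l))"
      by (simp add: algebra_simps sum.distrib)
    then show ?thesis
      using zero_mod_add[OF zero_mod_add[OF \<theta>_mult(1)[OF c ii uvl] mn(1)[OF uvl]] mn(2)[OF uvl]] by (simp only:)
  qed
  moreover have "integral (a \<otimes> b)" unfolding integral_def using \<theta>_mult(2)[OF c ii] by blast
  ultimately show ?case by (intro conjI exI[of _ "\<lambda>y. m y + n y"]) auto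
qed

text \<open>Write \<open>\<sigma> z = 1 + D\<close>. In \<open>(1 + D)^p\<close> the coefficients
  before the last term are divisible by \<open>p\<close>, and the last term \<open>D^p\<close>
  vanishes below order \<open>K\<close>. Up to order \<open>m\<close> only \<open>p D\<close>
  contributes, since \<open>D^k\<close> with \<open>k \<ge> 2\<close> starts at order
  \<open>2 m > m\<close>.\<close>

lemma integral_pow:
  assumes z: "z \<in> carrier G" and d: "\<And>u v l. u < N \<Longrightarrow> v < N \<Longrightarrow> l < K \<Longrightarrow> p_integral p (fps_nth (dev z u v) l)"
    and m: "m > 0" "\<And>u v l. u < N \<Longrightarrow> v < N \<Longrightarrow> l < m \<Longrightarrow> fps_nth (dev z u v) l = 0"
  shows "integral (z [^] p)" and "u < N \<Longrightarrow> v < N \<Longrightarrow> l < K \<Longrightarrow> l \<le> m \<Longrightarrow> \<theta> (z [^] p) u v l = fps_nth (dev z u v) l"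
proof -
  define D where "D = mat N N (\<lambda>(u, v). dev z u v)"
  have Dc: "D \<in> carrier_mat N N" unfolding D_def by simp
  have \<sigma>z: "\<sigma> z \<in> carrier_mat N N" using rep z unfolding mrep_def by blast
  have \<sigma>D: "\<sigma> z = 1\<^sub>m N + D" using \<sigma>z by (intro eq_matI) (auto simp: D_def dev_def)
  have Dint: "p_integral p (fps_nth ((D ^\<^sub>m k) $$ (u, v)) l)" if "u < N" "v < N" "l < K" for k u v l
    using that
  proof (induction k arbitrary: u v l)
    case 0
    then show ?case using p_integral_0[OF p] p_integral_1[OF p] Dc by simp
  next
    case (Suc k)
    have "(D ^\<^sub>m Suc k) $$ (u, v) = (\<Sum>a<N. (D ^\<^sub>m k) $$ (u, a) * D $$ (a, v))"
      using mat_mult_entry[OF pow_carrier_mat[OF Dc] Dc Suc.prems(1,2)] by simp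
    then show ?case using Suc d
      by (auto simp: fps_sum_nth fps_mult_nth D_def intro!: p_integral_sum p_integral_mult p)
  qed
  have Dlow: "fps_nth ((D ^\<^sub>m k) $$ (u, v)) l = 0" if "u < N" "v < N" "l < k * m" for k u v l
    by (rule mat_pow_low_zero[OF Dc _ that]) (use m(2) in \<open>simp add: D_def\<close>)
  have bin: "dev (z [^] p) u v = (\<Sum>k=1..p. of_nat (p choose k) * (D ^\<^sub>m k) $$ (u, v))" if "u < N" "v < N" for u v
  proof -
    have "\<sigma> (z [^] p) $$ (u, v) = (\<Sum>k\<le>p. of_nat (p choose k) * (D ^\<^sub>m k) $$ (u, v))"
      unfolding mrep_pow[OF rep z] \<sigma>D by (rule mat_binomial[OF Dc that])
    also have "\<dots> = (if u = v then 1 else 0) + (\<Sum>k=1..p. of_nat (p choose k) * (D ^\<^sub>m k) $$ (u, v))"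
    proof -
      have "{..p} = insert 0 {1..p}" by auto
      then show ?thesis using that Dc by simp
    qed
    finally show ?thesis unfolding dev_def by simp
  qed
  have \<theta>: "\<theta> (z [^] p) u v l = (\<Sum>k=1..<p. of_nat ((p choose k) div p) * fps_nth ((D ^\<^sub>m k) $$ (u, v)) l)"
    if uvl: "u < N" "v < N" "l < K" for u v l
  proof -
    \<comment> \<open>Here \<open>K \<le> p\<close> enters: it removes the term
      \<open>k = p\<close>, the only one in the sum whose binomial coefficient is not divisible by
      \<open>p\<close>.\<close>
    have "l < p * m" using uvl(3) Kp m(1) by (metis less_le_trans mult.right_neutral mult_le_mono2 Suc_leI One_nat_def)
    then have top: "fps_nth ((D ^\<^sub>m p) $$ (u, v)) l = 0" using Dlow uvl by blast
    have "fps_nth (dev (z [^] p) u v) l = (\<Sum>k=1..p. of_nat (p choose k) * fps_nth ((D ^\<^sub>m k) $$ (u, v)) l)"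
      unfolding bin[OF uvl(1,2)] by (simp add: fps_sum_nth fps_of_nat[symmetric] del: fps_of_nat)
    also have "\<dots> = (\<Sum>k=1..<p. of_nat (p choose k) * fps_nth ((D ^\<^sub>m k) $$ (u, v)) l)"
      using top prime_gt_0_nat[OF p] by (simp add: atLeastLessThanSuc_atLeastAtMost[symmetric] sum.atLeastLessThan_Suc)
    also have "\<dots> = (\<Sum>k=1..<p. of_nat p * (of_nat ((p choose k) div p) * fps_nth ((D ^\<^sub>m k) $$ (u, v)) l))"
    proof (rule sum.cong)
      fix k assume "k \<in> {1..<p}"
      then have "p dvd (p choose k)" using p by (intro dvd_choose_prime) auto
      then have "(of_nat (p choose k) :: rat) = of_nat p * of_nat ((p choose k) div p)"
        by (metis dvd_mult_div_cancel of_nat_mult)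
      then show "of_nat (p choose k) * fps_nth ((D ^\<^sub>m k) $$ (u, v)) l = of_nat p * (of_nat ((p choose k) div p) * fps_nth ((D ^\<^sub>m k) $$ (u, v)) l)"
        by simp
    qed simp
    finally show ?thesis unfolding \<theta>_def using p_nonzero by (simp add: sum_distrib_left[symmetric])
  qed
  have nat_int: "p_integral p (of_nat k)" for k using p_integral_of_int[OF p, of "int k"] by simp
  show "integral (z [^] p)"
    unfolding integral_def using \<theta> Dint nat_int by (auto intro!: p_integral_sum p_integral_mult p)
  assume uv: "u < N" "v < N" and l: "l < K" "l \<le> m"
  have "\<theta> (z [^] p) u v l = (\<Sum>k=1..<p. if k = 1 then fps_nth (dev z u v) l else 0)"
    unfolding \<theta>[OF uv l(1)]
  proof (rule sum.cong)
    fix k assume k: "k \<in> {1..<p}"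
    show "of_nat ((p choose k) div p) * fps_nth ((D ^\<^sub>m k) $$ (u, v)) l = (if k = 1 then fps_nth (dev z u v) l else 0)"
    proof (cases "k = 1")
      case True
      have "D ^\<^sub>m 1 = D" using Dc by simp
      then show ?thesis using True uv prime_gt_0_nat[OF p] by (simp add: D_def)
    next
      case False
      then have "2 * m \<le> k * m" using k by (intro mult_le_mono1) auto
      then have "l < k * m" using l(2) m(1) by linarith
      then show ?thesis using False Dlow[OF uv, of l k] l m(1) by simp
    qed
  qed simp
  also have "\<dots> = fps_nth (dev z u v) l" using prime_gt_1_nat[OF p] by simp
  finally show "\<theta> (z [^] p) u v l = fps_nth (dev z u v) l" .
qed

end

text \<open>For a large prime \<open>p\<close>, the \<open>\<theta>\<close>-coefficients of the
  \<open>p\<close>-th powers of the \<open>g i\<close> vanish below the distinct orders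
  \<open>k i\<close> and have a \<open>p\<close>-unit at order \<open>k i\<close>. Hence they give
  \<open>r + 1\<close> independent vectors over the field with \<open>p\<close> elements. By
  additivity, however, they lie in the span of the vectors of at most \<open>r\<close> generators of
  the subgroup that these powers generate.\<close>

lemma (in group) rank_bounds_orders:
  fixes \<sigma> :: "'a \<Rightarrow> rat fps mat" and g :: "nat \<Rightarrow> 'a" and k :: "nat \<Rightarrow> nat"
  assumes rk: "rank_le G r" and rep: "mrep G N \<sigma>" and g: "\<And>i. i \<le> r \<Longrightarrow> g i \<in> carrier G"
    and k: "\<And>i. i \<le> r \<Longrightarrow> k i > 0" "\<And>i j. i < j \<Longrightarrow> j \<le> r \<Longrightarrow> k i < k j"
    and low: "\<And>i u v l. i \<le> r \<Longrightarrow> u < N \<Longrightarrow> v < N \<Longrightarrow> l < k i \<Longrightarrow>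
      fps_nth (\<sigma> (g i) $$ (u, v) - (if u = v then 1 else 0)) l = 0"
    and lead: "\<And>i. i \<le> r \<Longrightarrow> \<exists>u<N. \<exists>v<N. fps_nth (\<sigma> (g i) $$ (u, v) - (if u = v then 1 else 0)) (k i) \<noteq> 0"
  shows False
proof -
  define K where "K = Suc (k r)"
  have kK: "k i < K" if "i \<le> r" for i
    using k(2)[of i r] that unfolding K_def by (cases "i = r") auto
  define d where "d z u v = \<sigma> z $$ (u, v) - (if u = v then 1 else 0)" for z u v
  obtain u0 v0 where lead': "\<And>i. i \<le> r \<Longrightarrow> u0 i < N \<and> v0 i < N \<and> fps_nth (d (g i) (u0 i) (v0 i)) (k i) \<noteq> 0"
    using lead unfolding d_def by metis
  \<comment> \<open>The rationals that have to be \<open>p\<close>-integral. Including the inverses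
    of the leading coefficients makes these coefficients units at \<open>p\<close>; the entries for
    \<open>inv (g i)\<close> serve the integrality of inverses.\<close>
  define F where "F = (\<Union>i\<in>{..r}. \<Union>u\<in>{..<N}. \<Union>v\<in>{..<N}. \<Union>l\<in>{..<K}.
      {fps_nth (d (g i) u v) l, fps_nth (d (inv (g i)) u v) l})
      \<union> (\<lambda>i. inverse (fps_nth (d (g i) (u0 i) (v0 i)) (k i))) ` {..r}"
  have "finite F" unfolding F_def by auto
  then obtain B where B: "\<And>p q. Factorial_Ring.prime p \<Longrightarrow> p > B \<Longrightarrow> q \<in> F \<Longrightarrow> p_integral p q"
    using p_integral_large by blast
  obtain p where pp: "Factorial_Ring.prime p" "p > max B K" using bigger_prime by blast
  interpret rat_series_rep G N K \<sigma> p
    by unfold_locales (use rep pp in auto)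
  have dd: "dev = d" unfolding dev_def d_def by auto
  have int1: "p_integral p (fps_nth (dev (g i) u v) l)" "p_integral p (fps_nth (dev (inv (g i)) u v) l)"
    if "i \<le> r" "u < N" "v < N" "l < K" for i u v l
  proof -
    have "fps_nth (d (g i) u v) l \<in> F" "fps_nth (d (inv (g i)) u v) l \<in> F"
      using that unfolding F_def by blast+
    then show "p_integral p (fps_nth (dev (g i) u v) l)" "p_integral p (fps_nth (dev (inv (g i)) u v) l)"
      using B pp unfolding dd by auto
  qed
  have int2: "p_integral p (inverse (fps_nth (dev (g i) (u0 i) (v0 i)) (k i)))" if "i \<le> r" for i
  proof -
    have "inverse (fps_nth (d (g i) (u0 i) (v0 i)) (k i)) \<in> F" using that unfolding F_def by auto
    then show ?thesis using B pp unfolding dd by auto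
  qed
  have low1: "fps_nth (dev (g i) u v) l = 0" if "i \<le> r" "u < N" "v < N" "l < k i" for i u v l
    using low[OF that] unfolding dev_def .
  have low2: "fps_nth (dev (inv (g i)) u v) l = 0" if i: "i \<le> r" and uv: "u < N" "v < N" and l: "l < 1" for i u v l
  proof -
    have gi: "g i \<in> carrier G" using g i by blast
    have "fps_nth (dev (inv (g i) \<otimes> g i) u v) 0 = fps_nth (dev (inv (g i)) u v) 0"
      unfolding dev_mult[OF inv_closed[OF gi] gi uv] using low1[OF i _ uv(2)] k(1)[OF i] uv
      by (simp add: fps_sum_nth)
    moreover have "dev (inv (g i) \<otimes> g i) u v = 0" using gi rep uv unfolding dev_def mrep_def by simp
    ultimately show ?thesis using l by simp
  qed
  define h where "h i = g i [^] p" for i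
  have hc: "h i \<in> carrier G" if "i \<le> r" for i using g that unfolding h_def by simp
  have hint: "integral (h i)" if "i \<le> r" for i
    unfolding h_def by (rule integral_pow(1)[OF g[OF that] int1(1)[OF that] k(1)[OF that] low1[OF that]])
  have hint': "integral (inv (h i))" if "i \<le> r" for i
  proof -
    have "integral (inv (g i) [^] p)"
      by (rule integral_pow(1)[of _ 1]) (use g int1(2) low2 that in auto)
    then show ?thesis unfolding h_def using nat_pow_inv[OF g[OF that]] by simp
  qed
  have h\<theta>: "\<theta> (h i) u v l = fps_nth (dev (g i) u v) l" if "i \<le> r" "u < N" "v < N" "l \<le> k i" for i u v l
    unfolding h_def
    by (rule integral_pow(2)[OF g[OF that(1)] int1(1)[OF that(1)] k(1)[OF that(1)] low1[OF that(1)]])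
      (use that kK[of i] in auto)
  define S where "S = h ` {..r}"
  have S: "S \<subseteq> carrier G" "finite S" unfolding S_def using hc by auto
  have Sint: "integral y \<and> integral (inv y)" if "y \<in> S" for y using that hint hint' unfolding S_def by auto
  obtain Y where Y: "Y \<subseteq> carrier G" "finite Y" "card Y \<le> r" "generate G Y = generate G S"
    using rk[unfolded rank_le_def, rule_format, OF S] by auto
  \<comment> \<open>The generators supplied by the rank bound are arbitrary, but they lie in the
    subgroup generated by \<open>S\<close>, where integrality is already known.\<close>
  have Yint: "integral y \<and> integral (inv y)" if "y \<in> Y" for y
  proof -
    have y: "y \<in> generate G S" using that generate.incl[of y Y G] Y(4) by simp
    have y': "inv y \<in> generate G S" using generate_m_inv_closed[OF S(1) y] .
    show ?thesis using integral_generate[OF S Sint y] integral_generate[OF S Sint y'] by blast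
  qed
  have "\<exists>n::'a \<Rightarrow> int. \<forall>u<N. \<forall>v<N. \<forall>l<K. zero_mod (\<theta> (h i) u v l - (\<Sum>y\<in>Y. of_int (n y) * \<theta> y u v l))"
    if "i \<le> r" for i
  proof -
    have "h i \<in> generate G Y" unfolding Y(4) by (rule generate.incl) (use that in \<open>auto simp: S_def\<close>)
    then show ?thesis using integral_generate[OF Y(1,2) Yint] by blast
  qed
  then obtain n :: "nat \<Rightarrow> 'a \<Rightarrow> int" where n: "\<And>i u v l. i \<le> r \<Longrightarrow> u < N \<Longrightarrow> v < N \<Longrightarrow> l < K \<Longrightarrow>
      zero_mod (\<theta> (h i) u v l - (\<Sum>y\<in>Y. of_int (n i y) * \<theta> y u v l))"
    by metis
  have p1: "p > 1" using prime_gt_1_nat[OF pp(1)] .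
  \<comment> \<open>Pigeonhole in place of linear algebra over the field with \<open>p\<close>
    elements: \<open>p ^ Suc r\<close> coefficient vectors have at most \<open>p ^ r\<close> images,
    and the difference \<open>e\<close> of two vectors with equal image is a relation modulo
    \<open>p\<close>.\<close>
  define \<Phi> where "\<Phi> c = (\<lambda>y\<in>Y. (\<Sum>i\<le>r. c i * n i y) mod int p)" for c :: "nat \<Rightarrow> int"
  have "\<not> inj_on \<Phi> ({..r} \<rightarrow>\<^sub>E {0..<int p})"
  proof
    assume inj: "inj_on \<Phi> ({..r} \<rightarrow>\<^sub>E {0..<int p})"
    have "\<Phi> ` ({..r} \<rightarrow>\<^sub>E {0..<int p}) \<subseteq> Y \<rightarrow>\<^sub>E {0..<int p}" unfolding \<Phi>_def using p1 by auto
    then have "card ({..r} \<rightarrow>\<^sub>E {0..<int p}) \<le> card (Y \<rightarrow>\<^sub>E {0..<int p})"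
      using Y(2) by (intro card_inj_on_le[OF inj]) (auto intro: finite_PiE)
    then have "p ^ Suc r \<le> p ^ card Y" using Y(2) by (simp add: card_PiE)
    then have "Suc r \<le> card Y" using p1 power_le_imp_le_exp by blast
    then show False using Y(3) by simp
  qed
  then obtain c c' where c: "c \<in> {..r} \<rightarrow>\<^sub>E {0..<int p}" "c' \<in> {..r} \<rightarrow>\<^sub>E {0..<int p}" "\<Phi> c = \<Phi> c'" "c \<noteq> c'"
    unfolding inj_on_def by blast
  define e where "e i = c i - c' i" for i
  have edvd: "int p dvd (\<Sum>i\<le>r. e i * n i y)" if "y \<in> Y" for y
  proof -
    have "(\<Sum>i\<le>r. c i * n i y) mod int p = (\<Sum>i\<le>r. c' i * n i y) mod int p"
      using fun_cong[OF c(3), of y] that unfolding \<Phi>_def by simp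
    then show ?thesis unfolding e_def by (simp add: left_diff_distrib sum_subtractf mod_eq_dvd_iff)
  qed
  have "\<exists>i\<le>r. e i \<noteq> 0"
  proof (rule ccontr)
    assume "\<not> (\<exists>i\<le>r. e i \<noteq> 0)"
    then have "c i = c' i" for i using c(1,2) unfolding e_def by (cases "i \<le> r") (auto simp: PiE_def extensional_def)
    then show False using c(4) by blast
  qed
  then obtain i0 where "i0 \<le> r \<and> e i0 \<noteq> 0" by blast
  \<comment> \<open>At order \<open>k i\<close> the terms before \<open>i\<close> have coefficient
    0, and those after \<open>i\<close> still vanish because their orders are larger. The relation
    thus isolates \<open>e i\<close> times a unit, so \<open>p\<close> divides \<open>e i\<close>,
    although \<open>0 < \<bar>e i\<bar> < p\<close>.\<close>
  define i where "i = (LEAST i. i \<le> r \<and> e i \<noteq> 0)"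
  have i: "i \<le> r" "e i \<noteq> 0" using LeastI[of "\<lambda>i. i \<le> r \<and> e i \<noteq> 0", OF \<open>i0 \<le> r \<and> e i0 \<noteq> 0\<close>] unfolding i_def by auto
  have imin: "e j = 0" if "j < i" for j
    using not_less_Least[of j "\<lambda>i. i \<le> r \<and> e i \<noteq> 0"] that i(1) unfolding i_def[symmetric] by auto
  let ?u = "u0 i" and ?v = "v0 i" and ?l = "k i"
  have uv: "?u < N" "?v < N" and A: "fps_nth (dev (g i) ?u ?v) ?l \<noteq> 0" using lead'[OF i(1)] unfolding dd by auto
  have lK: "?l < K" using kK i(1) .
  have int_int: "p_integral p (of_int m)" for m using pp(1) by simp
  have "zero_mod (\<Sum>j\<le>r. of_int (e j) * (\<theta> (h j) ?u ?v ?l - (\<Sum>y\<in>Y. of_int (n j y) * \<theta> y ?u ?v ?l)))"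
    using n uv lK by (intro zero_mod_sum zero_mod_mult int_int) auto
  moreover have "zero_mod (\<Sum>y\<in>Y. of_int (\<Sum>j\<le>r. e j * n j y) * \<theta> y ?u ?v ?l)"
  proof (rule zero_mod_sum)
    fix y assume y: "y \<in> Y"
    have "zero_mod (of_int (\<Sum>j\<le>r. e j * n j y))"
    proof -
      obtain m where "(\<Sum>j\<le>r. e j * n j y) = int p * m" using edvd[OF y] by blast
      then show ?thesis using zero_mod_p[OF int_int, of m] by simp
    qed
    moreover have "p_integral p (\<theta> y ?u ?v ?l)" using Yint[OF y] uv lK unfolding integral_def by blast
    ultimately show "zero_mod (of_int (\<Sum>j\<le>r. e j * n j y) * \<theta> y ?u ?v ?l)"
      using zero_mod_mult by (metis mult.commute)
  qed
  moreover have "(\<Sum>j\<le>r. of_int (e j) * (\<theta> (h j) ?u ?v ?l - (\<Sum>y\<in>Y. of_int (n j y) * \<theta> y ?u ?v ?l)))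
      + (\<Sum>y\<in>Y. of_int (\<Sum>j\<le>r. e j * n j y) * \<theta> y ?u ?v ?l) = (\<Sum>j\<le>r. of_int (e j) * \<theta> (h j) ?u ?v ?l)"
  proof -
    have "(\<Sum>y\<in>Y. of_int (\<Sum>j\<le>r. e j * n j y) * \<theta> y ?u ?v ?l) = (\<Sum>y\<in>Y. \<Sum>j\<le>r. of_int (e j) * (of_int (n j y) * \<theta> y ?u ?v ?l))"
      by (simp add: sum_distrib_right mult.assoc)
    also have "\<dots> = (\<Sum>j\<le>r. of_int (e j) * (\<Sum>y\<in>Y. of_int (n j y) * \<theta> y ?u ?v ?l))"
      unfolding sum_distrib_left by (rule sum.swap)
    finally show ?thesis by (simp add: right_diff_distrib sum_subtractf)
  qed
  ultimately have zm: "zero_mod (\<Sum>j\<le>r. of_int (e j) * \<theta> (h j) ?u ?v ?l)" by (metis (no_types, lifting) zero_mod_add)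
  have "(\<Sum>j\<le>r. of_int (e j) * \<theta> (h j) ?u ?v ?l) = (\<Sum>j\<le>r. if j = i then of_int (e i) * fps_nth (dev (g i) ?u ?v) ?l else 0)"
  proof (rule sum.cong)
    fix j assume j: "j \<in> {..r}"
    consider "j < i" | "j = i" | "i < j" by linarith
    then show "of_int (e j) * \<theta> (h j) ?u ?v ?l = (if j = i then of_int (e i) * fps_nth (dev (g i) ?u ?v) ?l else 0)"
    proof cases
      case 3
      then have "k i < k j" using k(2) j by simp
      then have "\<theta> (h j) ?u ?v ?l = 0" using h\<theta>[of j ?u ?v ?l] low1[of j ?u ?v ?l] j uv by simp
      then show ?thesis using 3 by simp
    qed (use imin h\<theta>[of i ?u ?v ?l] i uv in auto)
  qed simp
  then have "zero_mod (of_int (e i) * fps_nth (dev (g i) ?u ?v) ?l)" using zm i by simp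
  then have "zero_mod (inverse (fps_nth (dev (g i) ?u ?v) ?l) * (of_int (e i) * fps_nth (dev (g i) ?u ?v) ?l))"
    using int2[OF i(1)] zero_mod_mult by blast
  moreover have "inverse a * (of_int (e i) * a) = of_int (e i)" if "a \<noteq> 0" for a :: rat
    using that by (simp add: field_simps)
  ultimately have "zero_mod (of_int (e i))" using A by simp
  then have "int p dvd e i" unfolding zero_mod_def by (rule p_integral_quotient[OF pp(1)])
  moreover have "\<bar>e i\<bar> < int p" using c(1,2) i(1) unfolding e_def by (fastforce simp: PiE_def Pi_def)
  ultimately show False using i(2) by (metis dvd_imp_le_int abs_of_nat leD)
qed

subsection \<open>Generated subrings and their homomorphisms\<close>

text \<open>The generated subring as a set; for the empty set of generators it is the prime
  ring.\<close>

inductive_set gring :: "'f::comm_ring_1 set \<Rightarrow> 'f set" for A where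
  one: "1 \<in> gring A"
| base: "a \<in> A \<Longrightarrow> a \<in> gring A"
| add: "x \<in> gring A \<Longrightarrow> y \<in> gring A \<Longrightarrow> x + y \<in> gring A"
| mult: "x \<in> gring A \<Longrightarrow> y \<in> gring A \<Longrightarrow> x * y \<in> gring A"
| uminus: "x \<in> gring A \<Longrightarrow> - x \<in> gring A"

lemma gring_zero: "0 \<in> gring A"
  using gring.add[OF gring.one gring.uminus[OF gring.one]] by simp

lemma gring_sum: "(\<And>i. i \<in> I \<Longrightarrow> f i \<in> gring A) \<Longrightarrow> sum f I \<in> gring A"
  by (induction I rule: infinite_finite_induct) (auto intro: gring_zero gring.add)

lemma gring_prod: "(\<And>i. i \<in> I \<Longrightarrow> f i \<in> gring A) \<Longrightarrow> prod f I \<in> gring A"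
  by (induction I rule: infinite_finite_induct) (auto intro: gring.one gring.mult)

lemma gring_power: "x \<in> gring A \<Longrightarrow> x ^ n \<in> gring A"
  by (induction n) (auto intro: gring.intros)

lemma gring_mono: "A \<subseteq> B \<Longrightarrow> gring A \<subseteq> gring B"
proof
  fix x assume "A \<subseteq> B" "x \<in> gring A"
  from this(2,1) show "x \<in> gring B" by induction (auto intro: gring.intros)
qed

lemma gring_of_int: "of_int z \<in> gring A"
proof -
  have "of_nat n \<in> gring A" for n by (induction n) (auto intro: gring_zero gring.intros)
  then show ?thesis by (cases z) (auto intro: gring.uminus simp del: of_nat_Suc)
qed

definition coeffs_in :: "'f::zero set \<Rightarrow> 'f poly \<Rightarrow> bool" where
  "coeffs_in B p \<longleftrightarrow> (\<forall>i. poly.coeff p i \<in> B)"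

lemma coeffs_in_gring_mult:
  "coeffs_in (gring A) p \<Longrightarrow> coeffs_in (gring A) q \<Longrightarrow> coeffs_in (gring A) (p * q)"
  unfolding coeffs_in_def by (auto simp: coeff_mult intro!: gring_sum gring.mult)

lemma gring_insert:
  assumes "y \<in> gring (insert a A)"
  shows "\<exists>p. coeffs_in (gring A) p \<and> y = poly p a"
  using assms
proof induction
  case one
  show ?case by (rule exI[of _ 1]) (auto simp: coeffs_in_def coeff_1 intro: gring_zero gring.one)
next
  case (base b)
  show ?case
  proof (cases "b = a")
    case True
    have "coeffs_in (gring A) [:0, 1:]"
      unfolding coeffs_in_def by (auto simp: coeff_pCons intro: gring_zero gring.one split: nat.splits)
    then show ?thesis using True by (intro exI[of _ "[:0, 1:]"]) auto
  next
    case False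
    then have "coeffs_in (gring A) [:b:]"
      using base unfolding coeffs_in_def by (auto simp: coeff_pCons intro: gring_zero gring.base split: nat.splits)
    then show ?thesis by (intro exI[of _ "[:b:]"]) auto
  qed
next
  case (add x y)
  then obtain p q where "coeffs_in (gring A) p \<and> x = poly p a" "coeffs_in (gring A) q \<and> y = poly q a" by blast
  then show ?case by (intro exI[of _ "p + q"]) (auto simp: coeffs_in_def intro: gring.add)
next
  case (mult x y)
  then obtain p q where "coeffs_in (gring A) p \<and> x = poly p a" "coeffs_in (gring A) q \<and> y = poly q a" by blast
  then show ?case by (intro exI[of _ "p * q"]) (auto intro: coeffs_in_gring_mult)
next
  case (uminus x)
  then obtain p where "coeffs_in (gring A) p \<and> x = poly p a" by blast
  then show ?case by (intro exI[of _ "- p"]) (auto simp: coeffs_in_def intro: gring.uminus)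
qed

section \<open>Algebraic independence and specialization of variables\<close>

definition transcendental :: "'f::field set \<Rightarrow> 'f \<Rightarrow> bool" where
  "transcendental B a \<longleftrightarrow> (\<forall>p. coeffs_in B p \<longrightarrow> poly p a = 0 \<longrightarrow> p = 0)"

text \<open>Algebraic independence over the prime ring, with elements adjoined from the end of the
  list. Coefficients in a ring rather than a field suffice, as denominators can be cleared.\<close>

fun indep :: "'f::field list \<Rightarrow> bool" where
  "indep [] = True"
| "indep (a # as) = (indep as \<and> transcendental (gring (set as)) a)"

text \<open>A transcendence basis selected from \<open>E\<close>: an element joins the list exactly
  when it is transcendental over those already chosen.\<close>

lemma indep_exists:
  assumes "finite E"
  shows "\<exists>as. set as \<subseteq> E \<and> indep as \<and>
    (\<forall>e\<in>E. \<exists>p. p \<noteq> 0 \<and> coeffs_in (gring (set as)) p \<and> poly p e = 0)"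
  using assms
proof (induction E rule: finite_induct)
  case empty
  show ?case by (intro exI[of _ "[]"]) auto
next
  case (insert e E)
  then obtain as where as: "set as \<subseteq> E" "indep as"
    "\<forall>e\<in>E. \<exists>p. p \<noteq> 0 \<and> coeffs_in (gring (set as)) p \<and> poly p e = 0" by blast
  show ?case
  proof (cases "transcendental (gring (set as)) e")
    case True
    have "coeffs_in (gring (set (e # as))) [:- e, 1:]"
      unfolding coeffs_in_def
      by (auto simp: coeff_pCons intro: gring_zero gring.one gring.uminus gring.base split: nat.splits)
    then have e: "\<exists>p. p \<noteq> 0 \<and> coeffs_in (gring (set (e # as))) p \<and> poly p e = 0"
      by (intro exI[of _ "[:- e, 1:]"]) auto
    have "coeffs_in (gring (set (e # as))) p" if "coeffs_in (gring (set as)) p" for p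
      using that gring_mono[of "set as" "set (e # as)"] unfolding coeffs_in_def by auto
    then have "\<exists>p. p \<noteq> 0 \<and> coeffs_in (gring (set (e # as))) p \<and> poly p x = 0" if "x \<in> E" for x
      using as(3) that by blast
    then show ?thesis using True as e by (intro exI[of _ "e # as"]) auto
  next
    case False
    then show ?thesis using as unfolding transcendental_def by (intro exI[of _ as]) auto
  qed
qed

text \<open>The rings involved are subsets of one field, so a homomorphism is a total function of
  which only the values on \<open>B\<close> matter.\<close>

definition ring_hom_on :: "'f::comm_ring_1 set \<Rightarrow> ('f \<Rightarrow> 's::comm_ring_1) \<Rightarrow> bool" where
  "ring_hom_on B \<phi> \<longleftrightarrow> \<phi> 1 = 1 \<and> (\<forall>x\<in>B. \<forall>y\<in>B. \<phi> (x + y) = \<phi> x + \<phi> y \<and> \<phi> (x * y) = \<phi> x * \<phi> y)"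

context
  fixes A :: "'f::comm_ring_1 set" and \<phi> :: "'f \<Rightarrow> 's::comm_ring_1"
  assumes \<phi>: "ring_hom_on (gring A) \<phi>"
begin

lemma ring_hom_on_zero: "\<phi> 0 = 0"
proof -
  have "\<phi> (0 + 0) = \<phi> 0 + \<phi> 0" using \<phi> gring_zero unfolding ring_hom_on_def by blast
  then show ?thesis by simp
qed

lemma ring_hom_on_uminus: assumes "x \<in> gring A" shows "\<phi> (- x) = - \<phi> x"
proof -
  have "\<phi> (x + - x) = \<phi> x + \<phi> (- x)" using \<phi> assms gring.uminus unfolding ring_hom_on_def by blast
  then show ?thesis using ring_hom_on_zero by (simp add: add_eq_0_iff)
qed

lemma ring_hom_on_sum: "(\<And>i. i \<in> I \<Longrightarrow> f i \<in> gring A) \<Longrightarrow> \<phi> (sum f I) = (\<Sum>i\<in>I. \<phi> (f i))"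
proof (induction I rule: infinite_finite_induct)
  case (insert i I)
  have "\<phi> (f i + sum f I) = \<phi> (f i) + \<phi> (sum f I)"
    using \<phi> insert.prems gring_sum[of I f A] unfolding ring_hom_on_def by simp
  then show ?case using insert by simp
qed (auto simp: ring_hom_on_zero)

lemma ring_hom_on_power: "x \<in> gring A \<Longrightarrow> \<phi> (x ^ n) = \<phi> x ^ n"
  by (induction n) (use \<phi> gring_power[of x A] in \<open>auto simp: ring_hom_on_def\<close>)

end

lemma ring_hom_on_unique:
  assumes "ring_hom_on (gring A) \<phi>" "ring_hom_on (gring A) \<psi>" "\<And>a. a \<in> A \<Longrightarrow> \<phi> a = \<psi> a" "y \<in> gring A"
  shows "\<phi> y = \<psi> y"
  using assms(4)
proof induction
  case (uminus x)
  then show ?case using ring_hom_on_uminus assms(1,2) by metis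
qed (use assms in \<open>auto simp: ring_hom_on_def\<close>)

text \<open>Transcendence makes the polynomial with \<open>y = poly p a\<close> unique, so
  \<open>a\<close> may be sent to an arbitrary \<open>b\<close>.\<close>

lemma ring_hom_on_extend:
  fixes \<phi> :: "'f::field \<Rightarrow> 's::comm_ring_1"
  assumes \<phi>: "ring_hom_on (gring A) \<phi>" and a: "transcendental (gring A) a"
  obtains \<psi> where "ring_hom_on (gring (insert a A)) \<psi>" "\<And>y. y \<in> gring A \<Longrightarrow> \<psi> y = \<phi> y" "\<psi> a = b"
    "\<And>p. coeffs_in (gring A) p \<Longrightarrow> \<psi> (poly p a) = poly (map_poly \<phi> p) b"
proof -
  note \<phi>0 = ring_hom_on_zero[OF \<phi>]
  define P where "P y = (SOME p. coeffs_in (gring A) p \<and> y = poly p a)" for y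
  have P: "P (poly p a) = p" if p: "coeffs_in (gring A) p" for p
  proof -
    have "coeffs_in (gring A) (P (poly p a)) \<and> poly p a = poly (P (poly p a)) a"
      unfolding P_def by (rule someI[of _ p]) (use p in auto)
    then have "coeffs_in (gring A) (P (poly p a) - p)" "poly (P (poly p a) - p) a = 0"
      using p unfolding coeffs_in_def
      by (auto simp: diff_conv_add_uminus simp del: add_uminus_conv_diff intro!: gring.add gring.uminus)
    then show ?thesis using a unfolding transcendental_def by fastforce
  qed
  define \<psi> where "\<psi> y = poly (map_poly \<phi> (P y)) b" for y
  have \<psi>p: "\<psi> (poly p a) = poly (map_poly \<phi> p) b" if "coeffs_in (gring A) p" for p
    unfolding \<psi>_def P[OF that] ..
  have hom: "ring_hom_on (gring (insert a A)) \<psi>"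
    unfolding ring_hom_on_def
  proof (intro conjI ballI)
    have c1: "coeffs_in (gring A) 1" unfolding coeffs_in_def by (auto simp: coeff_1 intro: gring_zero gring.one)
    have "map_poly \<phi> 1 = 1"
      by (rule poly_eqI) (use \<phi> \<phi>0 in \<open>auto simp: coeff_map_poly coeff_1 ring_hom_on_def\<close>)
    then show "\<psi> 1 = 1" using \<psi>p[OF c1] by simp
    fix x y assume xy: "x \<in> gring (insert a A)" "y \<in> gring (insert a A)"
    obtain p where p: "coeffs_in (gring A) p" "x = poly p a" using gring_insert[OF xy(1)] by blast
    obtain q where q: "coeffs_in (gring A) q" "y = poly q a" using gring_insert[OF xy(2)] by blast
    have "map_poly \<phi> (p + q) = map_poly \<phi> p + map_poly \<phi> q"
      by (rule poly_eqI) (use \<phi> \<phi>0 p q in \<open>auto simp: coeff_map_poly ring_hom_on_def coeffs_in_def\<close>)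
    moreover have "coeffs_in (gring A) (p + q)" using p q unfolding coeffs_in_def by (auto intro: gring.add)
    ultimately show "\<psi> (x + y) = \<psi> x + \<psi> y" using \<psi>p p q by (metis poly_add)
    have "map_poly \<phi> (p * q) = map_poly \<phi> p * map_poly \<phi> q"
    proof (rule poly_eqI)
      fix n
      have "\<phi> (\<Sum>i\<le>n. poly.coeff p i * poly.coeff q (n - i)) = (\<Sum>i\<le>n. \<phi> (poly.coeff p i * poly.coeff q (n - i)))"
        by (rule ring_hom_on_sum[OF \<phi>]) (use p q in \<open>auto simp: coeffs_in_def intro: gring.mult\<close>)
      then show "poly.coeff (map_poly \<phi> (p * q)) n = poly.coeff (map_poly \<phi> p * map_poly \<phi> q) n"
        using \<phi> \<phi>0 p q by (simp add: coeff_map_poly coeff_mult ring_hom_on_def coeffs_in_def)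
    qed
    then show "\<psi> (x * y) = \<psi> x * \<psi> y" using \<psi>p p q coeffs_in_gring_mult by (metis poly_mult)
  qed
  have cc: "coeffs_in (gring A) [:y:]" if "y \<in> gring A" for y
    using that unfolding coeffs_in_def by (auto simp: coeff_pCons intro: gring_zero split: nat.splits)
  have cX: "coeffs_in (gring A) [:0, 1:]"
    unfolding coeffs_in_def by (auto simp: coeff_pCons intro: gring_zero gring.one split: nat.splits)
  have \<phi>1: "\<phi> 1 = 1" using \<phi> unfolding ring_hom_on_def by blast
  show ?thesis
  proof (rule that[OF hom _ _ \<psi>p])
    show "\<psi> y = \<phi> y" if "y \<in> gring A" for y using \<psi>p[OF cc[OF that]] \<phi>0 by (simp add: map_poly_pCons)
    show "\<psi> a = b" using \<psi>p[OF cX] \<phi>0 \<phi>1 by (simp add: map_poly_pCons)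
  qed
qed

lemma ring_hom_on_int:
  assumes "\<And>z::int. of_int z = (0::'f::field) \<Longrightarrow> of_int z = (0::'s::comm_ring_1)"
  shows "ring_hom_on (gring ({}::'f set)) (\<lambda>y. of_int (SOME z. y = of_int z) :: 's)"
proof -
  have ex: "\<exists>z::int. y = of_int z" if "y \<in> gring ({}::'f set)" for y
    using that
  proof induction
    case one show ?case by (rule exI[of _ 1]) simp
  next
    case (add x y) then show ?case by (metis of_int_add)
  next
    case (mult x y) then show ?case by (metis of_int_mult)
  next
    case (uminus x) then show ?case by (metis of_int_minus)
  qed auto
  have wd: "(of_int (SOME w. (of_int z :: 'f) = of_int w) :: 's) = of_int z" for z :: int
  proof -
    have "(of_int z :: 'f) = of_int (SOME w. (of_int z :: 'f) = of_int w)" by (rule someI[of _ z]) simp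
    then have "(of_int ((SOME w. (of_int z :: 'f) = of_int w) - z) :: 'f) = 0" by simp
    then have "(of_int ((SOME w. (of_int z :: 'f) = of_int w) - z) :: 's) = 0" by (rule assms)
    then show ?thesis by simp
  qed
  show ?thesis unfolding ring_hom_on_def
  proof (intro conjI ballI)
    show "(of_int (SOME z. (1::'f) = of_int z) :: 's) = 1" using wd[of 1] by simp
    fix x y :: 'f assume "x \<in> gring {}" "y \<in> gring {}"
    then obtain z w :: int where zw: "x = of_int z" "y = of_int w" using ex by blast
    show "(of_int (SOME z. x + y = of_int z) :: 's) = of_int (SOME z. x = of_int z) + of_int (SOME z. y = of_int z)"
      using wd[of z] wd[of w] wd[of "z + w"] unfolding zw by simp
    show "(of_int (SOME z. x * y = of_int z) :: 's) = of_int (SOME z. x = of_int z) * of_int (SOME z. y = of_int z)"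
      using wd[of z] wd[of w] wd[of "z * w"] unfolding zw by simp
  qed
qed

lemma ring_hom_on_indep:
  fixes c :: "'f::field \<Rightarrow> 's::comm_ring_1"
  assumes "\<And>z::int. of_int z = (0::'f) \<Longrightarrow> of_int z = (0::'s)" and "indep as"
  shows "\<exists>\<phi>. ring_hom_on (gring (set as)) \<phi> \<and> (\<forall>a\<in>set as. \<phi> a = c a)"
  using assms(2)
proof (induction as)
  case Nil
  then show ?case using ring_hom_on_int[OF assms(1)] by auto
next
  case (Cons a as)
  then obtain \<phi> where \<phi>: "ring_hom_on (gring (set as)) \<phi>" "\<forall>a\<in>set as. \<phi> a = c a" by auto
  obtain \<psi> where "ring_hom_on (gring (insert a (set as))) \<psi>" "\<And>y. y \<in> gring (set as) \<Longrightarrow> \<psi> y = \<phi> y" "\<psi> a = c a"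
    using ring_hom_on_extend[OF \<phi>(1), of a "c a"] Cons.prems by (metis indep.simps(2))
  then show ?case using \<phi>(2) gring.base[of _ "set as"] by (intro exI[of _ \<psi>]) auto
qed

text \<open>A nonzero polynomial does not vanish at all points with coordinates in an infinite set.
  With \<open>f = poly p a\<close>, induction keeps the leading coefficient of \<open>p\<close>
  nonzero, and \<open>a\<close> is then sent to an element of \<open>C\<close> outside the finitely
  many roots of the specialized polynomial.\<close>

lemma ring_hom_on_indep_nonzero:
  fixes C :: "'s::idom set"
  assumes ch: "\<And>z::int. of_int z = (0::'f::field) \<longleftrightarrow> of_int z = (0::'s)" and "indep as" and C: "infinite C"
    and "f \<in> gring (set as)" "f \<noteq> (0::'f)"
  shows "\<exists>\<phi>. ring_hom_on (gring (set as)) \<phi> \<and> (\<forall>a\<in>set as. \<phi> a \<in> C) \<and> \<phi> f \<noteq> 0"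
  using assms(2,4,5)
proof (induction as arbitrary: f)
  case Nil
  have h: "ring_hom_on (gring ({}::'f set)) (\<lambda>y. of_int (SOME z. y = of_int z) :: 's)"
    by (rule ring_hom_on_int) (use ch in simp)
  have f: "f \<in> gring {}" using Nil by simp
  have "\<exists>z::int. f = of_int z" using f
  proof induction
    case one show ?case by (rule exI[of _ 1]) simp
  next
    case (add x y) then show ?case by (metis of_int_add)
  next
    case (mult x y) then show ?case by (metis of_int_mult)
  next
    case (uminus x) then show ?case by (metis of_int_minus)
  qed auto
  then have "f = of_int (SOME z. f = of_int z)" by (rule someI_ex)
  then have "(of_int (SOME z. f = of_int z) :: 's) \<noteq> 0" using Nil.prems(3) ch by metis
  then show ?case using h by auto
next
  case (Cons a as)
  have a: "transcendental (gring (set as)) a" "indep as" using Cons.prems by auto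
  obtain p where p: "coeffs_in (gring (set as)) p" "f = poly p a"
    using gring_insert[of f a "set as"] Cons.prems(2) by auto
  have "p \<noteq> 0" using p Cons.prems(3) by auto
  then have l: "lead_coeff p \<noteq> 0" by simp
  have "lead_coeff p \<in> gring (set as)" using p unfolding coeffs_in_def by blast
  then obtain \<phi> where \<phi>: "ring_hom_on (gring (set as)) \<phi>" "\<forall>a\<in>set as. \<phi> a \<in> C" "\<phi> (lead_coeff p) \<noteq> 0"
    using Cons.IH[OF a(2) _ l] by blast
  have "poly.coeff (map_poly \<phi> p) (Polynomial.degree p) \<noteq> 0"
    using \<phi>(3) ring_hom_on_zero[OF \<phi>(1)] by (simp add: coeff_map_poly)
  then have "map_poly \<phi> p \<noteq> 0" by auto
  then have "finite {x. poly (map_poly \<phi> p) x = 0}" by (rule poly_roots_finite)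
  then have "\<not> C \<subseteq> {x. poly (map_poly \<phi> p) x = 0}" using C finite_subset by blast
  then obtain b where b: "b \<in> C" "poly (map_poly \<phi> p) b \<noteq> 0" by blast
  obtain \<psi> where \<psi>: "ring_hom_on (gring (insert a (set as))) \<psi>" "\<And>y. y \<in> gring (set as) \<Longrightarrow> \<psi> y = \<phi> y" "\<psi> a = b"
    "\<And>p. coeffs_in (gring (set as)) p \<Longrightarrow> \<psi> (poly p a) = poly (map_poly \<phi> p) b"
    using ring_hom_on_extend[OF \<phi>(1) a(1), of b] by blast
  then show ?case using \<phi>(2) b p gring.base[of _ "set as"] by (intro exI[of _ \<psi>]) auto
qed

section \<open>Localizations and fields of fractions\<close>

definition localization :: "'f::field set \<Rightarrow> 'f \<Rightarrow> 'f set" where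
  "localization B f = {y. \<exists>k. y * f ^ k \<in> B}"

lemma ring_hom_on_localization:
  fixes \<phi> :: "'f::field \<Rightarrow> 's::comm_ring_1"
  assumes \<phi>: "ring_hom_on (gring A) \<phi>" and f: "f \<in> gring A" "f \<noteq> 0" and u: "\<phi> f * u = 1"
  obtains \<psi> where "ring_hom_on (localization (gring A) f) \<psi>" "\<And>y. y \<in> gring A \<Longrightarrow> \<psi> y = \<phi> y"
    "\<And>y k. y * f ^ k \<in> gring A \<Longrightarrow> \<psi> y * \<phi> f ^ k = \<phi> (y * f ^ k)"
    "\<And>y k. y * f ^ k \<in> gring A \<Longrightarrow> \<psi> y = \<phi> (y * f ^ k) * u ^ k"
proof -
  define \<psi> where "\<psi> y = \<phi> (y * f ^ (SOME k. y * f ^ k \<in> gring A)) * u ^ (SOME k. y * f ^ k \<in> gring A)" for y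
  have uk: "\<phi> f ^ k * u ^ k = 1" for k using u by (simp add: power_mult_distrib[symmetric])
  have mul: "\<phi> (x * y) = \<phi> x * \<phi> y" if "x \<in> gring A" "y \<in> gring A" for x y
    using \<phi> that unfolding ring_hom_on_def by blast
  have wd: "\<phi> (y * f ^ k) * u ^ k = \<phi> (y * f ^ l) * u ^ l" if "y * f ^ k \<in> gring A" "y * f ^ l \<in> gring A" for y k l
  proof -
    have "\<phi> (y * f ^ k) * u ^ k = \<phi> (y * f ^ k) * \<phi> f ^ l * u ^ l * u ^ k" using uk[of l] by (simp add: mult.assoc)
    also have "\<dots> = \<phi> (y * f ^ k * f ^ l) * u ^ l * u ^ k"
      using mul[OF that(1) gring_power[OF f(1)], of l] ring_hom_on_power[OF \<phi> f(1)] by simp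
    also have "y * f ^ k * f ^ l = y * f ^ l * f ^ k" by (simp add: ac_simps)
    also have "\<phi> (y * f ^ l * f ^ k) * u ^ l * u ^ k = \<phi> (y * f ^ l) * \<phi> f ^ k * u ^ l * u ^ k"
      using mul[OF that(2) gring_power[OF f(1)], of k] ring_hom_on_power[OF \<phi> f(1)] by simp
    also have "\<dots> = \<phi> (y * f ^ l) * u ^ l * (\<phi> f ^ k * u ^ k)" by (simp add: ac_simps)
    finally show ?thesis using uk by simp
  qed
  have \<psi>: "\<psi> y = \<phi> (y * f ^ k) * u ^ k" if "y * f ^ k \<in> gring A" for y k
    unfolding \<psi>_def by (rule wd[OF someI[of "\<lambda>k. y * f ^ k \<in> gring A", OF that] that])
  have \<psi>B: "\<psi> y = \<phi> y" if "y \<in> gring A" for y using \<psi>[of y 0] that by simp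
  have \<psi>f: "\<psi> y * \<phi> f ^ k = \<phi> (y * f ^ k)" if "y * f ^ k \<in> gring A" for y k
    unfolding \<psi>[OF that] using uk[of k] by (metis mult.assoc mult.commute mult.right_neutral)
  have "ring_hom_on (localization (gring A) f) \<psi>"
    unfolding ring_hom_on_def
  proof (intro conjI ballI)
    show "\<psi> 1 = 1" using \<psi>B[OF gring.one] \<phi> unfolding ring_hom_on_def by simp
    fix x y assume "x \<in> localization (gring A) f" "y \<in> localization (gring A) f"
    then obtain k l where k: "x * f ^ k \<in> gring A" "y * f ^ l \<in> gring A" unfolding localization_def by blast
    have kl: "x * f ^ (k + l) \<in> gring A" "y * f ^ (k + l) \<in> gring A"
      using gring.mult[OF k(1) gring_power[OF f(1), of l]] gring.mult[OF k(2) gring_power[OF f(1), of k]]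
      by (simp_all add: power_add ac_simps)
    have e: "(x + y) * f ^ (k + l) = x * f ^ (k + l) + y * f ^ (k + l)" by (simp add: algebra_simps)
    then have in1: "(x + y) * f ^ (k + l) \<in> gring A" using gring.add[OF kl] by simp
    have "\<phi> ((x + y) * f ^ (k + l)) = \<phi> (x * f ^ (k + l)) + \<phi> (y * f ^ (k + l))"
      unfolding e using \<phi> kl unfolding ring_hom_on_def by blast
    then show "\<psi> (x + y) = \<psi> x + \<psi> y" unfolding \<psi>[OF in1] \<psi>[OF kl(1)] \<psi>[OF kl(2)] by (simp add: algebra_simps)
    have e: "x * y * f ^ (k + l) = (x * f ^ k) * (y * f ^ l)" by (simp add: power_add ac_simps)
    then have in2: "x * y * f ^ (k + l) \<in> gring A" using gring.mult[OF k] by (simp only:)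
    have "\<phi> (x * y * f ^ (k + l)) = \<phi> (x * f ^ k) * \<phi> (y * f ^ l)" unfolding e by (rule mul[OF k])
    then show "\<psi> (x * y) = \<psi> x * \<psi> y" unfolding \<psi>[OF in2] \<psi>[OF k(1)] \<psi>[OF k(2)] by (simp add: power_add ac_simps)
  qed
  then show ?thesis using that \<psi>B \<psi>f \<psi> by blast
qed

lemma gring_subset_localization: "gring A \<subseteq> localization (gring A) f"
  unfolding localization_def by (auto intro: exI[of _ 0])

definition fractions :: "'f::field set \<Rightarrow> 'f set" where
  "fractions B = {x / y |x y. x \<in> B \<and> y \<in> B}"

lemma is_subfield_fractions: "is_subfield (fractions (gring A))"
proof -
  have I: "x / y \<in> fractions (gring A)" if "x \<in> gring A" "y \<in> gring A" for x y
    using that unfolding fractions_def by blast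
  show ?thesis
    unfolding is_subfield_def
  proof (intro conjI ballI)
    show "0 \<in> fractions (gring A)" "1 \<in> fractions (gring A)"
      using I[OF gring_zero gring.one] I[OF gring.one gring.one] by auto
    fix x assume "x \<in> fractions (gring A)"
    then obtain a b where ab: "a \<in> gring A" "b \<in> gring A" "x = a / b" unfolding fractions_def by blast
    show "- x \<in> fractions (gring A)" "inverse x \<in> fractions (gring A)"
      using I[OF gring.uminus[OF ab(1)] ab(2)] I[OF ab(2,1)] ab(3) by auto
    fix y assume "y \<in> fractions (gring A)"
    then obtain c d where cd: "c \<in> gring A" "d \<in> gring A" "y = c / d" unfolding fractions_def by blast
    show "x * y \<in> fractions (gring A)"
      using I[OF gring.mult[OF ab(1) cd(1)] gring.mult[OF ab(2) cd(2)]] ab(3) cd(3) by simp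
    show "x + y \<in> fractions (gring A)"
    proof (cases "b = 0 \<or> d = 0")
      case True
      then show ?thesis using ab cd I by auto
    next
      case False
      then have "x + y = (a * d + c * b) / (b * d)" using ab cd by (simp add: add_frac_eq)
      moreover have "(a * d + c * b) / (b * d) \<in> fractions (gring A)"
        using ab cd by (intro I gring.add gring.mult)
      ultimately show ?thesis by simp
    qed
  qed
qed

lemma gring_subset_fractions: "gring A \<subseteq> fractions (gring A)"
  unfolding fractions_def using gring.one by force

subsection \<open>Descent to a localization\<close>

text \<open>The case of \<open>fspan\<close> for functions on one point, that is, spans inside the
  field itself.\<close>

definition kspan :: "'f::field set \<Rightarrow> 'f set \<Rightarrow> 'f set" where
  "kspan K W = {(\<Sum>w\<in>W. u w * w) |u. \<forall>w\<in>W. u w \<in> K}"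

lemma kspan_fspan: "y \<in> kspan K W \<longleftrightarrow> (\<lambda>_::unit. y) \<in> fspan K ((\<lambda>w _. w) ` W)"
proof -
  have inj: "inj_on (\<lambda>w (_::unit). w) W" by (rule inj_onI) (metis)
  have e: "(\<Sum>f\<in>(\<lambda>w (_::unit). w) ` W. u f * f s) = (\<Sum>w\<in>W. u (\<lambda>_. w) * w)" for u and s :: unit
    by (subst sum.reindex[OF inj]) simp
  show ?thesis
  proof
    assume "y \<in> kspan K W"
    then obtain u where u: "y = (\<Sum>w\<in>W. u w * w)" "\<forall>w\<in>W. u w \<in> K" unfolding kspan_def by blast
    show "(\<lambda>_::unit. y) \<in> fspan K ((\<lambda>w _. w) ` W)"
      unfolding fspan_def
      by (intro CollectI exI[of _ "\<lambda>f. u (f ())"]) (use u e[of "\<lambda>f. u (f ())"] in auto)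
  next
    assume "(\<lambda>_::unit. y) \<in> fspan K ((\<lambda>w _. w) ` W)"
    then obtain u where u: "(\<lambda>_::unit. y) = (\<lambda>s. \<Sum>f\<in>(\<lambda>w _. w) ` W. u f * f s)" "\<forall>f\<in>(\<lambda>w _. w) ` W. u f \<in> K"
      unfolding fspan_def by blast
    have "y = (\<Sum>w\<in>W. u (\<lambda>_. w) * w)" using fun_cong[OF u(1), of "()"] e by simp
    then show "y \<in> kspan K W" unfolding kspan_def using u(2) by (intro CollectI exI[of _ "\<lambda>w. u (\<lambda>_. w)"]) auto
  qed
qed

lemma kspan_add: "is_subfield K \<Longrightarrow> x \<in> kspan K W \<Longrightarrow> y \<in> kspan K W \<Longrightarrow> x + y \<in> kspan K W"
  unfolding kspan_fspan using fspan_add[of K "\<lambda>_. x" _ "\<lambda>_. y"] by simp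

lemma kspan_scale: "is_subfield K \<Longrightarrow> x \<in> kspan K W \<Longrightarrow> c \<in> K \<Longrightarrow> c * x \<in> kspan K W"
  unfolding kspan_fspan using fspan_scale[of K "\<lambda>_. x" _ c] by simp

lemma kspan_zero: "is_subfield K \<Longrightarrow> 0 \<in> kspan K W"
  unfolding kspan_fspan by (rule fspan_zero)

lemma kspan_base: "is_subfield K \<Longrightarrow> finite W \<Longrightarrow> w \<in> W \<Longrightarrow> w \<in> kspan K W"
  unfolding kspan_fspan by (rule fspan_base) auto

lemma kspan_sum:
  assumes "is_subfield K" "\<And>i. i \<in> I \<Longrightarrow> f i \<in> kspan K W" shows "sum f I \<in> kspan K W"
  using assms(2) by (induction I rule: infinite_finite_induct) (auto intro: kspan_zero kspan_add assms(1))

lemma kspan_induct [consumes 2, case_names scale add zero]: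
  assumes "finite W" "y \<in> kspan K W"
    and "\<And>c w. c \<in> K \<Longrightarrow> w \<in> W \<Longrightarrow> P (c * w)"
    and "\<And>x y. P x \<Longrightarrow> P y \<Longrightarrow> P (x + y)" and "P 0"
  shows "P y"
proof -
  obtain u where u: "y = (\<Sum>w\<in>W. u w * w)" "\<forall>w\<in>W. u w \<in> K" using assms(2) unfolding kspan_def by blast
  have "P (\<Sum>w\<in>Z. u w * w)" if "Z \<subseteq> W" for Z
    using finite_subset[OF that assms(1)] that u(2)
    by (induction Z rule: finite_induct) (auto intro: assms(3-5))
  from this[OF subset_refl] show ?thesis unfolding u(1) .
qed

text \<open>A direct sum of spaces indexed by \<open>S\<close>: placing each spanning element at a
  single point gives a finite spanning set, as required by \<open>mrep_of_module\<close>.\<close>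

lemma fspan_pointwise:
  assumes K: "is_subfield K" and S: "finite S" and W: "\<And>s. s \<in> S \<Longrightarrow> finite (W s)"
  shows "{v. (\<forall>s\<in>S. v s \<in> kspan K (W s)) \<and> (\<forall>s. s \<notin> S \<longrightarrow> v s = 0)} =
    fspan K ((\<lambda>(s, w) t. if t = s then w else 0) ` (SIGMA s:S. W s))" (is "?V = fspan K ?D")
proof
  have fD: "finite ?D" using S W by auto
  show "?V \<subseteq> fspan K ?D"
  proof
    fix v assume v: "v \<in> ?V"
    have d: "(\<lambda>t. if t = s then y else 0) \<in> fspan K ?D" if s: "s \<in> S" and y: "y \<in> kspan K (W s)" for s y
      using W[OF s] y
    proof (induction rule: kspan_induct)
      case (scale c w)
      have "(\<lambda>t. if t = s then w else 0) \<in> ?D" using s scale(2) by force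
      from fspan_scale[OF K fspan_base[OF K fD this] scale(1)]
      have "(\<lambda>t. c * (if t = s then w else 0)) \<in> fspan K ?D" .
      then show ?case by (simp add: if_distrib[of "\<lambda>x. c * x"] cong: if_cong)
    next
      case (add x y)
      have "(\<lambda>t. (if t = s then x else 0) + (if t = s then y else 0)) = (\<lambda>t. if t = s then x + y else 0)" by auto
      then show ?case using fspan_add[OF K add] by simp
    next
      case zero
      then show ?case using fspan_zero[OF K] by simp
    qed
    have "v = (\<lambda>t. \<Sum>s\<in>S. if t = s then v s else 0)"
    proof
      show "v t = (\<Sum>s\<in>S. if t = s then v s else 0)" for t using v S by (cases "t \<in> S") auto
    qed
    also have "\<dots> \<in> fspan K ?D" by (rule fspan_sum[OF K]) (use d v in auto)
    finally show "v \<in> fspan K ?D" .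
  qed
  show "fspan K ?D \<subseteq> ?V"
  proof
    fix v assume "v \<in> fspan K ?D"
    then obtain u where u: "v = (\<lambda>s. \<Sum>f\<in>?D. u f * f s)" "\<forall>f\<in>?D. u f \<in> K" unfolding fspan_def by blast
    have "f t \<in> kspan K (W t)" if "f \<in> ?D" "t \<in> S" for f t
      using that kspan_base[OF K W[OF that(2)]] kspan_zero[OF K] by auto
    moreover have "f t = 0" if "f \<in> ?D" "t \<notin> S" for f t using that by auto
    ultimately show "v \<in> ?V" unfolding u(1) using u(2)
      by (auto intro!: kspan_sum[OF K] kspan_scale[OF K] sum.neutral simp del: mult_eq_0_iff)
  qed
qed

text \<open>Algebraic elements are adjoined one at a time. If \<open>e\<close> satisfies an equation
  of degree \<open>d\<close>, the products \<open>w * e ^ i\<close> with \<open>i < d\<close> span a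
  ring, because the equation rewrites every higher power of \<open>e\<close>.\<close>

lemma finite_extension:
  fixes K :: "'f::field set"
  assumes K: "is_subfield K" and "finite E" and "\<forall>e\<in>E. \<exists>p. p \<noteq> 0 \<and> coeffs_in K p \<and> poly p e = 0"
  shows "\<exists>W. finite W \<and> 1 \<in> kspan K W \<and> E \<subseteq> kspan K W \<and> (\<forall>x\<in>kspan K W. \<forall>y\<in>kspan K W. x * y \<in> kspan K W)"
  using assms(2,3)
proof (induction E rule: finite_induct)
  case empty
  have "x \<in> kspan K {1} \<longleftrightarrow> x \<in> K" for x unfolding kspan_def by auto
  then show ?case using K by (intro exI[of _ "{1}"]) (auto simp: is_subfield_def)
next
  case (insert e E)
  obtain W where W: "finite W" and W1: "1 \<in> kspan K W" and WE: "E \<subseteq> kspan K W"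
    and Wm: "\<And>x y. x \<in> kspan K W \<Longrightarrow> y \<in> kspan K W \<Longrightarrow> x * y \<in> kspan K W"
    using insert by auto
  obtain p where p: "p \<noteq> 0" "coeffs_in K p" "poly p e = 0" using insert.prems by auto
  define d where "d = Polynomial.degree p"
  define c where "c i = - poly.coeff p i / lead_coeff p" for i
  have l: "lead_coeff p \<noteq> 0" using p by simp
  have cK: "c i \<in> K" for i using K p(2) unfolding c_def is_subfield_def coeffs_in_def by (auto simp: divide_inverse)
  have "(\<Sum>i<d. poly.coeff p i * e ^ i) + lead_coeff p * e ^ d = 0"
    using p(3) unfolding poly_altdef d_def by (simp add: lessThan_Suc_atMost[symmetric])
  then have "lead_coeff p * e ^ d = - (\<Sum>i<d. poly.coeff p i * e ^ i)" by (simp add: eq_neg_iff_add_eq_0 add.commute)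
  then have "e ^ d = - (\<Sum>i<d. poly.coeff p i * e ^ i) / lead_coeff p" using l by (simp add: field_simps)
  then have ed: "e ^ d = (\<Sum>i<d. c i * e ^ i)"
    unfolding c_def by (simp add: sum_divide_distrib sum_negf)
  have d0: "d > 0" using ed by (cases "d = 0") auto
  define W' where "W' = (\<lambda>(w, i). w * e ^ i) ` (W \<times> {..<d})"
  have fW': "finite W'" unfolding W'_def using W by simp
  have pw: "y * e ^ m \<in> kspan K W'" if "y \<in> kspan K W" for y m
    using that
  proof (induction m arbitrary: y rule: less_induct)
    case (less m)
    show ?case
    proof (cases "m < d")
      case True
      show ?thesis using W less.prems
      proof (induction rule: kspan_induct)
        case (scale a w)
        have "w * e ^ m \<in> W'" unfolding W'_def using scale(2) True by force
        then show ?case using kspan_scale[OF K kspan_base[OF K fW'] scale(1)] by (simp add: mult.assoc)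
      next
        case (add x y) then show ?case using kspan_add[OF K] by (simp add: distrib_right)
      next
        case zero then show ?case using kspan_zero[OF K] by simp
      qed
    next
      case False
      have "y * e ^ m = y * e ^ (m - d) * e ^ d" using False by (simp add: mult.assoc power_add[symmetric])
      also have "\<dots> = (\<Sum>i<d. (c i * y) * e ^ (m - d + i))"
        unfolding ed by (simp add: sum_distrib_left power_add ac_simps)
      also have "\<dots> \<in> kspan K W'"
      proof (rule kspan_sum[OF K])
        fix i assume "i \<in> {..<d}"
        then have "m - d + i < m" using False by auto
        then show "(c i * y) * e ^ (m - d + i) \<in> kspan K W'"
          using less.IH kspan_scale[OF K less.prems cK] by blast
      qed
      finally show ?thesis .
    qed
  qed
  have "x * y \<in> kspan K W'" if x: "x \<in> kspan K W'" and y: "y \<in> kspan K W'" for x y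
    using fW' x
  proof (induction rule: kspan_induct)
    case (scale a w)
    obtain w1 i where w: "w1 \<in> W" "w = w1 * e ^ i" using scale(2) unfolding W'_def by auto
    show ?case using fW' y
    proof (induction rule: kspan_induct)
      case (scale b v)
      obtain v1 j where v: "v1 \<in> W" "v = v1 * e ^ j" using scale(2) unfolding W'_def by auto
      have "w1 * v1 * e ^ (i + j) \<in> kspan K W'" by (rule pw[OF Wm]) (use kspan_base[OF K W] w v in auto)
      then have "(a * b) * (w1 * v1 * e ^ (i + j)) \<in> kspan K W'"
        by (rule kspan_scale[OF K]) (use K scale \<open>a \<in> K\<close> in \<open>auto simp: is_subfield_def\<close>)
      then show ?case unfolding w v by (simp add: power_add ac_simps)
    qed (auto simp: algebra_simps intro: kspan_add kspan_zero K)
  qed (auto simp: algebra_simps intro: kspan_add kspan_zero K)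
  moreover have "1 \<in> kspan K W'" "insert e E \<subseteq> kspan K W'"
    using pw[OF W1, of 0] pw[OF W1, of 1] pw[of _ 0] WE by auto
  ultimately show ?case using fW' by blast
qed

lemma localization_add:
  assumes f: "f \<in> gring A" and "x \<in> localization (gring A) f" "y \<in> localization (gring A) f"
  shows "x + y \<in> localization (gring A) f"
proof -
  obtain k l where k: "x * f ^ k \<in> gring A" "y * f ^ l \<in> gring A" using assms unfolding localization_def by blast
  have "(x + y) * f ^ (k + l) = (x * f ^ k) * f ^ l + (y * f ^ l) * f ^ k" by (simp add: algebra_simps power_add)
  also have "\<dots> \<in> gring A" by (rule gring.add[OF gring.mult[OF k(1) gring_power[OF f]] gring.mult[OF k(2) gring_power[OF f]]])
  finally show ?thesis unfolding localization_def by blast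
qed

lemma localization_mult:
  assumes "x \<in> localization (gring A) f" "y \<in> localization (gring A) f"
  shows "x * y \<in> localization (gring A) f"
proof -
  obtain k l where k: "x * f ^ k \<in> gring A" "y * f ^ l \<in> gring A" using assms unfolding localization_def by blast
  have "(x * y) * f ^ (k + l) = (x * f ^ k) * (y * f ^ l)" by (simp add: power_add ac_simps)
  also have "\<dots> \<in> gring A" by (rule gring.mult[OF k])
  finally show ?thesis unfolding localization_def by blast
qed

lemma common_denominator:
  assumes "finite Z" "Z \<subseteq> fractions (gring A)"
  shows "\<exists>f\<in>gring A. f \<noteq> 0 \<and> Z \<subseteq> localization (gring A) f"
  using assms
proof (induction Z rule: finite_induct)
  case empty
  show ?case by (intro bexI[of _ 1]) (auto intro: gring.one)
next
  case (insert x Z)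
  then obtain f where f: "f \<in> gring A" "f \<noteq> 0" "Z \<subseteq> localization (gring A) f" by auto
  obtain a b where ab: "a \<in> gring A" "b \<in> gring A" "x = a / b" using insert.prems unfolding fractions_def by auto
  show ?case
  proof (cases "b = 0")
    case True
    then have "x \<in> localization (gring A) f" using ab gring_zero gring_subset_localization by auto
    then show ?thesis using f by blast
  next
    case False
    have "x * (f * b) ^ 1 = a * f" using ab False by simp
    then have "x \<in> localization (gring A) (f * b)"
      unfolding localization_def using gring.mult[OF ab(1) f(1)] by (metis mem_Collect_eq)
    moreover have "y \<in> localization (gring A) (f * b)" if "y \<in> Z" for y
    proof -
      obtain k where k: "y * f ^ k \<in> gring A" using f(3) \<open>y \<in> Z\<close> unfolding localization_def by blast
      have "y * (f * b) ^ k = (y * f ^ k) * b ^ k" by (simp add: power_mult_distrib ac_simps)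
      also have "\<dots> \<in> gring A" using k gring_power[OF ab(2)] by (rule gring.mult)
      finally show ?thesis unfolding localization_def by blast
    qed
    ultimately show ?thesis using f False gring.mult[OF f(1) ab(2)] by (intro bexI[of _ "f * b"]) auto
  qed
qed

lemma (in group) mrep_entries_closed:
  assumes rep: "mrep G n \<sigma>" and S: "S \<subseteq> carrier G" "generate G S = carrier G"
    and L: "0 \<in> L" "1 \<in> L" "\<And>x y. x \<in> L \<Longrightarrow> y \<in> L \<Longrightarrow> x + y \<in> L" "\<And>x y. x \<in> L \<Longrightarrow> y \<in> L \<Longrightarrow> x * y \<in> L"
    and E: "\<And>s i j. s \<in> S \<Longrightarrow> i < n \<Longrightarrow> j < n \<Longrightarrow> \<sigma> s $$ (i, j) \<in> L \<and> \<sigma> (inv s) $$ (i, j) \<in> L"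
    and g: "g \<in> carrier G" and ij: "i < n" "j < n"
  shows "\<sigma> g $$ (i, j) \<in> L"
proof -
  have Lsum: "sum f I \<in> L" if "\<And>i. i \<in> I \<Longrightarrow> f i \<in> L" for f and I :: "nat set"
    using that by (induction I rule: infinite_finite_induct) (auto intro: L)
  have "g \<in> generate G S" using g S by simp
  then show ?thesis using ij
  proof (induction arbitrary: i j rule: generate.induct)
    case one
    then show ?case using rep L unfolding mrep_def by auto
  next
    case (eng g h)
    have gh: "g \<in> carrier G" "h \<in> carrier G" using eng.hyps S by auto
    then have "\<sigma> (g \<otimes> h) $$ (i, j) = (\<Sum>l<n. \<sigma> g $$ (i, l) * \<sigma> h $$ (l, j))"
      using rep mat_mult_entry[of "\<sigma> g" n "\<sigma> h"] eng.prems unfolding mrep_def by simp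
    also have "\<dots> \<in> L" using eng.IH eng.prems by (intro Lsum L(4)) auto
    finally show ?case .
  qed (use E in auto)
qed

text \<open>Restriction of scalars. All entries of \<open>\<sigma>\<close> lie in a ring that is
  finite-dimensional over the field \<open>K\<close> of rational functions in \<open>as\<close>, so
  vectors over this ring form a finite-dimensional \<open>K\<close>-space on which \<open>G\<close>
  acts faithfully. The new matrices of the generators and their inverses have finitely many entries,
  so one denominator \<open>f\<close> suffices.\<close>

lemma (in group) rep_over_localization:
  fixes \<sigma> :: "'a \<Rightarrow> 'f::field mat"
  assumes rep: "mrep G n \<sigma>" and inj: "inj_on \<sigma> (carrier G)"
    and S: "finite S" "S \<subseteq> carrier G" "generate G S = carrier G"
  shows "\<exists>as f N \<rho>. indep as \<and> f \<in> gring (set as) \<and> f \<noteq> (0::'f) \<and> mrep G N \<rho> \<and> inj_on \<rho> (carrier G) \<and>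
    (\<forall>g\<in>carrier G. \<forall>i<N. \<forall>j<N. \<rho> g $$ (i, j) \<in> localization (gring (set as)) f)"
proof -
  define E where "E = (\<Union>g\<in>S \<union> m_inv G ` S. (\<lambda>(i, j). \<sigma> g $$ (i, j)) ` ({..<n} \<times> {..<n}))"
  have fE: "finite E" unfolding E_def using S by auto
  obtain as where as: "indep as" "\<forall>e\<in>E. \<exists>p. p \<noteq> 0 \<and> coeffs_in (gring (set as)) p \<and> poly p e = 0"
    using indep_exists[OF fE] by blast
  define K where "K = fractions (gring (set as))"
  have K: "is_subfield K" unfolding K_def by (rule is_subfield_fractions)
  have "\<forall>e\<in>E. \<exists>p. p \<noteq> 0 \<and> coeffs_in K p \<and> poly p e = 0"
    using as(2) gring_subset_fractions unfolding K_def coeffs_in_def by blast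
  then obtain W where W: "finite W" "1 \<in> kspan K W" "E \<subseteq> kspan K W"
      "\<forall>x\<in>kspan K W. \<forall>y\<in>kspan K W. x * y \<in> kspan K W"
    using finite_extension[OF K fE] by blast
  have \<sigma>L: "\<sigma> g $$ (i, j) \<in> kspan K W" if "g \<in> carrier G" "i < n" "j < n" for g i j
  proof (rule mrep_entries_closed[OF rep S(2,3) _ _ _ _ _ that])
    show "\<sigma> s $$ (i, j) \<in> kspan K W \<and> \<sigma> (inv s) $$ (i, j) \<in> kspan K W" if "s \<in> S" "i < n" "j < n" for s i j
      using that W(3) unfolding E_def by force
  qed (use kspan_zero[OF K] kspan_add[OF K] W in auto)
  define V where "V = {v :: nat \<Rightarrow> 'f. (\<forall>s\<in>{..<n}. v s \<in> kspan K W) \<and> (\<forall>s. s \<notin> {..<n} \<longrightarrow> v s = 0)}"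
  define D where "D = (\<lambda>(s, w) t. if t = s then w else (0::'f)) ` (SIGMA s:{..<n}. W)"
  have VD: "V = fspan K D" unfolding V_def D_def by (rule fspan_pointwise[OF K]) (use W in auto)
  have fD: "finite D" unfolding D_def using W by auto
  define act where "act g v = (\<lambda>i. if i < n then \<Sum>j<n. \<sigma> g $$ (i, j) * v j else 0)" for g and v :: "nat \<Rightarrow> 'f"
  have \<sigma>m: "\<sigma> (g \<otimes> h) $$ (i, j) = (\<Sum>l<n. \<sigma> g $$ (i, l) * \<sigma> h $$ (l, j))" if "g \<in> carrier G" "h \<in> carrier G" "i < n" "j < n" for g h i j
    using rep mat_mult_entry[of "\<sigma> g" n "\<sigma> h"] that unfolding mrep_def by simp
  have \<sigma>1: "\<sigma> \<one> $$ (i, j) = (if i = j then 1 else 0)" if "i < n" "j < n" for i j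
    using rep that unfolding mrep_def by simp
  have \<sigma>c: "\<sigma> g \<in> carrier_mat n n" if "g \<in> carrier G" for g using rep that unfolding mrep_def by blast
  obtain N \<rho> where \<rho>: "mrep G N \<rho>" "inj_on \<rho> (carrier G)"
    "\<And>g i j. g \<in> carrier G \<Longrightarrow> i < N \<Longrightarrow> j < N \<Longrightarrow> \<rho> g $$ (i, j) \<in> K"
  proof (rule mrep_of_module[OF K fD VD, of act])
    fix g v assume "g \<in> carrier G" "v \<in> V"
    then show "act g v \<in> V" unfolding V_def act_def using \<sigma>L W(4) by (auto intro!: kspan_sum[OF K])
  next
    fix g v w assume "g \<in> carrier G" "v \<in> V" "w \<in> V"
    show "act g (\<lambda>s. v s + w s) = (\<lambda>s. act g v s + act g w s)"
      unfolding act_def by (auto simp: algebra_simps sum.distrib)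
  next
    fix g v c assume "g \<in> carrier G" "v \<in> V" "c \<in> K"
    show "act g (\<lambda>s. c * v s) = (\<lambda>s. c * act g v s)"
      unfolding act_def by (auto simp: sum_distrib_left ac_simps)
  next
    fix g h v assume gh: "g \<in> carrier G" "h \<in> carrier G" and v: "v \<in> V"
    show "act (g \<otimes> h) v = act g (act h v)"
    proof
      fix i
      show "act (g \<otimes> h) v i = act g (act h v) i"
      proof (cases "i < n")
        case True
        have "act (g \<otimes> h) v i = (\<Sum>j<n. \<Sum>l<n. \<sigma> g $$ (i, l) * (\<sigma> h $$ (l, j) * v j))"
          unfolding act_def using True \<sigma>m[OF gh True] by (simp add: sum_distrib_right mult.assoc)
        also have "\<dots> = (\<Sum>l<n. \<Sum>j<n. \<sigma> g $$ (i, l) * (\<sigma> h $$ (l, j) * v j))" by (rule sum.swap)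
        also have "\<dots> = act g (act h v) i" unfolding act_def using True by (simp add: sum_distrib_left)
        finally show ?thesis .
      qed (simp add: act_def)
    qed
  next
    fix v assume v: "v \<in> V"
    show "act \<one> v = v"
    proof
      show "act \<one> v i = v i" for i
        using v \<sigma>1 unfolding act_def V_def by (auto simp: if_distrib[of "\<lambda>x. x * _"] cong: if_cong)
    qed
  next
    fix g assume g: "g \<in> carrier G" and triv: "\<And>v. v \<in> V \<Longrightarrow> act g v = v"
    have "\<sigma> g $$ (i, j) = (if i = j then 1 else 0)" if ij: "i < n" "j < n" for i j
    proof -
      define v where "v t = (if t = j then 1 else (0::'f))" for t
      have "v \<in> V" unfolding V_def v_def using ij W(2) kspan_zero[OF K] by auto
      then have "act g v i = v i" using triv by simp
      then show ?thesis using ij unfolding act_def v_def by (auto simp: if_distrib[of "\<lambda>x. _ * x"] cong: if_cong)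
    qed
    then have "\<sigma> g = \<sigma> \<one>" using \<sigma>c[OF g] \<sigma>c[OF one_closed] \<sigma>1 by (intro eq_matI) auto
    then show "g = \<one>" using inj g by (auto dest: inj_onD)
  qed (blast intro: that)
  define Ent where "Ent = (\<Union>g\<in>S \<union> m_inv G ` S. (\<lambda>(i, j). \<rho> g $$ (i, j)) ` ({..<N} \<times> {..<N}))"
  have "Ent \<subseteq> K" unfolding Ent_def using \<rho>(3) S(2) by (auto simp: subset_iff)
  moreover have "finite Ent" unfolding Ent_def using S by auto
  ultimately obtain f where f: "f \<in> gring (set as)" "f \<noteq> 0" "Ent \<subseteq> localization (gring (set as)) f"
    using common_denominator unfolding K_def by blast
  have "\<rho> g $$ (i, j) \<in> localization (gring (set as)) f" if "g \<in> carrier G" "i < N" "j < N" for g i j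
  proof (rule mrep_entries_closed[OF \<rho>(1) S(2,3) _ _ _ _ _ that])
    show "\<rho> s $$ (i, j) \<in> localization (gring (set as)) f \<and> \<rho> (inv s) $$ (i, j) \<in> localization (gring (set as)) f"
      if "s \<in> S" "i < N" "j < N" for s i j
      using that f(3) unfolding Ent_def by force
  qed (use gring_subset_localization[of "set as" f] gring_zero gring.one localization_add[OF f(1)] localization_mult in auto)
  then show ?thesis using as(1) f(1,2) \<rho>(1,2) by blast
qed

subsection \<open>Taylor expansion at a specialization\<close>

lemma ring_hom_on_closed_sum:
  assumes \<phi>: "ring_hom_on B \<phi>" and B: "0 \<in> B" "\<And>x y. x \<in> B \<Longrightarrow> y \<in> B \<Longrightarrow> x + y \<in> B"
    and f: "\<And>i. i \<in> I \<Longrightarrow> f i \<in> B"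
  shows "\<phi> (sum f I) = (\<Sum>i\<in>I. \<phi> (f i))"
proof -
  have "\<phi> (0 + 0) = \<phi> 0 + \<phi> 0" using \<phi> B(1) unfolding ring_hom_on_def by blast
  then have 0: "\<phi> 0 = 0" by simp
  have c: "sum f J \<in> B" if "J \<subseteq> I" for J
    using that f by (induction J rule: infinite_finite_induct) (auto intro: B)
  show ?thesis using f c
  proof (induction I rule: infinite_finite_induct)
    case (insert i I)
    have "sum f I \<in> B" "f i \<in> B" using insert.prems by auto
    then have "\<phi> (f i + sum f I) = \<phi> (f i) + \<phi> (sum f I)" using \<phi> unfolding ring_hom_on_def by blast
    then show ?case using insert by (auto simp: subset_insertI2)
  qed (auto simp: 0)
qed

lemma (in group) mrep_map_mat:
  assumes rep: "mrep G N \<rho>" and T: "ring_hom_on B T"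
    and B: "0 \<in> B" "\<And>x y. x \<in> B \<Longrightarrow> y \<in> B \<Longrightarrow> x + y \<in> B" "\<And>x y. x \<in> B \<Longrightarrow> y \<in> B \<Longrightarrow> x * y \<in> B"
    and e: "\<And>g i j. g \<in> carrier G \<Longrightarrow> i < N \<Longrightarrow> j < N \<Longrightarrow> \<rho> g $$ (i, j) \<in> B"
  shows "mrep G N (\<lambda>g. map_mat T (\<rho> g))"
  unfolding mrep_def
proof (intro conjI ballI)
  have T0: "T 0 = 0" using ring_hom_on_closed_sum[OF T B(1,2), of "{}"] by simp
  have T1: "T 1 = 1" using T unfolding ring_hom_on_def by blast
  show "map_mat T (\<rho> g) \<in> carrier_mat N N" if "g \<in> carrier G" for g using rep that unfolding mrep_def by simp
  show "map_mat T (\<rho> \<one>) = 1\<^sub>m N" using rep T0 T1 unfolding mrep_def by (intro eq_matI) auto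
  fix g h assume g: "g \<in> carrier G" and h: "h \<in> carrier G"
  have c: "\<rho> g \<in> carrier_mat N N" "\<rho> h \<in> carrier_mat N N" and m: "\<rho> (g \<otimes> h) = \<rho> g * \<rho> h"
    using rep g h unfolding mrep_def by auto
  show "map_mat T (\<rho> (g \<otimes> h)) = map_mat T (\<rho> g) * map_mat T (\<rho> h)"
  proof (rule eq_matI)
    fix i j assume "i < dim_row (map_mat T (\<rho> g) * map_mat T (\<rho> h))" "j < dim_col (map_mat T (\<rho> g) * map_mat T (\<rho> h))"
    then have ij: "i < N" "j < N" using c by auto
    have "T ((\<rho> g * \<rho> h) $$ (i, j)) = (\<Sum>l<N. T (\<rho> g $$ (i, l) * \<rho> h $$ (l, j)))"
      unfolding mat_mult_entry[OF c ij]
      by (rule ring_hom_on_closed_sum[OF T B(1,2)]) (use e g h ij B(3) in auto)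
    also have "\<dots> = (\<Sum>l<N. T (\<rho> g $$ (i, l)) * T (\<rho> h $$ (l, j)))"
      using T e g h ij unfolding ring_hom_on_def by (intro sum.cong) auto
    also have "\<dots> = (map_mat T (\<rho> g) * map_mat T (\<rho> h)) $$ (i, j)"
      using mat_mult_entry[of "map_mat T (\<rho> g)" N "map_mat T (\<rho> h)"] c ij by simp
    finally show "map_mat T (\<rho> (g \<otimes> h)) $$ (i, j) = (map_mat T (\<rho> g) * map_mat T (\<rho> h)) $$ (i, j)"
      using m c ij by simp
  qed (use c m in auto)
qed

section \<open>Polynomials of bounded degree and the setting of a specialization\<close>

fun monomials :: "'f::field set \<Rightarrow> nat \<Rightarrow> 'f set" where
  "monomials A 0 = {1}"
| "monomials A (Suc j) = monomials A j \<union> (\<lambda>(a, m). a * m) ` (A \<times> monomials A j)"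

lemma finite_monomials: "finite A \<Longrightarrow> finite (monomials A j)"
  by (induction j) auto

lemma monomials_mono: "i \<le> j \<Longrightarrow> monomials A i \<subseteq> monomials A j"
  by (induction j) (auto simp: le_Suc_eq)

lemma monomials_mult: "x \<in> monomials A i \<Longrightarrow> y \<in> monomials A j \<Longrightarrow> x * y \<in> monomials A (i + j)"
proof (induction i arbitrary: x)
  case (Suc i)
  show ?case
  proof (cases "x \<in> monomials A i")
    case True
    then show ?thesis using Suc monomials_mono[of "i + j" "Suc i + j" A] by auto
  next
    case False
    then obtain a m where "a \<in> A" "m \<in> monomials A i" "x = a * m" using Suc.prems by auto
    then show ?thesis using Suc.IH[of m] Suc.prems(2) by (force simp: mult.assoc)
  qed
qed auto

text \<open>\<open>as\<close> are the variables, \<open>f\<close> the denominator, \<open>C\<close>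
  the field of constants, and \<open>\<phi>\<close> is evaluation at a point over \<open>C\<close>
  where \<open>f\<close> does not vanish. Evaluation takes values in the same field
  \<open>'f\<close>, so that \<open>a - \<phi> a\<close> makes sense.\<close>

locale specialization =
  fixes as :: "'f::field list" and f :: 'f and C :: "'f set" and \<phi> :: "'f \<Rightarrow> 'f"
  assumes indep: "indep as" and f: "f \<in> gring (set as)" and C: "is_subfield C"
    and \<phi>: "ring_hom_on (gring (set as)) \<phi>" and \<phi>C: "\<And>a. a \<in> set as \<Longrightarrow> \<phi> a \<in> C" and \<phi>f: "\<phi> f \<noteq> 0"
begin

text \<open>The polynomials of degree at most \<open>j\<close> in the variables with coefficients in
  \<open>C\<close>.\<close>

definition H :: "nat \<Rightarrow> 'f set" where "H j = kspan C (monomials (set as) j)"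

lemma finite_monomials_as: "finite (monomials (set as) j)" by (rule finite_monomials) simp

lemma H_mono: "i \<le> j \<Longrightarrow> H i \<subseteq> H j"
proof
  fix y assume "i \<le> j" "y \<in> H i"
  from finite_monomials_as this(2)[unfolded H_def] show "y \<in> H j" unfolding H_def
  proof (induction rule: kspan_induct)
    case (scale c w)
    then have "w \<in> monomials (set as) j" using monomials_mono[OF \<open>i \<le> j\<close>] by blast
    then show ?case using kspan_scale[OF C kspan_base[OF C finite_monomials_as]] scale by blast
  qed (auto intro: kspan_add kspan_zero C)
qed

lemma H_mult:
  assumes "x \<in> H i" "y \<in> H j" shows "x * y \<in> H (i + j)"
  using finite_monomials_as assms(1)[unfolded H_def]
proof (induction rule: kspan_induct)
  case (scale c w)
  show ?case using finite_monomials_as assms(2)[unfolded H_def]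
  proof (induction rule: kspan_induct)
    case (scale d v)
    have "w * v \<in> monomials (set as) (i + j)" by (rule monomials_mult) (use scale \<open>w \<in> _\<close> in auto)
    then have "(c * d) * (w * v) \<in> H (i + j)" unfolding H_def
      by (intro kspan_scale[OF C kspan_base[OF C finite_monomials_as]]) (use C scale \<open>c \<in> C\<close> in \<open>auto simp: is_subfield_def\<close>)
    then show ?case by (simp add: ac_simps)
  qed (auto simp: algebra_simps H_def intro: kspan_add kspan_zero C)
qed (auto simp: algebra_simps H_def intro: kspan_add kspan_zero C)

lemma H_0: "H 0 = C"
  unfolding H_def kspan_def by auto

lemma H_add: "x \<in> H i \<Longrightarrow> y \<in> H i \<Longrightarrow> x + y \<in> H i"
  unfolding H_def by (rule kspan_add[OF C])

lemma H_zero: "0 \<in> H i"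
  unfolding H_def by (rule kspan_zero[OF C])

lemma H_scale: "c \<in> C \<Longrightarrow> x \<in> H i \<Longrightarrow> c * x \<in> H i"
  unfolding H_def by (rule kspan_scale[OF C])

lemma H_uminus: "x \<in> H i \<Longrightarrow> - x \<in> H i"
proof -
  have "- 1 \<in> C" using C unfolding is_subfield_def by blast
  then show "x \<in> H i \<Longrightarrow> - x \<in> H i" using H_scale[of "-1" x i] by simp
qed

lemma H_sum: "(\<And>k. k \<in> I \<Longrightarrow> h k \<in> H i) \<Longrightarrow> sum h I \<in> H i"
  unfolding H_def by (rule kspan_sum[OF C])

definition HS :: "'f fps set" where "HS = {s. \<forall>j. fps_nth s j \<in> H j}"

lemma HS_add: "s \<in> HS \<Longrightarrow> t \<in> HS \<Longrightarrow> s + t \<in> HS"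
  unfolding HS_def by (auto intro: H_add)

lemma HS_mult: "s \<in> HS \<Longrightarrow> t \<in> HS \<Longrightarrow> s * t \<in> HS"
  unfolding HS_def
proof (intro CollectI allI)
  fix j assume st: "s \<in> {s. \<forall>j. fps_nth s j \<in> H j}" "t \<in> {s. \<forall>j. fps_nth s j \<in> H j}"
  have "fps_nth s i * fps_nth t (j - i) \<in> H j" if "i \<in> {0..j}" for i
    using H_mult[of "fps_nth s i" i "fps_nth t (j - i)" "j - i"] st that by simp
  then show "fps_nth (s * t) j \<in> H j" unfolding fps_mult_nth by (rule H_sum)
qed

lemma HS_uminus: "s \<in> HS \<Longrightarrow> - s \<in> HS"
  unfolding HS_def by (auto intro: H_uminus)

lemma HS_one: "1 \<in> HS"
  unfolding HS_def using C H_0 by (auto simp: is_subfield_def intro: H_zero)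

lemma HS_power: "s \<in> HS \<Longrightarrow> s ^ n \<in> HS"
  by (induction n) (auto intro: HS_one HS_mult)

text \<open>\<open>H 0\<close> is the field \<open>C\<close>, so the constant term can be inverted
  there, and the recursion for the coefficients of the inverse respects the degree bound. This
  admits the denominators \<open>f ^ k\<close>.\<close>

lemma HS_inverse: assumes s: "s \<in> HS" and s0: "fps_nth s 0 \<noteq> 0" shows "inverse s \<in> HS"
  unfolding HS_def
proof (intro CollectI allI)
  have 0: "inverse (fps_nth s 0) \<in> C" using s C H_0 unfolding HS_def is_subfield_def by auto
  fix j show "fps_nth (inverse s) j \<in> H j"
  proof (induction j rule: less_induct)
    case (less j)
    show ?case
    proof (cases "j = 0")
      case True
      then show ?thesis using 0 H_0 by simp
    next
      case False
      have "fps_nth (s * inverse s) j = 0" using s0 False by (simp add: inverse_mult_eq_1')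
      then have "(\<Sum>i=0..j. fps_nth s i * fps_nth (inverse s) (j - i)) = 0" by (simp add: fps_mult_nth)
      then have "fps_nth s 0 * fps_nth (inverse s) j + (\<Sum>i=1..j. fps_nth s i * fps_nth (inverse s) (j - i)) = 0"
        by (simp add: sum.atLeast_Suc_atMost)
      then have "fps_nth (inverse s) j = inverse (fps_nth s 0) * - (\<Sum>i=1..j. fps_nth s i * fps_nth (inverse s) (j - i))"
        using s0 by (simp add: field_simps eq_neg_iff_add_eq_0)
      moreover have "fps_nth s i * fps_nth (inverse s) (j - i) \<in> H j" if "i \<in> {1..j}" for i
        using H_mult[of "fps_nth s i" i "fps_nth (inverse s) (j - i)" "j - i"] s less.IH[of "j - i"] that
        unfolding HS_def by auto
      then have "(\<Sum>i=1..j. fps_nth s i * fps_nth (inverse s) (j - i)) \<in> H j" by (rule H_sum)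
      ultimately show ?thesis using H_scale[OF 0 H_uminus] by simp
    qed
  qed
qed

text \<open>The substitution \<open>a \<mapsto> c + x (a - c)\<close>, where \<open>c = \<phi> a\<close>: the Taylor expansion at the point \<open>c\<close>
  along the line through \<open>c\<close> and the generic point.\<close>

definition \<tau> :: "'f \<Rightarrow> 'f poly" where
  "\<tau> = (SOME \<tau>. ring_hom_on (gring (set as)) \<tau> \<and> (\<forall>a\<in>set as. \<tau> a = [:\<phi> a, a - \<phi> a:]))"

lemma \<tau>: "ring_hom_on (gring (set as)) \<tau>" "\<And>a. a \<in> set as \<Longrightarrow> \<tau> a = [:\<phi> a, a - \<phi> a:]"
proof -
  have "\<exists>\<tau>::'f \<Rightarrow> 'f poly. ring_hom_on (gring (set as)) \<tau> \<and> (\<forall>a\<in>set as. \<tau> a = [:\<phi> a, a - \<phi> a:])"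
    by (rule ring_hom_on_indep[OF _ indep]) (simp add: of_int_poly)
  from someI_ex[OF this] show "ring_hom_on (gring (set as)) \<tau>" "\<And>a. a \<in> set as \<Longrightarrow> \<tau> a = [:\<phi> a, a - \<phi> a:]"
    unfolding \<tau>_def by auto
qed

lemma ring_hom_on_poly_\<tau>: "ring_hom_on (gring (set as)) (\<lambda>y. poly (\<tau> y) z)"
  using \<tau>(1) unfolding ring_hom_on_def by simp

lemma \<tau>_0: "y \<in> gring (set as) \<Longrightarrow> poly (\<tau> y) 0 = \<phi> y"
  by (rule ring_hom_on_unique[OF ring_hom_on_poly_\<tau> \<phi>]) (use \<tau> in auto)

text \<open>Setting the series variable to 1 undoes the substitution. This makes the expansion
  injective.\<close>

lemma \<tau>_1: "y \<in> gring (set as) \<Longrightarrow> poly (\<tau> y) 1 = y"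
  by (rule ring_hom_on_unique[OF ring_hom_on_poly_\<tau>, of "\<lambda>y. y"]) (use \<tau> in \<open>auto simp: ring_hom_on_def\<close>)

lemma \<tau>_HS: "y \<in> gring (set as) \<Longrightarrow> fps_of_poly (\<tau> y) \<in> HS"
proof (induction rule: gring.induct)
  case one
  then show ?case using \<tau>(1) HS_one unfolding ring_hom_on_def by simp
next
  case (base a)
  have c: "\<phi> a \<in> H 0" using \<phi>C base H_0 by simp
  have "a \<in> monomials (set as) 1" using base by (force simp: image_iff)
  then have "a \<in> H 1" unfolding H_def by (rule kspan_base[OF C finite_monomials_as])
  moreover have "- \<phi> a \<in> H 1" using c H_mono[of 0 1] H_uminus by auto
  ultimately have "a - \<phi> a \<in> H 1" using H_add by fastforce
  then show ?case unfolding HS_def \<tau>(2)[OF base]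
    using c H_zero by (auto simp: coeff_pCons split: nat.splits)
next
  case (add x y)
  then show ?case using \<tau>(1) HS_add unfolding ring_hom_on_def by (simp add: fps_of_poly_add)
next
  case (mult x y)
  then show ?case using \<tau>(1) HS_mult unfolding ring_hom_on_def by (simp add: fps_of_poly_mult)
next
  case (uminus x)
  then show ?case using ring_hom_on_uminus[OF \<tau>(1)] HS_uminus by (simp add: fps_of_poly_uminus)
qed

abbreviation R :: "'f set" where "R \<equiv> localization (gring (set as)) f"

lemma \<tau>f: "fps_nth (fps_of_poly (\<tau> f)) 0 \<noteq> 0"
  using \<tau>_0[OF f] \<phi>f by (simp add: poly_0_coeff_0)

lemma f_nonzero: "f \<noteq> 0"
  using \<phi>f ring_hom_on_zero[OF \<phi>] by auto

text \<open>The expansion extends to \<open>R\<close> because the expansion of \<open>f\<close> has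
  the nonzero constant term \<open>\<phi> f\<close> and is therefore a unit among power series. The
  form with cleared denominator yields polynomial identities and degrees; the solved form yields
  membership in \<open>HS\<close>.\<close>

definition T :: "'f \<Rightarrow> 'f fps" where
  "T = (SOME T. ring_hom_on R T \<and>
    (\<forall>y k. y * f ^ k \<in> gring (set as) \<longrightarrow> T y * fps_of_poly (\<tau> f) ^ k = fps_of_poly (\<tau> (y * f ^ k)) \<and>
      T y = fps_of_poly (\<tau> (y * f ^ k)) * inverse (fps_of_poly (\<tau> f)) ^ k))"

lemma T: "ring_hom_on R T"
    "\<And>y k. y * f ^ k \<in> gring (set as) \<Longrightarrow> T y * fps_of_poly (\<tau> f) ^ k = fps_of_poly (\<tau> (y * f ^ k))"
    "\<And>y k. y * f ^ k \<in> gring (set as) \<Longrightarrow> T y = fps_of_poly (\<tau> (y * f ^ k)) * inverse (fps_of_poly (\<tau> f)) ^ k"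
proof -
  have h: "ring_hom_on (gring (set as)) (\<lambda>y. fps_of_poly (\<tau> y))"
    using \<tau>(1) unfolding ring_hom_on_def by (simp add: fps_of_poly_add fps_of_poly_mult)
  have u: "fps_of_poly (\<tau> f) * inverse (fps_of_poly (\<tau> f)) = 1" using \<tau>f by (rule inverse_mult_eq_1')
  obtain \<psi> where "ring_hom_on R \<psi>" "\<And>y k. y * f ^ k \<in> gring (set as) \<Longrightarrow> \<psi> y * fps_of_poly (\<tau> f) ^ k = fps_of_poly (\<tau> (y * f ^ k))"
    "\<And>y k. y * f ^ k \<in> gring (set as) \<Longrightarrow> \<psi> y = fps_of_poly (\<tau> (y * f ^ k)) * inverse (fps_of_poly (\<tau> f)) ^ k"
    using ring_hom_on_localization[OF h f f_nonzero u] by metis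
  then have "\<exists>T. ring_hom_on R T \<and>
    (\<forall>y k. y * f ^ k \<in> gring (set as) \<longrightarrow> T y * fps_of_poly (\<tau> f) ^ k = fps_of_poly (\<tau> (y * f ^ k)) \<and>
      T y = fps_of_poly (\<tau> (y * f ^ k)) * inverse (fps_of_poly (\<tau> f)) ^ k)" by blast
  from someI_ex[OF this, folded T_def]
  show "ring_hom_on R T"
    "\<And>y k. y * f ^ k \<in> gring (set as) \<Longrightarrow> T y * fps_of_poly (\<tau> f) ^ k = fps_of_poly (\<tau> (y * f ^ k))"
    "\<And>y k. y * f ^ k \<in> gring (set as) \<Longrightarrow> T y = fps_of_poly (\<tau> (y * f ^ k)) * inverse (fps_of_poly (\<tau> f)) ^ k"
    by blast+
qed

lemma R_closed: "0 \<in> R" "1 \<in> R" "\<And>x y. x \<in> R \<Longrightarrow> y \<in> R \<Longrightarrow> x + y \<in> R" "\<And>x y. x \<in> R \<Longrightarrow> y \<in> R \<Longrightarrow> x * y \<in> R"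
  using gring_subset_localization[of "set as" f] gring_zero[of "set as"] gring.one[of "set as"]
    localization_add[OF f] localization_mult by auto

lemma R_uminus: "x \<in> R \<Longrightarrow> - x \<in> R"
  using R_closed(4)[of "-1" x] gring_subset_localization[of "set as" f] gring.uminus[OF gring.one, of "set as"] by auto

lemma T_zero: "T 0 = 0"
  using ring_hom_on_closed_sum[OF T(1) R_closed(1,3), of "{}"] by simp

lemma T_diff: "x \<in> R \<Longrightarrow> y \<in> R \<Longrightarrow> T (x - y) = T x - T y"
proof -
  assume xy: "x \<in> R" "y \<in> R"
  have "x - y \<in> R" using R_closed(3)[OF xy(1) R_uminus[OF xy(2)]] by simp
  then have "T (x - y + y) = T (x - y) + T y" using T(1) xy unfolding ring_hom_on_def by blast
  then show ?thesis by simp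
qed

lemma T_HS: assumes "y \<in> R" shows "T y \<in> HS"
proof -
  obtain k where k: "y * f ^ k \<in> gring (set as)" using assms unfolding localization_def by blast
  show ?thesis unfolding T(3)[OF k] by (intro HS_mult HS_power HS_inverse \<tau>_HS k f \<tau>f)
qed

lemma T_eq_0: assumes "y \<in> R" "T y = 0" shows "y = 0"
proof -
  obtain k where k: "y * f ^ k \<in> gring (set as)" using assms unfolding localization_def by blast
  have "fps_of_poly (\<tau> (y * f ^ k)) = 0" using T(2)[OF k] assms(2) by simp
  then have "\<tau> (y * f ^ k) = 0" by simp
  then have "y * f ^ k = 0" using \<tau>_1[OF k] by simp
  then show ?thesis using f_nonzero by simp
qed

lemma T_inj: "inj_on T R"
proof (rule inj_onI)
  fix x y assume xy: "x \<in> R" "y \<in> R" "T x = T y"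
  have "x - y \<in> R" using R_closed(3)[OF xy(1) R_uminus[OF xy(2)]] by simp
  then have "x - y = 0" by (rule T_eq_0) (use T_diff xy in simp)
  then show "x = y" by simp
qed

end

subsection \<open>The case of characteristic zero\<close>

lemma map_poly_ring_hom_on:
  assumes \<phi>: "ring_hom_on (gring A) \<phi>" and p: "coeffs_in (gring A) p" and q: "coeffs_in (gring A) q"
  shows "map_poly \<phi> (p + q) = map_poly \<phi> p + map_poly \<phi> q" "map_poly \<phi> (p * q) = map_poly \<phi> p * map_poly \<phi> q"
proof -
  note \<phi>0 = ring_hom_on_zero[OF \<phi>]
  show "map_poly \<phi> (p + q) = map_poly \<phi> p + map_poly \<phi> q"
    by (rule poly_eqI) (use \<phi> \<phi>0 p q in \<open>auto simp: coeff_map_poly ring_hom_on_def coeffs_in_def\<close>)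
  show "map_poly \<phi> (p * q) = map_poly \<phi> p * map_poly \<phi> q"
  proof (rule poly_eqI)
    fix n
    have "\<phi> (\<Sum>i\<le>n. poly.coeff p i * poly.coeff q (n - i)) = (\<Sum>i\<le>n. \<phi> (poly.coeff p i * poly.coeff q (n - i)))"
      by (rule ring_hom_on_sum[OF \<phi>]) (use p q in \<open>auto simp: coeffs_in_def intro: gring.mult\<close>)
    then show "poly.coeff (map_poly \<phi> (p * q)) n = poly.coeff (map_poly \<phi> p * map_poly \<phi> q) n"
      using \<phi> \<phi>0 p q by (simp add: coeff_map_poly coeff_mult ring_hom_on_def coeffs_in_def)
  qed
qed

lemma fps_mult_low:
  fixes s t :: "'a::comm_ring_1 fps"
  assumes "\<And>l. l < k \<Longrightarrow> fps_nth s l = 0"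
  shows "l < k \<Longrightarrow> fps_nth (s * t) l = 0" "fps_nth (s * t) k = fps_nth s k * fps_nth t 0"
proof -
  show "l < k \<Longrightarrow> fps_nth (s * t) l = 0" using assms by (auto simp: fps_mult_nth intro!: sum.neutral)
  have "fps_nth (s * t) k = (\<Sum>i=0..k. if i = k then fps_nth s k * fps_nth t 0 else 0)"
    unfolding fps_mult_nth by (rule sum.cong) (use assms in auto)
  then show "fps_nth (s * t) k = fps_nth s k * fps_nth t 0" by simp
qed

lemma gring_empty: "gring ({} :: 'a::comm_ring_1 set) = range of_int"
proof
  show "gring ({} :: 'a set) \<subseteq> range of_int"
  proof
    fix y :: 'a assume "y \<in> gring {}"
    then have "\<exists>z. y = of_int z"
    proof induction
      case one show ?case by (rule exI[of _ 1]) simp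
    next
      case (add x y) then show ?case by (metis of_int_add)
    next
      case (mult x y) then show ?case by (metis of_int_mult)
    next
      case (uminus x) then show ?case by (metis of_int_minus)
    qed auto
    then show "y \<in> range of_int" by blast
  qed
qed (auto intro: gring_of_int)

lemma prime_field_hom:
  assumes ch: "\<And>z::int. of_int z = (0::'f::field) \<longleftrightarrow> z = 0"
  obtains \<psi> :: "'f::field \<Rightarrow> rat" where "ring_hom_on (fractions (gring {})) \<psi>" "inj_on \<psi> (fractions (gring {}))"
proof -
  define \<psi> where "\<psi> y = (SOME r. \<exists>a b::int. b \<noteq> 0 \<and> y = of_int a / of_int b \<and> r = of_int a / (of_int b :: rat))" for y :: 'f
  have eq: "(of_int a / of_int b = (of_int c / of_int d :: 'f)) \<longleftrightarrow> (of_int a / of_int b = (of_int c / of_int d :: rat))"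
    if "b \<noteq> 0" "d \<noteq> 0" for a b c d :: int
  proof -
    have "(of_int a / of_int b = (of_int c / of_int d :: 'f)) \<longleftrightarrow> of_int (a * d - c * b) = (0 :: 'f)"
      using that ch by (simp add: frac_eq_eq)
    also have "\<dots> \<longleftrightarrow> a * d = c * b" unfolding ch by simp
    also have "\<dots> \<longleftrightarrow> (of_int (a * d) :: rat) = of_int (c * b)" by (metis of_int_eq_iff)
    also have "\<dots> \<longleftrightarrow> (of_int a / of_int b = (of_int c / of_int d :: rat))"
      using that by (simp add: frac_eq_eq)
    finally show ?thesis .
  qed
  have \<psi>: "\<psi> (of_int a / of_int b) = of_int a / of_int b" if "b \<noteq> 0" for a b :: int
  proof -
    have "\<exists>c d::int. d \<noteq> 0 \<and> (of_int a / of_int b :: 'f) = of_int c / of_int d \<and> \<psi> (of_int a / of_int b) = of_int c / (of_int d :: rat)"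
      unfolding \<psi>_def by (rule someI_ex) (use that in blast)
    then show ?thesis using eq that by metis
  qed
  have ex: "\<exists>a b::int. b \<noteq> 0 \<and> y = of_int a / of_int b" if "y \<in> fractions (gring {})" for y :: 'f
  proof -
    have "\<exists>a b::int. y = of_int a / of_int b" using that unfolding fractions_def gring_empty by blast
    then obtain a b :: int where ab: "y = of_int a / of_int b" by blast
    show ?thesis
    proof (cases "b = 0")
      case True
      then show ?thesis using ab by (intro exI[of _ 0] exI[of _ 1]) auto
    qed (use ab in blast)
  qed
  show ?thesis
  proof (rule that)
    show "ring_hom_on (fractions (gring {})) \<psi>"
      unfolding ring_hom_on_def
    proof (intro conjI ballI)
      show "\<psi> 1 = 1" using \<psi>[of 1 1] by simp
      fix x y :: 'f assume "x \<in> fractions (gring {})" "y \<in> fractions (gring {})"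
      then obtain a b c d :: int where *: "b \<noteq> 0" "x = of_int a / of_int b" "d \<noteq> 0" "y = of_int c / of_int d"
        using ex by metis
      have "x + y = of_int (a * d + c * b) / of_int (b * d)" using * ch by (simp add: add_frac_eq)
      then show "\<psi> (x + y) = \<psi> x + \<psi> y" using * \<psi>[of "b * d" "a * d + c * b"] \<psi>[of b a] \<psi>[of d c]
        by (simp add: add_frac_eq)
      have "x * y = of_int (a * c) / of_int (b * d)" using * by simp
      then show "\<psi> (x * y) = \<psi> x * \<psi> y" using * \<psi>[of "b * d" "a * c"] \<psi>[of b a] \<psi>[of d c] by simp
    qed
    show "inj_on \<psi> (fractions (gring {}))"
    proof (rule inj_onI)
      fix x y :: 'f assume "x \<in> fractions (gring {})" "y \<in> fractions (gring {})" and e: "\<psi> x = \<psi> y"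
      then obtain a b c d :: int where *: "b \<noteq> 0" "x = of_int a / of_int b" "d \<noteq> 0" "y = of_int c / of_int d"
        using ex by metis
      then show "x = y" using e \<psi> eq by metis
    qed
  qed
qed

lemma (in group) Q_linear_of_prime_field_rep:
  fixes \<sigma> :: "'a \<Rightarrow> 'f::field mat"
  assumes ch: "\<And>z::int. of_int z = (0::'f) \<longleftrightarrow> z = 0"
    and rep: "mrep G N \<sigma>" and inj: "inj_on \<sigma> (carrier G)"
    and e: "\<And>g i j. g \<in> carrier G \<Longrightarrow> i < N \<Longrightarrow> j < N \<Longrightarrow> \<sigma> g $$ (i, j) \<in> fractions (gring {})"
  shows "Q_linear G"
proof -
  obtain \<psi> :: "'f \<Rightarrow> rat" where \<psi>: "ring_hom_on (fractions (gring {})) \<psi>" "inj_on \<psi> (fractions (gring {}))"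
    using prime_field_hom[OF ch] by blast
  have K: "is_subfield (fractions (gring ({} :: 'f set)))" by (rule is_subfield_fractions)
  have m: "mrep G N (\<lambda>g. map_mat \<psi> (\<sigma> g))"
    by (rule mrep_map_mat[OF rep \<psi>(1) _ _ _ e]) (use K in \<open>auto simp: is_subfield_def\<close>)
  have "inj_on (\<lambda>g. map_mat \<psi> (\<sigma> g)) (carrier G)"
  proof (rule inj_onI)
    fix g h assume g: "g \<in> carrier G" and h: "h \<in> carrier G" and eq: "map_mat \<psi> (\<sigma> g) = map_mat \<psi> (\<sigma> h)"
    have c: "\<sigma> g \<in> carrier_mat N N" "\<sigma> h \<in> carrier_mat N N" using rep g h unfolding mrep_def by auto
    have "\<sigma> g = \<sigma> h"
    proof (rule eq_matI)
      fix i j assume "i < dim_row (\<sigma> h)" "j < dim_col (\<sigma> h)"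
      then have ij: "i < N" "j < N" using c by auto
      have "map_mat \<psi> (\<sigma> g) $$ (i, j) = map_mat \<psi> (\<sigma> h) $$ (i, j)" using eq by simp
      then have "\<psi> (\<sigma> g $$ (i, j)) = \<psi> (\<sigma> h $$ (i, j))" using c ij by simp
      then show "\<sigma> g $$ (i, j) = \<sigma> h $$ (i, j)" using \<psi>(2) e[OF g ij] e[OF h ij] by (auto dest: inj_onD)
    qed (use c in auto)
    then show "g = h" using inj g h by (auto dest: inj_onD)
  qed
  then show ?thesis by (rule Q_linear_of_mrep[OF m])
qed

text \<open>\<open>G\<close> acts on the vectors of power series truncated at order \<open>K\<close> whose \<open>l\<close>-th coefficients lie
  in \<open>H l\<close>; they form a finite-dimensional space over \<open>C\<close>.\<close>

lemma (in specialization) truncated_rep: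
  fixes G :: "('g, 'b) monoid_scheme" and \<sigma> :: "'g \<Rightarrow> 'f fps mat"
  assumes G: "group G" and rep: "mrep G N \<sigma>"
    and HS: "\<And>g i j. g \<in> carrier G \<Longrightarrow> i < N \<Longrightarrow> j < N \<Longrightarrow> \<sigma> g $$ (i, j) \<in> HS"
    and K: "K > 0" and faithful: "\<And>g. g \<in> carrier G \<Longrightarrow> (\<And>i j l. i < N \<Longrightarrow> j < N \<Longrightarrow> l < K \<Longrightarrow>
      fps_nth (\<sigma> g $$ (i, j) - (if i = j then 1 else 0)) l = 0) \<Longrightarrow> g = \<one>\<^bsub>G\<^esub>"
  obtains M \<rho> where "mrep G M \<rho>" "inj_on \<rho> (carrier G)"
    "\<And>g i j. g \<in> carrier G \<Longrightarrow> i < M \<Longrightarrow> j < M \<Longrightarrow> \<rho> g $$ (i, j) \<in> C"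
proof -
  interpret G: group G by fact
  define S where "S = {..<N} \<times> {..<K}"
  define V where "V = {w :: nat \<times> nat \<Rightarrow> 'f. (\<forall>s\<in>S. w s \<in> kspan C (monomials (set as) (snd s))) \<and> (\<forall>s. s \<notin> S \<longrightarrow> w s = 0)}"
  define D where "D = (\<lambda>(s, w) t. if t = s then w else (0::'f)) ` (SIGMA s:S. monomials (set as) (snd s))"
  have VD: "V = fspan C D" unfolding V_def D_def by (rule fspan_pointwise[OF C]) (use finite_monomials_as in \<open>auto simp: S_def\<close>)
  have fD: "finite D" unfolding D_def S_def using finite_monomials_as by auto
  define F where "F w l = Abs_fps (\<lambda>q. w (l, q))" for w :: "nat \<times> nat \<Rightarrow> 'f" and l :: nat
  define act where "act g w = (\<lambda>(i, j). if i < N \<and> j < K then fps_nth (\<Sum>l<N. \<sigma> g $$ (i, l) * F w l) j else 0)" for g w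
  have Fadd: "F (\<lambda>s. v s + w s) l = F v l + F w l" for v w l unfolding F_def by (rule fps_ext) simp
  have Fscale: "F (\<lambda>s. c * v s) l = fps_const c * F v l" for c v l unfolding F_def by (rule fps_ext) simp
  have FHS: "F w l \<in> HS" if "w \<in> V" "l < N" for w l
    unfolding HS_def
  proof (intro CollectI allI)
    fix q
    show "fps_nth (F w l) q \<in> H q"
      using that H_zero[of q] unfolding F_def V_def S_def H_def by (cases "q < K") auto
  qed
  have HSsum: "sum h I \<in> HS" if "\<And>i. i \<in> I \<Longrightarrow> h i \<in> HS" for h and I :: "nat set"
    using that unfolding HS_def by (auto simp: fps_sum_nth intro: H_sum)
  obtain M \<rho> where "mrep G M \<rho>" "inj_on \<rho> (carrier G)"
    "\<And>g i j. g \<in> carrier G \<Longrightarrow> i < M \<Longrightarrow> j < M \<Longrightarrow> \<rho> g $$ (i, j) \<in> C"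
  proof (rule G.mrep_of_module[OF C fD VD, of act])
    fix g v assume g: "g \<in> carrier G" and v: "v \<in> V"
    have "(\<Sum>l<N. \<sigma> g $$ (i, l) * F v l) \<in> HS" if "i < N" for i
      by (intro HSsum HS_mult) (use HS FHS g v that in auto)
    then show "act g v \<in> V" unfolding V_def act_def S_def HS_def H_def by auto
  next
    fix g v w assume "g \<in> carrier G" "v \<in> V" "w \<in> V"
    show "act g (\<lambda>s. v s + w s) = (\<lambda>s. act g v s + act g w s)"
      unfolding act_def Fadd by (auto simp: algebra_simps sum.distrib)
  next
    fix g v c assume "g \<in> carrier G" "v \<in> V" "c \<in> C"
    have "(\<Sum>l<N. \<sigma> g $$ (i, l) * F (\<lambda>s. c * v s) l) = fps_const c * (\<Sum>l<N. \<sigma> g $$ (i, l) * F v l)" for i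
      unfolding Fscale by (simp add: sum_distrib_left ac_simps)
    then show "act g (\<lambda>s. c * v s) = (\<lambda>s. c * act g v s)"
      unfolding act_def by auto
  next
    fix g h v assume gh: "g \<in> carrier G" "h \<in> carrier G" and v: "v \<in> V"
    have c: "\<sigma> g \<in> carrier_mat N N" "\<sigma> h \<in> carrier_mat N N" and m: "\<sigma> (g \<otimes>\<^bsub>G\<^esub> h) = \<sigma> g * \<sigma> h"
      using rep gh unfolding mrep_def by auto
    have "fps_nth (\<Sum>l<N. \<sigma> (g \<otimes>\<^bsub>G\<^esub> h) $$ (i, l) * F v l) j = fps_nth (\<Sum>m<N. \<sigma> g $$ (i, m) * F (act h v) m) j"
      if i: "i < N" and j: "j < K" for i j
    proof -
      have "(\<Sum>l<N. \<sigma> (g \<otimes>\<^bsub>G\<^esub> h) $$ (i, l) * F v l) = (\<Sum>l<N. \<Sum>m<N. \<sigma> g $$ (i, m) * (\<sigma> h $$ (m, l) * F v l))"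
        unfolding m using mat_mult_entry[OF c i] by (simp add: sum_distrib_right mult.assoc)
      also have "\<dots> = (\<Sum>m<N. \<sigma> g $$ (i, m) * (\<Sum>l<N. \<sigma> h $$ (m, l) * F v l))"
        unfolding sum_distrib_left by (rule sum.swap)
      finally have "fps_nth (\<Sum>l<N. \<sigma> (g \<otimes>\<^bsub>G\<^esub> h) $$ (i, l) * F v l) j
          = (\<Sum>m<N. fps_nth (\<sigma> g $$ (i, m) * (\<Sum>l<N. \<sigma> h $$ (m, l) * F v l)) j)"
        by (simp add: fps_sum_nth)
      \<comment> \<open>A coefficient of order \<open>j < K\<close> of a product involves only
        coefficients up to \<open>j\<close>, so the truncation of \<open>act h v\<close> at
        \<open>K\<close> is harmless.\<close>
      also have "\<dots> = (\<Sum>m<N. fps_nth (\<sigma> g $$ (i, m) * F (act h v) m) j)"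
      proof (rule sum.cong)
        fix m assume m: "m \<in> {..<N}"
        have "fps_nth (\<Sum>l<N. \<sigma> h $$ (m, l) * F v l) q = fps_nth (F (act h v) m) q" if "q \<le> j" for q
        proof -
          have "fps_nth (F (act h v) m) q = act h v (m, q)" by (simp add: F_def)
          then show ?thesis using m j that by (simp add: act_def)
        qed
        then show "fps_nth (\<sigma> g $$ (i, m) * (\<Sum>l<N. \<sigma> h $$ (m, l) * F v l)) j = fps_nth (\<sigma> g $$ (i, m) * F (act h v) m) j"
          unfolding fps_mult_nth by simp
      qed simp
      finally show ?thesis by (simp add: fps_sum_nth)
    qed
    then show "act (g \<otimes>\<^bsub>G\<^esub> h) v = act g (act h v)"
      unfolding act_def[of "g \<otimes>\<^bsub>G\<^esub> h"] act_def[of g] by (intro ext) auto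
  next
    fix v assume v: "v \<in> V"
    have "(\<Sum>l<N. \<sigma> \<one>\<^bsub>G\<^esub> $$ (i, l) * F v l) = F v i" if "i < N" for i
    proof -
      have "(\<Sum>l<N. \<sigma> \<one>\<^bsub>G\<^esub> $$ (i, l) * F v l) = (\<Sum>l<N. if l = i then F v l else 0)"
        using rep that unfolding mrep_def by (intro sum.cong) auto
      then show ?thesis using that by simp
    qed
    then show "act \<one>\<^bsub>G\<^esub> v = v"
      using v unfolding act_def V_def S_def F_def by (intro ext) auto
  next
    fix g assume g: "g \<in> carrier G" and triv: "\<And>v. v \<in> V \<Longrightarrow> act g v = v"
    show "g = \<one>\<^bsub>G\<^esub>"
    proof (rule faithful[OF g])
      fix i l j assume il: "i < N" "l < N" and j: "j < K"
      \<comment> \<open>The constant series 1 in position \<open>l\<close>; acting on it reads off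
        the \<open>l\<close>-th column of \<open>\<sigma> g\<close>.\<close>
      define w where "w s = (if s = (l, 0) then 1 else (0::'f))" for s :: "nat \<times> nat"
      have "1 \<in> C" "0 \<in> C" using C unfolding is_subfield_def by auto
      then have "w \<in> V" unfolding V_def w_def S_def using il K H_0 H_zero unfolding H_def by auto
      then have e: "act g w (i, j) = w (i, j)" using triv by simp
      have "F w m = (if m = l then 1 else 0)" for m unfolding F_def w_def by (rule fps_ext) auto
      then have "(\<Sum>m<N. \<sigma> g $$ (i, m) * F w m) = (\<Sum>m<N. if m = l then \<sigma> g $$ (i, m) else 0)"
        by (intro sum.cong) auto
      then have "act g w (i, j) = fps_nth (\<sigma> g $$ (i, l)) j" unfolding act_def using il j by simp
      then show "fps_nth (\<sigma> g $$ (i, l) - (if i = l then 1 else 0)) j = 0"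
        using e unfolding w_def by auto
    qed
  qed (blast intro: that)
  then show ?thesis using that by blast
qed

lemma finite_nat_set_chain:
  fixes J :: "nat set"
  assumes "\<not> (finite J \<and> card J \<le> r)"
  obtains k :: "nat \<Rightarrow> nat" where "\<And>i. i \<le> r \<Longrightarrow> k i \<in> J" "\<And>i j. i < j \<Longrightarrow> j \<le> r \<Longrightarrow> k i < k j"
proof -
  obtain K where K: "K \<subseteq> J" "finite K" "card K = Suc r"
  proof (cases "finite J")
    case True
    then have "Suc r \<le> card J" using assms by simp
    then show ?thesis using that by (metis obtain_subset_with_card_n)
  next
    case False
    then show ?thesis using that by (metis infinite_arbitrarily_large)
  qed
  define xs where "xs = sorted_list_of_set K"
  have xs: "length xs = Suc r" "set xs = K" "sorted_wrt (<) xs"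
    unfolding xs_def using K by auto
  show ?thesis
  proof (rule that[of "\<lambda>i. xs ! i"])
    show "xs ! i \<in> J" if "i \<le> r" for i using xs K(1) that nth_mem[of i xs] by auto
    show "xs ! i < xs ! j" if "i < j" "j \<le> r" for i j
      using sorted_wrt_nth_less[OF xs(3), of i j] that xs(1) by simp
  qed
qed

text \<open>With the point over the prime ring, the coefficients of the expansion are again
  polynomials in the variables over the prime ring, so they can be specialized a second
  time.\<close>

lemma (in specialization) coeffs_\<tau>:
  assumes "\<And>a. a \<in> set as \<Longrightarrow> \<phi> a \<in> gring {}" and "y \<in> gring (set as)"
  shows "coeffs_in (gring (set as)) (\<tau> y)"
  using assms(2)
proof (induction rule: gring.induct)
  case one
  have "\<tau> 1 = 1" using \<tau>(1) unfolding ring_hom_on_def by blast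
  then show ?case unfolding coeffs_in_def by (auto simp: coeff_1 intro: gring_zero gring.one)
next
  case (base a)
  have "\<phi> a \<in> gring (set as)" using assms(1)[OF base] gring_mono[of "{}" "set as"] by auto
  moreover from this have "a - \<phi> a \<in> gring (set as)"
    using gring.add[OF gring.base[OF base] gring.uminus] by fastforce
  ultimately show ?case unfolding coeffs_in_def \<tau>(2)[OF base]
    by (auto simp: coeff_pCons intro: gring_zero split: nat.splits)
next
  case (add x y)
  then have "\<tau> (x + y) = \<tau> x + \<tau> y" using \<tau>(1) unfolding ring_hom_on_def by blast
  then show ?case using add unfolding coeffs_in_def by (auto intro: gring.add)
next
  case (mult x y)
  then have "\<tau> (x * y) = \<tau> x * \<tau> y" using \<tau>(1) unfolding ring_hom_on_def by blast
  then show ?case using mult coeffs_in_gring_mult by metis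
next
  case (uminus x)
  then show ?case using ring_hom_on_uminus[OF \<tau>(1)] unfolding coeffs_in_def by (auto intro: gring.uminus)
qed

lemma ring_hom_on_of_int:
  assumes \<phi>: "ring_hom_on (gring A) \<phi>" shows "\<phi> (of_int z) = of_int z"
proof -
  have "\<phi> (of_nat n) = of_nat n" for n
  proof (induction n)
    case (Suc n)
    have "of_nat n \<in> gring A" using gring_of_int[of "int n"] by simp
    then have "\<phi> (1 + of_nat n) = \<phi> 1 + \<phi> (of_nat n)" using \<phi> gring.one unfolding ring_hom_on_def by blast
    then show ?case using Suc \<phi> unfolding ring_hom_on_def by simp
  qed (simp add: ring_hom_on_zero[OF \<phi>])
  moreover have "(of_nat n :: 'a) \<in> gring A" for n using gring_of_int[of "int n"] by simp
  ultimately show ?thesis using ring_hom_on_uminus[OF \<phi>] by (cases z) (auto simp del: of_nat_Suc)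
qed

text \<open>Two specializations occur. The first, at an integer point where \<open>f\<close> does
  not vanish, produces the power series. If more than \<open>r\<close> positive orders occurred, a
  second one, applied to the coefficients and keeping the chosen leading coefficients nonzero, would
  give rational series of the same orders, contrary to \<open>rank_bounds_orders\<close>. So orders
  are bounded, and a truncation is faithful.\<close>

lemma (in group) Q_linear_char_0:
  fixes \<sigma>0 :: "'a \<Rightarrow> 'f::field mat"
  assumes ch: "\<And>z::int. of_int z = (0::'f) \<longleftrightarrow> z = 0" and rk: "rank_le G r"
    and rep0: "mrep G n \<sigma>0" and inj0: "inj_on \<sigma>0 (carrier G)"
    and S: "finite S" "S \<subseteq> carrier G" "generate G S = carrier G"
  shows "Q_linear G"
proof -
  obtain as f N \<rho> where as: "indep as" and f: "f \<in> gring (set as)" "f \<noteq> (0::'f)"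
    and rep: "mrep G N \<rho>" and inj: "inj_on \<rho> (carrier G)"
    and loc: "\<forall>g\<in>carrier G. \<forall>i<N. \<forall>j<N. \<rho> g $$ (i, j) \<in> localization (gring (set as)) f"
    using rep_over_localization[OF rep0 inj0 S] by blast
  have ch': "of_int z = (0::'f) \<longleftrightarrow> of_int z = (0::rat)" for z using ch by simp
  have "infinite (range (of_int :: int \<Rightarrow> rat))" using finite_imageD[of of_int UNIV] by (auto simp: inj_on_def)
  from ring_hom_on_indep_nonzero[OF ch' as this f]
  obtain \<nu> :: "'f \<Rightarrow> rat" where \<nu>: "ring_hom_on (gring (set as)) \<nu>" "\<And>a. a \<in> set as \<Longrightarrow> \<nu> a \<in> range of_int" "\<nu> f \<noteq> 0"
    by blast
  \<comment> \<open>The integer point is found by specializing to the rationals and reused in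
    \<open>'f\<close>. Every polynomial takes the same integer value there in both fields; the
    nonzero integer value of \<open>f\<close> later survives the second specialization.\<close>
  define c where "c a = (SOME z::int. \<nu> a = of_int z)" for a
  have c: "\<nu> a = of_int (c a)" if "a \<in> set as" for a
    using \<nu>(2)[OF that] unfolding c_def by (metis (mono_tags, lifting) imageE someI_ex)
  obtain \<phi> :: "'f \<Rightarrow> 'f" where \<phi>: "ring_hom_on (gring (set as)) \<phi>" "\<And>a. a \<in> set as \<Longrightarrow> \<phi> a = of_int (c a)"
    using ring_hom_on_indep[OF _ as, of "\<lambda>a. of_int (c a)"] by blast
  have both: "\<exists>z::int. \<phi> y = of_int z \<and> \<nu> y = of_int z" if "y \<in> gring (set as)" for y
    using that
  proof (induction rule: gring.induct)
    case one
    then show ?case using \<phi>(1) \<nu>(1) unfolding ring_hom_on_def by (intro exI[of _ 1]) simp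
  next
    case (base a)
    then show ?case using \<phi>(2) c by blast
  next
    case (add x y)
    then obtain z w :: int where "\<phi> x = of_int z \<and> \<nu> x = of_int z" "\<phi> y = of_int w \<and> \<nu> y = of_int w" by blast
    then show ?case using \<phi>(1) \<nu>(1) add.hyps unfolding ring_hom_on_def by (intro exI[of _ "z + w"]) simp
  next
    case (mult x y)
    then obtain z w :: int where "\<phi> x = of_int z \<and> \<nu> x = of_int z" "\<phi> y = of_int w \<and> \<nu> y = of_int w" by blast
    then show ?case using \<phi>(1) \<nu>(1) mult.hyps unfolding ring_hom_on_def by (intro exI[of _ "z * w"]) simp
  next
    case (uminus x)
    then obtain z :: int where "\<phi> x = of_int z \<and> \<nu> x = of_int z" by blast
    then show ?case using ring_hom_on_uminus[OF \<phi>(1) uminus.hyps] ring_hom_on_uminus[OF \<nu>(1) uminus.hyps]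
      by (intro exI[of _ "- z"]) simp
  qed
  obtain z0 :: int where z0: "\<phi> f = of_int z0" "\<nu> f = of_int z0" using both[OF f(1)] by blast
  have z00: "z0 \<noteq> 0" using z0(2) \<nu>(3) by auto
  define C where "C = fractions (gring ({} :: 'f set))"
  have \<phi>gr: "\<phi> a \<in> gring {}" if "a \<in> set as" for a unfolding \<phi>(2)[OF that] by (rule gring_of_int)
  interpret sp: specialization as f C \<phi>
  proof
    show "is_subfield C" unfolding C_def by (rule is_subfield_fractions)
    show "\<phi> a \<in> C" if "a \<in> set as" for a using \<phi>gr[OF that] gring_subset_fractions unfolding C_def by blast
    show "\<phi> f \<noteq> 0" using z0(1) z00 ch by simp
  qed (use as f \<phi> in auto)
  define \<sigma> where "\<sigma> g = map_mat sp.T (\<rho> g)" for g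
  have \<rho>c: "\<rho> g \<in> carrier_mat N N" if "g \<in> carrier G" for g using rep that unfolding mrep_def by blast
  have \<sigma>: "mrep G N \<sigma>" unfolding \<sigma>_def
    by (rule mrep_map_mat[OF rep sp.T(1) sp.R_closed(1,3,4)]) (use loc in auto)
  have T1: "sp.T 1 = 1" using sp.T(1) unfolding ring_hom_on_def by blast
  define z where "z g i j = \<rho> g $$ (i, j) - (if i = j then 1 else 0)" for g i j
  have zR: "z g i j \<in> sp.R" if "g \<in> carrier G" "i < N" "j < N" for g i j
    using sp.R_closed(3)[of "\<rho> g $$ (i, j)" "- (if i = j then 1 else 0)"] sp.R_uminus[OF sp.R_closed(2)] sp.R_closed(1) loc that
    unfolding z_def by auto
  have dev: "\<sigma> g $$ (i, j) - (if i = j then 1 else 0) = sp.T (z g i j)" if "g \<in> carrier G" "i < N" "j < N" for g i j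
    using sp.T_diff[of "\<rho> g $$ (i, j)" "if i = j then 1 else 0"] sp.R_closed(1,2) loc that \<rho>c[OF that(1)] T1 sp.T_zero
    unfolding z_def \<sigma>_def by auto
  \<comment> \<open>The order of \<open>\<rho> g - 1\<close> after expansion. Order 0 is excluded
    because \<open>rank_bounds_orders\<close> speaks of elements congruent to 1 modulo the
    variable.\<close>
  define ord where "ord g k \<longleftrightarrow> k > 0 \<and> (\<forall>i<N. \<forall>j<N. \<forall>l<k. fps_nth (sp.T (z g i j)) l = 0) \<and>
      (\<exists>i<N. \<exists>j<N. fps_nth (sp.T (z g i j)) k \<noteq> 0)" for g k
  define J where "J = {k. \<exists>g\<in>carrier G. ord g k}"
  have J: "finite J \<and> card J \<le> r"
  proof (rule ccontr)
    assume "\<not> (finite J \<and> card J \<le> r)"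
    then obtain k :: "nat \<Rightarrow> nat" where k: "\<And>i. i \<le> r \<Longrightarrow> k i \<in> J" "\<And>i j. i < j \<Longrightarrow> j \<le> r \<Longrightarrow> k i < k j"
      using finite_nat_set_chain by blast
    have "\<exists>g. i \<le> r \<longrightarrow> g \<in> carrier G \<and> ord g (k i)" for i using k(1) unfolding J_def by blast
    then obtain g where g: "\<And>i. i \<le> r \<Longrightarrow> g i \<in> carrier G" "\<And>i. i \<le> r \<Longrightarrow> ord (g i) (k i)" by metis
    have "\<exists>u v. i \<le> r \<longrightarrow> u < N \<and> v < N \<and> fps_nth (sp.T (z (g i) u v)) (k i) \<noteq> 0" for i
      using g(2) unfolding ord_def by blast
    then obtain u v where uv: "\<And>i. i \<le> r \<Longrightarrow> u i < N" "\<And>i. i \<le> r \<Longrightarrow> v i < N"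
      "\<And>i. i \<le> r \<Longrightarrow> fps_nth (sp.T (z (g i) (u i) (v i))) (k i) \<noteq> 0" by metis
    have "\<exists>e. i \<le> r \<longrightarrow> z (g i) (u i) (v i) * f ^ e \<in> gring (set as)" for i
      using zR[OF g(1) uv(1,2)] unfolding localization_def by blast
    then obtain e where e: "\<And>i. i \<le> r \<Longrightarrow> z (g i) (u i) (v i) * f ^ e i \<in> gring (set as)" by metis
    \<comment> \<open>The leading coefficient at order \<open>k i\<close>, taken after clearing the
      denominator so that it lies in the polynomial ring. Clearing multiplies it by a nonzero
      constant only.\<close>
    define y where "y i = poly.coeff (sp.\<tau> (z (g i) (u i) (v i) * f ^ e i)) (k i)" for i
    have ygr: "y i \<in> gring (set as)" if "i \<le> r" for i
      using sp.coeffs_\<tau>[OF \<phi>gr e[OF that]] unfolding y_def coeffs_in_def by blast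
    have y0: "y i \<noteq> 0" if "i \<le> r" for i
    proof -
      have "fps_nth (sp.T (z (g i) (u i) (v i)) * fps_of_poly (sp.\<tau> f) ^ e i) (k i)
          = fps_nth (sp.T (z (g i) (u i) (v i))) (k i) * fps_nth (fps_of_poly (sp.\<tau> f) ^ e i) 0"
        by (rule fps_mult_low(2)) (use g(2)[OF that] uv(1,2)[OF that] in \<open>auto simp: ord_def\<close>)
      moreover have "fps_nth (fps_of_poly (sp.\<tau> f) ^ e i) 0 \<noteq> 0" using sp.\<tau>f by (simp add: fps_nth_power_0)
      ultimately show ?thesis using uv(3)[OF that] unfolding sp.T(2)[OF e[OF that]] y_def by simp
    qed
    have Y: "prod y {..r} \<in> gring (set as)" "prod y {..r} \<noteq> 0" using ygr y0 by (auto intro: gring_prod)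
    obtain \<epsilon> :: "'f \<Rightarrow> rat" where \<epsilon>: "ring_hom_on (gring (set as)) \<epsilon>" "\<epsilon> (prod y {..r}) \<noteq> 0"
      using ring_hom_on_indep_nonzero[OF ch' as \<open>infinite (range of_int)\<close> Y] by blast
    have \<epsilon>y: "\<epsilon> (y i) \<noteq> 0" if "i \<le> r" for i
    proof
      assume "\<epsilon> (y i) = 0"
      moreover have "prod y {..r} = y i * prod y ({..r} - {i})" using that by (simp add: prod.remove)
      moreover have "prod y ({..r} - {i}) \<in> gring (set as)" using ygr by (auto intro: gring_prod)
      ultimately show False using \<epsilon> ygr[OF that] unfolding ring_hom_on_def by simp
    qed
    define \<tau>e where "\<tau>e y = fps_of_poly (map_poly \<epsilon> (sp.\<tau> y))" for y
    have \<epsilon>0: "\<epsilon> 0 = 0" by (rule ring_hom_on_zero[OF \<epsilon>(1)])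
    have \<tau>e: "ring_hom_on (gring (set as)) \<tau>e"
      unfolding ring_hom_on_def
    proof (intro conjI ballI)
      have "sp.\<tau> 1 = 1" using sp.\<tau>(1) unfolding ring_hom_on_def by blast
      moreover have "map_poly \<epsilon> 1 = 1"
        by (rule poly_eqI) (use \<epsilon> \<epsilon>0 in \<open>auto simp: coeff_map_poly coeff_1 ring_hom_on_def\<close>)
      ultimately show "\<tau>e 1 = 1" unfolding \<tau>e_def by simp
      fix x y assume xy: "x \<in> gring (set as)" "y \<in> gring (set as)"
      have m: "sp.\<tau> (x + y) = sp.\<tau> x + sp.\<tau> y" "sp.\<tau> (x * y) = sp.\<tau> x * sp.\<tau> y"
        using sp.\<tau>(1) xy unfolding ring_hom_on_def by auto
      have cf: "coeffs_in (gring (set as)) (sp.\<tau> x)" "coeffs_in (gring (set as)) (sp.\<tau> y)"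
        using sp.coeffs_\<tau> \<phi>gr xy by blast+
      show "\<tau>e (x + y) = \<tau>e x + \<tau>e y" "\<tau>e (x * y) = \<tau>e x * \<tau>e y"
        unfolding \<tau>e_def m map_poly_ring_hom_on[OF \<epsilon>(1) cf] by (simp_all add: fps_of_poly_add fps_of_poly_mult)
    qed
    have nth\<tau>e: "fps_nth (\<tau>e y) l = \<epsilon> (poly.coeff (sp.\<tau> y) l)" for y l
      unfolding \<tau>e_def using \<epsilon>0 by (simp add: coeff_map_poly)
    have \<tau>ef: "fps_nth (\<tau>e f) 0 \<noteq> 0"
      unfolding nth\<tau>e using sp.\<tau>_0[OF f(1)] z0(1) z00 ring_hom_on_of_int[OF \<epsilon>(1)] by (simp add: poly_0_coeff_0)
    obtain Te where Te: "ring_hom_on sp.R Te" "\<And>y k. y * f ^ k \<in> gring (set as) \<Longrightarrow> Te y * \<tau>e f ^ k = \<tau>e (y * f ^ k)"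
      "\<And>y k. y * f ^ k \<in> gring (set as) \<Longrightarrow> Te y = \<tau>e (y * f ^ k) * inverse (\<tau>e f) ^ k"
      using ring_hom_on_localization[OF \<tau>e f inverse_mult_eq_1'[OF \<tau>ef]] by metis
    have Te1: "Te 1 = 1" using Te(1) unfolding ring_hom_on_def by blast
    have \<sigma>e: "mrep G N (\<lambda>g. map_mat Te (\<rho> g))"
      by (rule mrep_map_mat[OF rep Te(1) sp.R_closed(1,3,4)]) (use loc in auto)
    have Te0: "Te 0 = 0" using ring_hom_on_closed_sum[OF Te(1) sp.R_closed(1,3), of "{}"] by simp
    have deve: "map_mat Te (\<rho> g) $$ (i, j) - (if i = j then 1 else 0) = Te (z g i j)" if "g \<in> carrier G" "i < N" "j < N" for g i j
    proof -
      have "Te (z g i j + (if i = j then 1 else 0)) = Te (z g i j) + Te (if i = j then 1 else 0)"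
        using Te(1) zR[OF that] sp.R_closed(1,2) unfolding ring_hom_on_def by auto
      then show ?thesis using \<rho>c[OF that(1)] that Te1 Te0 unfolding z_def by auto
    qed
    show False
    proof (rule rank_bounds_orders[OF rk \<sigma>e, of g k])
      show "0 < k i" if "i \<le> r" for i using g(2)[OF that] unfolding ord_def by blast
      show "fps_nth (map_mat Te (\<rho> (g i)) $$ (a, b) - (if a = b then 1 else 0)) l = 0"
        if i: "i \<le> r" and ab: "a < N" "b < N" and l: "l < k i" for i a b l
      proof -
        obtain q where q: "z (g i) a b * f ^ q \<in> gring (set as)"
          using zR[OF g(1)[OF i] ab] unfolding localization_def by blast
        have "fps_nth (sp.T (z (g i) a b) * fps_of_poly (sp.\<tau> f) ^ q) l' = 0" if "l' < k i" for l'
          by (rule fps_mult_low(1)[of "k i"]) (use g(2)[OF i] ab that in \<open>auto simp: ord_def\<close>)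
        then have "poly.coeff (sp.\<tau> (z (g i) a b * f ^ q)) l' = 0" if "l' < k i" for l'
          unfolding sp.T(2)[OF q] using that by simp
        then have "fps_nth (\<tau>e (z (g i) a b * f ^ q)) l' = 0" if "l' < k i" for l'
          unfolding nth\<tau>e using \<epsilon>0 that by simp
        then show ?thesis unfolding deve[OF g(1)[OF i] ab] Te(3)[OF q]
          by (intro fps_mult_low(1)[OF _ l]) auto
      qed
      note low = this
      show "\<exists>a<N. \<exists>b<N. fps_nth (map_mat Te (\<rho> (g i)) $$ (a, b) - (if a = b then 1 else 0)) (k i) \<noteq> 0"
        if i: "i \<le> r" for i
      proof -
        have "fps_nth (Te (z (g i) (u i) (v i)) * \<tau>e f ^ e i) (k i)
            = fps_nth (Te (z (g i) (u i) (v i))) (k i) * fps_nth (\<tau>e f ^ e i) 0"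
          by (rule fps_mult_low(2)) (use low[OF i uv(1)[OF i] uv(2)[OF i]] deve[OF g(1)[OF i] uv(1,2)[OF i]] in auto)
        moreover have "fps_nth (Te (z (g i) (u i) (v i)) * \<tau>e f ^ e i) (k i) \<noteq> 0"
          unfolding Te(2)[OF e[OF i]] nth\<tau>e using \<epsilon>y[OF i] unfolding y_def .
        ultimately have "fps_nth (Te (z (g i) (u i) (v i))) (k i) \<noteq> 0" by auto
        then show ?thesis using deve[OF g(1)[OF i] uv(1,2)[OF i]] uv(1,2)[OF i] by metis
      qed
    qed (use g k in auto)
  qed
  \<comment> \<open>Larger than every positive order that occurs, where \<open>insert 0\<close>
    covers the case that there is none. Hence an element congruent to 1 below order \<open>K\<close>
    is \<open>\<one>\<close>.\<close>
  define K where "K = Suc (Max (insert 0 J))"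
  have faithful: "g = \<one>" if g: "g \<in> carrier G" and low: "\<And>i j l. i < N \<Longrightarrow> j < N \<Longrightarrow> l < K \<Longrightarrow>
      fps_nth (\<sigma> g $$ (i, j) - (if i = j then 1 else 0)) l = 0" for g
  proof (rule ccontr)
    assume ne: "g \<noteq> \<one>"
    have "\<exists>i<N. \<exists>j<N. z g i j \<noteq> 0"
    proof (rule ccontr)
      assume "\<not> ?thesis"
      then have "\<rho> g $$ (i, j) = (if i = j then 1 else 0)" if "i < N" "j < N" for i j
        using that unfolding z_def by (metis eq_iff_diff_eq_0)
      then have "\<rho> g = 1\<^sub>m N" using \<rho>c[OF g] by (intro eq_matI) auto
      then have "\<rho> g = \<rho> \<one>" using rep unfolding mrep_def by simp
      then show False using inj g ne by (auto dest: inj_onD)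
    qed
    then obtain i j where ij: "i < N" "j < N" "z g i j \<noteq> 0" by blast
    then have "sp.T (z g i j) \<noteq> 0" using sp.T_eq_0[OF zR[OF g ij(1,2)]] by blast
    then have ex: "\<exists>l. \<exists>i<N. \<exists>j<N. fps_nth (sp.T (z g i j)) l \<noteq> 0" using ij by (metis fps_nonzero_nth)
    define k where "k = (LEAST l. \<exists>i<N. \<exists>j<N. fps_nth (sp.T (z g i j)) l \<noteq> 0)"
    have k1: "\<exists>i<N. \<exists>j<N. fps_nth (sp.T (z g i j)) k \<noteq> 0" unfolding k_def by (rule LeastI_ex[OF ex])
    have k2: "fps_nth (sp.T (z g i j)) l = 0" if "l < k" "i < N" "j < N" for l i j
      using not_less_Least[OF that(1)[unfolded k_def]] that by blast
    have kK: "k \<ge> K" using k1 low dev[OF g] by (metis linorder_not_less)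
    then have "ord g k" unfolding ord_def K_def using k1 k2 by auto
    then have "k \<in> J" unfolding J_def using g by blast
    then have "k \<le> Max (insert 0 J)" using J by (intro Max_ge) auto
    then show False using kK unfolding K_def by simp
  qed
  have "\<sigma> g $$ (i, j) \<in> sp.HS" if "g \<in> carrier G" "i < N" "j < N" for g i j
    unfolding \<sigma>_def using sp.T_HS loc that \<rho>c[OF that(1)] by auto
  then obtain M \<rho>' where \<rho>': "mrep G M \<rho>'" "inj_on \<rho>' (carrier G)"
    "\<And>g i j. g \<in> carrier G \<Longrightarrow> i < M \<Longrightarrow> j < M \<Longrightarrow> \<rho>' g $$ (i, j) \<in> C"
    using sp.truncated_rep[OF is_group \<sigma>, of K] faithful K_def by (metis zero_less_Suc)
  then show ?thesis using Q_linear_of_prime_field_rep[OF ch \<rho>'(1,2)] unfolding C_def by blast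
qed

subsection \<open>Commuting \<open>p\<close>-powers of matrices\<close>

lemma linear_dependence_exists:
  fixes v :: "'i \<Rightarrow> 's \<Rightarrow> 'f::field"
  assumes "finite S" "finite I" "card I > card S"
  shows "\<exists>\<alpha>. (\<exists>i\<in>I. \<alpha> i \<noteq> 0) \<and> (\<forall>s\<in>S. (\<Sum>i\<in>I. \<alpha> i * v i s) = 0)"
  using assms
proof (induction S arbitrary: I v rule: finite_induct)
  case empty
  then obtain i where "i \<in> I" by (metis card.empty ex_in_conv less_nat_zero_code)
  then show ?case by (intro exI[of _ "\<lambda>_. 1"]) auto
next
  case (insert s0 S)
  show ?case
  proof (cases "\<exists>i\<in>I. v i s0 \<noteq> 0")
    case False
    have "card I > card S" using insert by simp
    then obtain \<alpha> where "\<exists>i\<in>I. \<alpha> i \<noteq> 0" "\<forall>s\<in>S. (\<Sum>i\<in>I. \<alpha> i * v i s) = 0"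
      using insert.IH[OF insert.prems(1)] by blast
    then show ?thesis using False by (intro exI[of _ \<alpha>]) auto
  next
    case True
    then obtain i0 where i0: "i0 \<in> I" "v i0 s0 \<noteq> 0" by blast
    define w where "w i s = v i s - v i s0 / v i0 s0 * v i0 s" for i s
    have "card (I - {i0}) > card S" using insert i0 by simp
    then obtain \<alpha> where \<alpha>: "\<exists>i\<in>I - {i0}. \<alpha> i \<noteq> 0" "\<forall>s\<in>S. (\<Sum>i\<in>I - {i0}. \<alpha> i * w i s) = 0"
      using insert.IH[of "I - {i0}" w] insert.prems(1) by blast
    define \<beta> where "\<beta> i = (if i = i0 then - (\<Sum>i\<in>I - {i0}. \<alpha> i * (v i s0 / v i0 s0)) else \<alpha> i)" for i
    have e: "(\<Sum>i\<in>I. \<beta> i * v i s) = (\<Sum>i\<in>I - {i0}. \<alpha> i * w i s)" for s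
    proof -
      have "(\<Sum>i\<in>I. \<beta> i * v i s) = \<beta> i0 * v i0 s + (\<Sum>i\<in>I - {i0}. \<beta> i * v i s)"
        using i0 insert.prems(1) by (simp add: sum.remove)
      also have "(\<Sum>i\<in>I - {i0}. \<beta> i * v i s) = (\<Sum>i\<in>I - {i0}. \<alpha> i * v i s)"
        by (rule sum.cong) (auto simp: \<beta>_def)
      finally show ?thesis
        by (simp add: \<beta>_def w_def right_diff_distrib sum_subtractf sum_distrib_right mult.assoc)
    qed
    have "(\<Sum>i\<in>I - {i0}. \<alpha> i * w i s0) = 0" using i0(2) by (simp add: w_def)
    then have "\<forall>s\<in>insert s0 S. (\<Sum>i\<in>I. \<beta> i * v i s) = 0" using \<alpha>(2) e by auto
    moreover have "\<exists>i\<in>I. \<beta> i \<noteq> 0" using \<alpha>(1) unfolding \<beta>_def by auto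
    ultimately show ?thesis by blast
  qed
qed

definition annihilates :: "'f::comm_ring_1 mat \<Rightarrow> nat \<Rightarrow> 'f poly \<Rightarrow> bool" where
  "annihilates A N q \<longleftrightarrow> (\<forall>u<N. \<forall>v<N. (\<Sum>k\<le>Polynomial.degree q. poly.coeff q k * (A ^\<^sub>m k) $$ (u, v)) = 0)"

lemma eval_mat_extend:
  fixes A :: "'f::comm_ring_1 mat"
  assumes "Polynomial.degree q \<le> n"
  shows "(\<Sum>k\<le>Polynomial.degree q. poly.coeff q k * (A ^\<^sub>m k) $$ (u, v)) = (\<Sum>k\<le>n. poly.coeff q k * (A ^\<^sub>m k) $$ (u, v))"
  by (rule sum.mono_neutral_left) (use assms in \<open>auto simp: coeff_eq_0\<close>)

text \<open>Polynomials vanishing at \<open>A\<close> form an ideal, so a relation may be replaced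
  by its powers.\<close>

lemma annihilates_mult:
  assumes A: "A \<in> carrier_mat N N" and q: "annihilates A N q"
  shows "annihilates A N (q * r)"
proof (induction r)
  case 0
  show ?case unfolding annihilates_def by simp
next
  case (pCons a r)
  define n where "n = max (Polynomial.degree (q * pCons a r)) (max (Polynomial.degree q) (Suc (Polynomial.degree (q * r))))"
  show ?case
    unfolding annihilates_def
  proof (intro allI impI)
    fix u v assume uv: "u < N" "v < N"
    have c: "poly.coeff (q * pCons a r) k = a * poly.coeff q k + (case k of 0 \<Rightarrow> 0 | Suc j \<Rightarrow> poly.coeff (q * r) j)" for k
      by (simp add: mult_pCons_right coeff_pCons)
    obtain n' where n': "n = Suc n'" "Polynomial.degree (q * r) \<le> n'" unfolding n_def
      by (metis max.cobounded2 max.coboundedI2 Suc_le_D Suc_le_mono)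
    have "(\<Sum>k\<le>Polynomial.degree (q * pCons a r). poly.coeff (q * pCons a r) k * (A ^\<^sub>m k) $$ (u, v))
        = (\<Sum>k\<le>n. poly.coeff (q * pCons a r) k * (A ^\<^sub>m k) $$ (u, v))"
      by (rule eval_mat_extend) (simp add: n_def)
    also have "\<dots> = a * (\<Sum>k\<le>n. poly.coeff q k * (A ^\<^sub>m k) $$ (u, v))
        + (\<Sum>k\<le>n. (case k of 0 \<Rightarrow> 0 | Suc j \<Rightarrow> poly.coeff (q * r) j) * (A ^\<^sub>m k) $$ (u, v))"
      unfolding c by (simp add: distrib_right sum.distrib sum_distrib_left mult.assoc)
    also have "(\<Sum>k\<le>n. poly.coeff q k * (A ^\<^sub>m k) $$ (u, v)) = 0"
      using q uv eval_mat_extend[of q n A u v] unfolding annihilates_def n_def by simp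
    also have "(\<Sum>k\<le>n. (case k of 0 \<Rightarrow> 0 | Suc j \<Rightarrow> poly.coeff (q * r) j) * (A ^\<^sub>m k) $$ (u, v))
        = (\<Sum>k\<le>n'. poly.coeff (q * r) k * (A ^\<^sub>m Suc k) $$ (u, v))"
      unfolding n'(1) by (subst sum.atMost_Suc_shift) simp
    also have "\<dots> = (\<Sum>k\<le>n'. \<Sum>w<N. poly.coeff (q * r) k * ((A ^\<^sub>m k) $$ (u, w) * A $$ (w, v)))"
      using mat_mult_entry[OF pow_carrier_mat[OF A] A uv] by (simp add: sum_distrib_left)
    also have "\<dots> = (\<Sum>w<N. (\<Sum>k\<le>n'. poly.coeff (q * r) k * (A ^\<^sub>m k) $$ (u, w)) * A $$ (w, v))"
      by (subst sum.swap) (simp add: sum_distrib_right mult.assoc)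
    also have "\<dots> = 0"
      using pCons(2) uv eval_mat_extend[OF n'(2), of A u] unfolding annihilates_def by (intro sum.neutral) auto
    finally show "(\<Sum>k\<le>Polynomial.degree (q * pCons a r). poly.coeff (q * pCons a r) k * (A ^\<^sub>m k) $$ (u, v)) = 0"
      by simp
  qed
qed

lemma annihilates_sum_monom:
  fixes A :: "'f::comm_ring_1 mat" and c :: "nat \<Rightarrow> 'f" and e :: "nat \<Rightarrow> nat"
  assumes "finite I"
  shows "annihilates A N (\<Sum>j\<in>I. Polynomial.monom (c j) (e j)) \<longleftrightarrow>
    (\<forall>u<N. \<forall>v<N. (\<Sum>j\<in>I. c j * (A ^\<^sub>m e j) $$ (u, v)) = 0)"
proof -
  define n where "n = max (Polynomial.degree (\<Sum>j\<in>I. Polynomial.monom (c j) (e j))) (Max (insert 0 (e ` I)))"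
  have en: "e j \<le> n" if "j \<in> I" for j
    unfolding n_def using assms that by (intro max.coboundedI2 Max_ge) auto
  have "(\<Sum>k\<le>Polynomial.degree (\<Sum>j\<in>I. Polynomial.monom (c j) (e j)). poly.coeff (\<Sum>j\<in>I. Polynomial.monom (c j) (e j)) k * (A ^\<^sub>m k) $$ (u, v))
      = (\<Sum>j\<in>I. c j * (A ^\<^sub>m e j) $$ (u, v))" for u v
  proof -
    have "(\<Sum>k\<le>Polynomial.degree (\<Sum>j\<in>I. Polynomial.monom (c j) (e j)). poly.coeff (\<Sum>j\<in>I. Polynomial.monom (c j) (e j)) k * (A ^\<^sub>m k) $$ (u, v))
      = (\<Sum>k\<le>n. \<Sum>j\<in>I. (if e j = k then c j else 0) * (A ^\<^sub>m k) $$ (u, v))"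
      by (subst eval_mat_extend[of _ n]) (auto simp: n_def coeff_sum sum_distrib_right)
    also have "\<dots> = (\<Sum>j\<in>I. \<Sum>k\<le>n. (if k = e j then c j * (A ^\<^sub>m k) $$ (u, v) else 0))"
      by (subst sum.swap) (auto intro!: sum.cong)
    also have "\<dots> = (\<Sum>j\<in>I. c j * (A ^\<^sub>m e j) $$ (u, v))" using en by (intro sum.cong) auto
    finally show ?thesis .
  qed
  then show ?thesis unfolding annihilates_def by simp
qed

text \<open>Raising an additive relation between the powers \<open>A, A^p, A^(p^2), \<dots>\<close> to the power \<open>p^s\<close>
  gives relations that express each sufficiently high \<open>p\<close>-power of \<open>A\<close> through higher ones.\<close>

lemma frobenius_relation:
  fixes A :: "'f::field mat"
  assumes A: "A \<in> carrier_mat N N" and p: "Factorial_Ring.prime CHAR('f)"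
  shows "\<exists>\<alpha> m. m \<le> N * N \<and> \<alpha> m \<noteq> (0::'f) \<and> (\<forall>s. \<forall>u<N. \<forall>v<N.
    (\<Sum>j\<in>{m..N*N}. \<alpha> j ^ (CHAR('f) ^ s) * (A ^\<^sub>m (CHAR('f) ^ (j + s))) $$ (u, v)) = 0)"
proof -
  let ?p = "CHAR('f)"
  \<comment> \<open>There are \<open>N * N + 1\<close> powers \<open>A^(p^j)\<close>, one more than
    the dimension of the space of matrices.\<close>
  have "card {0..N*N} > card ({..<N} \<times> {..<N})" by (simp add: card_cartesian_product)
  then obtain \<alpha> where \<alpha>: "\<exists>j\<in>{0..N*N}. \<alpha> j \<noteq> 0"
    "\<forall>s\<in>{..<N} \<times> {..<N}. (\<Sum>j\<in>{0..N*N}. \<alpha> j * (A ^\<^sub>m (?p ^ j)) $$ s) = 0"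
    using linear_dependence_exists[of "{..<N} \<times> {..<N}" "{0..N*N}" "\<lambda>j s. (A ^\<^sub>m (?p ^ j)) $$ s"] by auto
  \<comment> \<open>The lowest index with nonzero coefficient, so that each relation can be solved
    for its lowest power of \<open>A\<close>.\<close>
  define j0 where "j0 = (LEAST j. \<alpha> j \<noteq> 0)"
  obtain j1 where j1: "j1 \<le> N * N" "\<alpha> j1 \<noteq> 0" using \<alpha>(1) by auto
  have j0: "\<alpha> j0 \<noteq> 0" unfolding j0_def by (rule LeastI[of "\<lambda>j. \<alpha> j \<noteq> 0", OF j1(2)])
  have j0N: "j0 \<le> N * N" using Least_le[of "\<lambda>j. \<alpha> j \<noteq> 0", OF j1(2)] j1(1) unfolding j0_def by simp
  have j0l: "\<alpha> j = 0" if "j < j0" for j using not_less_Least[OF that[unfolded j0_def]] by blast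
  define L where "L = (\<Sum>j\<in>{0..N*N}. Polynomial.monom (\<alpha> j) (?p ^ j))"
  have annL: "annihilates A N L" unfolding L_def annihilates_sum_monom[OF finite_atLeastAtMost] using \<alpha>(2) by auto
  show ?thesis
  proof (intro exI[of _ \<alpha>] exI[of _ j0] conjI j0N j0 allI impI)
    fix s u v assume uv: "u < N" "v < N"
    have pp: "Factorial_Ring.prime CHAR('f poly)" using p by simp
    have "L ^ (?p ^ s) = (\<Sum>j\<in>{0..N*N}. Polynomial.monom (\<alpha> j) (?p ^ j) ^ (?p ^ s))"
      unfolding L_def by (rule freshmans_dream_sum'[OF pp]) simp
    also have "\<dots> = (\<Sum>j\<in>{0..N*N}. Polynomial.monom (\<alpha> j ^ (?p ^ s)) (?p ^ (j + s)))"
      by (simp add: monom_power power_add)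
    finally have e: "L ^ (?p ^ s) = (\<Sum>j\<in>{0..N*N}. Polynomial.monom (\<alpha> j ^ (?p ^ s)) (?p ^ (j + s)))" .
    have p0: "?p ^ s > 0" using p prime_gt_0_nat by simp
    have "annihilates A N (L * L ^ (?p ^ s - 1))" by (rule annihilates_mult[OF A annL])
    also have "L * L ^ (?p ^ s - 1) = L ^ (?p ^ s)" using p0 by (metis power_eq_if less_numeral_extra(3))
    finally have "(\<Sum>j\<in>{0..N*N}. \<alpha> j ^ (?p ^ s) * (A ^\<^sub>m (?p ^ (j + s))) $$ (u, v)) = 0"
      unfolding e annihilates_sum_monom[OF finite_atLeastAtMost] using uv by blast
    moreover have "(\<Sum>j\<in>{0..N*N}. \<alpha> j ^ (?p ^ s) * (A ^\<^sub>m (?p ^ (j + s))) $$ (u, v))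
        = (\<Sum>j\<in>{j0..N*N}. \<alpha> j ^ (?p ^ s) * (A ^\<^sub>m (?p ^ (j + s))) $$ (u, v))"
      by (rule sum.mono_neutral_right) (use j0l p0 in auto)
    ultimately show "(\<Sum>j\<in>{j0..N*N}. \<alpha> j ^ (?p ^ s) * (A ^\<^sub>m (?p ^ (j + s))) $$ (u, v)) = 0" by simp
  qed
qed

text \<open>Taking \<open>s = l - j0\<close>, the lowest term of the relation is
  \<open>A^(p^l)\<close> with nonzero coefficient, and the other terms are higher
  \<open>p\<close>-powers of \<open>A\<close>, which already commute with \<open>W\<close>. The
  exponent descends one by one as far as \<open>N * N\<close>, the bound for
  \<open>j0\<close>.\<close>

lemma p_power_commute_descend:
  fixes A W :: "'f::field mat"
  assumes A: "A \<in> carrier_mat N N" and W: "W \<in> carrier_mat N N" and p: "Factorial_Ring.prime CHAR('f)"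
    and c: "\<And>m. m \<ge> i \<Longrightarrow> W * A ^\<^sub>m (CHAR('f) ^ m) = A ^\<^sub>m (CHAR('f) ^ m) * W"
    and m: "m \<ge> N * N"
  shows "W * A ^\<^sub>m (CHAR('f) ^ m) = A ^\<^sub>m (CHAR('f) ^ m) * W"
proof -
  let ?p = "CHAR('f)"
  obtain \<alpha> j0 where j0: "j0 \<le> N * N" "\<alpha> j0 \<noteq> (0::'f)" and rel0:
    "\<forall>s. \<forall>u<N. \<forall>v<N. (\<Sum>j\<in>{j0..N*N}. \<alpha> j ^ (?p ^ s) * (A ^\<^sub>m (?p ^ (j + s))) $$ (u, v)) = 0"
    using frobenius_relation[OF A p] by (elim exE conjE)
  have rel: "\<And>s u v. u < N \<Longrightarrow> v < N \<Longrightarrow> (\<Sum>j\<in>{j0..N*N}. \<alpha> j ^ (?p ^ s) * (A ^\<^sub>m (?p ^ (j + s))) $$ (u, v)) = 0"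
    using rel0 by blast
  have Ac: "A ^\<^sub>m k \<in> carrier_mat N N" for k by (rule pow_carrier_mat[OF A])
  have step: "W * A ^\<^sub>m (?p ^ l) = A ^\<^sub>m (?p ^ l) * W"
    if l: "l \<ge> N * N" and up: "\<And>m. m > l \<Longrightarrow> W * A ^\<^sub>m (?p ^ m) = A ^\<^sub>m (?p ^ m) * W" for l
  proof (rule eq_matI)
    fix u v assume "u < dim_row (A ^\<^sub>m (?p ^ l) * W)" "v < dim_col (A ^\<^sub>m (?p ^ l) * W)"
    then have uv: "u < N" "v < N" using A W Ac by auto
    define s where "s = l - j0"
    define c where "c j = \<alpha> j ^ (?p ^ s)" for j
    define B where "B j = A ^\<^sub>m (?p ^ (j + s))" for j
    have Bc: "B j \<in> carrier_mat N N" for j unfolding B_def by (rule Ac)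
    have ls: "j0 + s = l" using l j0(1) unfolding s_def by simp
    have "(\<Sum>j\<in>{j0..N*N}. c j * (W * B j) $$ (u, v)) = (\<Sum>j\<in>{j0..N*N}. \<Sum>w<N. W $$ (u, w) * (c j * B j $$ (w, v)))"
      unfolding mat_mult_entry[OF W Bc uv] by (simp add: sum_distrib_left ac_simps)
    also have "\<dots> = (\<Sum>w<N. W $$ (u, w) * (\<Sum>j\<in>{j0..N*N}. c j * B j $$ (w, v)))"
      by (subst sum.swap) (simp add: sum_distrib_left)
    also have "\<dots> = 0" using rel uv unfolding c_def B_def by (intro sum.neutral) auto
    finally have 1: "(\<Sum>j\<in>{j0..N*N}. c j * (W * B j) $$ (u, v)) = 0" .
    have "(\<Sum>j\<in>{j0..N*N}. c j * (B j * W) $$ (u, v)) = (\<Sum>j\<in>{j0..N*N}. \<Sum>w<N. (c j * B j $$ (u, w)) * W $$ (w, v))"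
      unfolding mat_mult_entry[OF Bc W uv] by (simp add: sum_distrib_left ac_simps)
    also have "\<dots> = (\<Sum>w<N. (\<Sum>j\<in>{j0..N*N}. c j * B j $$ (u, w)) * W $$ (w, v))"
      by (subst sum.swap) (simp add: sum_distrib_right)
    also have "\<dots> = 0" using rel uv unfolding c_def B_def by (intro sum.neutral) auto
    finally have 2: "(\<Sum>j\<in>{j0..N*N}. c j * (B j * W) $$ (u, v)) = 0" .
    have "(\<Sum>j\<in>{j0..N*N}. c j * ((W * B j) $$ (u, v) - (B j * W) $$ (u, v))) = 0"
      using 1 2 by (simp add: right_diff_distrib sum_subtractf)
    moreover have "(\<Sum>j\<in>{j0..N*N}. c j * ((W * B j) $$ (u, v) - (B j * W) $$ (u, v)))
        = c j0 * ((W * B j0) $$ (u, v) - (B j0 * W) $$ (u, v))"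
    proof -
      have "c j * ((W * B j) $$ (u, v) - (B j * W) $$ (u, v)) = 0" if "j \<in> {j0..N*N} - {j0}" for j
        using up[of "j + s"] that ls unfolding B_def by auto
      then show ?thesis using j0(1) by (subst sum.remove[of _ j0]) (auto intro!: sum.neutral simp del: mult_eq_0_iff)
    qed
    moreover have "c j0 \<noteq> 0" using j0(2) unfolding c_def by simp
    ultimately have "(W * B j0) $$ (u, v) = (B j0 * W) $$ (u, v)" by simp
    then show "(W * A ^\<^sub>m (?p ^ l)) $$ (u, v) = (A ^\<^sub>m (?p ^ l) * W) $$ (u, v)" unfolding B_def ls .
  qed (use A W Ac in auto)
  have "\<forall>m\<ge>max (N * N) (i - d). W * A ^\<^sub>m (?p ^ m) = A ^\<^sub>m (?p ^ m) * W" for d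
  proof (induction d)
    case 0
    then show ?case using c by auto
  next
    case (Suc d)
    show ?case
    proof (intro allI impI)
      fix m assume m: "m \<ge> max (N * N) (i - Suc d)"
      show "W * A ^\<^sub>m (?p ^ m) = A ^\<^sub>m (?p ^ m) * W"
      proof (rule step)
        show "N * N \<le> m" using m by simp
        fix m' assume "m < m'"
        then have "m' \<ge> max (N * N) (i - d)" using m by auto
        then show "W * A ^\<^sub>m (?p ^ m') = A ^\<^sub>m (?p ^ m') * W" using Suc by blast
      qed
    qed
  qed
  from this[of i] show ?thesis using m by simp
qed

text \<open>The descent is used twice: first for \<open>g\<close> against high powers of
  \<open>h\<close>, then for \<open>h\<close> against the power of \<open>g\<close> so obtained. The
  resulting exponent no longer depends on \<open>i\<close>.\<close>

lemma (in group) p_powers_commute_uniform: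
  fixes \<rho> :: "'a \<Rightarrow> 'f::field mat"
  assumes rep: "mrep G N \<rho>" and inj: "inj_on \<rho> (carrier G)" and p: "Factorial_Ring.prime CHAR('f)"
    and g: "g \<in> carrier G" and h: "h \<in> carrier G"
    and c: "g [^] (CHAR('f) ^ i) \<otimes> h [^] (CHAR('f) ^ i) = h [^] (CHAR('f) ^ i) \<otimes> g [^] (CHAR('f) ^ i)"
  shows "g [^] (CHAR('f) ^ (N * N)) \<otimes> h [^] (CHAR('f) ^ (N * N)) = h [^] (CHAR('f) ^ (N * N)) \<otimes> g [^] (CHAR('f) ^ (N * N))"
proof -
  let ?p = "CHAR('f)"
  have comm_iff: "x \<otimes> y = y \<otimes> x \<longleftrightarrow> \<rho> x * \<rho> y = \<rho> y * \<rho> x" if "x \<in> carrier G" "y \<in> carrier G" for x y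
    using rep inj that unfolding mrep_def by (metis inj_onD m_closed)
  have \<rho>c: "\<rho> x \<in> carrier_mat N N" if "x \<in> carrier G" for x using rep that unfolding mrep_def by blast
  have pw: "g [^] (?p ^ m) \<otimes> h [^] (?p ^ m') = h [^] (?p ^ m') \<otimes> g [^] (?p ^ m)" if "m \<ge> i" "m' \<ge> i" for m m'
  proof -
    have "g [^] (?p ^ m) = (g [^] (?p ^ i)) [^] (?p ^ (m - i))" "h [^] (?p ^ m') = (h [^] (?p ^ i)) [^] (?p ^ (m' - i))"
      using that g h by (simp_all add: nat_pow_pow power_add[symmetric])
    moreover have "(g [^] (?p ^ i)) \<otimes> (h [^] (?p ^ i)) [^] (?p ^ (m' - i)) = (h [^] (?p ^ i)) [^] (?p ^ (m' - i)) \<otimes> g [^] (?p ^ i)"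
      by (rule commute_nat_pow[OF c]) (use g h in auto)
    ultimately show ?thesis
      using commute_nat_pow[of "(h [^] (?p ^ i)) [^] (?p ^ (m' - i))" "g [^] (?p ^ i)" "?p ^ (m - i)"] g h by simp
  qed
  have 1: "g [^] (?p ^ m) \<otimes> h [^] (?p ^ m') = h [^] (?p ^ m') \<otimes> g [^] (?p ^ m)" if "m \<ge> N * N" "m' \<ge> i" for m m'
  proof -
    have "\<rho> (h [^] (?p ^ m')) * \<rho> g ^\<^sub>m (?p ^ m) = \<rho> g ^\<^sub>m (?p ^ m) * \<rho> (h [^] (?p ^ m'))"
    proof (rule p_power_commute_descend[OF \<rho>c[OF g] _ p _ that(1)])
      show "\<rho> (h [^] (?p ^ m')) * \<rho> g ^\<^sub>m (?p ^ m) = \<rho> g ^\<^sub>m (?p ^ m) * \<rho> (h [^] (?p ^ m'))" if "m \<ge> i" for m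
        using pw[OF that \<open>m' \<ge> i\<close>] comm_iff[of "g [^] (?p ^ m)" "h [^] (?p ^ m')"] g h mrep_pow[OF rep g] by simp
    qed (use \<rho>c h in auto)
    then show ?thesis using comm_iff[of "g [^] (?p ^ m)" "h [^] (?p ^ m')"] g h mrep_pow[OF rep g] by simp
  qed
  have "\<rho> (g [^] (?p ^ (N * N))) * \<rho> h ^\<^sub>m (?p ^ (N * N)) = \<rho> h ^\<^sub>m (?p ^ (N * N)) * \<rho> (g [^] (?p ^ (N * N)))"
  proof (rule p_power_commute_descend[OF \<rho>c[OF h] _ p])
    show "\<rho> (g [^] (?p ^ (N * N))) * \<rho> h ^\<^sub>m (?p ^ m) = \<rho> h ^\<^sub>m (?p ^ m) * \<rho> (g [^] (?p ^ (N * N)))" if "m \<ge> i" for m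
      using 1[OF order_refl that] comm_iff[of "g [^] (?p ^ (N * N))" "h [^] (?p ^ m)"] g h mrep_pow[OF rep h] by simp
  qed (use \<rho>c g in auto)
  then show ?thesis using comm_iff[of "g [^] (?p ^ (N * N))" "h [^] (?p ^ (N * N))"] g h mrep_pow[OF rep h] by simp
qed

subsection \<open>Congruence subgroups\<close>

definition fps_cong :: "nat \<Rightarrow> nat \<Rightarrow> 'a::comm_ring_1 fps mat \<Rightarrow> 'a fps mat \<Rightarrow> bool" where
  "fps_cong N k A B \<longleftrightarrow> (\<forall>i<N. \<forall>j<N. \<forall>l<k. fps_nth (A $$ (i, j)) l = fps_nth (B $$ (i, j)) l)"

lemma fps_cong_refl: "fps_cong N k A A"
  unfolding fps_cong_def by simp

lemma fps_cong_sym: "fps_cong N k A B \<Longrightarrow> fps_cong N k B A"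
  unfolding fps_cong_def by simp

lemma fps_cong_mult:
  assumes "A \<in> carrier_mat N N" "A' \<in> carrier_mat N N" "B \<in> carrier_mat N N" "B' \<in> carrier_mat N N"
    and "fps_cong N k A A'" "fps_cong N k B B'"
  shows "fps_cong N k (A * B) (A' * B')"
  unfolding fps_cong_def
proof (intro allI impI)
  fix i j l assume ij: "i < N" "j < N" and l: "l < k"
  show "fps_nth ((A * B) $$ (i, j)) l = fps_nth ((A' * B') $$ (i, j)) l"
    unfolding mat_mult_entry[OF assms(1,3) ij] mat_mult_entry[OF assms(2,4) ij] fps_sum_nth fps_mult_nth
    using assms(5,6) ij l unfolding fps_cong_def by (intro sum.cong) auto
qed

text \<open>With \<open>A = 1 + X\<close> and \<open>B = 1 + Y\<close> one has
  \<open>A B - B A = X Y - Y X\<close>, and both products have order at least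
  \<open>k + 1\<close>.\<close>

lemma fps_cong_commute:
  assumes A: "A \<in> carrier_mat N N" and B: "B \<in> carrier_mat N N"
    and a: "fps_cong N 1 A (1\<^sub>m N)" and b: "fps_cong N k B (1\<^sub>m N)"
  shows "fps_cong N (Suc k) (A * B) (B * A)"
  unfolding fps_cong_def
proof (intro allI impI)
  fix i j l assume ij: "i < N" "j < N" and l: "l < Suc k"
  define X' where "X' i j = A $$ (i, j) - (if i = j then 1 else 0)" for i j
  define Y' where "Y' i j = B $$ (i, j) - (if i = j then 1 else 0)" for i j
  have X0: "fps_nth (X' i j) l = 0" if "i < N" "j < N" "l < 1" for i j l
    using a that unfolding X'_def fps_cong_def by auto
  have Y0: "fps_nth (Y' i j) l = 0" if "i < N" "j < N" "l < k" for i j l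
    using b that unfolding Y'_def fps_cong_def by auto
  have "(A * B) $$ (i, j) - (B * A) $$ (i, j) = (\<Sum>m<N. X' i m * Y' m j) - (\<Sum>m<N. Y' i m * X' m j)"
  proof -
    have 1: "(A * B) $$ (i, j) = (\<Sum>m<N. X' i m * Y' m j) + X' i j + Y' i j + (if i = j then 1 else 0)"
    proof -
      have "(A * B) $$ (i, j) = (\<Sum>m<N. (X' i m + (if i = m then 1 else 0)) * (Y' m j + (if m = j then 1 else 0)))"
        unfolding mat_mult_entry[OF A B ij] X'_def Y'_def by simp
      also have "\<dots> = (\<Sum>m<N. X' i m * Y' m j) + (\<Sum>m<N. X' i m * (if m = j then 1 else 0))
          + (\<Sum>m<N. (if i = m then 1 else 0) * Y' m j) + (\<Sum>m<N. (if i = m then 1 else 0) * (if m = j then 1 else 0))"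
        by (simp add: algebra_simps sum.distrib)
      also have "(\<Sum>m<N. X' i m * (if m = j then 1 else 0)) = X' i j"
        using ij by (simp add: if_distrib[of "\<lambda>x. _ * x"] cong: if_cong)
      also have "(\<Sum>m<N. (if i = m then 1 else 0) * Y' m j) = Y' i j"
        using ij by (simp add: if_distrib[of "\<lambda>x. x * _"] cong: if_cong)
      also have "(\<Sum>m<N. (if i = m then 1 else 0) * (if m = j then 1 else 0)) = (if i = j then 1 else (0::'a fps))"
        using ij by (simp add: if_distrib[of "\<lambda>x. x * _"] cong: if_cong)
      finally show ?thesis .
    qed
    have 2: "(B * A) $$ (i, j) = (\<Sum>m<N. Y' i m * X' m j) + Y' i j + X' i j + (if i = j then 1 else 0)"
    proof -
      have "(B * A) $$ (i, j) = (\<Sum>m<N. (Y' i m + (if i = m then 1 else 0)) * (X' m j + (if m = j then 1 else 0)))"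
        unfolding mat_mult_entry[OF B A ij] X'_def Y'_def by simp
      also have "\<dots> = (\<Sum>m<N. Y' i m * X' m j) + (\<Sum>m<N. Y' i m * (if m = j then 1 else 0))
          + (\<Sum>m<N. (if i = m then 1 else 0) * X' m j) + (\<Sum>m<N. (if i = m then 1 else 0) * (if m = j then 1 else 0))"
        by (simp add: algebra_simps sum.distrib)
      also have "(\<Sum>m<N. Y' i m * (if m = j then 1 else 0)) = Y' i j"
        using ij by (simp add: if_distrib[of "\<lambda>x. _ * x"] cong: if_cong)
      also have "(\<Sum>m<N. (if i = m then 1 else 0) * X' m j) = X' i j"
        using ij by (simp add: if_distrib[of "\<lambda>x. x * _"] cong: if_cong)
      also have "(\<Sum>m<N. (if i = m then 1 else 0) * (if m = j then 1 else 0)) = (if i = j then 1 else (0::'a fps))"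
        using ij by (simp add: if_distrib[of "\<lambda>x. x * _"] cong: if_cong)
      finally show ?thesis .
    qed
    show ?thesis unfolding 1 2 by simp
  qed
  moreover have "fps_nth (X' i m * Y' m j) l = 0" "fps_nth (Y' i m * X' m j) l = 0" if m: "m < N" for m
  proof -
    have "fps_nth (X' i m) q * fps_nth (Y' m j) (l - q) = 0" "fps_nth (Y' i m) (l - q) * fps_nth (X' m j) q = 0" if "q \<le> l" for q
      using X0[of i m q] X0[of m j q] Y0[of m j "l - q"] Y0[of i m "l - q"] ij m l that
      by (cases "q = 0"; simp)+
    then show "fps_nth (X' i m * Y' m j) l = 0" unfolding fps_mult_nth by (intro sum.neutral) auto
    have "fps_nth (X' m j * Y' i m) l = 0" unfolding fps_mult_nth
      using \<open>\<And>q. q \<le> l \<Longrightarrow> fps_nth (Y' i m) (l - q) * fps_nth (X' m j) q = 0\<close>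
      by (intro sum.neutral) (auto simp: mult.commute)
    then show "fps_nth (Y' i m * X' m j) l = 0" by (simp add: mult.commute)
  qed
  ultimately have "fps_nth ((A * B) $$ (i, j) - (B * A) $$ (i, j)) l = 0" by (simp add: fps_sum_nth)
  then show "fps_nth ((A * B) $$ (i, j)) l = fps_nth ((B * A) $$ (i, j)) l" by simp
qed

text \<open>The middle binomial coefficients vanish, so \<open>(1 + D)^p = 1 + D^p\<close>, and
  \<open>D^p\<close> has order at least \<open>p k\<close>.\<close>

lemma fps_cong_frobenius:
  fixes A :: "'a::idom fps mat"
  assumes A: "A \<in> carrier_mat N N" and p: "Factorial_Ring.prime CHAR('a)" and k: "fps_cong N k A (1\<^sub>m N)"
  shows "fps_cong N (CHAR('a) * k) (A ^\<^sub>m CHAR('a)) (1\<^sub>m N)"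
proof -
  let ?p = "CHAR('a)"
  define D where "D = A - 1\<^sub>m N"
  have D: "D \<in> carrier_mat N N" unfolding D_def using A by auto
  have AD: "A = 1\<^sub>m N + D" unfolding D_def using A by (intro eq_matI) auto
  have low: "fps_nth (D $$ (u, v)) l = 0" if "u < N" "v < N" "l < k" for u v l
    using k that A unfolding fps_cong_def D_def by auto
  show ?thesis
    unfolding fps_cong_def
  proof (intro allI impI)
    fix i j l assume ij: "i < N" "j < N" and l: "l < ?p * k"
    have z: "of_nat (?p choose q) * (D ^\<^sub>m q) $$ (i, j) = 0" if "q \<in> {..?p} - {0, ?p}" for q
    proof -
      have "?p dvd (?p choose q)" using that p by (intro dvd_choose_prime) auto
      then have "(of_nat (?p choose q) :: 'a fps) = 0"
        by (metis of_nat_eq_0_iff_char_dvd semiring_char_fps)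
      then show ?thesis by simp
    qed
    have "(A ^\<^sub>m ?p) $$ (i, j) = (\<Sum>q\<in>{..?p}. of_nat (?p choose q) * (D ^\<^sub>m q) $$ (i, j))"
      unfolding AD by (rule mat_binomial[OF D ij])
    also have "\<dots> = (\<Sum>q\<in>{0, ?p}. of_nat (?p choose q) * (D ^\<^sub>m q) $$ (i, j))"
      by (rule sum.mono_neutral_right) (use z in auto)
    also have "\<dots> = 1\<^sub>m N $$ (i, j) + (D ^\<^sub>m ?p) $$ (i, j)" using p D ij by simp
    finally show "fps_nth ((A ^\<^sub>m ?p) $$ (i, j)) l = fps_nth (1\<^sub>m N $$ (i, j)) l"
      using mat_pow_low_zero[OF D low ij l] by simp
  qed
qed

definition congruence_subgroup :: "('g, 'b) monoid_scheme \<Rightarrow> nat \<Rightarrow> ('g \<Rightarrow> 'a::comm_ring_1 fps mat) \<Rightarrow> nat \<Rightarrow> 'g set" where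
  "congruence_subgroup G N \<sigma> k = {g \<in> carrier G. fps_cong N k (\<sigma> g) (1\<^sub>m N)}"

context group
begin

lemma congruence_iff:
  assumes rep: "mrep G N \<sigma>" and a: "a \<in> carrier G" and b: "b \<in> carrier G"
  shows "a \<otimes> inv b \<in> congruence_subgroup G N \<sigma> k \<longleftrightarrow> fps_cong N k (\<sigma> a) (\<sigma> b)"
proof -
  have c: "\<sigma> x \<in> carrier_mat N N" if "x \<in> carrier G" for x using rep that unfolding mrep_def by blast
  have m: "\<sigma> (x \<otimes> y) = \<sigma> x * \<sigma> y" if "x \<in> carrier G" "y \<in> carrier G" for x y using rep that unfolding mrep_def by blast
  have 1: "\<sigma> \<one> = 1\<^sub>m N" using rep unfolding mrep_def by blast
  show ?thesis
  proof
    assume "a \<otimes> inv b \<in> congruence_subgroup G N \<sigma> k"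
    then have "fps_cong N k (\<sigma> (a \<otimes> inv b)) (1\<^sub>m N)" unfolding congruence_subgroup_def by blast
    then have "fps_cong N k (\<sigma> (a \<otimes> inv b) * \<sigma> b) (1\<^sub>m N * \<sigma> b)"
      using a b by (intro fps_cong_mult c fps_cong_refl) auto
    moreover have "\<sigma> (a \<otimes> inv b) * \<sigma> b = \<sigma> a"
      using a b m[of "a \<otimes> inv b" b] by (simp add: m_assoc)
    ultimately show "fps_cong N k (\<sigma> a) (\<sigma> b)" using c[OF b] by simp
  next
    assume "fps_cong N k (\<sigma> a) (\<sigma> b)"
    then have "fps_cong N k (\<sigma> a * \<sigma> (inv b)) (\<sigma> b * \<sigma> (inv b))"
      using a b by (intro fps_cong_mult c fps_cong_refl) auto
    then show "a \<otimes> inv b \<in> congruence_subgroup G N \<sigma> k"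
      unfolding congruence_subgroup_def using a b m[of a "inv b"] m[of b "inv b"] 1 by simp
  qed
qed

lemma congruence_subgroup_normal:
  assumes rep: "mrep G N \<sigma>"
  shows "congruence_subgroup G N \<sigma> k \<lhd> G"
proof -
  have c: "\<sigma> x \<in> carrier_mat N N" if "x \<in> carrier G" for x using rep that unfolding mrep_def by blast
  have m: "\<sigma> (x \<otimes> y) = \<sigma> x * \<sigma> y" if "x \<in> carrier G" "y \<in> carrier G" for x y using rep that unfolding mrep_def by blast
  have 1: "\<sigma> \<one> = 1\<^sub>m N" using rep unfolding mrep_def by blast
  have mem: "x \<in> congruence_subgroup G N \<sigma> k \<longleftrightarrow> x \<in> carrier G \<and> fps_cong N k (\<sigma> x) (\<sigma> \<one>)" for x
    unfolding congruence_subgroup_def 1 by simp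
  have sub: "subgroup (congruence_subgroup G N \<sigma> k) G"
  proof (rule subgroupI)
    show "congruence_subgroup G N \<sigma> k \<subseteq> carrier G" unfolding congruence_subgroup_def by blast
    show "congruence_subgroup G N \<sigma> k \<noteq> {}" using mem fps_cong_refl by blast
    fix a assume a: "a \<in> congruence_subgroup G N \<sigma> k"
    then have "fps_cong N k (\<sigma> \<one>) (\<sigma> a)" "a \<in> carrier G" using mem fps_cong_sym by auto
    then have "\<one> \<otimes> inv a \<in> congruence_subgroup G N \<sigma> k" using congruence_iff[OF rep] by blast
    then show "inv a \<in> congruence_subgroup G N \<sigma> k" using \<open>a \<in> carrier G\<close> by simp
    fix b assume b: "b \<in> congruence_subgroup G N \<sigma> k"
    have "fps_cong N k (\<sigma> a * \<sigma> b) (\<sigma> \<one> * \<sigma> \<one>)" by (intro fps_cong_mult c) (use a b mem in auto)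
    then show "a \<otimes> b \<in> congruence_subgroup G N \<sigma> k" using a b mem m 1 by simp
  qed
  show ?thesis
  proof (rule normal_invI[OF sub])
    fix x h assume x: "x \<in> carrier G" and h: "h \<in> congruence_subgroup G N \<sigma> k"
    have hc: "h \<in> carrier G" using h mem by blast
    have "fps_cong N k (\<sigma> x * \<sigma> h) (\<sigma> x * \<sigma> \<one>)" by (intro fps_cong_mult c fps_cong_refl) (use x h mem in auto)
    then have "fps_cong N k (\<sigma> (x \<otimes> h)) (\<sigma> x)" using m[OF x hc] m[OF x one_closed] x by simp
    then show "x \<otimes> h \<otimes> inv x \<in> congruence_subgroup G N \<sigma> k" using congruence_iff[OF rep, of "x \<otimes> h" x] x hc by simp
  qed
qed

lemma congruence_filtration:
  fixes \<sigma> :: "'a \<Rightarrow> 'c::idom fps mat"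
  assumes rep: "mrep G N \<sigma>" and one: "congruence_subgroup G N \<sigma> 1 = carrier G"
    and p: "Factorial_Ring.prime CHAR('c)"
  shows "p_filtration CHAR('c) (congruence_subgroup G N \<sigma>)"
proof -
  have c: "\<sigma> x \<in> carrier_mat N N" if "x \<in> carrier G" for x using rep that unfolding mrep_def by blast
  have m: "\<sigma> (x \<otimes> y) = \<sigma> x * \<sigma> y" if "x \<in> carrier G" "y \<in> carrier G" for x y using rep that unfolding mrep_def by blast
  have "cmod (congruence_subgroup G N \<sigma> (Suc k)) x y" if x: "x \<in> carrier G" and y: "y \<in> congruence_subgroup G N \<sigma> k" for k x y
  proof -
    have yc: "y \<in> carrier G" "fps_cong N k (\<sigma> y) (1\<^sub>m N)" using y unfolding congruence_subgroup_def by auto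
    have "fps_cong N 1 (\<sigma> x) (1\<^sub>m N)" using x one unfolding congruence_subgroup_def by blast
    then have "fps_cong N (Suc k) (\<sigma> (x \<otimes> y)) (\<sigma> (y \<otimes> x))"
      unfolding m[OF x yc(1)] m[OF yc(1) x] by (intro fps_cong_commute c x yc)
    then have "(x \<otimes> y) \<otimes> inv (y \<otimes> x) \<in> congruence_subgroup G N \<sigma> (Suc k)"
      using congruence_iff[OF rep, of "x \<otimes> y" "y \<otimes> x"] x yc by simp
    moreover have "(x \<otimes> y) \<otimes> inv (y \<otimes> x) = x \<otimes> y \<otimes> inv x \<otimes> inv y" using x yc by (simp add: inv_mult_group m_assoc)
    ultimately show ?thesis unfolding cmod_def by simp
  qed
  moreover have "x [^] CHAR('c) \<in> congruence_subgroup G N \<sigma> (CHAR('c) * k)" if "x \<in> congruence_subgroup G N \<sigma> k" for x k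
    using that fps_cong_frobenius[OF c p, of x k] mrep_pow[OF rep] unfolding congruence_subgroup_def by auto
  moreover have "congruence_subgroup G N \<sigma> (Suc k) \<subseteq> congruence_subgroup G N \<sigma> k" for k
    unfolding congruence_subgroup_def fps_cong_def by auto
  ultimately show ?thesis
    unfolding p_filtration_def central_filtration_def using congruence_subgroup_normal[OF rep] one by blast
qed

text \<open>The coset of an element is determined by the coefficients of its entries below order
  \<open>k\<close>, which range over finite sets.\<close>

lemma congruence_finite_index:
  assumes rep: "mrep G N \<sigma>"
    and fin: "\<And>l. finite (H l)" and e: "\<And>g i j l. g \<in> carrier G \<Longrightarrow> i < N \<Longrightarrow> j < N \<Longrightarrow> fps_nth (\<sigma> g $$ (i, j)) l \<in> H l"
  obtains R where "finite R" "R \<subseteq> carrier G" "carrier G = (\<Union>\<rho>\<in>R. congruence_subgroup G N \<sigma> k #> \<rho>)"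
proof -
  let ?I = "{..<N} \<times> {..<N} \<times> {..<k}"
  define t where "t g = (\<lambda>(i, j, l)\<in>?I. fps_nth (\<sigma> g $$ (i, j)) l)" for g
  have "t g \<in> PiE ?I (\<lambda>x. H (snd (snd x)))" if "g \<in> carrier G" for g
    unfolding t_def using e[OF that] by (auto simp: PiE_def extensional_def)
  then have "t ` carrier G \<subseteq> PiE ?I (\<lambda>x. H (snd (snd x)))" by blast
  moreover have "finite (PiE ?I (\<lambda>x. H (snd (snd x))))" using fin by (intro finite_PiE) auto
  ultimately have ft: "finite (t ` carrier G)" using finite_subset by blast
  define s where "s v = (SOME g. g \<in> carrier G \<and> t g = v)" for v
  have s: "s (t g) \<in> carrier G" "t (s (t g)) = t g" if "g \<in> carrier G" for g
    using someI[of "\<lambda>h. h \<in> carrier G \<and> t h = t g" g] that unfolding s_def by auto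
  have sub: "subgroup (congruence_subgroup G N \<sigma> k) G" using normal_imp_subgroup[OF congruence_subgroup_normal[OF rep]] .
  show ?thesis
  proof (rule that[of "s ` t ` carrier G"])
    show "finite (s ` t ` carrier G)" using ft by simp
    show Rc: "s ` t ` carrier G \<subseteq> carrier G" using s by auto
    show "carrier G = (\<Union>\<rho>\<in>s ` t ` carrier G. congruence_subgroup G N \<sigma> k #> \<rho>)"
    proof
      show "carrier G \<subseteq> (\<Union>\<rho>\<in>s ` t ` carrier G. congruence_subgroup G N \<sigma> k #> \<rho>)"
      proof
        fix g assume g: "g \<in> carrier G"
        have "fps_cong N k (\<sigma> g) (\<sigma> (s (t g)))"
          unfolding fps_cong_def
        proof (intro allI impI)
          fix i j l assume "i < N" "j < N" "l < k"
          then show "fps_nth (\<sigma> g $$ (i, j)) l = fps_nth (\<sigma> (s (t g)) $$ (i, j)) l"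
            using fun_cong[OF s(2)[OF g], of "(i, j, l)"] unfolding t_def by simp
        qed
        then have "g \<otimes> inv (s (t g)) \<in> congruence_subgroup G N \<sigma> k" using congruence_iff[OF rep g] s(1)[OF g] by blast
        then have "g \<in> congruence_subgroup G N \<sigma> k #> s (t g)"
          using subgroup.rcos_module_rev[OF sub is_group s(1)[OF g] g] by simp
        then show "g \<in> (\<Union>\<rho>\<in>s ` t ` carrier G. congruence_subgroup G N \<sigma> k #> \<rho>)" using g by blast
      qed
      show "(\<Union>\<rho>\<in>s ` t ` carrier G. congruence_subgroup G N \<sigma> k #> \<rho>) \<subseteq> carrier G"
        using Rc r_coset_subset_G[OF subgroup.subset[OF sub]] by blast
    qed
  qed
qed

end

text \<open>A measure of complexity for matrices of rational functions: \<open>d\<close> and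
  \<open>c\<close> add under products, hence grow linearly under powers.\<close>

definition numerators :: "nat \<Rightarrow> 'f::field fps \<Rightarrow> 'f fps mat \<Rightarrow> nat \<Rightarrow> nat \<Rightarrow> bool" where
  "numerators N F A d c \<longleftrightarrow> (\<forall>i<N. \<forall>j<N. \<exists>P. Polynomial.degree P \<le> d \<and> A $$ (i, j) * F ^ c = fps_of_poly P)"

lemma numerators_mult:
  assumes A: "A \<in> carrier_mat N N" and B: "B \<in> carrier_mat N N"
    and nA: "numerators N F A d c" and nB: "numerators N F B d' c'"
  shows "numerators N F (A * B) (d + d') (c + c')"
  unfolding numerators_def
proof (intro allI impI)
  fix i j assume ij: "i < N" "j < N"
  have "\<forall>m. \<exists>P. m < N \<longrightarrow> Polynomial.degree P \<le> d \<and> A $$ (i, m) * F ^ c = fps_of_poly P"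
    using nA ij unfolding numerators_def by blast
  then obtain P where P: "\<And>m. m < N \<Longrightarrow> Polynomial.degree (P m) \<le> d \<and> A $$ (i, m) * F ^ c = fps_of_poly (P m)" by metis
  have "\<forall>m. \<exists>P. m < N \<longrightarrow> Polynomial.degree P \<le> d' \<and> B $$ (m, j) * F ^ c' = fps_of_poly P"
    using nB ij unfolding numerators_def by blast
  then obtain Q where Q: "\<And>m. m < N \<Longrightarrow> Polynomial.degree (Q m) \<le> d' \<and> B $$ (m, j) * F ^ c' = fps_of_poly (Q m)" by metis
  have "(A * B) $$ (i, j) * F ^ (c + c') = (\<Sum>m<N. (A $$ (i, m) * F ^ c) * (B $$ (m, j) * F ^ c'))"
    unfolding mat_mult_entry[OF A B ij] by (simp add: sum_distrib_left power_add ac_simps)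
  also have "\<dots> = fps_of_poly (\<Sum>m<N. P m * Q m)" using P Q by (simp add: fps_of_poly_sum fps_of_poly_mult)
  finally have "(A * B) $$ (i, j) * F ^ (c + c') = fps_of_poly (\<Sum>m<N. P m * Q m)" .
  moreover have "Polynomial.degree (\<Sum>m<N. P m * Q m) \<le> d + d'"
    using P Q by (intro degree_sum_le) (auto intro: order_trans[OF degree_mult_le] add_mono)
  ultimately show "\<exists>P. Polynomial.degree P \<le> d + d' \<and> (A * B) $$ (i, j) * F ^ (c + c') = fps_of_poly P" by blast
qed

lemma numerators_power:
  assumes A: "A \<in> carrier_mat N N" and nA: "numerators N F A d c"
  shows "numerators N F (A ^\<^sub>m q) (d * q) (c * q)"
proof (induction q)
  case 0
  have "\<exists>P. Polynomial.degree P \<le> 0 \<and> (if i = j then 1 else 0) * (F :: 'a fps) ^ 0 = fps_of_poly P" for i j :: nat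
    by (rule exI[of _ "if i = j then 1 else 0"]) auto
  then show ?case using A unfolding numerators_def by simp
next
  case (Suc q)
  show ?case using numerators_mult[OF pow_carrier_mat[OF A] A Suc nA] by (simp add: add.commute)
qed

text \<open>Multiplied by \<open>F ^ c\<close>, both entries become polynomials of degree at most
  \<open>d < k\<close> that agree in all coefficients below \<open>k\<close>.\<close>

lemma numerators_cong_eq:
  assumes A: "numerators N F A d c" and B: "numerators N F B d c" and AB: "fps_cong N k A B" and k: "k > d"
    and F: "F \<noteq> 0" and ij: "i < N" "j < N"
  shows "A $$ (i, j) = B $$ (i, j)"
proof -
  obtain P where P: "Polynomial.degree P \<le> d" "A $$ (i, j) * F ^ c = fps_of_poly P" using A ij unfolding numerators_def by blast
  obtain Q where Q: "Polynomial.degree Q \<le> d" "B $$ (i, j) * F ^ c = fps_of_poly Q" using B ij unfolding numerators_def by blast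
  have "P = Q"
  proof (rule poly_eqI)
    fix l
    show "poly.coeff P l = poly.coeff Q l"
    proof (cases "l < k")
      case True
      have "fps_nth (A $$ (i, j) * F ^ c) l = fps_nth (B $$ (i, j) * F ^ c) l"
        unfolding fps_mult_nth using AB ij True unfolding fps_cong_def by (intro sum.cong) auto
      then show ?thesis unfolding P(2) Q(2) by simp
    next
      case False
      then show ?thesis using P(1) Q(1) k by (simp add: coeff_eq_0)
    qed
  qed
  then have "A $$ (i, j) * F ^ c = B $$ (i, j) * F ^ c" using P Q by simp
  then show ?thesis using F by simp
qed

subsection \<open>The case of positive characteristic\<close>

lemma frobenius_iterate:
  fixes z :: "'f::comm_ring_1"
  assumes "z ^ (p ^ i) = z" shows "z ^ (p ^ (i * j)) = z"
proof (induction j)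
  case (Suc j)
  have "z ^ (p ^ (i * Suc j)) = (z ^ (p ^ i)) ^ (p ^ (i * j))" by (simp add: power_mult[symmetric] power_add)
  then show ?case using assms Suc by simp
qed simp

text \<open>The set is the union of the finite subfields. Were it finite, one Frobenius power
  \<open>z^q\<close> would fix all of it. But a root \<open>w\<close> of \<open>X^q - X - 1\<close>
  satisfies \<open>w^(q^j) = w + j\<close>, hence \<open>w^(q^p) = w\<close>, so \<open>w\<close>
  belongs to the set although \<open>w^q = w + 1\<close>.\<close>

lemma infinite_finite_order_elements:
  assumes p: "Factorial_Ring.prime CHAR('f::alg_closed_field)"
  shows "infinite {z::'f. \<exists>i>0. z ^ (CHAR('f) ^ i) = z}" (is "infinite ?K")
proof
  let ?p = "CHAR('f)"
  assume fin: "finite ?K"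
  define e where "e z = (SOME i. i > 0 \<and> z ^ (?p ^ i) = z)" for z :: 'f
  have e: "e z > 0 \<and> z ^ (?p ^ e z) = z" if "z \<in> ?K" for z
    unfolding e_def by (rule someI_ex) (use that in blast)
  define m where "m = (\<Prod>z\<in>?K. e z)"
  have m0: "m > 0" unfolding m_def using e by (intro prod_pos) blast
  have fixed: "z ^ (?p ^ m) = z" if "z \<in> ?K" for z
  proof -
    have "m = e z * (\<Prod>z\<in>?K - {z}. e z)" unfolding m_def using fin that by (rule prod.remove)
    then show ?thesis using frobenius_iterate[of z ?p "e z"] e[OF that] by simp
  qed
  let ?q = "?p ^ m"
  have q: "?q > 1" by (rule one_less_power[OF prime_gt_1_nat[OF p] m0])
  have q0: "?q > 0" "CHAR('f) > 0" using q prime_gt_0_nat[OF p] by auto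
  define P where "P = Polynomial.monom 1 ?q - [:1, 1:: 'f:]"
  have "Polynomial.coeff P ?q = 1" using q q0 m0 unfolding P_def by (simp add: coeff_pCons split: nat.splits)
  then have "Polynomial.degree P \<ge> ?q" by (intro le_degree) simp
  then have "Polynomial.degree P > 0" using q by simp
  then obtain w where "poly P w = 0" using alg_closed_imp_poly_has_root by blast
  then have w: "w ^ ?q = w + 1" unfolding P_def by (simp add: poly_monom algebra_simps)
  have "w ^ (?q ^ j) = w + of_nat j" for j
  proof (induction j)
    case (Suc j)
    have "w ^ (?q ^ Suc j) = (w ^ (?q ^ j)) ^ ?q" by (simp add: power_mult[symmetric] mult.commute)
    also have "\<dots> = (w + of_nat j) ^ ?q" using Suc by simp
    also have "\<dots> = w ^ ?q + of_nat j ^ ?q" by (rule freshmans_dream'[OF p]) simp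
    also have "(of_nat j :: 'f) ^ ?q = of_nat j"
    proof (induction j)
      case 0
      then show ?case using q0 by simp
    next
      case (Suc j)
      have "(1 + of_nat j :: 'f) ^ ?q = 1 ^ ?q + of_nat j ^ ?q" by (rule freshmans_dream'[OF p]) simp
      then show ?case using Suc by simp
    qed
    finally show ?case using w by (simp add: algebra_simps)
  qed simp
  then have "w ^ (?q ^ ?p) = w" by simp
  then have "w ^ (?p ^ (m * ?p)) = w" by (simp add: power_mult)
  then have "w \<in> ?K" using m0 prime_gt_0_nat[OF p] by (intro CollectI exI[of _ "m * ?p"]) simp
  from fixed[OF this] show False using w by simp
qed

lemma frobenius_fixed_field:
  assumes p: "Factorial_Ring.prime CHAR('f::field)" and m: "m > 0"
  shows "is_subfield {z::'f. z ^ (CHAR('f) ^ m) = z}" "finite {z::'f. z ^ (CHAR('f) ^ m) = z}"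
proof -
  let ?q = "CHAR('f) ^ m"
  have q: "?q > 1" by (rule one_less_power[OF prime_gt_1_nat[OF p] m])
  have q0: "?q > 0" "CHAR('f) > 0" using q prime_gt_0_nat[OF p] by auto
  have add: "(x + y) ^ ?q = x ^ ?q + y ^ ?q" for x y :: 'f by (rule freshmans_dream'[OF p]) simp
  have neg: "(- x) ^ ?q = - (x ^ ?q)" for x :: 'f
  proof -
    have "(x + - x) ^ ?q = x ^ ?q + (- x) ^ ?q" by (rule add)
    then have "x ^ ?q + (- x) ^ ?q = 0" using q0 by (simp add: zero_power)
    then show ?thesis by (rule minus_unique[symmetric])
  qed
  show "is_subfield {z::'f. z ^ ?q = z}"
    unfolding is_subfield_def using q0 add neg by (auto simp: power_mult_distrib power_inverse)
  define P where "P = Polynomial.monom 1 ?q - [:0, 1:: 'f:]"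
  have "Polynomial.coeff P ?q = 1" using q q0 m unfolding P_def by (simp add: coeff_pCons split: nat.splits)
  then have "P \<noteq> 0" by auto
  then have "finite {z. poly P z = 0}" by (rule poly_roots_finite)
  moreover have "poly P z = 0 \<longleftrightarrow> z ^ ?q = z" for z unfolding P_def by (simp add: poly_monom)
  ultimately show "finite {z::'f. z ^ ?q = z}" by simp
qed

lemma finite_kspan:
  assumes "finite K" "finite W" shows "finite (kspan K W)"
proof -
  have "kspan K W \<subseteq> (\<lambda>u. \<Sum>w\<in>W. u w * w) ` (W \<rightarrow>\<^sub>E K)"
  proof
    fix y assume "y \<in> kspan K W"
    then obtain u where u: "y = (\<Sum>w\<in>W. u w * w)" "\<forall>w\<in>W. u w \<in> K" unfolding kspan_def by blast
    have "y = (\<Sum>w\<in>W. (restrict u W) w * w)" unfolding u(1) by (rule sum.cong) auto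
    then show "y \<in> (\<lambda>u. \<Sum>w\<in>W. u w * w) ` (W \<rightarrow>\<^sub>E K)" using u(2) by (intro image_eqI[of _ _ "restrict u W"]) auto
  qed
  then show ?thesis using assms by (meson finite_PiE finite_imageI finite_subset)
qed

text \<open>The subgroup \<open>A\<close> generated by the \<open>q\<close>-th powers is abelian. The index of \<open>A \<Gamma> k\<close> is bounded
  independently of \<open>k\<close>, so some \<open>\<Gamma> k\<close> lies in the closure of \<open>A\<close>.\<close>

lemma (in group) filtration_eventually_abelian:
  assumes \<Gamma>: "central_filtration \<Gamma>" and sep: "\<And>x. (\<And>k. x \<in> \<Gamma> k) \<Longrightarrow> x = \<one>"
    and fin: "\<And>k. finite (rcosets (\<Gamma> k))" and rk: "rank_le G r" and q: "q > (0::nat)"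
    and comm: "\<And>x y. x \<in> carrier G \<Longrightarrow> y \<in> carrier G \<Longrightarrow> x [^] q \<otimes> y [^] q = y [^] q \<otimes> x [^] q"
  obtains k where "\<And>x y. x \<in> \<Gamma> k \<Longrightarrow> y \<in> \<Gamma> k \<Longrightarrow> x \<otimes> y = y \<otimes> x"
proof -
  define A where "A = generate G ((\<lambda>x. x [^] q) ` carrier G)"
  have A: "A \<lhd> G" unfolding A_def by (rule normal_generate_pow[OF carrier_normal])
  have As: "subgroup A G" by (rule normal_imp_subgroup[OF A])
  note cf = \<Gamma>[unfolded central_filtration_def]
  have \<Gamma>n: "\<Gamma> k \<lhd> G" for k using cf by blast
  have \<Gamma>s: "subgroup (\<Gamma> k) G" for k using normal_imp_subgroup[OF \<Gamma>n] .
  have \<Gamma>mono: "\<Gamma> j \<subseteq> \<Gamma> i" if "i \<le> j" for i j using central_filtration_antimono[OF \<Gamma> that] .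
  define B where "B k = A <#> \<Gamma> k" for k
  have B: "B k \<lhd> G" for k unfolding B_def by (rule normal_set_mult[OF A \<Gamma>n])
  have Bs: "subgroup (B k) G" for k by (rule normal_imp_subgroup[OF B])
  have Bmono: "B j \<subseteq> B i" if "i \<le> j" for i j unfolding B_def by (rule mono_set_mult) (use \<Gamma>mono that in auto)
  have AB: "A \<subseteq> B k" "\<Gamma> k \<subseteq> B k" for k unfolding B_def using set_mult_left[OF As \<Gamma>s] set_mult_right[OF As \<Gamma>s] by auto
  \<comment> \<open>The quotient by \<open>B k\<close> is finite, has rank at most \<open>r\<close>
    and is killed by \<open>q\<close>, so its order is bounded independently of \<open>k\<close>;
    \<open>S\<close> represents distinct cosets in it.\<close>
  have bound: "card S \<le> (q ^ r) ^ r * q ^ r"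
    if S: "finite S" "S \<subseteq> carrier G" "\<And>s t. s \<in> S \<Longrightarrow> t \<in> S \<Longrightarrow> s \<noteq> t \<Longrightarrow> s \<otimes> inv t \<notin> B k" for S k
  proof -
    interpret N: normal "B k" G by (rule B)
    interpret h: group_hom G "G Mod (B k)" "\<lambda>x. B k #> x"
      using N.factorgroup_is_group N.r_coset_hom_Mod is_group by (simp add: group_hom_axioms_def group_hom_def)
    have surj: "(\<lambda>x. B k #> x) ` carrier G = carrier (G Mod B k)" by (simp add: carrier_FactGroup)
    have fq: "finite (carrier (G Mod B k))"
    proof -
      define s where "s c = (SOME g. g \<in> c)" for c :: "'a set"
      have "carrier (G Mod B k) \<subseteq> (\<lambda>c. B k #> s c) ` (rcosets (\<Gamma> k))"
      proof
        fix d assume "d \<in> carrier (G Mod B k)"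
        then obtain g where g: "g \<in> carrier G" "d = B k #> g" unfolding surj[symmetric] by blast
        let ?c = "\<Gamma> k #> g"
        have c: "?c \<in> rcosets (\<Gamma> k)" using rcosetsI[OF subgroup.subset[OF \<Gamma>s] g(1)] .
        have "g \<in> ?c" by (rule rcos_self[OF g(1) \<Gamma>s])
        then have "s ?c \<in> ?c" unfolding s_def by (rule someI)
        then obtain \<gamma> where \<gamma>: "\<gamma> \<in> \<Gamma> k" "s ?c = \<gamma> \<otimes> g" unfolding r_coset_def by blast
        then have "s ?c \<in> B k #> g" unfolding r_coset_def using AB by blast
        then have "d = B k #> s ?c" unfolding g(2) by (rule repr_independence[OF _ g(1) Bs])
        then show "d \<in> (\<lambda>c. B k #> s c) ` (rcosets (\<Gamma> k))" using c by blast
      qed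
      then show ?thesis using fin[of k] finite_subset by blast
    qed
    have "card (carrier (G Mod B k)) \<le> (q ^ r) ^ r * q ^ r"
    proof (rule h.H.card_bound_of_exponent[OF _ fq _ _ q])
      show "rank_le (G Mod B k) r" by (rule rank_le_hom_image[OF h.group_hom_axioms surj rk])
      show "h.H.central_filtration (\<lambda>i. (\<lambda>x. B k #> x) ` \<Gamma> i)"
        by (rule central_filtration_hom_image[OF h.group_hom_axioms surj \<Gamma>])
      have triv: "B k #> x = B k" if "x \<in> B k" for x
        by (rule coset_join2[OF _ Bs that]) (use that N.mem_carrier in auto)
      show "(\<lambda>x. B k #> x) ` \<Gamma> k = {\<one>\<^bsub>G Mod B k\<^esub>}"
      proof -
        have "(\<lambda>x. B k #> x) ` \<Gamma> k = (\<lambda>x. B k) ` \<Gamma> k" using triv AB(2)[of k] by (intro image_cong) auto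
        also have "\<dots> = {B k}" using subgroup.one_closed[OF \<Gamma>s[of k]] by (simp add: image_constant_conv) blast
        finally show ?thesis by simp
      qed
      fix d assume "d \<in> carrier (G Mod B k)"
      then obtain g where g: "g \<in> carrier G" "d = B k #> g" unfolding surj[symmetric] by blast
      have "g [^] q \<in> B k" using AB(1) g(1) unfolding A_def by (auto intro: generate.incl)
      then show "d [^]\<^bsub>G Mod B k\<^esub> q = \<one>\<^bsub>G Mod B k\<^esub>"
        unfolding g(2) h.hom_nat_pow[OF g(1), symmetric] one_FactGroup by (rule triv)
    qed
    moreover have "card S \<le> card (carrier (G Mod B k))"
    proof (rule card_inj_on_le[OF _ _ fq])
      show "inj_on (\<lambda>x. B k #> x) S"
        using S rcos_eq_iff[OF Bs] by (intro inj_onI) blast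
      show "(\<lambda>x. B k #> x) ` S \<subseteq> carrier (G Mod B k)" using S(2) surj by blast
    qed
    ultimately show ?thesis by simp
  qed
  \<comment> \<open>A pair with \<open>S\<close> as large as possible marks the place from which the
    index of \<open>B k\<close> no longer grows.\<close>
  define P where "P = (\<lambda>(S, k). finite S \<and> S \<subseteq> carrier G \<and> (\<forall>s\<in>S. \<forall>t\<in>S. s \<noteq> t \<longrightarrow> s \<otimes> inv t \<notin> B k))"
  have P0: "P ({\<one>}, 0)" unfolding P_def by auto
  have "\<forall>x. P x \<longrightarrow> card (fst x) < Suc ((q ^ r) ^ r * q ^ r)" using bound unfolding P_def by (fastforce simp: less_Suc_eq_le)
  from ex_has_greatest_nat[of P "({\<one>}, 0)" "\<lambda>x. card (fst x)", OF P0 this]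
  obtain S k where Sk: "P (S, k)" and max: "\<And>S' k'. P (S', k') \<Longrightarrow> card S' \<le> card S" by auto
  have S: "finite S" "S \<subseteq> carrier G" "\<And>s t. s \<in> S \<Longrightarrow> t \<in> S \<Longrightarrow> s \<noteq> t \<Longrightarrow> s \<otimes> inv t \<notin> B k"
    using Sk unfolding P_def by auto
  have "card S \<ge> 1" using max[OF P0] by simp
  then obtain s0 where s0: "s0 \<in> S" by fastforce
  have s0c: "s0 \<in> carrier G" using s0 S by blast
  \<comment> \<open>An element \<open>g\<close> of \<open>\<Gamma> k\<close> outside
    \<open>B k'\<close> would provide the new representative \<open>g \<otimes> s0\<close> modulo
    \<open>B k'\<close>, against the maximality of \<open>S\<close>.\<close>
  have key: "\<Gamma> k \<subseteq> B k'" if k': "k' \<ge> k" for k'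
  proof (rule ccontr)
    assume "\<not> \<Gamma> k \<subseteq> B k'"
    then obtain g where g: "g \<in> \<Gamma> k" "g \<notin> B k'" by blast
    have gc: "g \<in> carrier G" using g subgroup.mem_carrier[OF \<Gamma>s] by blast
    have gB: "g \<in> B k" using g AB by blast
    have ns: "g \<otimes> s0 \<otimes> inv s \<notin> B k'" if s: "s \<in> S" for s
    proof (cases "s = s0")
      case True
      then show ?thesis using g gc s0c by (simp add: m_assoc)
    next
      case False
      have sc: "s \<in> carrier G" using s S by blast
      show ?thesis
      proof
        assume "g \<otimes> s0 \<otimes> inv s \<in> B k'"
        then have "g \<otimes> s0 \<otimes> inv s \<in> B k" using Bmono[OF k'] by blast
        then have "inv g \<otimes> (g \<otimes> s0 \<otimes> inv s) \<in> B k"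
          using subgroup.m_closed[OF Bs subgroup.m_inv_closed[OF Bs gB]] by blast
        then have "s0 \<otimes> inv s \<in> B k" using gc s0c sc by (simp add: m_assoc[symmetric])
        then show False using S(3)[OF s0 s] False by blast
      qed
    qed
    have ns': "s \<otimes> inv (g \<otimes> s0) \<notin> B k'" if s: "s \<in> S" for s
    proof
      have sc: "s \<in> carrier G" using s S by blast
      assume "s \<otimes> inv (g \<otimes> s0) \<in> B k'"
      then have "inv (s \<otimes> inv (g \<otimes> s0)) \<in> B k'" by (rule subgroup.m_inv_closed[OF Bs])
      then show False using ns[OF s] sc gc s0c by (simp add: inv_mult_group)
    qed
    have nin: "g \<otimes> s0 \<notin> S"
    proof
      assume "g \<otimes> s0 \<in> S"
      from ns[OF this] show False using gc s0c subgroup.one_closed[OF Bs] by simp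
    qed
    have "P (insert (g \<otimes> s0) S, k')"
      unfolding P_def using S ns ns' gc s0c Bmono[OF k'] by auto
    then have "card (insert (g \<otimes> s0) S) \<le> card S" by (rule max)
    then show False using nin S(1) by simp
  qed
  show ?thesis
  proof (rule that)
    fix x y assume x: "x \<in> \<Gamma> k" and y: "y \<in> \<Gamma> k"
    have c: "x \<in> carrier G" "y \<in> carrier G" using x y subgroup.mem_carrier[OF \<Gamma>s] by auto
    have AA: "cmod (\<Gamma> k') a b" if "a \<in> A" "b \<in> A" for a b k'
    proof (rule cmod_generate2[OF \<Gamma>n _ _ _ that[unfolded A_def]])
      fix s t assume "s \<in> (\<lambda>x. x [^] q) ` carrier G" "t \<in> (\<lambda>x. x [^] q) ` carrier G"
      then have "s \<in> carrier G" "t \<in> carrier G" "s \<otimes> t = t \<otimes> s" using comm by auto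
      then show "cmod (\<Gamma> k') s t" using cmod_iff[OF \<Gamma>n] by metis
    qed auto
    \<comment> \<open>At every depth \<open>x\<close> and \<open>y\<close> agree with elements of
      \<open>A\<close> up to factors in the filtration, so their commutator lies in all terms of the
      filtration.\<close>
    have "x \<otimes> y \<otimes> inv x \<otimes> inv y \<in> \<Gamma> k'" for k'
    proof -
      define k'' where "k'' = max k k'"
      obtain a \<gamma> where a: "a \<in> A" "\<gamma> \<in> \<Gamma> k''" "x = a \<otimes> \<gamma>"
        using key[of k''] x unfolding B_def set_mult_def k''_def by auto
      obtain b \<delta> where b: "b \<in> A" "\<delta> \<in> \<Gamma> k''" "y = b \<otimes> \<delta>"
        using key[of k''] y unfolding B_def set_mult_def k''_def by auto
      have cc: "a \<in> carrier G" "\<gamma> \<in> carrier G" "b \<in> carrier G" "\<delta> \<in> carrier G"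
        using a b subgroup.mem_carrier[OF As] subgroup.mem_carrier[OF \<Gamma>s] by auto
      have xy: "cmod (\<Gamma> k'') z y" if z: "z \<in> carrier G" "cmod (\<Gamma> k'') z b" for z
      proof -
        have "cmod (\<Gamma> k'') z \<delta>" using cmod_of_mem[OF \<Gamma>n b(2) z(1)] cmod_sym[OF \<Gamma>n] z(1) cc by blast
        then show ?thesis using subgroup.m_closed[OF cmod_subgroup[OF \<Gamma>n[of k''] z(1)], where x = b and y = \<delta>] z cc b(3) by blast
      qed
      have "cmod (\<Gamma> k'') y a" using xy[OF cc(1) AA[OF a(1) b(1)]] cmod_sym[OF \<Gamma>n] c cc by blast
      moreover have "cmod (\<Gamma> k'') y \<gamma>" using cmod_of_mem[OF \<Gamma>n a(2) c(2)] cmod_sym[OF \<Gamma>n] c cc by blast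
      ultimately have "cmod (\<Gamma> k'') y x"
        using subgroup.m_closed[OF cmod_subgroup[OF \<Gamma>n[of k''] c(2)], where x = a and y = \<gamma>] cc a(3) by blast
      then have "cmod (\<Gamma> k'') x y" using cmod_sym[OF \<Gamma>n] c by blast
      then show ?thesis unfolding cmod_def using \<Gamma>mono[of k' k''] unfolding k''_def by auto
    qed
    then have "cmod {\<one>} x y" unfolding cmod_def using sep by blast
    then show "x \<otimes> y = y \<otimes> x" using cmod_one_iff c by blast
  qed
qed

context group
begin

lemma finite_rcosets:
  assumes L: "subgroup L G" and R: "finite R" "R \<subseteq> carrier G" "carrier G = (\<Union>\<rho>\<in>R. L #> \<rho>)"
  shows "finite (rcosets L)"
proof (rule finite_subset)
  show "rcosets L \<subseteq> (\<lambda>\<rho>. L #> \<rho>) ` R"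
  proof
    fix c assume "c \<in> rcosets L"
    then obtain g where g: "g \<in> carrier G" "c = L #> g" unfolding RCOSETS_def by blast
    have "g \<in> (\<Union>\<rho>\<in>R. L #> \<rho>)" using g(1) unfolding R(3)[symmetric] .
    then obtain \<rho> where \<rho>: "\<rho> \<in> R" "g \<in> L #> \<rho>" by blast
    then have "L #> \<rho> = L #> g" using repr_independence[OF \<rho>(2) _ L] R(2) by blast
    then show "c \<in> (\<lambda>\<rho>. L #> \<rho>) ` R" using \<rho>(1) g(2) by blast
  qed
qed (use R in simp)

text \<open>The quotient by the term of index \<open>p ^ (2 * i + 1)\<close> is finite, and its
  induced filtration becomes trivial at this index, so \<open>p_powers_commute\<close> applies to
  it.\<close>

lemma p_powers_commute_mod:
  assumes rk: "rank_le G r" and p: "Factorial_Ring.prime p" and \<Gamma>: "p_filtration p \<Gamma>"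
    and fin: "finite (rcosets (\<Gamma> (p ^ (2 * i + 1))))" and g: "g \<in> carrier G" and h: "h \<in> carrier G"
  defines "x \<equiv> g [^] (p ^ (r + i))" and "y \<equiv> h [^] (p ^ (r + i))"
  shows "(x \<otimes> y) \<otimes> inv (y \<otimes> x) \<in> \<Gamma> (p ^ (2 * i + 1))"
proof -
  define L where "L = \<Gamma> (p ^ (2 * i + 1))"
  have L: "L \<lhd> G" using \<Gamma> unfolding L_def p_filtration_def central_filtration_def by blast
  interpret N: normal L G by (rule L)
  have Ls: "subgroup L G" by (rule normal_imp_subgroup[OF L])
  interpret h: group_hom G "G Mod L" "\<lambda>x. L #> x"
    using N.factorgroup_is_group N.r_coset_hom_Mod is_group by (simp add: group_hom_axioms_def group_hom_def)
  have surj: "(\<lambda>x. L #> x) ` carrier G = carrier (G Mod L)" by (simp add: carrier_FactGroup)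
  have fq: "finite (carrier (G Mod L))" using fin unfolding FactGroup_def L_def by simp
  have "(\<lambda>x. L #> x) ` L = (\<lambda>x. L) ` L" using coset_join2[OF _ Ls] N.mem_carrier by (intro image_cong) auto
  also have "\<dots> = {L}" using subgroup.one_closed[OF Ls] by blast
  finally have triv: "(\<lambda>x. L #> x) ` \<Gamma> (p ^ (2 * i + 1)) = {\<one>\<^bsub>G Mod L\<^esub>}" unfolding L_def by simp
  have c: "L #> g \<in> carrier (G Mod L)" "L #> h \<in> carrier (G Mod L)" using g h surj by blast+
  have xy: "x \<in> carrier G" "y \<in> carrier G" using g h unfolding x_def y_def by auto
  have pw: "(L #> g) [^]\<^bsub>G Mod L\<^esub> (p ^ (r + i)) = L #> x" "(L #> h) [^]\<^bsub>G Mod L\<^esub> (p ^ (r + i)) = L #> y"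
    unfolding x_def y_def using h.hom_nat_pow g h by simp_all
  have "(L #> x) \<otimes>\<^bsub>G Mod L\<^esub> (L #> y) = (L #> y) \<otimes>\<^bsub>G Mod L\<^esub> (L #> x)"
    using h.H.p_powers_commute[OF rank_le_hom_image[OF h.group_hom_axioms surj rk] fq p
        p_filtration_hom_image[OF h.group_hom_axioms surj \<Gamma>] triv c] unfolding pw .
  then have "L #> (x \<otimes> y) = L #> (y \<otimes> x)"
    using h.hom_mult[OF xy] h.hom_mult[OF xy(2,1)] by metis
  then show ?thesis using rcos_eq_iff[OF Ls, of "x \<otimes> y" "y \<otimes> x"] xy unfolding L_def by simp
qed

text \<open>The commutator of two \<open>p\<close>-powers is congruent to \<open>1\<close> to an order growing like \<open>p\<^sup>2\<^sup>i\<close>, whereas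
  the degrees of the numerators of its entries only grow like \<open>p\<^sup>i\<close>.\<close>

lemma rational_p_powers_commute:
  fixes \<sigma> :: "'a \<Rightarrow> 'f::field fps mat"
  assumes rep: "mrep G N \<sigma>" and inj: "inj_on \<sigma> (carrier G)" and one: "congruence_subgroup G N \<sigma> 1 = carrier G"
    and p: "Factorial_Ring.prime CHAR('f)" and rk: "rank_le G r"
    and fin: "\<And>k. finite (rcosets (congruence_subgroup G N \<sigma> k))"
    and F: "F \<noteq> 0" and g: "g \<in> carrier G" "numerators N F (\<sigma> g) d c" and h: "h \<in> carrier G" "numerators N F (\<sigma> h) d' c'"
  shows "\<exists>i. g [^] (CHAR('f) ^ i) \<otimes> h [^] (CHAR('f) ^ i) = h [^] (CHAR('f) ^ i) \<otimes> g [^] (CHAR('f) ^ i)"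
proof -
  let ?p = "CHAR('f)"
  \<comment> \<open>Chosen so that \<open>(d + d') * p^(r + i) = i * p^i\<close>, which is less than
    \<open>p^i * p^i\<close> and therefore less than \<open>k\<close>.\<close>
  define i where "i = (d + d') * ?p ^ r"
  define k where "k = ?p ^ (2 * i + 1)"
  define x where "x = g [^] (?p ^ (r + i))"
  define y where "y = h [^] (?p ^ (r + i))"
  have xy: "x \<in> carrier G" "y \<in> carrier G" unfolding x_def y_def using g h by auto
  have \<sigma>c: "\<sigma> z \<in> carrier_mat N N" if "z \<in> carrier G" for z using rep that unfolding mrep_def by blast
  have m: "\<sigma> (z \<otimes> w) = \<sigma> z * \<sigma> w" if "z \<in> carrier G" "w \<in> carrier G" for z w using rep that unfolding mrep_def by blast
  have p1: "?p > 1" by (rule prime_gt_1_nat[OF p])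
  have "(x \<otimes> y) \<otimes> inv (y \<otimes> x) \<in> congruence_subgroup G N \<sigma> k"
    unfolding x_def y_def k_def
    by (rule p_powers_commute_mod[OF rk p congruence_filtration[OF rep one p] fin g(1) h(1)])
  then have cong: "fps_cong N k (\<sigma> (x \<otimes> y)) (\<sigma> (y \<otimes> x))"
    using congruence_iff[OF rep] xy by blast
  let ?q = "?p ^ (r + i)"
  have nx: "numerators N F (\<sigma> x) (d * ?q) (c * ?q)" and ny: "numerators N F (\<sigma> y) (d' * ?q) (c' * ?q)"
    unfolding x_def y_def using mrep_pow[OF rep] numerators_power[OF \<sigma>c] g h by simp_all
  have n1: "numerators N F (\<sigma> (x \<otimes> y)) ((d + d') * ?q) ((c + c') * ?q)"
    using numerators_mult[OF \<sigma>c \<sigma>c nx ny] xy by (simp add: m[OF xy] distrib_right)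
  have n2: "numerators N F (\<sigma> (y \<otimes> x)) ((d + d') * ?q) ((c + c') * ?q)"
    using numerators_mult[OF \<sigma>c \<sigma>c ny nx] xy by (simp add: m[OF xy(2,1)] distrib_right add.commute)
  have "(d + d') * ?q = i * ?p ^ i" unfolding i_def by (simp add: power_add)
  also have "\<dots> < ?p ^ i * ?p ^ i" using power_gt_expt[of ?p i] p1 by (intro mult_strict_right_mono) auto
  also have "\<dots> \<le> k" unfolding k_def using p1 by (simp add: power_add mult_2)
  finally have "(d + d') * ?q < k" .
  then have "\<sigma> (x \<otimes> y) = \<sigma> (y \<otimes> x)"
    using numerators_cong_eq[OF n1 n2 cong _ F] \<sigma>c[of "x \<otimes> y"] \<sigma>c[of "y \<otimes> x"] xy by (intro eq_matI) auto
  then have "x \<otimes> y = y \<otimes> x" using inj xy by (auto dest: inj_onD)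
  then show ?thesis unfolding x_def y_def by blast
qed

lemma congruence_subgroup_separated:
  assumes rep: "mrep G N \<sigma>" and inj: "inj_on \<sigma> (carrier G)" and x: "\<And>k. x \<in> congruence_subgroup G N \<sigma> k"
  shows "x = \<one>"
proof -
  have xc: "x \<in> carrier G" using x unfolding congruence_subgroup_def by blast
  have c: "\<sigma> x \<in> carrier_mat N N" using rep xc unfolding mrep_def by blast
  have "\<sigma> x $$ (i, j) = 1\<^sub>m N $$ (i, j)" if "i < N" "j < N" for i j
  proof (rule fps_ext)
    fix l show "fps_nth (\<sigma> x $$ (i, j)) l = fps_nth (1\<^sub>m N $$ (i, j)) l"
      using x[of "Suc l"] that unfolding congruence_subgroup_def fps_cong_def by blast
  qed
  then have "\<sigma> x = \<sigma> \<one>" using rep c unfolding mrep_def by (intro eq_matI) auto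
  then show ?thesis using inj xc by (auto dest: inj_onD)
qed

lemma mrep_subgroup: "mrep G N \<sigma> \<Longrightarrow> subgroup H G \<Longrightarrow> mrep (G\<lparr>carrier := H\<rparr>) N \<sigma>"
  unfolding mrep_def using subgroup.mem_carrier by fastforce

text \<open>The constants must form a finite field, since this makes every \<open>H l\<close> and
  hence every congruence quotient finite. Over an algebraically closed field there are enough finite
  subfields to find a point with \<open>f\<close> nonzero.\<close>

lemma Q_linear_char_p:
  fixes \<sigma>0 :: "'a \<Rightarrow> 'f::alg_closed_field mat"
  assumes p: "Factorial_Ring.prime CHAR('f)" and rk: "rank_le G r"
    and rep0: "mrep G n \<sigma>0" and inj0: "inj_on \<sigma>0 (carrier G)"
    and S: "finite S" "S \<subseteq> carrier G" "generate G S = carrier G"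
  shows "Q_linear G"
proof -
  let ?p = "CHAR('f)"
  obtain as f N \<rho> where as: "indep as" and f: "f \<in> gring (set as)" "f \<noteq> (0::'f)"
    and rep: "mrep G N \<rho>" and inj: "inj_on \<rho> (carrier G)"
    and loc: "\<forall>g\<in>carrier G. \<forall>i<N. \<forall>j<N. \<rho> g $$ (i, j) \<in> localization (gring (set as)) f"
    using rep_over_localization[OF rep0 inj0 S] by blast
  from ring_hom_on_indep_nonzero[OF refl as infinite_finite_order_elements[OF p] f]
  obtain \<phi> :: "'f \<Rightarrow> 'f" where \<phi>: "ring_hom_on (gring (set as)) \<phi>"
    "\<forall>a\<in>set as. \<exists>i>0. \<phi> a ^ (?p ^ i) = \<phi> a" "\<phi> f \<noteq> 0"
    by blast
  define e where "e a = (SOME i. i > 0 \<and> \<phi> a ^ (?p ^ i) = \<phi> a)" for a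
  have e: "e a > 0 \<and> \<phi> a ^ (?p ^ e a) = \<phi> a" if "a \<in> set as" for a
    unfolding e_def by (rule someI_ex) (use \<phi>(2) that in blast)
  \<comment> \<open>Multiplying the exponents places all coordinates of the point in one finite
    field.\<close>
  define m where "m = (\<Prod>a\<in>set as. e a)"
  have m0: "m > 0" unfolding m_def using e by (intro prod_pos) blast
  define C where "C = {z::'f. z ^ (?p ^ m) = z}"
  note C = frobenius_fixed_field[OF p m0, folded C_def]
  interpret sp: specialization as f C \<phi>
  proof
    show "\<phi> a \<in> C" if "a \<in> set as" for a
    proof -
      have "m = e a * (\<Prod>b\<in>set as - {a}. e b)" unfolding m_def using that by (intro prod.remove) auto
      then show ?thesis using frobenius_iterate[of "\<phi> a" ?p "e a"] e[OF that] unfolding C_def by simp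
    qed
  qed (use as f \<phi> C in auto)
  define \<sigma> where "\<sigma> g = map_mat sp.T (\<rho> g)" for g
  have \<rho>c: "\<rho> g \<in> carrier_mat N N" if "g \<in> carrier G" for g using rep that unfolding mrep_def by blast
  have \<sigma>: "mrep G N \<sigma>" unfolding \<sigma>_def
    by (rule mrep_map_mat[OF rep sp.T(1) sp.R_closed(1,3,4)]) (use loc in auto)
  have inj\<sigma>: "inj_on \<sigma> (carrier G)"
  proof (rule inj_onI)
    fix g h assume g: "g \<in> carrier G" and h: "h \<in> carrier G" and eq: "\<sigma> g = \<sigma> h"
    have "\<rho> g = \<rho> h"
    proof (rule eq_matI)
      fix i j assume "i < dim_row (\<rho> h)" "j < dim_col (\<rho> h)"
      then have ij: "i < N" "j < N" using \<rho>c[OF h] by auto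
      have "\<sigma> g $$ (i, j) = \<sigma> h $$ (i, j)" using eq by simp
      then have "sp.T (\<rho> g $$ (i, j)) = sp.T (\<rho> h $$ (i, j))" unfolding \<sigma>_def using \<rho>c[OF g] \<rho>c[OF h] ij by simp
      then show "\<rho> g $$ (i, j) = \<rho> h $$ (i, j)" by (rule inj_onD[OF sp.T_inj]) (use loc g h ij in auto)
    qed (use \<rho>c[OF g] \<rho>c[OF h] in auto)
    then show "g = h" using inj g h by (auto dest: inj_onD)
  qed
  have H: "fps_nth (\<sigma> g $$ (i, j)) l \<in> sp.H l" if "g \<in> carrier G" "i < N" "j < N" for g i j l
    using sp.T_HS[of "\<rho> g $$ (i, j)"] loc that \<rho>c[OF that(1)] unfolding \<sigma>_def sp.HS_def by auto
  have fH: "finite (sp.H l)" for l unfolding sp.H_def by (rule finite_kspan[OF C(2) sp.finite_monomials_as])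
  define F where "F = fps_of_poly (sp.\<tau> f)"
  have F: "F \<noteq> 0" using sp.\<tau>f unfolding F_def by (metis fps_zero_nth)
  have num: "\<exists>d c. numerators N F (\<sigma> g) d c" if g: "g \<in> carrier G" for g
  proof -
    have "\<forall>x. \<exists>k. fst x < N \<longrightarrow> snd x < N \<longrightarrow> \<rho> g $$ x * f ^ k \<in> gring (set as)"
      using loc g unfolding localization_def by fastforce
    then obtain k where k: "\<And>i j. i < N \<Longrightarrow> j < N \<Longrightarrow> \<rho> g $$ (i, j) * f ^ k (i, j) \<in> gring (set as)"
      by (metis fst_conv snd_conv)
    define c where "c = sum k ({..<N} \<times> {..<N})"
    have c: "\<rho> g $$ (i, j) * f ^ c \<in> gring (set as)" if ij: "i < N" "j < N" for i j
    proof -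
      have "k (i, j) \<le> c" unfolding c_def by (rule member_le_sum) (use ij in auto)
      then have "f ^ c = f ^ k (i, j) * f ^ (c - k (i, j))" by (simp add: power_add[symmetric])
      then have eq: "\<rho> g $$ (i, j) * f ^ c = \<rho> g $$ (i, j) * f ^ k (i, j) * f ^ (c - k (i, j))"
        by (simp add: mult.assoc)
      show ?thesis unfolding eq by (rule gring.mult[OF k[OF ij] gring_power[OF f(1)]])
    qed
    define d where "d = (\<Sum>(i, j)\<in>{..<N} \<times> {..<N}. Polynomial.degree (sp.\<tau> (\<rho> g $$ (i, j) * f ^ c)))"
    have "numerators N F (\<sigma> g) d c"
      unfolding numerators_def
    proof (intro allI impI)
      fix i j assume ij: "i < N" "j < N"
      have "\<sigma> g $$ (i, j) * F ^ c = fps_of_poly (sp.\<tau> (\<rho> g $$ (i, j) * f ^ c))"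
        unfolding F_def \<sigma>_def using sp.T(2)[OF c[OF ij]] \<rho>c[OF g] ij by simp
      moreover have "Polynomial.degree (sp.\<tau> (\<rho> g $$ (i, j) * f ^ c)) \<le> d"
        unfolding d_def using member_le_sum[of "(i, j)" "{..<N} \<times> {..<N}" "\<lambda>(i, j). Polynomial.degree (sp.\<tau> (\<rho> g $$ (i, j) * f ^ c))"] ij
        by simp
      ultimately show "\<exists>P. Polynomial.degree P \<le> d \<and> \<sigma> g $$ (i, j) * F ^ c = fps_of_poly P" by blast
    qed
    then show ?thesis by blast
  qed
  \<comment> \<open>The filtration presupposes that all elements are congruent to 1 modulo the
    variable, so the argument runs in the first congruence subgroup.\<close>
  define G1 where "G1 = G\<lparr>carrier := congruence_subgroup G N \<sigma> 1\<rparr>"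
  have sub: "subgroup (congruence_subgroup G N \<sigma> k) G" for k
    by (rule normal_imp_subgroup[OF congruence_subgroup_normal[OF \<sigma>]])
  interpret G1: group G1 unfolding G1_def by (rule subgroup.subgroup_is_group[OF sub is_group])
  have G1c: "carrier G1 \<subseteq> carrier G" unfolding G1_def congruence_subgroup_def by auto
  have rep1: "mrep G1 N \<sigma>" "mrep G1 N \<rho>" unfolding G1_def by (rule mrep_subgroup[OF _ sub], fact)+
  have inj1: "inj_on \<sigma> (carrier G1)" "inj_on \<rho> (carrier G1)" using inj inj\<sigma> G1c inj_on_subset by blast+
  have rk1: "rank_le G1 r" unfolding G1_def by (rule rank_le_subgroup[OF rk sub])
  have one1: "congruence_subgroup G1 N \<sigma> 1 = carrier G1" unfolding G1_def congruence_subgroup_def by auto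
  have fin1: "finite (rcosets\<^bsub>G1\<^esub> (congruence_subgroup G1 N \<sigma> k))" for k
  proof -
    obtain R where R: "finite R" "R \<subseteq> carrier G1" "carrier G1 = (\<Union>\<rho>\<in>R. congruence_subgroup G1 N \<sigma> k #>\<^bsub>G1\<^esub> \<rho>)"
      by (rule G1.congruence_finite_index[where \<sigma> = \<sigma> and N = N and k = k and H = sp.H, OF rep1(1) fH])
        (use H[OF subsetD[OF G1c]] in auto)
    show ?thesis
      by (rule G1.finite_rcosets[OF normal_imp_subgroup[OF G1.congruence_subgroup_normal[OF rep1(1)]] R])
  qed
  define q where "q = ?p ^ (N * N)"
  have q: "q > 0" unfolding q_def using prime_gt_0_nat[OF p] by simp
  have comm: "x [^]\<^bsub>G1\<^esub> q \<otimes>\<^bsub>G1\<^esub> y [^]\<^bsub>G1\<^esub> q = y [^]\<^bsub>G1\<^esub> q \<otimes>\<^bsub>G1\<^esub> x [^]\<^bsub>G1\<^esub> q"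
    if xy: "x \<in> carrier G1" "y \<in> carrier G1" for x y
  proof -
    obtain d c d' c' where nums: "numerators N F (\<sigma> x) d c" "numerators N F (\<sigma> y) d' c'"
      using num[OF subsetD[OF G1c xy(1)]] num[OF subsetD[OF G1c xy(2)]] by blast
    obtain i where "x [^]\<^bsub>G1\<^esub> (?p ^ i) \<otimes>\<^bsub>G1\<^esub> y [^]\<^bsub>G1\<^esub> (?p ^ i) = y [^]\<^bsub>G1\<^esub> (?p ^ i) \<otimes>\<^bsub>G1\<^esub> x [^]\<^bsub>G1\<^esub> (?p ^ i)"
      using G1.rational_p_powers_commute[OF rep1(1) inj1(1) one1 p rk1 fin1 F xy(1) nums(1) xy(2) nums(2)] by blast
    then show ?thesis unfolding q_def by (rule G1.p_powers_commute_uniform[OF rep1(2) inj1(2) p xy])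
  qed
  have cf: "G1.central_filtration (congruence_subgroup G1 N \<sigma>)"
    using G1.congruence_filtration[OF rep1(1) one1 p] unfolding G1.p_filtration_def by blast
  have "\<exists>k. \<forall>x\<in>congruence_subgroup G1 N \<sigma> k. \<forall>y\<in>congruence_subgroup G1 N \<sigma> k. x \<otimes>\<^bsub>G1\<^esub> y = y \<otimes>\<^bsub>G1\<^esub> x"
    by (rule G1.filtration_eventually_abelian[OF cf G1.congruence_subgroup_separated[OF rep1(1) inj1(1)] fin1 rk1 q comm]) blast+
  then obtain k where k: "\<And>x y. x \<in> congruence_subgroup G1 N \<sigma> k \<Longrightarrow> y \<in> congruence_subgroup G1 N \<sigma> k \<Longrightarrow>
      x \<otimes>\<^bsub>G1\<^esub> y = y \<otimes>\<^bsub>G1\<^esub> x" by blast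
  \<comment> \<open>The level is \<open>Suc k\<close> so as to be at least 1, which puts the
    subgroup inside \<open>G1\<close> even for \<open>k = 0\<close>.\<close>
  have "congruence_subgroup G N \<sigma> (Suc k) \<subseteq> congruence_subgroup G1 N \<sigma> k"
    unfolding G1_def congruence_subgroup_def fps_cong_def by auto
  then have ab: "x \<otimes> y = y \<otimes> x" if "x \<in> congruence_subgroup G N \<sigma> (Suc k)" "y \<in> congruence_subgroup G N \<sigma> (Suc k)" for x y
    using k[of x y] that unfolding G1_def by auto
  obtain R where R: "finite R" "R \<subseteq> carrier G" "carrier G = (\<Union>\<rho>\<in>R. congruence_subgroup G N \<sigma> (Suc k) #> \<rho>)"
    using congruence_finite_index[OF \<sigma> fH H, of "Suc k"] by blast
  show ?thesis by (rule Q_linear_of_abelian_finite_index[OF S(2,1,3) sub ab R])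
qed

end

theorem proposition1p4:
  fixes n :: nat and G :: "'f::field mat set"
  assumes "infinite (UNIV :: 'f set)"
    and "n \<ge> 1"
    and "subgroup G (GL n)"
    and "finitely_generated ((GL n)\<lparr>carrier := G\<rparr>)"
    and "finite_pruefer_rank ((GL n)\<lparr>carrier := G\<rparr>)"
  shows "Q_linear ((GL n)\<lparr>carrier := G\<rparr>)"
proof -
  define G' where "G' = (GL n)\<lparr>carrier := G\<rparr>"
  interpret G': group G' unfolding G'_def by (rule subgroup.subgroup_is_group[OF assms(3) group_GL])
  obtain S where S: "finite S" "S \<subseteq> carrier G'" "generate G' S = carrier G'"
    using assms(4) unfolding finitely_generated_def G'_def by blast
  obtain r where r: "\<And>K. subgroup K G' \<Longrightarrow> finitely_generated (G'\<lparr>carrier := K\<rparr>) \<Longrightarrow> generated_by_at_most (G'\<lparr>carrier := K\<rparr>) r"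
    using assms(5) unfolding finite_pruefer_rank_def G'_def by blast
  \<comment> \<open>The hypothesis speaks of subgroups as groups in their own right; applied to the
    subgroup generated by \<open>W\<close>, it gives generators inside \<open>G'\<close>.\<close>
  have rk: "rank_le G' r"
    unfolding rank_le_def
  proof (intro allI impI)
    fix W assume W: "W \<subseteq> carrier G'" "finite W"
    define K where "K = generate G' W"
    have K: "subgroup K G'" unfolding K_def by (rule G'.generate_is_subgroup[OF W(1)])
    have WK: "W \<subseteq> K" unfolding K_def using generate.incl by fastforce
    have "generate (G'\<lparr>carrier := K\<rparr>) W = K" using G'.generate_consistent[OF WK K] unfolding K_def by simp
    then have "finitely_generated (G'\<lparr>carrier := K\<rparr>)" unfolding finitely_generated_def using W(2) WK by auto
    from r[OF K this] obtain T where T: "T \<subseteq> K" "finite T" "card T \<le> r" "generate (G'\<lparr>carrier := K\<rparr>) T = K"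
      unfolding generated_by_at_most_def by auto
    then show "\<exists>T\<subseteq>carrier G'. finite T \<and> card T \<le> r \<and> generate G' T = generate G' W"
      using G'.generate_consistent[OF T(1) K] subgroup.subset[OF K] unfolding K_def by (intro exI[of _ T]) auto
  qed
  have "g \<in> carrier_mat n n" if "g \<in> G" for g
    using subgroup.mem_carrier[OF assms(3) that] unfolding GL_def units_of_def Units_def by (simp add: ring_mat_simps)
  then have rep: "mrep G' n (\<lambda>g. g)"
    unfolding mrep_def G'_def GL_def by (simp add: units_of_def ring_mat_simps)
  show ?thesis
  proof (cases "CHAR('f) = 0")
    case True
    have "z = 0" if "of_int z = (0::'f)" for z :: int
    proof -
      have "of_nat (nat \<bar>z\<bar>) = (0::'f)" using that by (cases "z \<ge> 0") auto
      then show ?thesis using True of_nat_eq_0_iff_char_dvd[of "nat \<bar>z\<bar>", where 'a = 'f] by simp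
    qed
    then have "Q_linear G'" by (intro G'.Q_linear_char_0[OF _ rk rep _ S]) auto
    then show ?thesis unfolding G'_def .
  next
    case False
    \<comment> \<open>The algebraic closure has the same characteristic and supplies finite fields
      of constants that \<open>'f\<close> itself may lack.\<close>
    then have p: "Factorial_Ring.prime CHAR('f alg_closure)" using prime_CHAR_semidom[where 'a = 'f] by simp
    have "mrep G' n (\<lambda>g. map_mat to_ac g)"
      by (rule G'.mrep_map_mat[OF rep, of UNIV]) (auto simp: ring_hom_on_def)
    moreover have "inj_on (map_mat to_ac) (carrier G')"
      by (rule inj_onI) (auto simp: mat_eq_iff)
    ultimately have "Q_linear G'" by (rule G'.Q_linear_char_p[OF p rk _ _ S])
    then show ?thesis unfolding G'_def .
  qed
qed

end
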